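(* Let $k$ be a field of characteristic $0$ and let $X$ be any simplicial set. The restriction $$\rho_c : A_c^*X\to C_c^*X$$ of the integration map $\rho_X:A^*X\to C^*X$ induces a multiplicative isomorphism on cohomology.
   Context: Simplicial subsets: for a collection $S$ of simplices of a simplicial set $X$, $\langle S\rangle$ denotes the simplicial subset of $X$ generated by $S$. A simplicial set is finite if it has only finitely many non-degenerate simplices. Inclusions $K\subset X$ denote simplicial subsets. Polynomial forms: for each $p\ge 0$, $\nabla(p,* )$ is the commutative differential graded algebra over $k$ generated by $t_0,\dots,t_p$ in degree $0$ and $dt_0,\dots,dt_p$ in degree $1$, subject to $\sum_i t_i=1$ and $\sum_i dt_i=0$, with $d(t_i)=dt_i$; $\nabla(p,q)$ is its degree $q$ part. These form a simplicial CDGA, with structure maps the CDGA morphisms determined by $\partial_i t_j=t_j$ for $j<i$, $\partial_i t_i=0$, $\partial_i t_j=t_{j-1}$ for $j>i$; and $s_i t_j=t_j$ for $j<i$, $s_it_i=t_i+t_{i+1}$, $s_it_j=t_{j+1}$ for $j>i$. For each $q$, $\nabla( *,q)$ is the simplicial set $p\mapsto\nabla(p,q)$. The CDGA of polynomial forms is $A^qX:=\mathrm{sSet}(X,\nabla( *,q))$, with operations and differential defined simplexwise; for $\omega\in A^qX$ and a simplex $\sigma$, write $\omega|_\sigma:=\omega(\sigma)$. The (possibly non-unital) CDGA of compactly supported polynomial forms is $$A_c^qX:=\{\Phi\in A^qX \mid \exists\text{ finite } K\subset X \text{ with } \Phi|_{\langle X\setminus K\rangle}=0\}.$$ Cochains: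 $C^*X$ denotes here the normalised cochain complex of $X$ (the paper identifies it with the unnormalised one): the $k$-linear dual of the normalised chain complex $k[X_n]/D(k[X_n])$, where $D(k[X_n])$ is spanned by degenerate $n$-simplices, with differential induced by $\sum_i(-1)^i\partial_i$. It carries the usual cup product. The compactly supported cochains are $$C_c^qX:=\{c\in C^qX\mid \exists \text{ finite } K\subset X\text{ such that } c \text{ vanishes on all simplices of } \langle X\setminus K\rangle\}.$$ Integration: for $w=f(t_1,\dots,t_p)\,dt_1\cdots dt_p\in\nabla(p,p)$ with $f$ a polynomial over $k$, $\int w:=\int_{|\Delta^p|}f\,dt_1\cdots dt_p\in k$, computed monomial by monomial as an ordinary integral over $|\Delta^p|=\{(t_1,\dots,t_p)\in\mathbb{R}^p: t_i\ge0,\ \sum t_i\le1\}$ (this gives rational numbers on monomials, hence makes sense over $k$). The map $\rho_X:A^*X\to C^*X$ is defined by $\langle\rho_X\omega,\sigma\rangle=\int\omega|_\sigma$ for $\omega\in A^qX$, $\sigma\in X_q$; it vanishes on degenerate simplices and restricts to $\rho_c:A_c^*X\to C_c^*X$. "Multiplicative" means that the induced map on cohomology respects products. *)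

theory Defs
  imports "HOL-Analysis.Analysis" "HOL-Library.Poly_Mapping" "HOL-Algebra.QuotRing"
begin

section \<open>Simplicial sets\<close>

text \<open>The faces \<open>face X n i\<close> go from dimension \<open>Suc n\<close> to dimension \<open>n\<close> (\<open>i \<le> Suc n\<close>), the
  degeneracies \<open>degen X n i\<close> from \<open>n\<close> to \<open>Suc n\<close> (\<open>i \<le> n\<close>).\<close>

record 'a sset =
  simplices :: "nat \<Rightarrow> 'a set"
  face :: "nat \<Rightarrow> nat \<Rightarrow> 'a \<Rightarrow> 'a"
  degen :: "nat \<Rightarrow> nat \<Rightarrow> 'a \<Rightarrow> 'a"

locale simplicial_set =
  fixes X :: "'a sset"
  assumes face_closed: "i \<le> Suc n \<Longrightarrow> x \<in> simplices X (Suc n) \<Longrightarrow> face X n i x \<in> simplices X n"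
    and degen_closed: "i \<le> n \<Longrightarrow> x \<in> simplices X n \<Longrightarrow> degen X n i x \<in> simplices X (Suc n)"
    and face_face: "i < j \<Longrightarrow> j \<le> Suc (Suc n) \<Longrightarrow> x \<in> simplices X (Suc (Suc n)) \<Longrightarrow>
      face X n i (face X (Suc n) j x) = face X n (j - 1) (face X (Suc n) i x)"
    and degen_degen: "i \<le> j \<Longrightarrow> j \<le> n \<Longrightarrow> x \<in> simplices X n \<Longrightarrow>
      degen X (Suc n) i (degen X n j x) = degen X (Suc n) (Suc j) (degen X n i x)"
    and face_degen_less: "i < j \<Longrightarrow> j \<le> Suc n \<Longrightarrow> x \<in> simplices X (Suc n) \<Longrightarrow>
      face X (Suc n) i (degen X (Suc n) j x) = degen X n (j - 1) (face X n i x)"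
    and face_degen_same: "i = j \<or> i = Suc j \<Longrightarrow> j \<le> n \<Longrightarrow> x \<in> simplices X n \<Longrightarrow>
      face X n i (degen X n j x) = x"
    and face_degen_greater: "Suc j < i \<Longrightarrow> i \<le> Suc (Suc n) \<Longrightarrow> x \<in> simplices X (Suc n) \<Longrightarrow>
      face X (Suc n) i (degen X (Suc n) j x) = degen X n j (face X n (i - 1) x)"

definition sset_hom :: "'a sset \<Rightarrow> 'b sset \<Rightarrow> (nat \<Rightarrow> 'a \<Rightarrow> 'b) set" where
  "sset_hom X Y = {f.
     (\<forall>n. f n \<in> simplices X n \<rightarrow>\<^sub>E simplices Y n) \<and>
     (\<forall>n i. \<forall>x\<in>simplices X (Suc n). i \<le> Suc n \<longrightarrow> f n (face X n i x) = face Y n i (f (Suc n) x)) \<and>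
     (\<forall>n i. \<forall>x\<in>simplices X n. i \<le> n \<longrightarrow> f (Suc n) (degen X n i x) = degen Y n i (f n x))}"

definition simplicial_subset :: "'a sset \<Rightarrow> (nat \<Rightarrow> 'a set) \<Rightarrow> bool" where
  "simplicial_subset X K \<longleftrightarrow>
     (\<forall>n. K n \<subseteq> simplices X n) \<and>
     (\<forall>n i. \<forall>x\<in>K (Suc n). i \<le> Suc n \<longrightarrow> face X n i x \<in> K n) \<and>
     (\<forall>n i. \<forall>x\<in>K n. i \<le> n \<longrightarrow> degen X n i x \<in> K (Suc n))"

definition generated :: "'a sset \<Rightarrow> (nat \<Rightarrow> 'a set) \<Rightarrow> nat \<Rightarrow> 'a set" where
  "generated X S n = \<Inter> {K n |K. simplicial_subset X K \<and> (\<forall>m. S m \<subseteq> K m)}"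

definition degenerate :: "'a sset \<Rightarrow> nat \<Rightarrow> 'a set" where
  "degenerate X n = {x. \<exists>m i y. n = Suc m \<and> i \<le> m \<and> y \<in> simplices X m \<and> x = degen X m i y}"

definition finite_sset :: "'a sset \<Rightarrow> bool" where
  "finite_sset X \<longleftrightarrow> finite {(n, x). x \<in> simplices X n - degenerate X n}"

definition finite_subset :: "'a sset \<Rightarrow> (nat \<Rightarrow> 'a set) \<Rightarrow> bool" where
  "finite_subset X K \<longleftrightarrow> simplicial_subset X K \<and> finite_sset (X\<lparr>simplices := K\<rparr>)"

definition complement_span :: "'a sset \<Rightarrow> (nat \<Rightarrow> 'a set) \<Rightarrow> nat \<Rightarrow> 'a set" where
  "complement_span X K = generated X (\<lambda>m. simplices X m - K m)"


section \<open>Polynomials in the variables t_0, t_1, ...\<close>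

type_synonym 'k mpoly = "(nat \<Rightarrow>\<^sub>0 nat) \<Rightarrow>\<^sub>0 'k"

definition mp_const :: "'k::comm_ring_1 \<Rightarrow> 'k mpoly" where
  "mp_const c = Poly_Mapping.single 0 c"

definition mp_var :: "nat \<Rightarrow> 'k::comm_ring_1 mpoly" where
  "mp_var i = Poly_Mapping.single (Poly_Mapping.single i 1) 1"

definition mpolys_over :: "nat set \<Rightarrow> 'k::comm_ring_1 mpoly set" where
  "mpolys_over V = {f. \<forall>m\<in>Poly_Mapping.keys f. Poly_Mapping.keys m \<subseteq> V}"

definition mp_pderiv :: "nat \<Rightarrow> 'k::comm_ring_1 mpoly \<Rightarrow> 'k mpoly" where
  "mp_pderiv i f =
     (\<Sum>m\<in>Poly_Mapping.keys f. Poly_Mapping.single (m - Poly_Mapping.single i 1)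
       (of_nat (Poly_Mapping.lookup m i) * Poly_Mapping.lookup f m))"

definition mp_subst :: "(nat \<Rightarrow> 'k mpoly) \<Rightarrow> 'k::comm_ring_1 mpoly \<Rightarrow> 'k mpoly" where
  "mp_subst g f = (\<Sum>m\<in>Poly_Mapping.keys f. mp_const (Poly_Mapping.lookup f m) *
     (\<Prod>i\<in>Poly_Mapping.keys m. g i ^ Poly_Mapping.lookup m i))"


section \<open>The free CDGA on t_0, ..., t_p\<close>

text \<open>A form \<open>w\<close> stands for the sum over finite \<open>I\<close> of \<open>w I\<close> times the monomial \<open>dt_I\<close>, the product
  of the \<open>dt_i\<close> (\<open>i \<in> I\<close>) in increasing order. Thus \<open>dt_I dt_J\<close> is \<open>shuffle_sign I J\<close> times
  \<open>dt_(I \<union> J)\<close> if \<open>I\<close> and \<open>J\<close> are disjoint, and vanishes otherwise.\<close>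

type_synonym 'k form = "nat set \<Rightarrow> 'k mpoly"

definition shuffle_sign :: "nat set \<Rightarrow> nat set \<Rightarrow> 'r::comm_ring_1" where
  "shuffle_sign I J = (- 1) ^ card {(i, j). i \<in> I \<and> j \<in> J \<and> j < i}"

definition form_monom :: "'k::comm_ring_1 mpoly \<Rightarrow> nat set \<Rightarrow> 'k form" where
  "form_monom f I = (\<lambda>J. if J = I then f else 0)"

definition form_mult :: "'k::comm_ring_1 form \<Rightarrow> 'k form \<Rightarrow> 'k form" where
  "form_mult v w = (\<lambda>K. \<Sum>I\<in>Pow K. shuffle_sign I (K - I) * (v I * w (K - I)))"

definition form_d :: "'k::comm_ring_1 form \<Rightarrow> 'k form" where
  "form_d w = (\<lambda>K. \<Sum>i\<in>K. shuffle_sign {i} (K - {i}) * mp_pderiv i (w (K - {i})))"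

definition free_forms :: "nat \<Rightarrow> 'k::comm_ring_1 form ring" where
  "free_forms p =
     \<lparr>carrier = {w. (\<forall>I. w I \<in> mpolys_over {..p}) \<and> (\<forall>I. \<not> I \<subseteq> {..p} \<longrightarrow> w I = 0)},
      mult = form_mult,
      one = form_monom 1 {},
      zero = (\<lambda>_. 0),
      add = (\<lambda>v w I. v I + w I)\<rparr>"

text \<open>The CDGA morphism out of the free CDGA on \<open>t_0, ..., t_p\<close> which sends \<open>t_j\<close> to the polynomial
  \<open>g j\<close>, and hence \<open>dt_j\<close> to \<open>d (g j)\<close>.\<close>

definition form_subst :: "nat \<Rightarrow> (nat \<Rightarrow> 'k mpoly) \<Rightarrow> 'k::comm_ring_1 form \<Rightarrow> 'k form" where
  "form_subst p g w = (\<lambda>K. \<Sum>I\<in>Pow {..p}.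
     mp_subst g (w I) *
     foldr form_mult (map (\<lambda>i. form_d (form_monom (g i) {})) (sorted_list_of_set I))
       (form_monom 1 {}) K)"


section \<open>The simplicial CDGA of polynomial forms on simplices\<close>

text \<open>The elements of \<open>nabla_ring p\<close> are the cosets of the two-sided ideal \<open>nabla_ideal p\<close>; this ideal
  is stable under the differential, and substitutions respecting the relations descend.\<close>

definition nabla_ideal :: "nat \<Rightarrow> 'k::comm_ring_1 form set" where
  "nabla_ideal p = Idl\<^bsub>free_forms p\<^esub>
     {form_monom ((\<Sum>i\<le>p. mp_var i) - 1) {}, (\<lambda>I. \<Sum>i\<le>p. form_monom 1 {i} I)}"

definition nabla_ring :: "nat \<Rightarrow> 'k::comm_ring_1 form set ring" where
  "nabla_ring p = free_forms p Quot nabla_ideal p"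

definition nabla_class :: "nat \<Rightarrow> 'k::comm_ring_1 form \<Rightarrow> 'k form set" where
  "nabla_class p w = nabla_ideal p +>\<^bsub>free_forms p\<^esub> w"

definition nabla :: "nat \<Rightarrow> nat \<Rightarrow> 'k::comm_ring_1 form set set" where
  "nabla p q = nabla_class p ` {w \<in> carrier (free_forms p). \<forall>I. w I \<noteq> 0 \<longrightarrow> card I = q}"

definition nabla_smult :: "nat \<Rightarrow> 'k \<Rightarrow> 'k::comm_ring_1 form set \<Rightarrow> 'k form set" where
  "nabla_smult p c W = nabla_class p (form_monom (mp_const c) {}) \<otimes>\<^bsub>nabla_ring p\<^esub> W"

definition nabla_d :: "nat \<Rightarrow> 'k::comm_ring_1 form set \<Rightarrow> 'k form set" where
  "nabla_d p W = (\<Union>w\<in>W. nabla_class p (form_d w))"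

definition nabla_subst :: "nat \<Rightarrow> nat \<Rightarrow> (nat \<Rightarrow> 'k mpoly) \<Rightarrow> 'k::comm_ring_1 form set \<Rightarrow> 'k form set" where
  "nabla_subst p r g W = (\<Union>w\<in>W. nabla_class r (form_subst p g w))"

definition face_subst :: "nat \<Rightarrow> nat \<Rightarrow> 'k::comm_ring_1 mpoly" where
  "face_subst i j = (if j < i then mp_var j else if j = i then 0 else mp_var (j - 1))"

definition degen_subst :: "nat \<Rightarrow> nat \<Rightarrow> 'k::comm_ring_1 mpoly" where
  "degen_subst i j =
     (if j < i then mp_var j else if j = i then mp_var i + mp_var (Suc i) else mp_var (Suc j))"

definition nabla_sset :: "nat \<Rightarrow> 'k::comm_ring_1 form set sset" where
  "nabla_sset q =
     \<lparr>simplices = (\<lambda>p. nabla p q),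
      face = (\<lambda>p i. nabla_subst (Suc p) p (face_subst i)),
      degen = (\<lambda>p i. nabla_subst p (Suc p) (degen_subst i))\<rparr>"


section \<open>Graded algebras with differential and their cohomology\<close>

text \<open>Each operation takes the degree(s) of its argument(s) first. There is no unit, so that
  compactly supported forms and cochains are covered; the axioms of a DGA are not part of the record.\<close>

record ('k, 'm) dg =
  dg_carrier :: "nat \<Rightarrow> 'm set"
  dg_zero :: "nat \<Rightarrow> 'm"
  dg_add :: "nat \<Rightarrow> 'm \<Rightarrow> 'm \<Rightarrow> 'm"
  dg_smult :: "nat \<Rightarrow> 'k \<Rightarrow> 'm \<Rightarrow> 'm"
  dg_mult :: "nat \<Rightarrow> nat \<Rightarrow> 'm \<Rightarrow> 'm \<Rightarrow> 'm"
  dg_d :: "nat \<Rightarrow> 'm \<Rightarrow> 'm"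

definition cocycles :: "('k, 'm) dg \<Rightarrow> nat \<Rightarrow> 'm set" where
  "cocycles A q = {x \<in> dg_carrier A q. dg_d A q x = dg_zero A (Suc q)}"

definition coboundaries :: "('k, 'm) dg \<Rightarrow> nat \<Rightarrow> 'm set" where
  "coboundaries A q = (case q of 0 \<Rightarrow> {dg_zero A 0} | Suc r \<Rightarrow> dg_d A r ` dg_carrier A r)"

definition cohomologous :: "('k, 'm) dg \<Rightarrow> nat \<Rightarrow> ('m \<times> 'm) set" where
  "cohomologous A q =
     {(x, y). x \<in> cocycles A q \<and> y \<in> cocycles A q \<and> (\<exists>b\<in>coboundaries A q. y = dg_add A q x b)}"

definition cohomology :: "('k, 'm) dg \<Rightarrow> nat \<Rightarrow> 'm set set" where
  "cohomology A q = cocycles A q // cohomologous A q"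

definition coh_add :: "('k, 'm) dg \<Rightarrow> nat \<Rightarrow> 'm set \<Rightarrow> 'm set \<Rightarrow> 'm set" where
  "coh_add A q a b = (\<Union>x\<in>a. \<Union>y\<in>b. cohomologous A q `` {dg_add A q x y})"

definition coh_smult :: "('k, 'm) dg \<Rightarrow> nat \<Rightarrow> 'k \<Rightarrow> 'm set \<Rightarrow> 'm set" where
  "coh_smult A q c a = (\<Union>x\<in>a. cohomologous A q `` {dg_smult A q c x})"

definition coh_mult :: "('k, 'm) dg \<Rightarrow> nat \<Rightarrow> nat \<Rightarrow> 'm set \<Rightarrow> 'm set \<Rightarrow> 'm set" where
  "coh_mult A p q a b = (\<Union>x\<in>a. \<Union>y\<in>b. cohomologous A (p + q) `` {dg_mult A p q x y})"

definition cochain_map :: "('k, 'm) dg \<Rightarrow> ('k, 'n) dg \<Rightarrow> (nat \<Rightarrow> 'm \<Rightarrow> 'n) \<Rightarrow> bool" where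
  "cochain_map A B f \<longleftrightarrow> (\<forall>q. \<forall>x\<in>dg_carrier A q.
     f q x \<in> dg_carrier B q \<and>
     f (Suc q) (dg_d A q x) = dg_d B q (f q x) \<and>
     (\<forall>y\<in>dg_carrier A q. f q (dg_add A q x y) = dg_add B q (f q x) (f q y)) \<and>
     (\<forall>c. f q (dg_smult A q c x) = dg_smult B q c (f q x)))"

definition coh_map :: "('k, 'n) dg \<Rightarrow> (nat \<Rightarrow> 'm \<Rightarrow> 'n) \<Rightarrow> nat \<Rightarrow> 'm set \<Rightarrow> 'n set" where
  "coh_map B f q a = (\<Union>x\<in>a. cohomologous B q `` {f q x})"


section \<open>Polynomial forms on a simplicial set\<close>

definition forms :: "'a sset \<Rightarrow> ('k::comm_ring_1, nat \<Rightarrow> 'a \<Rightarrow> 'k form set) dg" where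
  "forms X =
     \<lparr>dg_carrier = (\<lambda>q. sset_hom X (nabla_sset q)),
      dg_zero = (\<lambda>q n. \<lambda>x\<in>simplices X n. \<zero>\<^bsub>nabla_ring n\<^esub>),
      dg_add = (\<lambda>q v w n. \<lambda>x\<in>simplices X n. v n x \<oplus>\<^bsub>nabla_ring n\<^esub> w n x),
      dg_smult = (\<lambda>q c w n. \<lambda>x\<in>simplices X n. nabla_smult n c (w n x)),
      dg_mult = (\<lambda>q r v w n. \<lambda>x\<in>simplices X n. v n x \<otimes>\<^bsub>nabla_ring n\<^esub> w n x),
      dg_d = (\<lambda>q w n. \<lambda>x\<in>simplices X n. nabla_d n (w n x))\<rparr>"

definition forms_c :: "'a sset \<Rightarrow> ('k::comm_ring_1, nat \<Rightarrow> 'a \<Rightarrow> 'k form set) dg" where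
  "forms_c X = (forms X)\<lparr>dg_carrier := (\<lambda>q. {w \<in> dg_carrier (forms X) q.
     \<exists>K. finite_subset X K \<and> (\<forall>n. \<forall>x\<in>complement_span X K n. w n x = \<zero>\<^bsub>nabla_ring n\<^esub>)})\<rparr>"


section \<open>Normalised cochains\<close>

definition chains :: "'a sset \<Rightarrow> nat \<Rightarrow> ('a \<Rightarrow>\<^sub>0 'k::comm_ring_1) set" where
  "chains X n = {v. Poly_Mapping.keys v \<subseteq> simplices X n}"

definition degenerate_chains :: "'a sset \<Rightarrow> nat \<Rightarrow> ('a \<Rightarrow>\<^sub>0 'k::comm_ring_1) set" where
  "degenerate_chains X n = {v. Poly_Mapping.keys v \<subseteq> degenerate X n}"

definition chain_boundary :: "'a sset \<Rightarrow> nat \<Rightarrow> ('a \<Rightarrow>\<^sub>0 'k) \<Rightarrow> ('a \<Rightarrow>\<^sub>0 'k::comm_ring_1)" where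
  "chain_boundary X n v =
     (\<Sum>x\<in>Poly_Mapping.keys v. \<Sum>i\<le>Suc n.
       Poly_Mapping.single (face X n i x) ((- 1) ^ i * Poly_Mapping.lookup v x))"

text \<open>The dual of the quotient \<open>k[X_n] / D(k[X_n])\<close>, as the space of linear functionals on \<open>k[X_n]\<close>
  that vanish on \<open>D(k[X_n])\<close>.\<close>

definition normalised_cochains :: "'a sset \<Rightarrow> nat \<Rightarrow> (('a \<Rightarrow>\<^sub>0 'k) \<Rightarrow> 'k::comm_ring_1) set" where
  "normalised_cochains X n = {c \<in> chains X n \<rightarrow>\<^sub>E UNIV.
     (\<forall>u\<in>chains X n. \<forall>v\<in>chains X n. c (u + v) = c u + c v) \<and>
     (\<forall>a. \<forall>v\<in>chains X n. c (Poly_Mapping.map ((*) a) v) = a * c v) \<and>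
     (\<forall>v\<in>degenerate_chains X n. c v = 0)}"

definition linear_extension :: "'a sset \<Rightarrow> nat \<Rightarrow> ('a \<Rightarrow> 'k) \<Rightarrow> ('a \<Rightarrow>\<^sub>0 'k) \<Rightarrow> 'k::comm_ring_1" where
  "linear_extension X n f = (\<lambda>v\<in>chains X n. \<Sum>x\<in>Poly_Mapping.keys v. Poly_Mapping.lookup v x * f x)"

definition on_simplex :: "(('a \<Rightarrow>\<^sub>0 'k) \<Rightarrow> 'k::comm_ring_1) \<Rightarrow> 'a \<Rightarrow> 'k" where
  "on_simplex c x = c (Poly_Mapping.single x 1)"

text \<open>\<open>front_face X p q\<close> and \<open>back_face X p q\<close> are the faces of a \<open>(p + q)\<close>-simplex spanned by its first
  \<open>p + 1\<close> and its last \<open>q + 1\<close> vertices, respectively.\<close>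

fun front_face :: "'a sset \<Rightarrow> nat \<Rightarrow> nat \<Rightarrow> 'a \<Rightarrow> 'a" where
  "front_face X p 0 x = x"
| "front_face X p (Suc q) x = front_face X p q (face X (p + q) (Suc (p + q)) x)"

fun back_face :: "'a sset \<Rightarrow> nat \<Rightarrow> nat \<Rightarrow> 'a \<Rightarrow> 'a" where
  "back_face X 0 q x = x"
| "back_face X (Suc p) q x = back_face X p q (face X (p + q) 0 x)"

definition cochains :: "'a sset \<Rightarrow> ('k::comm_ring_1, ('a \<Rightarrow>\<^sub>0 'k) \<Rightarrow> 'k) dg" where
  "cochains X =
     \<lparr>dg_carrier = normalised_cochains X,
      dg_zero = (\<lambda>q. \<lambda>v\<in>chains X q. 0),
      dg_add = (\<lambda>q b c. \<lambda>v\<in>chains X q. b v + c v),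
      dg_smult = (\<lambda>q a c. \<lambda>v\<in>chains X q. a * c v),
      dg_mult = (\<lambda>p q b c. linear_extension X (p + q)
        (\<lambda>x. on_simplex b (front_face X p q x) * on_simplex c (back_face X p q x))),
      dg_d = (\<lambda>q c. \<lambda>v\<in>chains X (Suc q). c (chain_boundary X q v))\<rparr>"

definition cochains_c :: "'a sset \<Rightarrow> ('k::comm_ring_1, ('a \<Rightarrow>\<^sub>0 'k) \<Rightarrow> 'k) dg" where
  "cochains_c X = (cochains X)\<lparr>dg_carrier := (\<lambda>q. {c \<in> dg_carrier (cochains X) q.
     \<exists>K. finite_subset X K \<and> (\<forall>x\<in>complement_span X K q. on_simplex c x = 0)})\<rparr>"


section \<open>Integration\<close>

text \<open>The integral of the monomial \<open>t_1^(m 1) ... t_p^(m p)\<close> over the standard simplex in R^p is rational;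
  \<open>monom_integral\<close> is this rational number.\<close>

definition monom_integral :: "nat \<Rightarrow> (nat \<Rightarrow>\<^sub>0 nat) \<Rightarrow> rat" where
  "monom_integral p m = (THE r. real_of_rat r =
     (LINT x:{x. (\<forall>i\<in>{1..p}. 0 \<le> x i) \<and> (\<Sum>i\<in>{1..p}. x i) \<le> 1} | (\<Pi>\<^sub>M i\<in>{1..p}. lborel).
        (\<Prod>i\<in>{1..p}. x i ^ Poly_Mapping.lookup m i)))"

definition mp_integral :: "nat \<Rightarrow> 'k::field_char_0 mpoly \<Rightarrow> 'k" where
  "mp_integral p f = (\<Sum>m\<in>Poly_Mapping.keys f. Poly_Mapping.lookup f m * of_rat (monom_integral p m))"

text \<open>Every element of \<open>nabla p p\<close> is \<open>f dt_1 ... dt_p\<close> for a unique polynomial \<open>f\<close> in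
  \<open>t_1, ..., t_p\<close>.\<close>

definition form_integral :: "nat \<Rightarrow> 'k::field_char_0 form set \<Rightarrow> 'k" where
  "form_integral p W = (THE c. \<exists>f\<in>mpolys_over {1..p}.
     W = nabla_class p (form_monom f {1..p}) \<and> c = mp_integral p f)"

definition rho :: "'a sset \<Rightarrow> nat \<Rightarrow> (nat \<Rightarrow> 'a \<Rightarrow> 'k::field_char_0 form set) \<Rightarrow> ('a \<Rightarrow>\<^sub>0 'k) \<Rightarrow> 'k" where
  "rho X q w = linear_extension X q (\<lambda>x. form_integral q (w q x))"

end

theory Submission
  imports Defs
begin

text \<open>On the simplex of dimension \<open>n\<close>, let \<open>h_i\<close> be the Poincare homotopy of the linear contraction onto the
  vertex \<open>i\<close>. The composite of the \<open>h_j\<close> over the vertices \<open>j\<close> of a face other than the last one, evaluated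
  at that last vertex, is integration over the face. Summing Whitney forms times iterated homotopies yields Dupont's operator \<open>s\<close> with
  \<open>d s + s d = 1 - W \<rho>\<close>, where \<open>W\<close> sends a cochain to the combination of Whitney forms with its values as
  coefficients; moreover \<open>\<rho> W = 1\<close>. All these operators commute with faces and degeneracies, hence act on
  \<open>A\<^sup>*X\<close>, and being defined simplexwise they respect compact supports. So \<open>W\<close> induces an inverse of
  \<open>\<rho>\<close> on cohomology.

  The defect of multiplicativity, \<open>E_n(a, b) = \<rho>(a b) - \<rho> a \<union> \<rho> b\<close> on the simplex of dimension \<open>n\<close>, vanishes
  for \<open>n = 0\<close>. The contraction onto the vertex \<open>0\<close> turns it recursively into a natural homotopy, which again only
  involves values on faces.\<close>

section \<open>Polynomials\<close>

text \<open>Compact supports shape everything: a primitive or a homotopy must vanish on a simplex as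
  soon as the data vanish on its faces. Hence no step chooses a primitive by an existence argument;
  each map is an explicit formula in the values on faces.

  In coordinates centred at a vertex the contraction onto it is a dilation. Cartan's formula for the
  Euler field then makes its homotopy algebraic: contract with the field and divide by the weight.
  This division is one place where characteristic 0 enters. Integration thereby becomes algebraic
  too, and agrees with the integral over the real simplex by Dirichlet's formula for monomials.

  Equality in the quotient is tested after eliminating \<open>t_0\<close>; the kernel of this
  elimination is shown to be the ideal of the relations.

  The inverse \<open>W\<close> does not respect products, so the product statement needs its own
  homotopy. The contraction onto the vertex 0 serves because every degeneracy fixes that vertex: the
  resulting cochain vanishes on degenerate simplices, as a normalised cochain must.\<close>

abbreviation coef :: "('a \<Rightarrow>\<^sub>0 'b::zero) \<Rightarrow> 'a \<Rightarrow> 'b" where "coef \<equiv> Poly_Mapping.lookup"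
abbreviation sgl :: "'a \<Rightarrow> 'b \<Rightarrow> ('a \<Rightarrow>\<^sub>0 'b::zero)" where "sgl \<equiv> Poly_Mapping.single"
abbreviation supp :: "('a \<Rightarrow>\<^sub>0 'b::zero) \<Rightarrow> 'a set" where "supp \<equiv> Poly_Mapping.keys"

lemma poly_mapping_sum_sgls: "f = (\<Sum>m\<in>supp f. sgl m (coef f m))"
proof (rule poly_mapping_eqI)
  fix k
  have "(\<Sum>m\<in>supp f. coef (sgl m (coef f m)) k) = (\<Sum>m\<in>supp f. if m = k then coef f k else 0)"
    by (rule sum.cong) (auto simp: lookup_single when_def)
  then show "coef f k = coef (\<Sum>m\<in>supp f. sgl m (coef f m)) k"
    by (auto simp: lookup_sum in_keys_iff)
qed

lemma poly_mapping_add_induct [case_names sgl add]: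
  assumes "\<And>m c. Q (sgl m c)" and "\<And>f g. Q f \<Longrightarrow> Q g \<Longrightarrow> Q (f + g)"
  shows "Q (f :: 'a \<Rightarrow>\<^sub>0 'b::comm_monoid_add)"
proof -
  have "Q (\<Sum>m\<in>S. sgl m (coef f m))" if "finite S" for S
    using that by induction (use assms(1)[of undefined 0] assms in auto)
  then show ?thesis by (metis poly_mapping_sum_sgls finite_keys)
qed

lemma sgl_mult: "sgl m c = mp_const c * sgl m (1::'k::comm_ring_1)"
  by (simp add: mp_const_def mult_single)

lemma mp_var_power: "mp_var i ^ k = (sgl (sgl i k) 1 :: 'k::comm_ring_1 mpoly)"
  by (induction k) (auto simp: mp_var_def mult_single simp flip: single_add)

lemma sgl_prod: "sgl m (1::'k::comm_ring_1) = (\<Prod>i\<in>supp m. mp_var i ^ coef m i)"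
proof -
  have "(\<Prod>i\<in>S. mp_var i ^ coef m i) = sgl (\<Sum>i\<in>S. sgl i (coef m i)) (1::'k)" if "finite S" for S
    using that by induction (auto simp: mp_var_power mult_single)
  then show ?thesis by (metis poly_mapping_sum_sgls finite_keys)
qed

lemma mp_const_simps [simp]: "mp_const 0 = 0" "mp_const 1 = 1"
  "mp_const (a + b) = mp_const a + mp_const b" "mp_const (a * b) = mp_const a * mp_const b"
  "mp_const (- a) = - mp_const a"
  by (auto simp: mp_const_def single_add mult_single single_uminus)

lemma lookup_mp_pderiv:
  "coef (mp_pderiv i f) m = of_nat (Suc (coef m i)) * coef f (m + sgl i 1)"
proof -
  have "coef (mp_pderiv i f) m =
    (\<Sum>l\<in>supp f. of_nat (coef l i) * coef f l when l - sgl i 1 = m)"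
    by (simp add: mp_pderiv_def lookup_sum lookup_single)
  also have "\<dots> = (\<Sum>l\<in>supp f. if l = m + sgl i 1 then of_nat (coef l i) * coef f l else 0)"
  proof (rule sum.cong[OF refl])
    fix l
    \<comment> \<open>Subtraction of exponents is truncated, so \<open>l - sgl i 1 = m\<close> has
      the spurious solution \<open>l = m\<close> without \<open>t_i\<close>; there the factor
      \<open>of_nat (coef l i)\<close> is 0.\<close>
    have "coef l i = 0 \<or> (l - sgl i 1 = m \<longleftrightarrow> l = m + sgl i 1)"
    proof (cases "coef l i = 0")
      case False
      then have "l = (l - sgl i 1) + sgl i 1"
        by (intro poly_mapping_eqI) (auto simp: lookup_add lookup_minus lookup_single when_def)
      then show ?thesis by (metis add_diff_cancel_right')
    qed auto
    then show "(of_nat (coef l i) * coef f l when l - sgl i 1 = m) =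
        (if l = m + sgl i 1 then of_nat (coef l i) * coef f l else 0)"
      by (auto simp: when_def)
  qed
  also have "\<dots> = of_nat (Suc (coef m i)) * coef f (m + sgl i 1)"
    by (auto simp: lookup_add in_keys_iff)
  finally show ?thesis .
qed

lemma mp_pderiv_add [simp]: "mp_pderiv i (f + g) = mp_pderiv i f + mp_pderiv i g"
  by (rule poly_mapping_eqI) (simp add: lookup_mp_pderiv lookup_add algebra_simps)

lemma mp_pderiv_0 [simp]: "mp_pderiv i 0 = 0"
  by (simp add: mp_pderiv_def)

lemma mp_pderiv_mono: "mp_pderiv i (sgl m c) = sgl (m - sgl i 1) (of_nat (coef m i) * c)"
  by (cases "c = 0") (auto simp: mp_pderiv_def)

lemma mp_pderiv_mult: "mp_pderiv i (f * g) = mp_pderiv i f * g + f * mp_pderiv i g"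
proof (induction f rule: poly_mapping_add_induct)
  case (sgl m c)
  show ?case
  proof (induction g rule: poly_mapping_add_induct)
    case (sgl l b)
    have "m - sgl i 1 + l = m + l - sgl i 1" if "coef m i \<noteq> 0"
      using that by (intro poly_mapping_eqI) (auto simp: lookup_add lookup_minus lookup_single when_def)
    moreover have "m + (l - sgl i 1) = m + l - sgl i 1" if "coef l i \<noteq> 0"
      using that by (intro poly_mapping_eqI) (auto simp: lookup_add lookup_minus lookup_single when_def)
    ultimately show ?case
      by (cases "coef m i = 0"; cases "coef l i = 0")
        (simp_all add: mp_pderiv_mono mult_single lookup_add ring_distribs single_add mult.assoc
          mult.left_commute)
  qed (auto simp: algebra_simps)
qed (auto simp: algebra_simps)

lemma mp_pderiv_var [simp]: "mp_pderiv i (mp_var j) = (if i = j then 1 else 0)"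
  by (auto simp: mp_var_def mp_pderiv_mono lookup_single)

lemma mp_pderiv_const [simp]: "mp_pderiv i (mp_const c) = 0"
  by (auto simp: mp_const_def mp_pderiv_mono)

lemma mp_pderiv_1 [simp]: "mp_pderiv i 1 = 0"
  using mp_pderiv_const[of i 1] by simp

lemma mp_subst_superset:
  assumes "finite S" "supp f \<subseteq> S"
  shows "mp_subst g f = (\<Sum>m\<in>S. mp_const (coef f m) * (\<Prod>i\<in>supp m. g i ^ coef m i))"
  unfolding mp_subst_def by (rule sum.mono_neutral_left) (use assms in \<open>auto simp: in_keys_iff\<close>)

lemma mp_subst_add [simp]: "mp_subst g (f + h) = mp_subst g f + mp_subst g h"
proof -
  let ?S = "supp f \<union> supp h"
  have "finite ?S" "supp f \<subseteq> ?S" "supp h \<subseteq> ?S" "supp (f + h) \<subseteq> ?S"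
    using Poly_Mapping.keys_add[of f h] by auto
  then show ?thesis
    by (simp add: mp_subst_superset[of ?S] lookup_add sum.distrib algebra_simps)
qed

lemma mp_subst_0 [simp]: "mp_subst g 0 = 0"
  by (simp add: mp_subst_def)

lemma mp_subst_mono: "mp_subst g (sgl m c) = mp_const c * (\<Prod>i\<in>supp m. g i ^ coef m i)"
  by (cases "c = 0") (auto simp: mp_subst_def)

lemma mp_subst_mult [simp]: "mp_subst g (f * h) = mp_subst g f * mp_subst g h"
proof (induction f rule: poly_mapping_add_induct)
  case (sgl m c)
  show ?case
  proof (induction h rule: poly_mapping_add_induct)
    case (sgl l b)
    let ?S = "supp m \<union> supp l"
    have *: "(\<Prod>i\<in>supp n. g i ^ coef n i) = (\<Prod>i\<in>?S. g i ^ coef n i)" if "supp n \<subseteq> ?S" for n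
      using that by (intro prod.mono_neutral_left) (auto simp: in_keys_iff)
    have "(\<Prod>i\<in>supp (m + l). g i ^ coef (m + l) i) =
        (\<Prod>i\<in>supp m. g i ^ coef m i) * (\<Prod>i\<in>supp l. g i ^ coef l i)"
      using Poly_Mapping.keys_add[of m l] by (subst (1 2 3) *) (auto simp: lookup_add power_add prod.distrib)
    then show ?case by (simp add: mult_single mp_subst_mono algebra_simps)
  qed (auto simp: algebra_simps)
qed (auto simp: algebra_simps)

lemma mp_subst_const [simp]: "mp_subst g (mp_const c) = mp_const c"
  by (simp add: mp_const_def mp_subst_mono)

lemma mp_subst_var [simp]: "mp_subst g (mp_var i) = g i"
  by (simp add: mp_var_def mp_subst_mono)

lemma mp_subst_1 [simp]: "mp_subst g 1 = 1"
  using mp_subst_const[of g 1] by simp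

lemma mp_subst_uminus [simp]: "mp_subst g (- f) = - mp_subst g f"
  by (metis add.inverse_unique mp_subst_0 mp_subst_add add.right_inverse)

lemma mp_subst_sum [simp]: "mp_subst g (sum f S) = (\<Sum>i\<in>S. mp_subst g (f i))"
  by (induction S rule: infinite_finite_induct) auto

section \<open>The algebra of forms\<close>

lemma shuffle_sign_Un_right:
  assumes "finite I" "finite J" "finite L" "J \<inter> L = {}"
  shows "shuffle_sign I (J \<union> L) = shuffle_sign I J * shuffle_sign I L"
proof -
  let ?A = "\<lambda>J. {(i, j). i \<in> I \<and> j \<in> J \<and> j < i}"
  have fin: "finite (?A J)" if "finite J" for J
    by (rule finite_subset[of _ "I \<times> J"]) (use that assms in auto)
  have "?A (J \<union> L) = ?A J \<union> ?A L" "?A J \<inter> ?A L = {}" using assms by auto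
  then have "card (?A (J \<union> L)) = card (?A J) + card (?A L)"
    using fin assms by (simp add: card_Un_disjoint)
  then show ?thesis by (simp add: shuffle_sign_def power_add)
qed

lemma shuffle_sign_Un_left:
  assumes "finite I" "finite J" "finite L" "J \<inter> L = {}"
  shows "shuffle_sign (J \<union> L) I = shuffle_sign J I * shuffle_sign L I"
proof -
  let ?A = "\<lambda>J. {(i, j). i \<in> J \<and> j \<in> I \<and> j < i}"
  have fin: "finite (?A J)" if "finite J" for J
    by (rule finite_subset[of _ "J \<times> I"]) (use that assms in auto)
  have "?A (J \<union> L) = ?A J \<union> ?A L" "?A J \<inter> ?A L = {}" using assms by auto
  then have "card (?A (J \<union> L)) = card (?A J) + card (?A L)"
    using fin assms by (simp add: card_Un_disjoint)
  then show ?thesis by (simp add: shuffle_sign_def power_add)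
qed

lemma shuffle_sign_empty [simp]: "shuffle_sign {} J = 1" "shuffle_sign I {} = 1"
  by (auto simp: shuffle_sign_def)

lemma shuffle_sign_sqr [simp]:
  fixes x :: "'r::comm_ring_1"
  shows "shuffle_sign I J * shuffle_sign I J = (1::'r)" "shuffle_sign I J * (shuffle_sign I J * x) = x"
  by (simp_all add: shuffle_sign_def minus_one_power_iff)

lemma shuffle_sign_singleton: "shuffle_sign {i} J = (- 1) ^ card {j\<in>J. j < i}"
proof -
  have "{(i', j). i' \<in> {i} \<and> j \<in> J \<and> j < i'} = Pair i ` {j\<in>J. j < i}" by auto
  then show ?thesis by (simp add: shuffle_sign_def card_image inj_on_def)
qed

text \<open>Finite support makes forms in all variables \<open>t_0, t_1, ...\<close> a ring. The dimension \<open>n\<close> enters only through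
  the relation \<open>eqv n\<close>, equality in \<open>nabla n\<close>, and the predicate \<open>fr n\<close>, being a form in
  \<open>t_0, ..., t_n\<close>.\<close>

typedef (overloaded) 'k pform =
  "{w :: 'k::comm_ring_1 form. finite {I. w I \<noteq> 0} \<and> (\<forall>I. w I \<noteq> 0 \<longrightarrow> finite I)}"
  morphisms cf Abs_pform
  by (rule exI[of _ "\<lambda>_. 0"]) auto

setup_lifting type_definition_pform

lemma pform_eqI: "(\<And>I. finite I \<Longrightarrow> cf a I = cf b I) \<Longrightarrow> a = b"
  by transfer (metis (no_types, lifting) ext)

lemma cf_infinite: "infinite I \<Longrightarrow> cf a I = 0"
  by transfer auto

lemma finite_supp_pform [simp]: "finite {I. cf a I \<noteq> 0}"
  by transfer auto

lemma form_mult_nonzero: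
  assumes "form_mult v w K \<noteq> 0"
  shows "\<exists>I J. K = I \<union> J \<and> v I \<noteq> 0 \<and> w J \<noteq> 0"
proof -
  obtain I where "I \<in> Pow K" "shuffle_sign I (K - I) * (v I * w (K - I)) \<noteq> 0"
    using assms unfolding form_mult_def by (rule sum.not_neutral_contains_not_neutral)
  then show ?thesis
    by (intro exI[of _ I] exI[of _ "K - I"]) auto
qed

instantiation pform :: (comm_ring_1) ring_1
begin

lift_definition zero_pform :: "'a pform" is "\<lambda>_. 0" by auto
lift_definition one_pform :: "'a pform" is "form_monom 1 {}" by (auto simp: form_monom_def)
lift_definition plus_pform :: "'a pform \<Rightarrow> 'a pform \<Rightarrow> 'a pform" is "\<lambda>v w I. v I + w I"
proof (intro conjI)
  fix v w :: "'a form"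
  assume a: "finite {I. v I \<noteq> 0} \<and> (\<forall>I. v I \<noteq> 0 \<longrightarrow> finite I)"
    "finite {I. w I \<noteq> 0} \<and> (\<forall>I. w I \<noteq> 0 \<longrightarrow> finite I)"
  show "finite {I. v I + w I \<noteq> 0}"
    by (rule finite_subset[of _ "{I. v I \<noteq> 0} \<union> {I. w I \<noteq> 0}"]) (use a in auto)
  show "\<forall>I. v I + w I \<noteq> 0 \<longrightarrow> finite I" using a by (metis add.right_neutral)
qed
lift_definition uminus_pform :: "'a pform \<Rightarrow> 'a pform" is "\<lambda>v I. - v I" by auto
definition minus_pform :: "'a pform \<Rightarrow> 'a pform \<Rightarrow> 'a pform" where "minus_pform a b = a + - b"
lift_definition times_pform :: "'a pform \<Rightarrow> 'a pform \<Rightarrow> 'a pform" is form_mult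
proof (intro conjI)
  fix v w :: "'a form"
  assume a: "finite {I. v I \<noteq> 0} \<and> (\<forall>I. v I \<noteq> 0 \<longrightarrow> finite I)"
    "finite {I. w I \<noteq> 0} \<and> (\<forall>I. w I \<noteq> 0 \<longrightarrow> finite I)"
  show "finite {I. form_mult v w I \<noteq> 0}"
  proof (rule finite_subset)
    show "{K. form_mult v w K \<noteq> 0} \<subseteq> (\<lambda>(I, J). I \<union> J) ` ({I. v I \<noteq> 0} \<times> {I. w I \<noteq> 0})"
      by (auto dest!: form_mult_nonzero)
  qed (use a in auto)
  show "\<forall>I. form_mult v w I \<noteq> 0 \<longrightarrow> finite I"
    using a by (auto dest!: form_mult_nonzero)
qed

lemma cf_mult: "cf (a * b) K = (\<Sum>I\<in>Pow K. shuffle_sign I (K - I) * (cf a I * cf b (K - I)))"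
  by transfer (simp add: form_mult_def)

text \<open>Both bracketings expand into a sum over the ways to cut \<open>K\<close> into three
  ordered blocks. Shuffle signs are multiplicative in each argument, so either way the sign is the
  product of the three pairwise ones.\<close>

lemma pform_mult_assoc: "a * b * c = a * (b * (c :: 'a pform))"
proof (rule pform_eqI)
  fix K :: "nat set" assume K: "finite K"
  let ?f = "\<lambda>J M. shuffle_sign J M * shuffle_sign J (K - J - M) * shuffle_sign M (K - J - M) *
      (cf a J * (cf b M * cf c (K - J - M)))"
  have 1: "cf (a * b * c) K = (\<Sum>I\<in>Pow K. \<Sum>J\<in>Pow I. ?f J (I - J))"
  proof -
    have "shuffle_sign I (K - I) * (shuffle_sign J (I - J) * (cf a J * cf b (I - J)) * cf c (K - I))
       = ?f J (I - J)" if "I \<subseteq> K" "J \<subseteq> I" for I J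
    proof -
      have "K - J - (I - J) = K - I" "I = J \<union> (I - J)" using that by auto
      moreover have "finite I" "finite J" using that K by (auto intro: finite_subset)
      ultimately have "shuffle_sign I (K - I) = shuffle_sign J (K - I) * (shuffle_sign (I - J) (K - I) :: 'a mpoly)"
        by (metis Diff_disjoint K finite_Diff shuffle_sign_Un_left)
      then show ?thesis using \<open>K - J - (I - J) = K - I\<close> by (simp add: ac_simps)
    qed
    then show ?thesis
      unfolding cf_mult[of "a * b"] by (auto simp: cf_mult[of a] sum_distrib_left sum_distrib_right intro!: sum.cong)
  qed
  have 2: "cf (a * (b * c)) K = (\<Sum>J\<in>Pow K. \<Sum>M\<in>Pow (K - J). ?f J M)"
  proof -
    have "shuffle_sign J (K - J) * (cf a J * (shuffle_sign M (K - J - M) * (cf b M * cf c (K - J - M))))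
       = ?f J M" if "J \<subseteq> K" "M \<subseteq> K - J" for J M
    proof -
      have "K - J = M \<union> (K - J - M)" using that by auto
      moreover have "finite M" "finite J" using that K by (auto intro: finite_subset)
      ultimately have "shuffle_sign J (K - J) = shuffle_sign J M * (shuffle_sign J (K - J - M) :: 'a mpoly)"
        by (metis Diff_disjoint K finite_Diff shuffle_sign_Un_right)
      then show ?thesis by (simp add: ac_simps)
    qed
    then show ?thesis
      unfolding cf_mult[of a] by (auto simp: cf_mult[of b] sum_distrib_left intro!: sum.cong)
  qed
  have finP: "finite (Pow I)" if "I \<subseteq> K" for I
    using that K by (meson finite_Pow_iff finite_subset)
  show "cf (a * b * c) K = cf (a * (b * c)) K"
    unfolding 1 2
    apply (subst sum.Sigma, use K finP in auto)
    apply (subst sum.Sigma, use K finP in auto)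
    apply (rule sum.reindex_bij_witness[of _ "\<lambda>(J, M). (J \<union> M, J)" "\<lambda>(I, J). (J, I - J)"])
    by auto
qed

instance
proof
  fix a b c :: "'a pform"
  show "a * b * c = a * (b * c)" by (rule pform_mult_assoc)
  show "a + b + c = a + (b + c)" by transfer (auto simp: add.assoc)
  show "a + b = b + a" by transfer (auto simp: add.commute)
  show "0 + a = a" by transfer auto
  show "- a + a = 0" by transfer auto
  show "a - b = a + - b" by (rule minus_pform_def)
  show "(a + b) * c = a * c + b * c"
    by transfer (simp add: form_mult_def ring_distribs sum.distrib)
  show "a * (b + c) = a * b + a * c"
    by transfer (simp add: form_mult_def ring_distribs sum.distrib)
  show "(0::'a pform) \<noteq> 1" 
    by (metis one_pform.rep_eq zero_pform.rep_eq form_monom_def zero_neq_one)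
  show "1 * a = a"
  proof (rule pform_eqI)
    fix K :: "nat set" assume "finite K"
    have "cf (1 * a) K = (\<Sum>I\<in>Pow K. if I = {} then cf a K else 0)"
      unfolding cf_mult by (rule sum.cong) (auto simp: one_pform.rep_eq form_monom_def)
    then show "cf (1 * a) K = cf a K" using \<open>finite K\<close> by simp
  qed
  show "a * 1 = a"
  proof (rule pform_eqI)
    fix K :: "nat set" assume "finite K"
    have "cf (a * 1) K = (\<Sum>I\<in>Pow K. if K = I then cf a K else 0)"
      unfolding cf_mult by (rule sum.cong) (auto simp: one_pform.rep_eq form_monom_def)
    also have "\<dots> = (if K \<in> Pow K then cf a K else 0)"
      by (rule sum.delta') (use \<open>finite K\<close> in auto)
    finally show "cf (a * 1) K = cf a K" by (simp only: Pow_iff subset_refl if_True)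
  qed
qed

end

section \<open>Coefficients and generators of the algebra of forms\<close>

lemma cf_simps [simp]: "cf 0 I = 0" "cf (a + b) I = cf a I + cf b I" "cf (- a) I = - cf a I"
  "cf (a - b) I = cf a I - cf b I"
  by (simp_all only: zero_pform.rep_eq plus_pform.rep_eq uminus_pform.rep_eq minus_pform_def
      diff_conv_add_uminus)

lemma cf_1: "cf 1 I = (if I = {} then 1 else 0)"
  by (auto simp: one_pform.rep_eq form_monom_def)

lemma cf_sum [simp]: "cf (sum f S) I = (\<Sum>x\<in>S. cf (f x) I)"
  by (induction S rule: infinite_finite_induct) auto

lift_definition pf_monom :: "'k::comm_ring_1 mpoly \<Rightarrow> nat set \<Rightarrow> 'k pform" is
  "\<lambda>f I. if finite I then form_monom f I else (\<lambda>_. 0)"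
  by (auto simp: form_monom_def)

definition Pf :: "'k::comm_ring_1 mpoly \<Rightarrow> 'k pform" where "Pf f = pf_monom f {}"
definition ee :: "nat set \<Rightarrow> 'k::comm_ring_1 pform" where "ee I = pf_monom 1 I"
definition sc :: "'k::comm_ring_1 \<Rightarrow> 'k pform" where "sc c = Pf (mp_const c)"
abbreviation Xv :: "nat \<Rightarrow> 'k::comm_ring_1 pform" where "Xv i \<equiv> Pf (mp_var i)"
abbreviation dtv :: "nat \<Rightarrow> 'k::comm_ring_1 pform" where "dtv i \<equiv> ee {i}"

lemma cf_pf_monom: "cf (pf_monom f I) J = (if finite I \<and> J = I then f else 0)"
  by (simp add: pf_monom.rep_eq form_monom_def)

lemma cf_ee: "cf (ee I) J = (if finite I \<and> J = I then 1 else 0)"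
  by (simp add: ee_def cf_pf_monom)

lemma cf_Pf: "cf (Pf f) J = (if J = {} then f else 0)"
  by (simp add: Pf_def cf_pf_monom)

lemma cf_mult_finite:
  assumes "finite K"
  shows "cf (pf_monom f I * b) K =
    (if finite I \<and> I \<subseteq> K then shuffle_sign I (K - I) * (f * cf b (K - I)) else 0)"
proof -
  have "cf (pf_monom f I * b) K = (\<Sum>M\<in>Pow K. if M = I then
      (if finite I then shuffle_sign I (K - I) * (f * cf b (K - I)) else 0) else 0)"
    unfolding cf_mult by (rule sum.cong) (auto simp: cf_pf_monom)
  also have "\<dots> = (if I \<in> Pow K then (if finite I then shuffle_sign I (K - I) * (f * cf b (K - I)) else 0) else 0)"
    by (rule sum.delta) (use assms in auto)
  finally show ?thesis by auto
qed

lemma cf_Pf_mult [simp]: "cf (Pf f * b) K = f * cf b K"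
  by (cases "finite K") (simp_all add: Pf_def cf_mult_finite cf_infinite)

lemma cf_sc_mult [simp]: "cf (sc c * b) K = mp_const c * cf b K"
  by (simp add: sc_def)

lemma cf_dtv_mult:
  "cf (dtv j * b) K = (if finite K \<and> j \<in> K then shuffle_sign {j} (K - {j}) * cf b (K - {j}) else 0)"
  by (cases "finite K") (simp_all add: ee_def cf_mult_finite cf_infinite)

lemma pf_monom_mult:
  assumes "finite I" "finite J"
  shows "pf_monom f I * pf_monom g J =
    (if I \<inter> J = {} then pf_monom (shuffle_sign I J * (f * g)) (I \<union> J) else 0)"
proof (rule pform_eqI)
  fix K :: "nat set" assume K: "finite K"
  have "K - I = J \<longleftrightarrow> I \<inter> J = {} \<and> K = I \<union> J" if "I \<subseteq> K" using that by auto
  moreover have "I \<union> J - I = J" if "I \<inter> J = {}" using that by auto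
  ultimately show "cf (pf_monom f I * pf_monom g J) K =
    cf (if I \<inter> J = {} then pf_monom (shuffle_sign I J * (f * g)) (I \<union> J) else 0) K"
    using K assms by (auto simp: cf_mult_finite cf_pf_monom)
qed

lemma pform_add_induct [case_names monom add]:
  fixes a :: "'k::comm_ring_1 pform"
  assumes "\<And>f I. finite I \<Longrightarrow> Q (pf_monom f I)" "\<And>a b. Q a \<Longrightarrow> Q b \<Longrightarrow> Q (a + b)"
  shows "Q a"
proof -
  have a: "a = (\<Sum>I | cf a I \<noteq> 0. pf_monom (cf a I) I)"
  proof (rule pform_eqI)
    fix K :: "nat set" assume "finite K"
    have "(\<Sum>I | cf a I \<noteq> 0. cf (pf_monom (cf a I) I) K) = (\<Sum>I | cf a I \<noteq> 0. if K = I then cf a I else 0)"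
      using \<open>finite K\<close> by (intro sum.cong) (auto simp: cf_pf_monom)
    then show "cf a K = cf (\<Sum>I | cf a I \<noteq> 0. pf_monom (cf a I) I) K"
      by (simp add: sum.delta)
  qed
  have 0: "Q 0"
  proof -
    have "pf_monom (0 :: 'k mpoly) {} = 0" by (rule pform_eqI) (simp add: cf_pf_monom)
    then show ?thesis using assms(1)[of "{}" 0] by simp
  qed
  have fin: "finite I" if "cf a I \<noteq> 0" for I using that cf_infinite by blast
  have "Q (\<Sum>I\<in>S. pf_monom (cf a I) I)" if "finite S" "S \<subseteq> {I. cf a I \<noteq> 0}" for S
    using that by (induction S) (use 0 assms fin in auto)
  then show ?thesis by (subst a) simp
qed

lemma Pf_simps [simp]: "Pf (f + g) = Pf f + Pf g" "Pf (f * g) = Pf f * Pf g" "Pf (- f) = - Pf f"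
  "Pf 1 = 1" "Pf 0 = 0" "Pf (f - g) = Pf f - Pf g"
  by (auto intro!: pform_eqI simp: cf_Pf cf_1)

lemma Pf_sum [simp]: "Pf (sum f S) = (\<Sum>i\<in>S. Pf (f i))"
  by (induction S rule: infinite_finite_induct) auto

lemma sc_simps [simp]: "sc (a + b) = sc a + sc b" "sc (a * b) = sc a * sc b" "sc (- a) = - sc a"
  "sc 1 = 1" "sc 0 = 0"
  by (auto simp: sc_def)

lemma sc_power [simp]: "sc (a ^ n) = sc a ^ n"
  by (induction n) auto

lemma sc_of_nat [simp]: "sc (of_nat n) = of_nat n"
  by (induction n) auto

lemma Pf_power [simp]: "Pf (f ^ n) = Pf f ^ n"
  by (induction n) auto

lemma Pf_commute: "a * Pf f = Pf f * a"
  by (induction a rule: pform_add_induct)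
    (auto simp: Pf_def pf_monom_mult algebra_simps)

lemma sc_commute: "a * sc c = sc c * a"
  by (simp add: sc_def Pf_commute)

lemma sc_left_commute: "a * (sc c * b) = sc c * (a * b)"
  by (metis mult.assoc sc_commute)

lemma Pf_left_commute: "a * (Pf f * b) = Pf f * (a * b)"
  by (metis mult.assoc Pf_commute)

lemma pf_monom_eq: "pf_monom f I = Pf f * ee I"
  by (rule pform_eqI) (simp add: cf_pf_monom cf_ee)

lemma ee_empty [simp]: "ee {} = 1"
  by (rule pform_eqI) (simp add: cf_ee cf_1)

lemma ee_mult: "finite I \<Longrightarrow> finite J \<Longrightarrow>
  ee I * ee J = (if I \<inter> J = {} then sc (shuffle_sign I J) * ee (I \<union> J) else 0)"
proof -
  have *: "mp_const (shuffle_sign I J) = (shuffle_sign I J :: 'a mpoly)"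
    by (simp add: shuffle_sign_def minus_one_power_iff)
  assume "finite I" "finite J"
  then show ?thesis
    unfolding ee_def by (auto simp: pf_monom_mult sc_def *)
      (auto intro!: pform_eqI simp: cf_pf_monom)
qed

lemma dtv_ee: "finite I \<Longrightarrow>
  dtv i * ee I = (if i \<notin> I then sc (shuffle_sign {i} I) * ee (insert i I) else 0)"
  by (simp add: ee_mult)

lemma dtv_ee_min: "finite I \<Longrightarrow> (\<And>j. j \<in> I \<Longrightarrow> i < j) \<Longrightarrow> dtv i * ee I = ee (insert i I)"
proof -
  assume I: "finite I" "\<And>j. j \<in> I \<Longrightarrow> i < j"
  then have "{j\<in>I. j < i} = {}" "i \<notin> I" by fastforce+
  then have "shuffle_sign {i} I = (1 :: 'a)"
    unfolding shuffle_sign_singleton by (simp only: card.empty power_0)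
  then show ?thesis using I \<open>i \<notin> I\<close> by (simp add: dtv_ee)
qed

text \<open>The forms in the variables from \<open>V\<close> are generated as an algebra by scalars,
  \<open>t_i\<close> and \<open>dt_i\<close>. Identities between algebra morphisms or derivations
  are later checked on these generators instead of on coefficients.\<close>

lemma pform_induct_on [consumes 2, case_names const var diff add mult]:
  fixes a :: "'k::comm_ring_1 pform"
  assumes "\<And>I. cf a I \<in> mpolys_over V" "\<And>I. cf a I \<noteq> 0 \<Longrightarrow> I \<subseteq> V"
  assumes c: "\<And>c. Q (sc c)" "\<And>i. i \<in> V \<Longrightarrow> Q (Xv i)" "\<And>i. i \<in> V \<Longrightarrow> Q (dtv i)"
    "\<And>a b. Q a \<Longrightarrow> Q b \<Longrightarrow> Q (a + b)" "\<And>a b. Q a \<Longrightarrow> Q b \<Longrightarrow> Q (a * b)"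
  shows "Q a"
proof -
  have 0: "Q 0" and 1: "Q 1" using c(1)[of 0] c(1)[of 1] by auto
  have pw: "Q (Xv i ^ n)" if "i \<in> V" for i n by (induction n) (use 1 c that in auto)
  have "Q (\<Prod>i\<leftarrow>xs. Xv i ^ coef m i)" if "set xs \<subseteq> V" for xs m
    using that by (induction xs) (use 1 pw c in auto)
  moreover have "(\<Prod>i\<leftarrow>xs. Xv i ^ coef m i) = Pf (\<Prod>i\<leftarrow>xs. mp_var i ^ coef m i)" for xs m
    by (induction xs) auto
  ultimately have calc: "Q (Pf (\<Prod>i\<leftarrow>xs. mp_var i ^ coef m i))" if "set xs \<subseteq> V" for xs m
    using that by metis
  have "Q (Pf (sgl m 1))" if "supp m \<subseteq> V" for m
  proof -
    have "sgl m (1 :: 'k) = (\<Prod>i\<leftarrow>sorted_list_of_set (supp m). mp_var i ^ coef m i)"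
      using sgl_prod[of m, where ?'k = 'k]
        prod.distinct_set_conv_list[of "sorted_list_of_set (supp m)" "\<lambda>i. mp_var i ^ coef m i :: 'k mpoly"]
      by simp
    then show ?thesis using calc that by simp
  qed
  then have "Q (Pf (sgl m x))" if "supp m \<subseteq> V" for m x
    unfolding sgl_mult[of m x] Pf_simps using that c(1,5) by (auto simp flip: sc_def)
  moreover have "Pf f = (\<Sum>m\<in>supp f. Pf (sgl m (coef f m)))" for f
    by (subst poly_mapping_sum_sgls) simp
  moreover have sm: "Q (sum F S)" if "finite S" "\<And>x. x \<in> S \<Longrightarrow> Q (F x)" for S and F :: "'c \<Rightarrow> 'k pform"
    using that by (induction S) (use 0 c in auto)
  ultimately have Pf: "Q (Pf f)" if "f \<in> mpolys_over V" for f
    using that unfolding mpolys_over_def by (metis (no_types, lifting) finite_keys mem_Collect_eq sm)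
  have ee: "Q (ee I)" if "finite I" "I \<subseteq> V" for I
    using that
  proof (induction I rule: finite_linorder_min_induct)
    case (insert i I)
    then show ?case using dtv_ee_min[of I i] c by (metis insert_subset)
  qed (use 1 in auto)
  have a: "a = (\<Sum>I | cf a I \<noteq> 0. Pf (cf a I) * ee I)"
  proof (rule pform_eqI)
    fix K :: "nat set" assume "finite K"
    have "(\<Sum>I | cf a I \<noteq> 0. cf (Pf (cf a I) * ee I) K) = (\<Sum>I | cf a I \<noteq> 0. if K = I then cf a I else 0)"
      using \<open>finite K\<close> by (intro sum.cong) (auto simp: cf_ee)
    then show "cf a K = cf (\<Sum>I | cf a I \<noteq> 0. Pf (cf a I) * ee I) K"
      by (simp add: sum.delta)
  qed
  have "Q (Pf (cf a I) * ee I)" if "cf a I \<noteq> 0" for I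
    using that assms(1,2) cf_infinite[of I a] by (intro c(5) Pf ee) blast+
  then show ?thesis by (subst a) (auto intro!: sm)
qed

lemma pform_induct [case_names const var diff add mult]:
  assumes "\<And>c. Q (sc c)" "\<And>i. Q (Xv i)" "\<And>i. Q (dtv i)"
    "\<And>a b. Q a \<Longrightarrow> Q b \<Longrightarrow> Q (a + b)" "\<And>a b. Q a \<Longrightarrow> Q b \<Longrightarrow> Q (a * b)"
  shows "Q a"
  by (rule pform_induct_on[where V = UNIV]) (use assms in \<open>auto simp: mpolys_over_def\<close>)

lemma dtv_anticommute: "dtv i * dtv j = - (dtv j * dtv i)"
proof (cases "i = j")
  case False
  have "shuffle_sign {i} {j} = (if j < i then - 1 else (1 :: 'a))" for i j :: nat
    by (simp add: shuffle_sign_singleton Collect_conv_if)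
  then show ?thesis using False by (auto simp: dtv_ee insert_commute)
qed (simp add: dtv_ee)

text \<open>The grading automorphism, \<open>(- 1) ^ q\<close> in degree \<open>q\<close>. With it
  the graded Leibniz rules can be stated for inhomogeneous forms.\<close>

lift_definition bar :: "'k::comm_ring_1 pform \<Rightarrow> 'k pform" is "\<lambda>w I. (- 1) ^ card I * w I"
  by (auto elim: rev_finite_subset)

lemma cf_bar: "cf (bar a) I = (- 1) ^ card I * cf a I"
  by (simp add: bar.rep_eq)

lemma bar_add [simp]: "bar (a + b) = bar a + bar b"
  by (rule pform_eqI) (simp add: cf_bar algebra_simps)

lemma bar_bar [simp]: "bar (bar a) = a"
  by (rule pform_eqI) (simp add: cf_bar flip: mult.assoc power_mult_distrib)

lemma bar_Pf [simp]: "bar (Pf f) = Pf f"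
  by (rule pform_eqI) (simp add: cf_bar cf_Pf)

lemma bar_sc [simp]: "bar (sc c) = sc c" by (simp add: sc_def)

lemma bar_0 [simp]: "bar 0 = 0" "bar 1 = 1"
  using bar_sc[of 0] bar_sc[of 1] by auto

lemma bar_ee: "bar (ee I) = (- 1) ^ card I * ee I"
proof -
  have "bar (ee I) = sc ((- 1) ^ card I) * ee I"
    by (rule pform_eqI) (simp add: cf_bar cf_ee minus_one_power_iff)
  then show ?thesis by simp
qed

lemma bar_pf_monom: "bar (pf_monom f I) = pf_monom ((- 1) ^ card I * f) I"
  by (rule pform_eqI) (simp add: cf_bar cf_pf_monom)

lemma bar_mult [simp]: "bar (a * b) = bar a * bar b"
proof (induction a rule: pform_add_induct)
  case (monom f I)
  show ?case
  proof (induction b rule: pform_add_induct)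
    case (monom g J)
    with \<open>finite I\<close> show ?case
      by (auto simp: pf_monom_mult bar_pf_monom card_Un_disjoint power_add algebra_simps)
  qed (simp add: algebra_simps)
qed (simp add: algebra_simps)

lemma dtv_mult_bar: "dtv i * a = bar a * dtv i"
proof (induction a rule: pform_induct)
  case (diff j)
  then show ?case by (simp add: bar_ee dtv_anticommute[of i])
qed (auto simp: Pf_commute sc_commute algebra_simps simp flip: mult.assoc, metis mult.assoc)

section \<open>The differential\<close>

lift_definition pd :: "nat \<Rightarrow> 'k::comm_ring_1 pform \<Rightarrow> 'k pform" is "\<lambda>i w I. mp_pderiv i (w I)"
proof (intro conjI)
  fix i and w :: "'k form" assume w: "finite {I. w I \<noteq> 0} \<and> (\<forall>I. w I \<noteq> 0 \<longrightarrow> finite I)"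
  have "w I \<noteq> 0" if "mp_pderiv i (w I) \<noteq> 0" for I using that mp_pderiv_0 by metis
  then show "finite {I. mp_pderiv i (w I) \<noteq> 0}" "\<forall>I. mp_pderiv i (w I) \<noteq> 0 \<longrightarrow> finite I"
    using w by (auto elim!: rev_finite_subset)
qed

lemma cf_pd: "cf (pd i a) I = mp_pderiv i (cf a I)"
  by (simp add: pd.rep_eq)

lemma mp_pderiv_sum: "mp_pderiv i (sum f S) = (\<Sum>x\<in>S. mp_pderiv i (f x))"
  by (induction S rule: infinite_finite_induct) auto

lemma mp_pderiv_sign: "mp_pderiv i (shuffle_sign I J * f) = shuffle_sign I J * mp_pderiv i f"
proof -
  have "mp_pderiv i (- f) = - mp_pderiv i f"
    by (metis add.inverse_unique add.right_inverse mp_pderiv_0 mp_pderiv_add)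
  then show ?thesis by (simp add: shuffle_sign_def minus_one_power_iff)
qed

lemma pd_mult: "pd i (a * b) = pd i a * b + a * pd i b"
  by (rule pform_eqI)
    (simp add: cf_pd cf_mult mp_pderiv_sum mp_pderiv_sign, simp add: mp_pderiv_mult ring_distribs sum.distrib)

lemma pd_add: "pd i (a + b) = pd i a + pd i b"
  by (rule pform_eqI) (simp add: cf_pd)

lemma finite_pderiv_nonzero: "finite {i. mp_pderiv i f \<noteq> 0}"
proof (induction f rule: poly_mapping_add_induct)
  case (sgl m c)
  have "{i. mp_pderiv i (sgl m c) \<noteq> 0} \<subseteq> supp m"
    by (auto simp: mp_pderiv_mono in_keys_iff intro!: gr0I)
  then show ?case by (rule finite_subset) simp
next
  case (add f g)
  then show ?case by (intro finite_subset[OF _ finite_UnI[OF add]]) auto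
qed

lift_definition dd :: "'k::comm_ring_1 pform \<Rightarrow> 'k pform" is form_d
proof (intro conjI)
  fix w :: "'k form" assume w: "finite {I. w I \<noteq> 0} \<and> (\<forall>I. w I \<noteq> 0 \<longrightarrow> finite I)"
  have *: "\<exists>J i. K = insert i J \<and> w J \<noteq> 0 \<and> mp_pderiv i (w J) \<noteq> 0" if "form_d w K \<noteq> 0" for K
  proof -
    have "\<exists>i\<in>K. shuffle_sign {i} (K - {i}) * mp_pderiv i (w (K - {i})) \<noteq> 0"
      using that unfolding form_d_def by (meson sum.neutral)
    then obtain i where "i \<in> K" "shuffle_sign {i} (K - {i}) * mp_pderiv i (w (K - {i})) \<noteq> 0" by blast
    then have "K = insert i (K - {i})" "mp_pderiv i (w (K - {i})) \<noteq> 0" by auto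
    then show ?thesis by (metis mp_pderiv_0)
  qed
  have "{K. form_d w K \<noteq> 0} \<subseteq> (\<Union>J\<in>{J. w J \<noteq> 0}. (\<lambda>i. insert i J) ` {i. mp_pderiv i (w J) \<noteq> 0})"
    using * by blast
  then show "finite {K. form_d w K \<noteq> 0}"
    by (rule finite_subset) (use w finite_pderiv_nonzero in auto)
  show "\<forall>I. form_d w I \<noteq> 0 \<longrightarrow> finite I" using w * by (metis finite_insert)
qed

lemma cf_dd: "finite V \<Longrightarrow> K \<subseteq> V \<Longrightarrow> cf (dd a) K = cf (\<Sum>i\<in>V. dtv i * pd i a) K"
proof -
  assume V: "finite V" "K \<subseteq> V"
  then have K: "finite K" by (auto intro: finite_subset)
  have "cf (dd a) K = (\<Sum>i\<in>K. shuffle_sign {i} (K - {i}) * mp_pderiv i (cf a (K - {i})))"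
    by (simp add: dd.rep_eq form_d_def)
  also have "\<dots> = (\<Sum>i\<in>V. cf (dtv i * pd i a) K)"
    by (rule sum.mono_neutral_cong_left) (use V K in \<open>auto simp: cf_dtv_mult cf_pd\<close>)
  finally show ?thesis by simp
qed

lemma cf_mult_cong:
  "(\<And>I. I \<subseteq> K \<Longrightarrow> cf a I = cf a' I) \<Longrightarrow> (\<And>I. I \<subseteq> K \<Longrightarrow> cf b I = cf b' I) \<Longrightarrow> cf (a * b) K = cf (a' * b') K"
  unfolding cf_mult by (rule sum.cong) auto

text \<open>The coefficient of a product at \<open>K\<close> only sees coefficients at subsets of
  \<open>K\<close>. There \<open>dd\<close> may be replaced by the finite sum of the
  \<open>dt_i\<close> times the partial derivatives over \<open>i\<close> in \<open>K\<close>, for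
  which the rule follows from \<open>pd_mult\<close> and \<open>dtv_mult_bar\<close>.\<close>

lemma dd_mult: "dd (a * b) = dd a * b + bar a * dd b"
proof (rule pform_eqI)
  fix K :: "nat set" assume K: "finite K"
  let ?d = "\<lambda>a. \<Sum>i\<in>K. dtv i * pd i a"
  have "dtv i * (a * pd i b) = bar a * (dtv i * pd i b)" for i
    by (metis dtv_mult_bar mult.assoc)
  then have "?d (a * b) = ?d a * b + bar a * ?d b"
    by (simp add: pd_mult distrib_left mult.assoc sum.distrib sum_distrib_left sum_distrib_right)
  then have "cf (dd (a * b)) K = cf (?d a * b) K + cf (bar a * ?d b) K"
    unfolding cf_dd[OF K subset_refl] by (simp only: cf_simps)
  moreover have "cf (?d a * b) K = cf (dd a * b) K" "cf (bar a * ?d b) K = cf (bar a * dd b) K"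
    by (intro cf_mult_cong refl cf_dd[OF K, symmetric]; assumption)+
  ultimately show "cf (dd (a * b)) K = cf (dd a * b + bar a * dd b) K" by simp
qed

lemma dd_add [simp]: "dd (a + b) = dd a + dd b"
  by (rule pform_eqI) (simp add: cf_dd[OF _ subset_refl] pd_add algebra_simps sum.distrib)

lemma dd_0 [simp]: "dd 0 = 0"
  using dd_add[of 0 0] by simp

lemma dd_uminus [simp]: "dd (- a) = - dd a"
  by (metis add.inverse_unique add.right_inverse dd_0 dd_add)

lemma dd_diff [simp]: "dd (a - b) = dd a - dd b"
  by (metis dd_add dd_uminus diff_conv_add_uminus)

lemma dd_sum [simp]: "dd (sum f S) = (\<Sum>i\<in>S. dd (f i))"
  by (induction S rule: infinite_finite_induct) auto

lemma cf_dd': "cf (dd a) K = (\<Sum>i\<in>K. shuffle_sign {i} (K - {i}) * mp_pderiv i (cf a (K - {i})))"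
  by (simp add: dd.rep_eq form_d_def)

lemma dd_sc [simp]: "dd (sc c) = 0"
  by (rule pform_eqI) (simp add: cf_dd' sc_def cf_Pf if_distrib[of "mp_pderiv _"] cong: if_cong)

lemma dd_1 [simp]: "dd 1 = 0"
  using dd_sc[of 1] by simp

lemma dd_Xv [simp]: "dd (Xv i) = dtv i"
proof (rule pform_eqI)
  fix K :: "nat set" assume "finite K"
  have "cf (dd (Xv i)) K = (\<Sum>j\<in>K. if j = i then (if K = {i} then 1 else 0) else 0)"
    unfolding cf_dd' by (rule sum.cong) (auto simp: cf_Pf)
  then show "cf (dd (Xv i)) K = cf (dtv i) K"
    using \<open>finite K\<close> by (cases "K = {i}") (auto simp: cf_ee split: if_splits)
qed

lemma dd_ee [simp]: "dd (ee I) = 0"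
  by (rule pform_eqI) (simp add: cf_dd' cf_ee if_distrib[of "mp_pderiv _"] cong: if_cong)

lemma dd_sc_mult [simp]: "dd (sc c * a) = sc c * dd a"
  by (simp add: dd_mult)

lemma dd_bar: "dd (bar a) = - bar (dd a)"
  by (induction a rule: pform_induct) (auto simp: dd_mult bar_ee)

lemma dd_dd [simp]: "dd (dd a) = 0"
  by (induction a rule: pform_induct) (auto simp: dd_mult dd_bar)

section \<open>Interior products\<close>

lift_definition contr :: "nat \<Rightarrow> 'k::comm_ring_1 pform \<Rightarrow> 'k pform" is
  "\<lambda>i w K. if finite K \<and> i \<notin> K then shuffle_sign {i} K * w (insert i K) else 0"
proof (intro conjI)
  fix i and w :: "'k form" assume w: "finite {I. w I \<noteq> 0} \<and> (\<forall>I. w I \<noteq> 0 \<longrightarrow> finite I)"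
  let ?f = "\<lambda>K. if finite K \<and> i \<notin> K then shuffle_sign {i} K * w (insert i K) else 0"
  have "K \<in> (\<lambda>J. J - {i}) ` {J. w J \<noteq> 0}" if "?f K \<noteq> 0" for K
  proof -
    have "i \<notin> K" "w (insert i K) \<noteq> 0" using that by (auto split: if_splits)
    moreover then have "K = insert i K - {i}" by auto
    ultimately show ?thesis by blast
  qed
  then have "{K. ?f K \<noteq> 0} \<subseteq> (\<lambda>J. J - {i}) ` {J. w J \<noteq> 0}" by blast
  then show "finite {K. ?f K \<noteq> 0}" by (rule finite_subset) (use w in auto)
  show "\<forall>K. ?f K \<noteq> 0 \<longrightarrow> finite K" by simp
qed

lemma cf_contr: "cf (contr i a) K =
    (if finite K \<and> i \<notin> K then shuffle_sign {i} K * cf a (insert i K) else 0)"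
  by (simp add: contr.rep_eq)

lemma contr_add: "contr i (a + b) = contr i a + contr i b"
  by (rule pform_eqI) (simp add: cf_contr distrib_left)

lemma contr_Pf_mult: "contr i (Pf f * b) = Pf f * contr i b"
  by (rule pform_eqI) (simp add: cf_contr mult.left_commute)

lemma contr_Pf: "contr i (Pf f) = 0"
  by (rule pform_eqI) (simp add: cf_contr cf_Pf)

text \<open>The sign in the definition of \<open>contr\<close> is that of moving \<open>dt_i\<close>
  to the front of the monomial. This rule on generators identifies \<open>contr i\<close> as the
  interior product with the coordinate field of \<open>t_i\<close>.\<close>

lemma contr_dtv_mult: "contr i (dtv j * b) = (if i = j then b else 0) - dtv j * contr i b"
proof (rule pform_eqI)
  fix K :: "nat set" assume K: "finite K"
  show "cf (contr i (dtv j * b)) K = cf ((if i = j then b else 0) - dtv j * contr i b) K"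
  proof (cases "i = j")
    case True
    then show ?thesis
      using K by (auto simp: cf_contr cf_dtv_mult insert_absorb)
  next
    case False
    consider "i \<in> K \<or> j \<notin> K" | "i \<notin> K" "j \<in> K" by blast
    then show ?thesis
    proof cases
      case 1
      then show ?thesis using K False by (auto simp: cf_contr cf_dtv_mult)
    next
      case 2
      have eq: "insert i K - {j} = insert i (K - {j})" using False by auto
      have K': "K = (K - {j}) \<union> {j}" using 2 by auto
      have s: "shuffle_sign {i} K = shuffle_sign {i} (K - {j}) * (shuffle_sign {i} {j} :: 'a mpoly)"
        by (subst K', subst shuffle_sign_Un_right) (use K in auto)
      have s': "shuffle_sign {j} (insert i (K - {j})) = shuffle_sign {j} {i} * (shuffle_sign {j} (K - {j}) :: 'a mpoly)"
        using shuffle_sign_Un_right[of "{j}" "{i}" "K - {j}"] K 2 by simp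
      have s'': "shuffle_sign {i} {j} = - (shuffle_sign {j} {i} :: 'a mpoly)"
        using False by (auto simp: shuffle_sign_singleton Collect_conv_if)
      show ?thesis
        using K False 2 by (simp add: cf_contr cf_dtv_mult eq s s' s'' mult.assoc mult.left_commute)
    qed
  qed
qed

lemma contr_dtv: "contr i (dtv j) = (if i = j then 1 else (0 :: 'a::comm_ring_1 pform))"
  using contr_dtv_mult[of i j "1 :: 'a pform"] contr_Pf[of i "1 :: 'a mpoly"] by auto

lemma contr_mult: "contr i (a * b) = contr i a * b + bar a * contr i b"
proof (induction a arbitrary: b rule: pform_induct)
  case (const c)
  then show ?case by (simp add: sc_def contr_Pf_mult contr_Pf)
next
  case (var j)
  then show ?case by (simp add: contr_Pf_mult contr_Pf)
next
  case (diff j)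
  then show ?case by (simp add: contr_dtv_mult contr_dtv bar_ee)
next
  case (add a a')
  then show ?case by (simp add: distrib_right contr_add)
next
  case (mult a a')
  show ?case by (simp add: mult.assoc mult.IH distrib_right distrib_left)
qed

text \<open>Contraction with the Euler vector field, the sum of the \<open>t_i \<partial>/\<partial>t_i\<close>.\<close>

definition iota :: "'k::comm_ring_1 pform \<Rightarrow> 'k pform" where
  "iota a = (\<Sum>i\<in>\<Union>{I. cf a I \<noteq> 0}. Xv i * contr i a)"

lemma finite_indices: "finite (\<Union>{I. cf a I \<noteq> 0})"
  using cf_infinite by (intro finite_Union) auto

lemma iota_superset:
  assumes "finite V" "\<Union>{I. cf a I \<noteq> 0} \<subseteq> V"
  shows "iota a = (\<Sum>i\<in>V. Xv i * contr i a)"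
  unfolding iota_def
proof (rule sum.mono_neutral_left)
  show "\<forall>i\<in>V - \<Union>{I. cf a I \<noteq> 0}. Xv i * contr i a = 0"
  proof
    fix i assume "i \<in> V - \<Union>{I. cf a I \<noteq> 0}"
    then have "cf a (insert i K) = 0" for K by auto
    then have "contr i a = 0" by (intro pform_eqI) (simp add: cf_contr)
    then show "Xv i * contr i a = 0" by simp
  qed
qed (use assms in auto)

lemma iota_common:
  obtains V where "finite V" "iota a = (\<Sum>i\<in>V. Xv i * contr i a)"
    "iota b = (\<Sum>i\<in>V. Xv i * contr i b)" "iota c = (\<Sum>i\<in>V. Xv i * contr i c)"
proof -
  let ?V = "\<Union>{I. cf a I \<noteq> 0} \<union> \<Union>{I. cf b I \<noteq> 0} \<union> \<Union>{I. cf c I \<noteq> 0}"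
  have "finite ?V" by (intro finite_UnI finite_indices)
  then show ?thesis by (intro that[of ?V] iota_superset) auto
qed

lemma iota_add [simp]: "iota (a + b) = iota a + iota b"
  by (rule iota_common[of a b "a + b"]) (simp add: contr_add distrib_left sum.distrib)

lemma iota_mult: "iota (a * b) = iota a * b + bar a * iota b"
proof -
  obtain V where V: "finite V" "iota a = (\<Sum>i\<in>V. Xv i * contr i a)"
    "iota b = (\<Sum>i\<in>V. Xv i * contr i b)" "iota (a * b) = (\<Sum>i\<in>V. Xv i * contr i (a * b))"
    using iota_common[of a b "a * b"] .
  show ?thesis
    unfolding V by (simp add: contr_mult distrib_left sum.distrib sum_distrib_left sum_distrib_right
        mult.assoc Pf_left_commute)
qed

lemma iota_Pf [simp]: "iota (Pf f) = 0"
  by (simp add: iota_def contr_Pf)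

lemma iota_sc [simp]: "iota (sc c) = 0"
  by (simp add: sc_def)

lemma iota_0 [simp]: "iota 0 = 0" "iota 1 = 0"
  using iota_sc[of 0] iota_sc[of 1] by auto

lemma iota_uminus [simp]: "iota (- a) = - iota a"
  by (metis add.inverse_unique add.right_inverse iota_0(1) iota_add)

lemma iota_diff [simp]: "iota (a - b) = iota a - iota b"
  by (metis iota_add iota_uminus diff_conv_add_uminus)

lemma iota_sum [simp]: "iota (sum f S) = (\<Sum>i\<in>S. iota (f i))"
  by (induction S rule: infinite_finite_induct) auto

lemma iota_sc_mult [simp]: "iota (sc c * a) = sc c * iota a"
  by (simp add: iota_mult)

lemma iota_dtv [simp]: "iota (dtv i) = Xv i"
  by (subst iota_superset[of "{i}"]) (auto simp: contr_dtv cf_ee)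

lemma iota_bar: "iota (bar a) = - bar (iota a)"
  by (induction a rule: pform_induct) (auto simp: iota_mult bar_ee)

lemma iota_iota [simp]: "iota (iota a) = 0"
  by (induction a rule: pform_induct) (auto simp: iota_mult iota_bar)

text \<open>The Lie derivative along the Euler field multiplies a monomial by its total weight, so
  \<open>GG\<close> below inverts it off the constants.\<close>

definition LL :: "'k::comm_ring_1 pform \<Rightarrow> 'k pform" where
  "LL a = dd (iota a) + iota (dd a)"

text \<open>The anticommutator of two odd derivations is a derivation without signs: the mixed terms
  cancel because \<open>dd\<close> and \<open>iota\<close> anticommute with
  \<open>bar\<close>.\<close>

lemma LL_mult: "LL (a * b) = LL a * b + a * LL b"
  by (simp add: LL_def dd_mult iota_mult dd_bar iota_bar distrib_left distrib_right)

lemma LL_add [simp]: "LL (a + b) = LL a + LL b"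
  by (simp add: LL_def)

lemma LL_simps [simp]: "LL (sc c) = 0" "LL (Xv i) = Xv i" "LL (dtv i) = dtv i" "LL 0 = 0" "LL 1 = 0"
  by (simp_all add: LL_def)

lemma LL_dd: "LL (dd a) = dd (LL a)" and LL_iota: "LL (iota a) = iota (LL a)"
  by (simp_all add: LL_def)

section \<open>Weights and the Poincare homotopy\<close>

definition wt :: "(nat \<Rightarrow>\<^sub>0 nat) \<Rightarrow> nat" where "wt m = (\<Sum>i\<in>supp m. coef m i)"

lemma wt_eq_0: "wt m = 0 \<longleftrightarrow> m = 0"
  by (auto simp: wt_def in_keys_iff intro!: poly_mapping_eqI)

lemma LL_eigen_mult:
  "LL a = of_nat p * a \<Longrightarrow> LL b = of_nat q * b \<Longrightarrow> LL (a * b) = of_nat (p + q) * (a * b)"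
  by (simp add: LL_mult distrib_right mult.assoc) (metis mult.assoc mult_of_nat_commute)

lemma LL_sgl: "LL (Pf (sgl m (1 :: 'a::comm_ring_1))) = of_nat (wt m) * Pf (sgl m 1)"
proof -
  have *: "LL (Pf (mp_var i ^ n :: 'a mpoly)) = of_nat n * Pf (mp_var i ^ n)" for i n
  proof (induction n)
    case (Suc n)
    show ?case using LL_eigen_mult[OF _ Suc, of "Xv i" 1] by simp
  qed simp
  have "LL (Pf (\<Prod>i\<in>S. mp_var i ^ coef m i :: 'a mpoly)) =
      of_nat (\<Sum>i\<in>S. coef m i) * Pf (\<Prod>i\<in>S. mp_var i ^ coef m i)" if "finite S" for S
    using that
  proof induction
    case (insert i S)
    show ?case using insert LL_eigen_mult[OF * insert(3)] by (simp del: Pf_power)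
  qed simp
  from this[OF finite_keys] show ?thesis unfolding sgl_prod wt_def .
qed

lemma LL_ee: "finite I \<Longrightarrow> LL (ee I) = of_nat (card I) * ee I"
proof (induction I rule: finite_linorder_min_induct)
  case (insert i I)
  then have "ee (insert i I) = dtv i * (ee I :: 'a pform)" "i \<notin> I" using dtv_ee_min by (metis, blast)
  then show ?case using insert LL_eigen_mult[of "dtv i" 1 "ee I" "card I"] by simp
qed simp

lemma pform_mono_induct [case_names mono add]:
  fixes a :: "'k::comm_ring_1 pform"
  assumes "\<And>m c I. finite I \<Longrightarrow> Q (sc c * (Pf (sgl m 1) * ee I))" "\<And>a b. Q a \<Longrightarrow> Q b \<Longrightarrow> Q (a + b)"
  shows "Q a"
proof (induction a rule: pform_add_induct)
  case (monom f I)
  show ?case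
  proof (induction f rule: poly_mapping_add_induct)
    case (sgl m c)
    show ?case using assms(1)[of I c m] monom
      by (simp add: pf_monom_eq sgl_mult[of m c] sc_def mult.assoc)
  qed (use assms(2) in \<open>auto simp: pf_monom_eq distrib_right\<close>)
qed (use assms in auto)

lemma coef_mp_const_mult: "coef (mp_const c * f) m = c * coef f m"
  by (simp add: mp_const_def flip: mult_map_scale_conv_mult) (simp add: map.rep_eq when_def)

lemma coef_LL: "coef (cf (LL a) I) m = of_nat (wt m + card I) * coef (cf a I) m"
proof (induction a rule: pform_mono_induct)
  case (mono l c J)
  have "LL (Pf (sgl l 1) * ee J) = sc (of_nat (wt l + card J)) * (Pf (sgl l (1::'a)) * ee J)"
    unfolding sc_of_nat by (intro LL_eigen_mult LL_sgl LL_ee mono)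
  then have "LL (sc c * (Pf (sgl l 1) * ee J)) = sc (of_nat (wt l + card J) * c) * (Pf (sgl l 1) * ee J)"
    by (simp only: LL_mult LL_simps) (simp add: mult.assoc sc_left_commute)
  then show ?case
    by (cases "l = m"; cases "I = J")
      (simp_all only: cf_sc_mult coef_mp_const_mult, simp_all add: cf_ee lookup_single mult.assoc)
qed (simp add: lookup_add distrib_left)

text \<open>The augmentation: restriction to the origin of all coordinates, hence multiplicative and
  zero in positive degrees.\<close>

definition ev0 :: "'k::comm_ring_1 pform \<Rightarrow> 'k" where "ev0 a = coef (cf a {}) 0"

lemma ev0_add [simp]: "ev0 (a + b) = ev0 a + ev0 b" "ev0 (a - b) = ev0 a - ev0 b" "ev0 0 = 0" "ev0 (- a) = - ev0 a"
  by (simp_all add: ev0_def lookup_add lookup_minus)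

lemma coef_mult_0: "coef (f * g) 0 = coef f 0 * coef (g :: 'k::comm_ring_1 mpoly) 0"
proof (induction f rule: poly_mapping_add_induct)
  case (sgl m c)
  show ?case
  proof (induction g rule: poly_mapping_add_induct)
    case (sgl l b)
    have "m + l = 0 \<longleftrightarrow> m = 0 \<and> l = 0"
      by (auto simp: poly_mapping_eq_iff lookup_add fun_eq_iff)
    then show ?case by (auto simp: mult_single lookup_single when_def)
  qed (simp add: lookup_add distrib_left)
qed (simp add: lookup_add distrib_right)

lemma ev0_mult [simp]: "ev0 (a * b) = ev0 a * ev0 b"
  by (simp add: ev0_def cf_mult coef_mult_0)

lemma ev0_simps [simp]: "ev0 (sc c) = c" "ev0 (Xv i) = 0" "ev0 (dtv i) = 0" "ev0 1 = 1"
  by (auto simp: ev0_def sc_def cf_Pf cf_ee mp_const_def mp_var_def lookup_single cf_1 when_def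
      poly_mapping_eq_iff fun_eq_iff)

lemma ev0_dd [simp]: "ev0 (dd a) = 0"
  by (induction a rule: pform_induct) (auto simp: dd_mult)

lemma ev0_iota [simp]: "ev0 (iota a) = 0"
  by (induction a rule: pform_induct) (auto simp: iota_mult)

lemma ev0_bar [simp]: "ev0 (bar a) = ev0 a"
  by (simp add: ev0_def cf_bar)

text \<open>In weight 0, that is on constants, the convention \<open>inverse 0 = 0\<close> makes the
  operator vanish. Invertibility of all positive weights is where characteristic 0 is used.\<close>

lift_definition GG :: "'k::field_char_0 pform \<Rightarrow> 'k pform" is
  "\<lambda>w I. Poly_Mapping.mapp (\<lambda>m c. c * inverse (of_nat (wt m + card I))) (w I)"
proof (intro conjI)
  fix w :: "'k form" assume w: "finite {I. w I \<noteq> 0} \<and> (\<forall>I. w I \<noteq> 0 \<longrightarrow> finite I)"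
  let ?f = "\<lambda>I. Poly_Mapping.mapp (\<lambda>m c. c * inverse (of_nat (wt m + card I))) (w I)"
  have *: "w I \<noteq> 0" if "?f I \<noteq> 0" for I
    using that by (auto simp: poly_mapping_eq_iff lookup_mapp fun_eq_iff)
  show "finite {I. ?f I \<noteq> 0}" by (rule finite_subset[of _ "{I. w I \<noteq> 0}"]) (use * w in blast)+
  show "\<forall>I. ?f I \<noteq> 0 \<longrightarrow> finite I" using * w by blast
qed

lemma coef_GG: "coef (cf (GG a) I) m = coef (cf a I) m * inverse (of_nat (wt m + card I))"
  by (auto simp: GG.rep_eq lookup_mapp when_def in_keys_iff)

lemma pform_coef_eqI: "(\<And>I m. finite I \<Longrightarrow> coef (cf a I) m = coef (cf b I) m) \<Longrightarrow> a = b"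
  by (intro pform_eqI poly_mapping_eqI)

lemma GG_add [simp]: "GG (a + b) = GG a + GG b"
  by (rule pform_coef_eqI) (simp add: coef_GG lookup_add distrib_right)

lemma GG_diff [simp]: "GG (a - b) = GG a - GG b"
  by (rule pform_coef_eqI) (simp add: coef_GG lookup_minus left_diff_distrib)

lemma GG_sc_mult [simp]: "GG (sc c * a) = sc c * GG a"
  by (rule pform_coef_eqI) (simp add: coef_GG coef_mp_const_mult)

lemma ev0_GG [simp]: "ev0 (GG a) = 0"
  by (simp add: ev0_def coef_GG wt_def)

lemma GG_sc [simp]: "GG (sc c) = 0"
  by (rule pform_coef_eqI) (auto simp: coef_GG sc_def cf_Pf mp_const_def lookup_single when_def wt_def)

lemma LL_GG: "LL (GG a) = a - sc (ev0 a)" and GG_LL: "GG (LL a) = a - sc (ev0 a)"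
proof -
  have "coef (cf (sc (ev0 a)) I) m = (if m = 0 \<and> I = {} then coef (cf a I) m else 0)" for I m
    by (auto simp: sc_def cf_Pf mp_const_def lookup_single when_def ev0_def)
  then have *: "coef (cf a I) m * (inverse (of_nat (wt m + card I)) * of_nat (wt m + card I))
      = coef (cf (a - sc (ev0 a)) I) m" if "finite I" for I m
    using that by (auto simp: lookup_minus wt_eq_0 field_simps simp del: of_nat_add)
  show "LL (GG a) = a - sc (ev0 a)" "GG (LL a) = a - sc (ev0 a)"
    by (rule pform_coef_eqI; simp only: coef_LL coef_GG *[symmetric] ac_simps)+
qed

text \<open>By \<open>GG_LL\<close> a form is determined by its image under \<open>LL\<close> and
  its value at the origin. So an operator that commutes with \<open>LL\<close> and is compatible
  with \<open>ev0\<close> commutes with \<open>GG\<close>, and no coefficients have to be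
  compared.\<close>

lemma LL_ev0_eqI: "LL x = LL y \<Longrightarrow> ev0 x = ev0 y \<Longrightarrow> x = (y :: 'k::field_char_0 pform)"
  by (metis GG_LL diff_add_cancel)

lemma GG_dd: "GG (dd a) = dd (GG a)"
  by (rule LL_ev0_eqI) (simp_all add: LL_dd LL_GG)

lemma GG_iota: "GG (iota a) = iota (GG a)"
  by (rule LL_ev0_eqI) (simp_all add: LL_iota LL_GG)

text \<open>The homotopy of the dilations by \<open>s\<close> in \<open>[0, 1]\<close>: on a form of
  weight \<open>w > 0\<close> the pullback is \<open>s ^ w\<close>, and the integral of
  \<open>s ^ (w - 1)\<close> is the factor \<open>1 / w\<close> in \<open>GG\<close>. The homotopy
  formula is then Cartan's formula followed by \<open>LL_GG\<close>.\<close>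

definition KK :: "'k::field_char_0 pform \<Rightarrow> 'k pform" where "KK a = iota (GG a)"

lemma KK_homotopy: "dd (KK a) + KK (dd a) = a - sc (ev0 a)"
  unfolding KK_def GG_dd LL_def[symmetric] LL_GG ..

lemma KK_simps [simp]: "KK (KK a) = 0" "ev0 (KK a) = 0" "KK (sc c) = 0" "KK (a + b) = KK a + KK b"
  "KK (a - b) = KK a - KK b" "KK (sc c * a) = sc c * KK a"
  by (simp_all add: KK_def GG_iota)

section \<open>Homogeneous forms\<close>

definition homog :: "nat \<Rightarrow> 'k::comm_ring_1 pform \<Rightarrow> bool" where
  "homog q a \<longleftrightarrow> (\<forall>I. cf a I \<noteq> 0 \<longrightarrow> card I = q)"

lemma homog_simps [simp]: "homog q 0" "homog 0 (Pf f)" "homog 0 (sc c)" "homog 0 1" "homog (card I) (ee I)"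
  by (auto simp: homog_def cf_Pf sc_def cf_1 cf_ee)

lemma homog_add [intro]: "homog q a \<Longrightarrow> homog q b \<Longrightarrow> homog q (a + b)"
  unfolding homog_def by (metis add.right_neutral cf_simps(2))

lemma homog_uminus [intro]: "homog q a \<Longrightarrow> homog q (- a)"
  unfolding homog_def by simp

lemma homog_sum [intro]: "(\<And>x. x \<in> S \<Longrightarrow> homog q (f x)) \<Longrightarrow> homog q (sum f S)"
  by (induction S rule: infinite_finite_induct) auto

lemma homog_mult [intro]:
  assumes "homog p a" "homog q b"
  shows "homog (p + q) (a * b)"
  unfolding homog_def
proof (intro allI impI)
  fix K assume K: "cf (a * b) K \<noteq> 0"
  then have "finite K" using cf_infinite by blast
  obtain I where "I \<in> Pow K" "shuffle_sign I (K - I) * (cf a I * cf b (K - I)) \<noteq> 0"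
    using K unfolding cf_mult by (meson sum.neutral)
  then have "cf a I \<noteq> 0" "cf b (K - I) \<noteq> 0" "I \<subseteq> K" by auto
  then show "card K = p + q"
    using assms \<open>finite K\<close> by (metis homog_def add.commute card_Diff_subset card_mono finite_subset le_add_diff_inverse2)
qed

lemma homog_sc_mult [intro]: "homog q a \<Longrightarrow> homog q (sc c * a)"
  using homog_mult[of 0 "sc c" q a] by simp

lemma homog_bar [intro]: "homog q a \<Longrightarrow> homog q (bar a)"
  unfolding homog_def cf_bar by (metis mult_zero_right)

lemma homog_bar_eq: "homog q a \<Longrightarrow> bar a = (- 1) ^ q * a"
proof -
  assume "homog q a"
  then have "bar a = sc ((- 1) ^ q) * a"
  proof (intro pform_eqI)
    fix I
    have "cf a I = 0 \<or> card I = q" using \<open>homog q a\<close> by (auto simp: homog_def)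
    then show "cf (bar a) I = cf (sc ((- 1) ^ q) * a) I"
      by (auto simp: cf_bar minus_one_power_iff)
  qed
  then show ?thesis by simp
qed

lemma homog_dd [intro]:
  assumes "homog q a" shows "homog (Suc q) (dd a)"
  unfolding homog_def
proof (intro allI impI)
  fix K assume K: "cf (dd a) K \<noteq> 0"
  then have "finite K" using cf_infinite by blast
  obtain i where i: "i \<in> K" "shuffle_sign {i} (K - {i}) * mp_pderiv i (cf a (K - {i})) \<noteq> 0"
    using K unfolding cf_dd' by (meson sum.neutral)
  then have "cf a (K - {i}) \<noteq> 0" by auto
  then have "card (K - {i}) = q" using assms by (simp add: homog_def)
  then show "card K = Suc q" using i(1) \<open>finite K\<close> by (metis card.remove)
qed

lemma homog_iota [intro]:
  assumes "homog (Suc q) a" shows "homog q (iota a)"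
proof -
  have "homog q (contr i a)" for i
    unfolding homog_def
  proof (intro allI impI)
    fix K assume "cf (contr i a) K \<noteq> 0"
    then have "finite K" "i \<notin> K" "cf a (insert i K) \<noteq> 0" by (auto simp: cf_contr split: if_splits)
    then show "card K = q" using assms by (auto simp: homog_def)
  qed
  then have "homog (0 + q) (Xv i * contr i a)" for i by (intro homog_mult homog_simps)
  then show ?thesis unfolding iota_def by auto
qed

lemma homog_0_iota: "homog 0 a \<Longrightarrow> iota a = 0"
proof -
  assume "homog 0 a"
  then have "cf a I \<noteq> 0 \<Longrightarrow> I = {}" for I
    unfolding homog_def using cf_infinite[of I a] by fastforce
  then show ?thesis unfolding iota_def by (auto intro!: sum.neutral)
qed

lemma homog_GG [intro]: "homog q a \<Longrightarrow> homog q (GG a)"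
  unfolding homog_def
  by (auto simp: poly_mapping_eq_iff fun_eq_iff coef_GG)

lemma homog_KK: "homog (Suc q) a \<Longrightarrow> homog q (KK a)" "homog 0 a \<Longrightarrow> KK a = 0"
  by (auto simp: KK_def intro: homog_0_iota)

lemma homog_ev0: "homog (Suc q) a \<Longrightarrow> ev0 a = 0"
  by (auto simp: homog_def ev0_def) (metis card.empty lookup_zero nat.distinct(1))

section \<open>Substitutions\<close>

text \<open>The ordered product by which \<open>form_subst\<close> replaces \<open>dt_I\<close>,
  with \<open>x i\<close> the differential of the polynomial substituted for
  \<open>t_i\<close>.\<close>

definition ext_prod :: "(nat \<Rightarrow> 'r::monoid_mult) \<Rightarrow> nat set \<Rightarrow> 'r" where
  "ext_prod x I = prod_list (map x (sorted_list_of_set I))"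

lemma ext_prod_empty [simp]: "ext_prod x {} = 1"
  by (simp add: ext_prod_def)

lemma ext_prod_min:
  assumes "finite I" "\<And>j. j \<in> I \<Longrightarrow> i < j"
  shows "ext_prod x (insert i I) = x i * ext_prod x I"
proof -
  have "i \<notin> I" using assms by blast
  have "sorted_list_of_set (insert i I) = insort i (sorted_list_of_set I)"
    using assms \<open>i \<notin> I\<close> by (simp add: sorted_list_of_set_insert_remove)
  also have "\<dots> = i # sorted_list_of_set I"
    by (rule insort_is_Cons) (use assms less_imp_le in auto)
  finally show ?thesis by (simp add: ext_prod_def)
qed

lemma shuffle_sign_min:
  "(\<And>j. j \<in> I \<Longrightarrow> i < j) \<Longrightarrow> shuffle_sign {i} I = (1 :: 'a::comm_ring_1)"
proof -
  assume "\<And>j. j \<in> I \<Longrightarrow> i < j"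
  then have "{j\<in>I. j < i} = {}" by fastforce
  then show ?thesis unfolding shuffle_sign_singleton by (simp only: card.empty power_0)
qed

lemma ext_prod_insert:
  fixes x :: "nat \<Rightarrow> 'k::comm_ring_1 pform"
  assumes x: "\<And>i j. x i * x j = - (x j * x i)" "\<And>i. x i * x i = 0" and I: "finite I"
  shows "x i * ext_prod x I = (if i \<in> I then 0 else sc (shuffle_sign {i} I) * ext_prod x (insert i I))"
  using I
proof (induction I rule: finite_linorder_min_induct)
  case empty
  show ?case using ext_prod_min[of "{}" i x] by simp
next
  case (insert m I)
  have E: "ext_prod x (insert m I) = x m * ext_prod x I" using insert ext_prod_min by blast
  have mI: "m \<notin> I" using insert by blast
  consider "i < m" | "i = m" | "m < i" by linarith
  then show ?case
  proof cases
    case 1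
    then have *: "i < j" if "j \<in> insert m I" for j using insert that by auto
    then show ?thesis using insert(1) ext_prod_min[of "insert m I" i x] shuffle_sign_min[of "insert m I" i, where ?'a = 'k]
      by auto
  next
    case 2
    then show ?thesis by (simp add: E x(2) flip: mult.assoc)
  next
    case 3
    have "x i * ext_prod x (insert m I) = - (x m * (x i * ext_prod x I))"
      by (simp add: E x(1)[of i m] flip: mult.assoc)
    also have "\<dots> = (if i \<in> I then 0 else - (sc (shuffle_sign {i} I) * (x m * ext_prod x (insert i I))))"
      by (simp add: insert.IH sc_left_commute)
    also have "\<dots> = (if i \<in> I then 0 else - (sc (shuffle_sign {i} I) * ext_prod x (insert m (insert i I))))"
    proof -
      have "m < j" if "j \<in> insert i I" for j using that insert 3 by auto
      then show ?thesis using ext_prod_min[of "insert i I" m x] insert(1) by simp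
    qed
    also have "\<dots> = (if i \<in> insert m I then 0 else sc (shuffle_sign {i} (insert m I)) * ext_prod x (insert i (insert m I)))"
    proof -
      have "shuffle_sign {i} (insert m I) = shuffle_sign {i} {m} * (shuffle_sign {i} I :: 'k)"
        using shuffle_sign_Un_right[of "{i}" "{m}" I] insert mI by simp
      also have "shuffle_sign {i} {m} = (- 1 :: 'k)"
        using 3 by (simp add: shuffle_sign_singleton Collect_conv_if)
      finally show ?thesis using 3 by (simp add: insert_commute)
    qed
    finally show ?thesis .
  qed
qed

text \<open>Anticommuting elements of square 0 have the same multiplication table as the
  \<open>dt_I\<close>; this is what makes substitutions multiplicative.\<close>

lemma ext_prod_mult:
  fixes x :: "nat \<Rightarrow> 'k::comm_ring_1 pform"
  assumes x: "\<And>i j. x i * x j = - (x j * x i)" "\<And>i. x i * x i = 0" and I: "finite I" and J: "finite J"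
  shows "ext_prod x I * ext_prod x J =
    (if I \<inter> J = {} then sc (shuffle_sign I J) * ext_prod x (I \<union> J) else 0)"
  using I
proof (induction I rule: finite_linorder_min_induct)
  case (insert m I)
  have mI: "m \<notin> I" using insert by blast
  have "ext_prod x (insert m I) * ext_prod x J = x m * (ext_prod x I * ext_prod x J)"
    using insert ext_prod_min[of I m x] by (simp add: mult.assoc)
  also have "\<dots> = (if I \<inter> J = {} then sc (shuffle_sign I J) * (x m * ext_prod x (I \<union> J)) else 0)"
    unfolding insert.IH by (simp add: sc_left_commute[of "x m"])
  also have "\<dots> = (if insert m I \<inter> J = {} then sc (shuffle_sign (insert m I) J) * ext_prod x (insert m I \<union> J) else 0)"
  proof -
    have 1: "shuffle_sign {m} (I \<union> J) = (shuffle_sign {m} J :: 'k)" if "I \<inter> J = {}"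
      using shuffle_sign_Un_right[of "{m}" I J, where ?'a = 'k] shuffle_sign_min[of I m, where ?'a = 'k] insert J that by simp
    have 2: "shuffle_sign (insert m I) J = shuffle_sign {m} J * (shuffle_sign I J :: 'k)"
      using shuffle_sign_Un_left[of J "{m}" I] insert J mI by simp
    show ?thesis
      using ext_prod_insert[of x "I \<union> J" m, OF x] mI insert(1) J
        sc_commute[of "sc (shuffle_sign I J :: 'k)" "shuffle_sign {m} J"]
      by (auto simp: 1 2 mult.assoc sc_left_commute[of "x m"]) (metis mult.assoc)
  qed
  finally show ?case .
qed simp

text \<open>Differentiate the identity \<open>g df = df g\<close>: the left side gives
  \<open>dg df\<close>, the right side \<open>- df dg\<close>.\<close>

lemma dd_Pf_anticommute: "dd (Pf f) * dd (Pf g) = - (dd (Pf g) * dd (Pf f))"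
proof -
  have "homog 1 (dd (Pf f))" for f :: "'a mpoly" using homog_dd[of 0 "Pf f"] by simp
  from homog_bar_eq[OF this] have b: "bar (dd (Pf f)) = - dd (Pf f)" for f :: "'a mpoly" by simp
  have "dd (Pf g * dd (Pf f)) = dd (dd (Pf f) * Pf g)" by (simp only: Pf_commute)
  then show ?thesis by (simp add: dd_mult b)
qed

text \<open>Anticommutation with itself gives twice the square; dividing by 2 is possible in
  characteristic 0.\<close>

lemma dd_Pf_sqr: "dd (Pf f) * dd (Pf f) = (0 :: 'k::field_char_0 pform)"
proof -
  have "sc 2 * (dd (Pf f) * dd (Pf f)) = (0 :: 'k pform)"
    using dd_Pf_anticommute[of f f] sc_of_nat[of 2, where ?'a = 'k] by (simp add: mult_2 eq_neg_iff_add_eq_0)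
  then have "sc (1/2) * (sc 2 * (dd (Pf f) * dd (Pf f))) = (0 :: 'k pform)" by simp
  moreover have "sc (1/2) * (sc 2 * x) = (x :: 'k pform)" for x
    by (simp flip: mult.assoc sc_simps(2))
  ultimately show ?thesis by simp
qed

text \<open>The operation \<open>form_subst\<close> freed from the dimension: the sum runs over the
  support of the form. Thus it is an endomorphism of the ring of forms in all variables, and
  composites need no bookkeeping of dimensions.\<close>

definition sub :: "(nat \<Rightarrow> 'k mpoly) \<Rightarrow> 'k::field_char_0 pform \<Rightarrow> 'k pform" where
  "sub g a = (\<Sum>I | cf a I \<noteq> 0. Pf (mp_subst g (cf a I)) * ext_prod (\<lambda>i. dd (Pf (g i))) I)"

lemma sub_superset:
  assumes "finite S" "{I. cf a I \<noteq> 0} \<subseteq> S"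
  shows "sub g a = (\<Sum>I\<in>S. Pf (mp_subst g (cf a I)) * ext_prod (\<lambda>i. dd (Pf (g i))) I)"
  unfolding sub_def by (rule sum.mono_neutral_left) (use assms in auto)

lemma sub_add [simp]: "sub g (a + b) = sub g a + sub g b"
proof -
  let ?S = "{I. cf a I \<noteq> 0} \<union> {I. cf b I \<noteq> 0}"
  have "{I. cf (a + b) I \<noteq> 0} \<subseteq> ?S" by auto
  then show ?thesis
    by (subst (1 2 3) sub_superset[of ?S]) (auto simp: distrib_right sum.distrib)
qed

lemma sub_monom: "finite I \<Longrightarrow> sub g (pf_monom f I) = Pf (mp_subst g f) * ext_prod (\<lambda>i. dd (Pf (g i))) I"
  by (subst sub_superset[of "{I}"]) (auto simp: cf_pf_monom)

lemma sub_mult [simp]: "sub g (a * b) = sub g a * sub g b"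
proof (induction a rule: pform_add_induct)
  case (monom f I)
  show ?case
  proof (induction b rule: pform_add_induct)
    case (monom h J)
    have s: "Pf (mp_subst g (shuffle_sign I J)) = (sc (shuffle_sign I J) :: 'a pform)"
      by (simp add: shuffle_sign_def minus_one_power_iff)
    show ?case
      using \<open>finite I\<close> monom
      by (simp add: pf_monom_mult sub_monom ext_prod_mult[OF dd_Pf_anticommute dd_Pf_sqr] s
          mult.assoc Pf_left_commute[of "ext_prod _ _"] Pf_left_commute[of "sc _"])
        (auto simp: sub_def)
  qed (simp add: distrib_left)
qed (simp add: distrib_right)

lemma sub_Pf [simp]: "sub g (Pf f) = Pf (mp_subst g f)"
  using sub_monom[of "{}" g f] by (simp add: pf_monom_eq)

lemma sub_sc [simp]: "sub g (sc c) = sc c"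
  by (simp add: sc_def)

lemma sub_0 [simp]: "sub g 0 = 0" "sub g 1 = 1"
  using sub_sc[of g 0] sub_sc[of g 1] by auto

lemma sub_uminus [simp]: "sub g (- a) = - sub g a"
  by (metis add.inverse_unique add.right_inverse sub_0(1) sub_add)

lemma sub_diff [simp]: "sub g (a - b) = sub g a - sub g b"
  by (metis diff_conv_add_uminus sub_add sub_uminus)

lemma sub_sum [simp]: "sub g (sum f S) = (\<Sum>i\<in>S. sub g (f i))"
  by (induction S rule: infinite_finite_induct) auto

lemma sub_dtv: "sub g (dtv i) = dd (Pf (g i))"
  using sub_monom[of "{i}" g 1] by (simp add: pf_monom_eq ext_prod_def)

lemma sub_eqI:
  assumes "\<And>i. F (Xv i) = G (Xv i)" "\<And>i. F (dtv i) = G (dtv i)" "\<And>c. F (sc c) = G (sc c)"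
    "\<And>a b. F (a + b) = F a + F b" "\<And>a b. G (a + b) = G a + G b"
    "\<And>a b. F (a * b) = F a * F b" "\<And>a b. G (a * b) = G a * G b"
  shows "F a = (G a :: 'k::comm_ring_1 pform)"
  by (induction a rule: pform_induct) (use assms in auto)

lemma bar_sub: "bar (sub g a) = sub g (bar a)"
proof (induction a rule: pform_induct)
  case (diff i)
  have "homog 1 (dd (Pf (g i)))" using homog_dd[of 0 "Pf (g i)"] by simp
  then show ?case by (simp add: sub_dtv bar_ee homog_bar_eq[of 1])
qed auto

lemma dd_sub: "dd (sub g a) = sub g (dd a)"
  by (induction a rule: pform_induct) (auto simp: dd_mult sub_dtv bar_sub)

lemma sub_sub: "sub g (sub h a) = sub (\<lambda>i. mp_subst g (h i)) a"
  by (rule sub_eqI) (auto simp: sub_dtv simp flip: dd_sub)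

lemma homog_ext_prod:
  assumes "\<And>i. homog 1 (x i)" "finite I" shows "homog (card I) (ext_prod x I)"
  using assms(2)
proof (induction I rule: finite_linorder_min_induct)
  case (insert m I)
  then have "m \<notin> I" by blast
  then show ?case
    using insert ext_prod_min[of I m x] homog_mult[OF assms(1) insert(3), of m] by simp
qed simp

lemma homog_sub [intro]:
  assumes "homog q a" shows "homog q (sub g a)"
  unfolding sub_def
proof (rule homog_sum)
  fix I assume "I \<in> {I. cf a I \<noteq> 0}"
  then have "card I = q" "finite I" using assms cf_infinite by (auto simp: homog_def)
  moreover have "homog 1 (dd (Pf (g i)))" for i using homog_dd[of 0 "Pf (g i)"] by simp
  ultimately show "homog q (Pf (mp_subst g (cf a I)) * ext_prod (\<lambda>i. dd (Pf (g i))) I)"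
    using homog_mult[of 0 "Pf (mp_subst g (cf a I))" "card I" "ext_prod (\<lambda>i. dd (Pf (g i))) I"] homog_ext_prod[of "\<lambda>i. dd (Pf (g i))" I]
    by simp
qed

text \<open>Substitutions by homogeneous linear forms; they commute with contraction with the Euler field.\<close>

definition linear_subst :: "(nat \<Rightarrow> 'k::comm_ring_1 mpoly) \<Rightarrow> bool" where
  "linear_subst g \<longleftrightarrow> (\<forall>i. LL (Pf (g i)) = Pf (g i) \<and> ev0 (Pf (g i)) = 0)"

text \<open>On the generator \<open>dt_i\<close> both sides are \<open>g i\<close>: since
  \<open>iota\<close> kills functions, \<open>iota (d (g i)) = LL (g i)\<close>, and a linear form
  has weight 1.\<close>

lemma iota_sub:
  assumes "linear_subst g" shows "iota (sub g a) = sub g (iota a)"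
proof (induction a rule: pform_induct)
  case (diff i)
  have "LL (Pf (g i)) = Pf (g i)" using assms by (simp add: linear_subst_def)
  then show ?case by (simp add: sub_dtv LL_def)
qed (auto simp: iota_mult bar_sub)

lemma ev0_sub:
  assumes "linear_subst g" shows "ev0 (sub g a) = ev0 a"
proof (induction a rule: pform_induct)
  case (var i)
  then show ?case using assms by (simp add: linear_subst_def)
qed (auto simp: sub_dtv)

lemma LL_sub: "linear_subst g \<Longrightarrow> LL (sub g a) = sub g (LL a)"
  by (simp add: LL_def iota_sub dd_sub)

lemma GG_sub: "linear_subst g \<Longrightarrow> GG (sub g a) = sub g (GG a)"
  by (rule LL_ev0_eqI) (simp_all add: LL_sub LL_GG ev0_sub)

lemma KK_sub: "linear_subst g \<Longrightarrow> KK (sub g a) = sub g (KK a)"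
  by (simp add: KK_def GG_sub iota_sub)

section \<open>Contractions of a simplex onto its vertices\<close>

definition nfs :: "nat \<Rightarrow> nat \<Rightarrow> nat \<Rightarrow> 'k::comm_ring_1 mpoly" where
  "nfs n i = (\<lambda>j. if j = i then 1 - (\<Sum>l\<in>{..n} - {i}. mp_var l) else mp_var j)"

text \<open>Elimination of \<open>t_i\<close> by means of \<open>t_0 + ... + t_n = 1\<close>. The vertex \<open>i\<close> becomes the origin of the remaining
  coordinates, so the Poincare homotopy \<open>KK\<close> is then the contraction onto that vertex.\<close>

definition nf :: "nat \<Rightarrow> nat \<Rightarrow> 'k::field_char_0 pform \<Rightarrow> 'k pform" where
  "nf n i = sub (nfs n i)"

definition eqv :: "nat \<Rightarrow> 'k::field_char_0 pform \<Rightarrow> 'k pform \<Rightarrow> bool" where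
  "eqv n a b \<longleftrightarrow> nf n 0 a = nf n 0 b"

lemma mp_subst_diff [simp]: "mp_subst g (f - h) = mp_subst g f - mp_subst g h"
  by (metis diff_conv_add_uminus mp_subst_add mp_subst_uminus)

lemma sum_nfs: "i \<le> n \<Longrightarrow> (\<Sum>j\<le>n. nfs n i j) = 1"
  by (subst sum.remove[of _ i]) (auto simp: nfs_def)

lemma nf_simps [simp]: "nf n i (a + b) = nf n i a + nf n i b" "nf n i (a * b) = nf n i a * nf n i b"
  "nf n i (- a) = - nf n i a" "nf n i (a - b) = nf n i a - nf n i b" "nf n i (sc c) = sc c"
  "nf n i 0 = 0" "nf n i 1 = 1" "nf n i (sum f S) = (\<Sum>x\<in>S. nf n i (f x))"
  by (simp_all add: nf_def)

lemma nf_power [simp]: "nf n i (a ^ k) = nf n i a ^ k"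
  by (induction k) auto

lemma nf_of_nat [simp]: "nf n i (of_nat k) = of_nat k"
  by (induction k) auto

lemma nf_dd: "nf n i (dd a) = dd (nf n i a)"
  by (simp add: nf_def dd_sub)

lemma nf_bar: "nf n i (bar a) = bar (nf n i a)"
  by (simp add: nf_def bar_sub)

text \<open>Eliminating \<open>t_i\<close> already imposes the relation, so a previous elimination
  of \<open>t_j\<close> leaves no trace. Hence \<open>eqv\<close>, although defined through the
  vertex 0, can be tested at every vertex.\<close>

lemma nf_nf [simp]:
  assumes "i \<le> n" "j \<le> n" shows "nf n i (nf n j a) = nf n i a"
proof -
  have "mp_subst (nfs n i) (nfs n j l) = (nfs n i l :: 'a mpoly)" for l
  proof (cases "l = j")
    case True
    have "nfs n i j + (\<Sum>l\<in>{..n} - {j}. nfs n i l) = (1 :: 'a mpoly)"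
      using sum_nfs[OF assms(1), where ?'a = 'a] assms(2) by (subst (asm) sum.remove[of _ j]) auto
    moreover have "mp_subst (nfs n i) (nfs n j l) = 1 - (\<Sum>l\<in>{..n} - {j}. nfs n i l :: 'a mpoly)"
      using True by (simp add: nfs_def[of n j])
    ultimately show ?thesis using True by (metis add_diff_cancel_right')
  qed (simp add: nfs_def[of n j])
  then show ?thesis by (simp add: nf_def sub_sub)
qed

lemma eqv_refl [simp]: "eqv n a a" by (simp add: eqv_def)

lemma eqv_sym: "eqv n a b \<Longrightarrow> eqv n b a" by (simp add: eqv_def)

lemma eqv_trans [trans]: "eqv n a b \<Longrightarrow> eqv n b c \<Longrightarrow> eqv n a c" by (simp add: eqv_def)

lemma eqv_add: "eqv n a b \<Longrightarrow> eqv n c d \<Longrightarrow> eqv n (a + c) (b + d)" by (simp add: eqv_def)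

lemma eqv_mult: "eqv n a b \<Longrightarrow> eqv n c d \<Longrightarrow> eqv n (a * c) (b * d)" by (simp add: eqv_def)

lemma eqv_sum: "(\<And>x. x \<in> S \<Longrightarrow> eqv n (f x) (g x)) \<Longrightarrow> eqv n (sum f S) (sum g S)"
  by (simp add: eqv_def)

lemma eqv_dd: "eqv n a b \<Longrightarrow> eqv n (dd a) (dd b)" by (simp add: eqv_def nf_dd)

lemma eqv_bar: "eqv n a b \<Longrightarrow> eqv n (bar a) (bar b)" by (simp add: eqv_def nf_bar)

lemma eqv_nf: "i \<le> n \<Longrightarrow> eqv n (nf n i a) a" by (simp add: eqv_def)

lemma nf_cong: "eqv n a b \<Longrightarrow> i \<le> n \<Longrightarrow> nf n i a = nf n i b"
  by (metis eqv_def le0 nf_nf)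

definition hh :: "nat \<Rightarrow> nat \<Rightarrow> 'k::field_char_0 pform \<Rightarrow> 'k pform" where
  "hh n i a = KK (nf n i a)"

text \<open>Restriction to the vertex \<open>i\<close>, which is the origin once \<open>t_i\<close>
  is eliminated.\<close>

definition eps :: "nat \<Rightarrow> nat \<Rightarrow> 'k::field_char_0 pform \<Rightarrow> 'k" where
  "eps n i a = ev0 (nf n i a)"

lemma hh_simps [simp]: "hh n i (a + b) = hh n i a + hh n i b" "hh n i (a - b) = hh n i a - hh n i b"
  "hh n i (sc c) = 0" "hh n i (sc c * a) = sc c * hh n i a"
  by (simp_all add: hh_def)

lemma eps_simps [simp]: "eps n i (a + b) = eps n i a + eps n i b" "eps n i (a - b) = eps n i a - eps n i b"
  "eps n i (sc c) = c" "eps n i (a * b) = eps n i a * eps n i b" "eps n i 1 = 1" "eps n i 0 = 0"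
  by (simp_all add: eps_def)

lemma hh_0 [simp]: "hh n i 0 = 0" "hh n i 1 = 0"
  using hh_simps(3)[of n i 0] hh_simps(3)[of n i 1] by auto

lemma hh_uminus [simp]: "hh n i (- a) = - hh n i a"
  by (metis hh_0(1) hh_simps(2) diff_0)

lemma eps_uminus [simp]: "eps n i (- a) = - eps n i a"
  by (metis eps_simps(2) eps_simps(6) diff_0)

lemma hh_sum [simp]: "hh n i (sum f S) = (\<Sum>x\<in>S. hh n i (f x))"
  by (induction S rule: infinite_finite_induct) auto

lemma eps_sum [simp]: "eps n i (sum f S) = (\<Sum>x\<in>S. eps n i (f x))"
  by (induction S rule: infinite_finite_induct) auto

lemma hh_sign: "hh n i ((- 1) ^ k * a) = (- 1) ^ k * hh n i a"
  by (simp add: minus_one_power_iff)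

lemma eps_sign: "eps n i ((- 1) ^ k * a) = (- 1) ^ k * eps n i a"
  by (simp add: minus_one_power_iff)

lemma eps_dd [simp]: "eps n i (dd a) = 0"
  by (simp add: eps_def nf_dd)

lemma eps_bar [simp]: "eps n i (bar a) = eps n i a"
  by (simp add: eps_def nf_bar)

lemma hh_cong: "eqv n a b \<Longrightarrow> i \<le> n \<Longrightarrow> hh n i a = hh n i b"
  by (simp add: hh_def nf_cong)

lemma eps_cong: "eqv n a b \<Longrightarrow> i \<le> n \<Longrightarrow> eps n i a = eps n i b"
  by (metis eps_def nf_cong)

lemma hh_homotopy: "i \<le> n \<Longrightarrow> eqv n (dd (hh n i a)) (a - sc (eps n i a) - hh n i (dd a))"
proof -
  assume "i \<le> n"
  have "dd (hh n i a) = nf n i a - sc (eps n i a) - hh n i (dd a)"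
    using KK_homotopy[of "nf n i a"] by (simp add: hh_def eps_def nf_dd algebra_simps)
  then show ?thesis using eqv_nf[OF \<open>i \<le> n\<close>] by (simp add: eqv_def)
qed

text \<open>Being fixed by this substitution expresses that a form contains neither
  \<open>t_i\<close> nor \<open>dt_i\<close>. It is linear, so \<open>KK\<close> commutes with
  it.\<close>

definition kill :: "nat \<Rightarrow> nat \<Rightarrow> 'k::comm_ring_1 mpoly" where
  "kill i = (\<lambda>j. if j = i then 0 else mp_var j)"

lemma linear_kill: "linear_subst (kill i)"
  by (simp add: linear_subst_def kill_def)

lemma mp_subst_kill: "mp_subst (kill i) (nfs n i j) = nfs n i j"
  by (auto simp: nfs_def kill_def)

lemma sub_kill_nf: "sub (kill i) (nf n i a) = nf n i a"
  by (simp add: nf_def sub_sub mp_subst_kill)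

lemma nf_sub_kill: "nf n i (sub (kill i) a) = sub (kill i) a"
proof -
  have "mp_subst (nfs n i) (kill i l) = (kill i l :: 'a mpoly)" for l by (auto simp: nfs_def kill_def)
  then show ?thesis by (simp add: nf_def sub_sub)
qed

text \<open>A form without \<open>t_i\<close> stays so under \<open>KK\<close>, and a second
  elimination does nothing to it. The relations \<open>hh_hh\<close> and \<open>eps_hh\<close> are
  thereby reduced to those for \<open>KK\<close>.\<close>

lemma nf_hh: "nf n i (hh n i a) = hh n i a"
  by (metis hh_def KK_sub linear_kill nf_sub_kill sub_kill_nf)

lemma hh_hh [simp]: "hh n i (hh n i a) = 0"
  by (metis KK_simps(1) hh_def nf_hh)

lemma eps_hh [simp]: "eps n i (hh n i a) = 0"
  by (metis KK_simps(2) eps_def hh_def nf_hh)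

lemma homog_nf [intro]: "homog q a \<Longrightarrow> homog q (nf n i a)"
  by (auto simp: nf_def)

lemma homog_hh: "homog (Suc q) a \<Longrightarrow> homog q (hh n i a)" "homog 0 a \<Longrightarrow> hh n i a = 0"
  by (auto simp: hh_def intro!: homog_KK)

lemma homog_eps: "homog (Suc q) a \<Longrightarrow> eps n i a = 0"
  by (metis eps_def homog_ev0 homog_nf)

text \<open>\<open>g\<close> is the pullback along the affine map of simplices which is \<open>\<phi>\<close> on vertices.\<close>

definition vertex_map :: "nat \<Rightarrow> nat \<Rightarrow> (nat \<Rightarrow> 'k::field_char_0 mpoly) \<Rightarrow> (nat \<Rightarrow> nat) \<Rightarrow> bool" where
  "vertex_map n r g \<phi> \<longleftrightarrow> linear_subst g \<and> (\<Sum>j\<le>n. g j) = (\<Sum>l\<le>r. mp_var l) \<and>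
    (\<forall>i\<le>r. \<phi> i \<le> n \<and> (\<forall>j. j \<noteq> \<phi> i \<longrightarrow> mp_subst (nfs r i) (g j) = g j))"

lemma nf_sub:
  assumes "vertex_map n r g \<phi>" "i \<le> r"
  shows "nf r i (sub g a) = nf r i (sub g (nf n (\<phi> i) a))"
proof -
  have "mp_subst (nfs r i) (g j) = mp_subst (nfs r i) (mp_subst g (nfs n (\<phi> i) j))" for j
  proof (cases "j = \<phi> i")
    case True
    let ?s = "mp_subst (nfs r i)"
    have "\<phi> i \<le> n" using assms by (auto simp: vertex_map_def)
    have "(\<Sum>j\<le>n. ?s (g j)) = ?s (\<Sum>l\<le>r. mp_var l)"
      using assms by (simp add: vertex_map_def flip: mp_subst_sum)
    also have "\<dots> = 1" using sum_nfs[OF assms(2)] by simp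
    finally have "?s (g (\<phi> i)) + (\<Sum>l\<in>{..n} - {\<phi> i}. ?s (g l)) = 1"
      using \<open>\<phi> i \<le> n\<close> by (subst (asm) sum.remove[of _ "\<phi> i"]) auto
    then show ?thesis using True by (simp add: nfs_def[of n] algebra_simps)
  qed (simp add: nfs_def[of n])
  then show ?thesis by (simp add: nf_def sub_sub)
qed

text \<open>An affine map sending the vertex \<open>i\<close> to \<open>\<phi> i\<close> becomes
  linear when these two vertices are taken as origins. Linear substitutions commute with
  \<open>KK\<close>, which is why the homotopies onto \<open>i\<close> and \<open>\<phi> i\<close>
  correspond.\<close>

lemma nf_sub_linear:
  assumes "vertex_map n r g \<phi>" "i \<le> r"
  obtains g' where "linear_subst g'" "\<And>y. nf r i (sub g (sub (kill (\<phi> i)) y)) = sub g' y"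
proof
  let ?g = "\<lambda>j. if j = \<phi> i then 0 else g j"
  show "linear_subst ?g" using assms by (auto simp: vertex_map_def linear_subst_def)
  have "mp_subst (nfs r i) (mp_subst g (kill (\<phi> i) j)) = ?g j" for j
    using assms by (auto simp: vertex_map_def kill_def)
  then show "nf r i (sub g (sub (kill (\<phi> i)) y)) = sub ?g y" for y
    by (simp add: nf_def sub_sub)
qed

lemma hh_sub:
  assumes "vertex_map n r g \<phi>" "i \<le> r"
  shows "hh r i (sub g a) = nf r i (sub g (hh n (\<phi> i) a))"
proof -
  obtain g' where g': "linear_subst g'" "\<And>y. nf r i (sub g (sub (kill (\<phi> i)) y)) = sub g' y"
    using nf_sub_linear[OF assms] by blast
  let ?y = "nf n (\<phi> i) a"
  have "hh r i (sub g a) = KK (sub g' ?y)"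
    by (simp add: hh_def nf_sub[OF assms, of a] sub_kill_nf flip: g'(2))
  also have "\<dots> = nf r i (sub g (KK (sub (kill (\<phi> i)) ?y)))"
    by (simp add: KK_sub[OF g'(1)] KK_sub[OF linear_kill] g'(2))
  finally show ?thesis by (simp add: sub_kill_nf hh_def)
qed

lemma eps_sub:
  assumes "vertex_map n r g \<phi>" "i \<le> r"
  shows "eps r i (sub g a) = eps n (\<phi> i) a"
proof -
  obtain g' where g': "linear_subst g'" "\<And>y. nf r i (sub g (sub (kill (\<phi> i)) y)) = sub g' y"
    using nf_sub_linear[OF assms] by blast
  have "eps r i (sub g a) = ev0 (sub g' (nf n (\<phi> i) a))"
    by (simp add: eps_def nf_sub[OF assms, of a] sub_kill_nf flip: g'(2))
  then show ?thesis by (simp add: ev0_sub[OF g'(1)] eps_def)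
qed

lemma eqv_sub:
  assumes "vertex_map n r g \<phi>" "eqv n a b"
  shows "eqv r (sub g a) (sub g b)"
proof -
  have "nf r 0 (sub g a) = nf r 0 (sub g (nf n (\<phi> 0) a))" for a
    by (rule nf_sub[OF assms(1)]) simp
  moreover have "nf n (\<phi> 0) a = nf n (\<phi> 0) b"
    using assms by (intro nf_cong) (auto simp: vertex_map_def)
  ultimately show ?thesis by (metis eqv_def)
qed

section \<open>Cofaces and codegeneracies on vertices\<close>

definition face_v :: "nat \<Rightarrow> nat \<Rightarrow> nat" where "face_v i l = (if l < i then l else Suc l)"
definition degen_v :: "nat \<Rightarrow> nat \<Rightarrow> nat" where "degen_v i l = (if l \<le> i then l else l - 1)"

lemma vertex_map_face:
  assumes "i \<le> Suc n" shows "vertex_map (Suc n) n (face_subst i) (face_v i)"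
proof -
  have "(\<Sum>j\<le>Suc n. face_subst i j) = (\<Sum>j\<in>{..Suc n} - {i}. face_subst i j)"
    by (rule sum.mono_neutral_right) (auto simp: face_subst_def)
  also have "\<dots> = (\<Sum>l\<le>n. mp_var l)"
    by (rule sum.reindex_bij_witness[of _ "face_v i" "\<lambda>j. if j < i then j else j - 1"])
      (use assms in \<open>auto simp: face_v_def face_subst_def split: if_splits\<close>)
  finally show ?thesis
    using assms by (auto simp: vertex_map_def linear_subst_def face_subst_def face_v_def nfs_def)
qed

lemma vertex_map_degen:
  assumes "i \<le> n" shows "vertex_map n (Suc n) (degen_subst i :: nat \<Rightarrow> 'a::field_char_0 mpoly) (degen_v i)"
proof -
  have "{..Suc n} - {i} - {Suc i} = {..Suc n} - {i, Suc i}" by auto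
  then have "(\<Sum>l\<le>Suc n. mp_var l) = mp_var i + (mp_var (Suc i) + (\<Sum>l\<in>{..Suc n} - {i, Suc i}. mp_var l :: 'a mpoly))"
    using assms sum.remove[of "{..Suc n}" i "mp_var :: nat \<Rightarrow> 'a mpoly"]
      sum.remove[of "{..Suc n} - {i}" "Suc i" "mp_var :: nat \<Rightarrow> 'a mpoly"]
    by (simp del: sum.atMost_Suc)
  moreover have "(\<Sum>l\<in>{..Suc n} - {i, Suc i}. mp_var l :: 'a mpoly) = (\<Sum>j\<in>{..n} - {i}. degen_subst i j)"
    by (rule sum.reindex_bij_witness[of _ "\<lambda>j. if j < i then j else Suc j" "degen_v i"])
      (use assms in \<open>auto simp: degen_v_def degen_subst_def split: if_splits\<close>)
  moreover have "(\<Sum>j\<le>n. degen_subst i j :: 'a mpoly) = degen_subst i i + (\<Sum>j\<in>{..n} - {i}. degen_subst i j)"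
    using assms by (intro sum.remove) auto
  ultimately have "(\<Sum>j\<le>n. degen_subst i j :: 'a mpoly) = (\<Sum>l\<le>Suc n. mp_var l)"
    by (simp add: degen_subst_def[of i i] add.assoc del: sum.atMost_Suc)
  then show ?thesis
    using assms by (auto simp: vertex_map_def linear_subst_def degen_subst_def degen_v_def nfs_def)
qed

section \<open>Iterated homotopies and integrals over faces\<close>

definition HH :: "nat \<Rightarrow> nat set \<Rightarrow> 'k::field_char_0 pform \<Rightarrow> 'k pform" where
  "HH n J a = fold (hh n) (sorted_list_of_set J) a"

text \<open>\<open>TT n J a\<close> is the integral of \<open>a\<close> over the face spanned by \<open>J\<close>; it is \<open>0\<close> unless \<open>a\<close> has degree \<open>card J - 1\<close>.\<close>

definition TT :: "nat \<Rightarrow> nat set \<Rightarrow> 'k::field_char_0 pform \<Rightarrow> 'k" where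
  "TT n J a = (if J = {} then 0 else eps n (Max J) (HH n (J - {Max J}) a))"

lemma HH_empty [simp]: "HH n {} a = a" by (simp add: HH_def)

lemma HH_min:
  assumes "finite J" "\<And>j. j \<in> J \<Longrightarrow> m < j"
  shows "HH n (insert m J) a = HH n J (hh n m a)"
proof -
  have "m \<notin> J" using assms(2)[of m] by auto
  then have "sorted_list_of_set (insert m J) = insort m (sorted_list_of_set J)"
    using assms by (simp add: sorted_list_of_set_insert_remove)
  also have "\<dots> = m # sorted_list_of_set J"
    by (rule insort_is_Cons) (use assms less_imp_le in auto)
  finally have "sorted_list_of_set (insert m J) = m # sorted_list_of_set J" .
  then show ?thesis by (simp add: HH_def)
qed

text \<open>The homotopies are applied in increasing order of the vertices, so that of the largest
  vertex is outermost. Inductions on faces therefore add the largest vertex when the last operator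
  matters, and the smallest when the first one does.\<close>

lemma HH_max:
  assumes "finite J" "\<And>j. j \<in> J \<Longrightarrow> j < m"
  shows "HH n (insert m J) a = hh n m (HH n J a)"
  using assms
proof (induction J arbitrary: a rule: finite_linorder_min_induct)
  case empty
  then show ?case by (simp add: HH_def)
next
  case (insert i J)
  have "HH n (insert m (insert i J)) a = HH n (insert i (insert m J)) a" by (simp add: insert_commute)
  also have "\<dots> = HH n (insert m J) (hh n i a)"
    using insert by (intro HH_min) auto
  also have "\<dots> = hh n m (HH n J (hh n i a))" using insert by auto
  also have "\<dots> = hh n m (HH n (insert i J) a)" using insert HH_min by metis
  finally show ?case .
qed

lemma TT_max:
  assumes "finite J" "\<And>j. j \<in> J \<Longrightarrow> j < m"
  shows "TT n (insert m J) a = eps n m (HH n J a)"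
proof -
  have "Max (insert m J) = m" by (rule Max_eqI) (use assms in \<open>auto intro: less_imp_le\<close>)
  moreover have "m \<notin> J" using assms(2)[of m] by auto
  ultimately show ?thesis by (simp add: TT_def)
qed

lemma HH_linear [simp]:
  "HH n J (a + b) = HH n J a + HH n J b" "HH n J (a - b) = HH n J a - HH n J b"
  "HH n J (sc c * a) = sc c * HH n J a"
proof -
  have "fold (hh n) xs (a + b) = fold (hh n) xs a + fold (hh n) xs b"
    "fold (hh n) xs (a - b) = fold (hh n) xs a - fold (hh n) xs b"
    "fold (hh n) xs (sc c * a) = sc c * fold (hh n) xs a" for xs
    by (induction xs arbitrary: a b) auto
  then show "HH n J (a + b) = HH n J a + HH n J b" "HH n J (a - b) = HH n J a - HH n J b"
    "HH n J (sc c * a) = sc c * HH n J a" by (simp_all add: HH_def)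
qed

lemma HH_0 [simp]: "HH n J 0 = 0" using HH_linear(2)[of n J 0 0] by simp

lemma TT_linear [simp]:
  "TT n J (a + b) = TT n J a + TT n J b" "TT n J (a - b) = TT n J a - TT n J b"
  "TT n J (sc c * a) = c * TT n J a" "TT n J 0 = 0"
  by (simp_all add: TT_def)

lemma HH_cong:
  assumes "eqv n a b" "J \<subseteq> {..n}"
  shows "eqv n (HH n J a) (HH n J b)"
proof -
  have "finite J" using assms finite_subset by blast
  then show ?thesis using assms
  proof (induction J arbitrary: a b rule: finite_linorder_min_induct)
    case (insert m J)
    then have "hh n m a = hh n m b" by (intro hh_cong) auto
    then show ?case using insert HH_min by (metis eqv_refl)
  qed simp
qed

lemma TT_cong:
  assumes "eqv n a b" "J \<subseteq> {..n}"
  shows "TT n J a = TT n J b"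
proof (cases "J = {}")
  case False
  have "finite J" using assms finite_subset by blast
  then have "Max J \<in> J" using False by simp
  moreover have "J - {Max J} \<subseteq> {..n}" using assms(2) by blast
  ultimately have "eps n (Max J) (HH n (J - {Max J}) a) = eps n (Max J) (HH n (J - {Max J}) b)"
    using assms by (intro eps_cong HH_cong) auto
  then show ?thesis by (simp add: TT_def)
qed (simp add: TT_def)

lemma card_greater_max:
  assumes "finite (J :: nat set)" "\<And>j. j \<in> J \<Longrightarrow> j < m" "j \<in> J"
  shows "card {l\<in>insert m J. j < l} = Suc (card {l\<in>J. j < l})"
proof -
  have "m \<notin> J" using assms(2)[of m] by auto
  have "{l\<in>insert m J. j < l} = insert m {l\<in>J. j < l}" using assms by auto
  then show ?thesis using assms(1) \<open>m \<notin> J\<close> by simp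
qed

text \<open>Moving \<open>dd\<close> through the homotopies by \<open>hh_homotopy\<close> leaves,
  for each vertex, a term with its homotopy omitted and a constant. The next homotopy kills a
  constant, so only the constant of the last vertex survives, and this is the integral over
  \<open>J\<close>.\<close>

lemma dd_HH:
  assumes "J \<subseteq> {..n}"
  shows "eqv n (dd (HH n J a)) ((- 1) ^ card J * HH n J (dd a) +
    (\<Sum>j\<in>J. (- 1) ^ card {l\<in>J. j < l} * HH n (J - {j}) a) - sc (TT n J a))"
proof -
  have "finite J" using assms finite_subset by blast
  then show ?thesis using assms
  proof (induction J rule: finite_linorder_max_induct)
    case empty
    \<comment> \<open>The convention \<open>TT n {} a = 0\<close> makes the formula true for the
      empty face, which starts the induction.\<close>
    then show ?case by (simp add: TT_def)
  next
    case (insert m J)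
    have m: "m \<notin> J" "m \<le> n" and J: "\<And>j. j \<in> J \<Longrightarrow> j < m" "finite J" using insert by auto
    have "eqv n (dd (HH n (insert m J) a)) (HH n J a - sc (eps n m (HH n J a)) - hh n m (dd (HH n J a)))"
      using hh_homotopy[OF m(2)] HH_max[OF J(2,1)] by metis
    also have "hh n m (dd (HH n J a)) = hh n m ((- 1) ^ card J * HH n J (dd a) +
        (\<Sum>j\<in>J. (- 1) ^ card {l\<in>J. j < l} * HH n (J - {j}) a) - sc (TT n J a))"
      using insert by (intro hh_cong) auto
    also have "\<dots> = (- 1) ^ card J * hh n m (HH n J (dd a)) +
        (\<Sum>j\<in>J. (- 1) ^ card {l\<in>J. j < l} * hh n m (HH n (J - {j}) a))"
      by (simp add: hh_sign)
    also have "hh n m (HH n J (dd a)) = HH n (insert m J) (dd a)"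
      by (rule HH_max[symmetric, OF J(2,1)])
    also have "(\<Sum>j\<in>J. (- 1) ^ card {l\<in>J. j < l} * hh n m (HH n (J - {j}) a)) =
        (\<Sum>j\<in>J. - ((- 1) ^ card {l\<in>insert m J. j < l} * HH n (insert m J - {j}) a))"
    proof (rule sum.cong[OF refl])
      fix j assume j: "j \<in> J"
      then have "insert m J - {j} = insert m (J - {j})" using J m by auto
      moreover have "HH n (insert m (J - {j})) a = hh n m (HH n (J - {j}) a)"
        by (rule HH_max) (use J in auto)
      ultimately show "(- 1) ^ card {l\<in>J. j < l} * hh n m (HH n (J - {j}) a) =
          - ((- 1) ^ card {l\<in>insert m J. j < l} * HH n (insert m J - {j}) a)"
        using card_greater_max[OF J(2,1) j] by simp
    qed
    also have "eps n m (HH n J a) = TT n (insert m J) a"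
      by (rule TT_max[symmetric, OF J(2,1)])
    finally have *: "eqv n (dd (HH n (insert m J) a)) (HH n J a - sc (TT n (insert m J) a) -
      ((- 1) ^ card J * HH n (insert m J) (dd a) +
        (\<Sum>j\<in>J. - ((- 1) ^ card {l\<in>insert m J. j < l} * HH n (insert m J - {j}) a))))" .
    have e: "{l\<in>insert m J. m < l} = {}" using J by fastforce
    have "(\<Sum>j\<in>insert m J. (- 1) ^ card {l\<in>insert m J. j < l} * HH n (insert m J - {j}) a) =
        HH n J a + (\<Sum>j\<in>J. (- 1) ^ card {l\<in>insert m J. j < l} * HH n (insert m J - {j}) a)"
    proof -
      have "insert m J - {m} = J" using m by blast
      then show ?thesis by (simp only: sum.insert[OF J(2) m(1)] e card.empty power_0 mult_1)
    qed
    then show ?case using * J m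
      by (simp add: sum_negf algebra_simps)
  qed
qed

section \<open>Dupont's contraction\<close>

definition whit :: "nat set \<Rightarrow> 'k::field_char_0 pform" where "whit J = iota (ee J)"

abbreviation NE :: "nat \<Rightarrow> nat set set" where "NE n \<equiv> Pow {..n} - {{}}"

lemma homog_whit: "finite J \<Longrightarrow> J \<noteq> {} \<Longrightarrow> homog (card J - 1) (whit J)"
  unfolding whit_def by (rule homog_iota) (metis Suc_pred' card_gt_0_iff homog_simps(5))

lemma bar_whit: "finite J \<Longrightarrow> J \<noteq> {} \<Longrightarrow> bar (whit J) = (- 1) ^ (card J - 1) * whit J"
  by (rule homog_bar_eq) (rule homog_whit)

text \<open>Since \<open>ee J\<close> is closed, this is the eigenvalue equation of
  \<open>LL\<close> on a form of weight \<open>card J\<close>.\<close>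

lemma dd_whit: "finite J \<Longrightarrow> dd (whit J) = of_nat (card J) * ee J"
  using LL_ee[of J] by (simp add: LL_def whit_def)

text \<open>Contract the product of the sum of all \<open>dt_i\<close> with \<open>dt_J\<close> by
  the Euler field and apply the relations: the \<open>t_i\<close> add up to 1, the
  \<open>dt_i\<close> to 0.\<close>

lemma sum_whit:
  assumes "J \<subseteq> {..n}"
  shows "eqv n (\<Sum>i\<in>{..n} - J. sc (shuffle_sign {i} J) * whit (insert i J)) (ee J)"
proof -
  have J: "finite J" using assms finite_subset by blast
  have io: "iota (dtv i * ee J) = Xv i * ee J - dtv i * whit J" for i
    by (simp add: iota_mult bar_ee whit_def)
  have "(\<Sum>i\<in>{..n} - J. sc (shuffle_sign {i} J) * whit (insert i J)) = (\<Sum>i\<in>{..n} - J. iota (dtv i * ee J))"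
    using J by (intro sum.cong) (auto simp: dtv_ee whit_def)
  also have "\<dots> = (\<Sum>i\<le>n. iota (dtv i * ee J))"
    using J assms by (intro sum.mono_neutral_left) (auto simp: dtv_ee)
  also have "\<dots> = (\<Sum>i\<le>n. Xv i) * ee J - dd (\<Sum>i\<le>n. Xv i) * whit J"
    by (simp add: io sum_subtractf sum_distrib_right)
  finally have *: "(\<Sum>i\<in>{..n} - J. sc (shuffle_sign {i} J) * whit (insert i J)) =
    (\<Sum>i\<le>n. Xv i) * ee J - dd (\<Sum>i\<le>n. Xv i) * whit J" .
  have X: "nf n 0 (\<Sum>i\<le>n. Xv i) = (1 :: 'a pform)"
    using sum_nfs[of 0 n, where ?'a = 'a] by (simp add: nf_def flip: Pf_sum)
  show ?thesis
    unfolding eqv_def * nf_simps(4) nf_simps(2) nf_dd X by simp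
qed

text \<open>The usual Whitney form of the face \<open>J\<close> is \<open>fact (card J - 1) * whit J\<close>.\<close>

definition dcoef :: "nat set \<Rightarrow> 'k::field_char_0" where
  "dcoef J = (- 1) ^ (card J - 1) * fact (card J - 1)"

definition ss :: "nat \<Rightarrow> 'k::field_char_0 pform \<Rightarrow> 'k pform" where
  "ss n a = (\<Sum>J\<in>NE n. sc (dcoef J) * (whit J * HH n J a))"

text \<open>The other elements of \<open>J\<close> lie above or below \<open>j\<close>, so the two
  counts add up to \<open>card J - 1\<close>. This translates the sign in \<open>dd_HH\<close> into
  the one in \<open>sum_whit\<close>.\<close>

lemma sign_swap:
  assumes "finite J" "j \<in> J"
  shows "(- 1) ^ card {l\<in>J. j < l} = (- 1) ^ (card J - 1) * (shuffle_sign {j} (J - {j}) :: 'k::comm_ring_1)"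
proof -
  have "J - {j} = {l\<in>J. j < l} \<union> {l\<in>J - {j}. l < j}" by auto
  then have "card (J - {j}) = card ({l\<in>J. j < l} \<union> {l\<in>J - {j}. l < j})" by (rule arg_cong)
  also have "\<dots> = card {l\<in>J. j < l} + card {l\<in>J - {j}. l < j}"
    using assms by (intro card_Un_disjoint) auto
  finally have "card J - 1 = card {l\<in>J. j < l} + card {l\<in>J - {j}. l < j}"
    using assms by simp
  then show ?thesis unfolding shuffle_sign_singleton power_add
    by (simp only: power_add mult.assoc) (simp flip: power_mult_distrib)
qed

lemma sum_pairs_swap:
  "(\<Sum>J\<in>NE n. \<Sum>j\<in>J. F j (J - {j})) = (\<Sum>L\<in>Pow {..n}. \<Sum>j\<in>{..n} - L. F j L)"
proof -
  have fin: "finite J" if "J \<in> NE n" for J using that finite_subset by blast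
  show ?thesis
    apply (subst sum.Sigma, use fin in auto)
    apply (subst sum.Sigma, use fin in auto)
    apply (rule sum.reindex_bij_witness[of _ "\<lambda>(L, j). (insert j L, j)" "\<lambda>(J, j). (J - {j}, j)"])
    by auto
qed

text \<open>The sum telescopes. Differentiating \<open>whit J\<close> produces \<open>dt_J\<close>
  times the iterated homotopy over \<open>J\<close>; the terms of \<open>dd_HH\<close> with a vertex
  \<open>j\<close> omitted, regrouped by \<open>L = J - {j}\<close> and summed over \<open>j\<close>
  by \<open>sum_whit\<close>, produce \<open>dt_L\<close> times the iterated homotopy over
  \<open>L\<close>. As \<open>k! (k + 1) = (k + 1)!\<close>, the coefficients agree up to sign and
  everything cancels except \<open>L = {}\<close>, which gives \<open>a\<close>, and the
  integrals.\<close>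

theorem dupont:
  "eqv n (dd (ss n a) + ss n (dd a)) (a - (\<Sum>J\<in>NE n. sc (fact (card J - 1) * TT n J a) * whit J))"
proof -
  let ?A = "\<lambda>J. sc ((- 1) ^ card J * fact (card J)) * (ee J * HH n J a)"
  let ?F = "\<lambda>j L. sc ((- 1) ^ card L * fact (card L)) * (sc (shuffle_sign {j} L) * whit (insert j L) * HH n L a)"
  let ?C = "\<lambda>J. sc (fact (card J - 1) * TT n J a) * whit J"
  have step: "eqv n (dd (sc (dcoef J) * (whit J * HH n J a)) + sc (dcoef J) * (whit J * HH n J (dd a)))
      (- ?A J + (\<Sum>j\<in>J. ?F j (J - {j})) - ?C J)" if J: "J \<in> NE n" for J
  proof -
    have fin: "finite J" "J \<noteq> {}" using J finite_subset by auto
    obtain k where k: "card J = Suc k" using fin by (metis card_gt_0_iff gr0_implies_Suc)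
    let ?D = "(- 1) ^ card J * HH n J (dd a) +
      (\<Sum>j\<in>J. (- 1) ^ card {l\<in>J. j < l} * HH n (J - {j}) a) - sc (TT n J a)"
    have cm: "(- 1) ^ k * whit J = whit J * ((- 1) ^ k)" by (simp add: minus_one_power_iff)
    have "eqv n (dd (sc (dcoef J) * (whit J * HH n J a)))
        (sc (dcoef J) * (of_nat (card J) * ee J * HH n J a + (- 1) ^ k * (whit J * ?D)))"
      using dd_HH[of J n a] J
      by (simp add: dd_mult dd_whit[OF fin(1)] bar_whit[OF fin] k mult.assoc eqv_def nf_dd)
    moreover have "sc (dcoef J) * (of_nat (card J) * ee J * HH n J a) = - ?A J"
    proof -
      have "sc (dcoef J) * of_nat (card J) = - sc ((- 1) ^ card J * fact (card J) :: 'a)"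
        unfolding sc_of_nat[symmetric] sc_simps(2,3)[symmetric] by (simp add: dcoef_def k algebra_simps)
      then show ?thesis by (metis mult.assoc mult_minus_left)
    qed
    moreover have "sc (dcoef J) * ((- 1) ^ k * (whit J * ?D)) =
      - (sc (dcoef J) * (whit J * HH n J (dd a))) + (\<Sum>j\<in>J. ?F j (J - {j})) - ?C J"
    proof -
      \<comment> \<open>The sign in \<open>dcoef\<close> is the one that \<open>dd\<close> picks up
        when it passes \<open>whit J\<close>, a form of degree \<open>card J - 1\<close>; only the
        factorial is left.\<close>
      have c: "sc (dcoef J) * (- 1) ^ k = (sc (fact k) :: 'a pform)"
        unfolding sc_power[symmetric] sc_simps(4)[symmetric] sc_simps(3)[symmetric] sc_simps(2)[symmetric]
        by (simp add: dcoef_def k minus_one_power_iff del: sc_simps sc_power)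
      have "sc (dcoef J) * ((- 1) ^ k * (whit J * ?D)) = sc (fact k) * (whit J * ?D)"
        unfolding c[symmetric] by (simp only: mult.assoc)
      also have "\<dots> = - ((-1)^k * sc (fact k) * (whit J * HH n J (dd a)))
          + (\<Sum>j\<in>J. sc (fact k) * (whit J * ((- 1) ^ card {l\<in>J. j < l} * HH n (J - {j}) a)))
          - sc (fact k) * (whit J * sc (TT n J a))"
        by (simp add: distrib_left right_diff_distrib sum_distrib_left k minus_one_power_iff)
      also have "(-1)^k * sc (fact k) = (sc (dcoef J) :: 'a pform)"
        unfolding sc_power[symmetric] sc_simps(4)[symmetric] sc_simps(3)[symmetric] sc_simps(2)[symmetric]
        by (simp add: dcoef_def k del: sc_simps sc_power)
      also have "sc (fact k) * (whit J * sc (TT n J a)) = ?C J"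
        unfolding sc_commute[of "whit J"] by (simp add: k mult.assoc)
      also have "(\<Sum>j\<in>J. sc (fact k) * (whit J * ((- 1) ^ card {l\<in>J. j < l} * HH n (J - {j}) a))) =
        (\<Sum>j\<in>J. ?F j (J - {j}))"
      proof (rule sum.cong[OF refl])
        fix j assume j: "j \<in> J"
        let ?s = "(- 1) ^ k * shuffle_sign {j} (J - {j}) :: 'a"
        have "sc ((- 1) ^ card {l\<in>J. j < l}) = ((- 1) ^ card {l\<in>J. j < l} :: 'a pform)" by simp
        then have s: "(- 1) ^ card {l\<in>J. j < l} = sc ?s"
          using sign_swap[OF fin(1) j, where ?'k = 'a] k by (simp only: diff_Suc_1)
        have "sc (fact k) * (whit J * ((- 1) ^ card {l\<in>J. j < l} * HH n (J - {j}) a)) =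
            sc (fact k * ?s) * (whit J * HH n (J - {j}) a)"
          unfolding s sc_simps(2)[of "fact k"] sc_left_commute[of "whit J"] by (simp only: mult.assoc)
        moreover have "fact k * ?s = (- 1) ^ card (J - {j}) * fact (card (J - {j})) * shuffle_sign {j} (J - {j})"
          using fin j k by simp
        moreover have "insert j (J - {j}) = J" using j by blast
        ultimately show "sc (fact k) * (whit J * ((- 1) ^ card {l\<in>J. j < l} * HH n (J - {j}) a)) = ?F j (J - {j})"
          by (simp only: sc_simps(2) mult.assoc)
      qed
      finally show ?thesis .
    qed
    ultimately have "eqv n (dd (sc (dcoef J) * (whit J * HH n J a)))
        (- ?A J + (- (sc (dcoef J) * (whit J * HH n J (dd a))) + (\<Sum>j\<in>J. ?F j (J - {j})) - ?C J))"
      by (simp only: distrib_left)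
    from eqv_add[OF this eqv_refl, of "sc (dcoef J) * (whit J * HH n J (dd a))"]
    show ?thesis by (simp add: algebra_simps)
  qed
  have "eqv n (dd (ss n a) + ss n (dd a)) (\<Sum>J\<in>NE n. - ?A J + (\<Sum>j\<in>J. ?F j (J - {j})) - ?C J)"
    unfolding ss_def dd_sum sum.distrib[symmetric] by (rule eqv_sum) (rule step)
  also have "(\<Sum>J\<in>NE n. - ?A J + (\<Sum>j\<in>J. ?F j (J - {j})) - ?C J) =
     (\<Sum>J\<in>NE n. \<Sum>j\<in>J. ?F j (J - {j})) - (\<Sum>J\<in>NE n. ?A J) - (\<Sum>J\<in>NE n. ?C J)"
    by (simp only: sum.distrib sum_subtractf sum_negf) simp
  also have "(\<Sum>J\<in>NE n. \<Sum>j\<in>J. ?F j (J - {j})) = (\<Sum>L\<in>Pow {..n}. \<Sum>j\<in>{..n} - L. ?F j L)"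
    by (rule sum_pairs_swap)
  finally have 1: "eqv n (dd (ss n a) + ss n (dd a))
     ((\<Sum>L\<in>Pow {..n}. \<Sum>j\<in>{..n} - L. ?F j L) - (\<Sum>J\<in>NE n. ?A J) - (\<Sum>J\<in>NE n. ?C J))" .
  have "eqv n (\<Sum>L\<in>Pow {..n}. \<Sum>j\<in>{..n} - L. ?F j L) (\<Sum>L\<in>Pow {..n}. ?A L)"
  proof (rule eqv_sum)
    fix L assume "L \<in> Pow {..n}"
    then have "eqv n (\<Sum>j\<in>{..n} - L. sc (shuffle_sign {j} L) * whit (insert j L)) (ee L)"
      by (intro sum_whit) auto
    then have "eqv n (sc ((- 1) ^ card L * fact (card L)) * ((\<Sum>j\<in>{..n} - L. sc (shuffle_sign {j} L) * whit (insert j L)) * HH n L a)) (?A L)"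
      by (intro eqv_mult eqv_refl)
    then show "eqv n (\<Sum>j\<in>{..n} - L. ?F j L) (?A L)"
      by (simp only: sum_distrib_left sum_distrib_right)
  qed
  also have "(\<Sum>L\<in>Pow {..n}. ?A L) = a + (\<Sum>J\<in>NE n. ?A J)"
    by (subst sum.remove[of _ "{}"]) auto
  finally have 2: "eqv n (\<Sum>L\<in>Pow {..n}. \<Sum>j\<in>{..n} - L. ?F j L) (a + (\<Sum>J\<in>NE n. ?A J))" .
  show ?thesis
    using 1 2 by (simp only: eqv_def nf_simps(4)) (simp only: nf_simps(1), simp)
qed

section \<open>Compatibility with faces and degeneracies\<close>

lemma HH_union:
  assumes "finite I" "finite J" "\<And>i j. i \<in> I \<Longrightarrow> j \<in> J \<Longrightarrow> i < j"
  shows "HH n (I \<union> J) a = HH n J (HH n I a)"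
  using assms(1,3)
proof (induction I arbitrary: a rule: finite_linorder_min_induct)
  case (insert m I)
  have "HH n (insert m (I \<union> J)) a = HH n (I \<union> J) (hh n m a)"
    using insert assms(2) by (intro HH_min) auto
  then show ?case using insert HH_min[of I m n a] by simp
qed simp

text \<open>Cofaces and codegeneracies are weakly monotone and repeat a value at most on two
  consecutive vertices. So they preserve the order in which homotopies are applied, and a repetition
  brings the same homotopy twice in succession.\<close>

definition vmap :: "nat \<Rightarrow> nat \<Rightarrow> (nat \<Rightarrow> 'k::field_char_0 mpoly) \<Rightarrow> (nat \<Rightarrow> nat) \<Rightarrow> bool" where
  "vmap n r g \<phi> \<longleftrightarrow> vertex_map n r g \<phi> \<and> (\<forall>l l'. l \<le> l' \<longrightarrow> \<phi> l \<le> \<phi> l') \<and>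
    (\<forall>l l'. l < l' \<longrightarrow> \<phi> l = \<phi> l' \<longrightarrow> l' = Suc l) \<and>
    (\<forall>j\<le>n. g j = (\<Sum>l | l \<le> r \<and> \<phi> l = j. mp_var l))"

lemma vmap_face:
  assumes "i \<le> Suc n" shows "vmap (Suc n) n (face_subst i) (face_v i)"
proof -
  have "{l. l \<le> n \<and> face_v i l = j} = (if j < i then {j} else if j = i then {} else {j - 1})" if "j \<le> Suc n" for j
    using that assms by (auto simp: face_v_def split: if_splits)
  then have "face_subst i j = (\<Sum>l | l \<le> n \<and> face_v i l = j. mp_var l)" if "j \<le> Suc n" for j
    using that by (simp add: face_subst_def)
  moreover have "face_v i l \<le> face_v i l'" if "l \<le> l'" for l l' using that by (auto simp: face_v_def)
  moreover have "l' = Suc l" if "l < l'" "face_v i l = face_v i l'" for l l'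
    using that by (auto simp: face_v_def split: if_splits)
  ultimately show ?thesis using vertex_map_face[OF assms] unfolding vmap_def by blast
qed

lemma vmap_degen:
  assumes "i \<le> n" shows "vmap n (Suc n) (degen_subst i) (degen_v i)"
proof -
  have "{l. l \<le> Suc n \<and> degen_v i l = j} = (if j < i then {j} else if j = i then {i, Suc i} else {Suc j})" if "j \<le> n" for j
    using that assms by (auto simp: degen_v_def split: if_splits)
  then have "degen_subst i j = (\<Sum>l | l \<le> Suc n \<and> degen_v i l = j. mp_var l)" if "j \<le> n" for j
    using that by (simp add: degen_subst_def)
  moreover have "degen_v i l \<le> degen_v i l'" if "l \<le> l'" for l l' using that by (auto simp: degen_v_def)
  moreover have "l' = Suc l" if "l < l'" "degen_v i l = degen_v i l'" for l l'
    using that by (auto simp: degen_v_def split: if_splits)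
  ultimately show ?thesis using vertex_map_degen[OF assms] unfolding vmap_def by blast
qed

lemma vmap_less:
  assumes "vmap n r g \<phi>" "inj_on \<phi> I" "i \<in> I" "j \<in> I" "i < j"
  shows "\<phi> i < \<phi> j"
proof -
  have "\<phi> i \<le> \<phi> j" using assms by (simp add: vmap_def)
  moreover have "\<phi> i \<noteq> \<phi> j" using assms by (metis inj_onD less_irrefl)
  ultimately show ?thesis by simp
qed

lemma HH_sub:
  assumes v: "vmap n r g \<phi>" and I: "I \<subseteq> {..r}" "inj_on \<phi> I"
  shows "eqv r (HH r I (sub g a)) (sub g (HH n (\<phi> ` I) a))"
proof -
  have "finite I" using I finite_subset by blast
  then show ?thesis using I
  proof (induction I rule: finite_linorder_max_induct)
    case (insert m I)
    have m: "m \<le> r" and vm: "vertex_map n r g \<phi>" using insert v by (auto simp: vmap_def)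
    have "HH r (insert m I) (sub g a) = hh r m (HH r I (sub g a))"
      using insert by (intro HH_max) auto
    also have "\<dots> = hh r m (sub g (HH n (\<phi> ` I) a))"
      using insert by (intro hh_cong) auto
    also have "\<dots> = nf r m (sub g (hh n (\<phi> m) (HH n (\<phi> ` I) a)))"
      by (rule hh_sub[OF vm m])
    also have "hh n (\<phi> m) (HH n (\<phi> ` I) a) = HH n (\<phi> ` insert m I) a"
      unfolding image_insert
    proof (rule HH_max[symmetric])
      show "j < \<phi> m" if "j \<in> \<phi> ` I" for j
        using that insert vmap_less[OF v insert(5), of _ m] by auto
    qed (use insert in auto)
    finally show ?case using eqv_nf[OF m] by metis
  qed simp
qed

text \<open>The least repetition is taken, in order that \<phi> is injective on the vertices before
  it and \<open>HH_sub\<close> applies to them.\<close>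

lemma not_inj_split:
  assumes v: "vmap n r g \<phi>" and "\<not> inj_on \<phi> I"
  obtains l where "l \<in> I" "Suc l \<in> I" "\<phi> l = \<phi> (Suc l)" "inj_on \<phi> {x\<in>I. x < l}"
proof -
  define P where "P l \<longleftrightarrow> l \<in> I \<and> Suc l \<in> I \<and> \<phi> l = \<phi> (Suc l)" for l
  have adj: "\<exists>l. P l \<and> (l = x \<or> l = y)" if xy: "x \<in> I" "y \<in> I" "x \<noteq> y" "\<phi> x = \<phi> y" for x y
  proof (cases "x < y")
    case True
    then have "y = Suc x" using v xy by (simp add: vmap_def)
    then show ?thesis using xy by (auto simp: P_def)
  next
    case False
    then have "y < x" using xy by simp
    then have "x = Suc y" using v xy unfolding vmap_def by metis
    then show ?thesis using xy by (auto simp: P_def)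
  qed
  obtain x y where "x \<in> I" "y \<in> I" "x \<noteq> y" "\<phi> x = \<phi> y" using assms(2) by (auto simp: inj_on_def)
  then have "\<exists>l. P l" using adj by blast
  then have P: "P (LEAST l. P l)" by (rule LeastI_ex)
  have "inj_on \<phi> {x\<in>I. x < (LEAST l. P l)}"
  proof (rule inj_onI, rule ccontr)
    fix x y assume xy: "x \<in> {x\<in>I. x < (LEAST l. P l)}" "y \<in> {x\<in>I. x < (LEAST l. P l)}" "\<phi> x = \<phi> y" "x \<noteq> y"
    then obtain l where "P l" "l = x \<or> l = y" using adj[of x y] by auto
    then show False using xy not_less_Least by auto
  qed
  then show ?thesis using that P unfolding P_def by blast
qed

text \<open>At a repetition the homotopies onto \<open>l\<close> and \<open>Suc l\<close> are both
  induced by the homotopy onto the same vertex, whose square is 0.\<close>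

lemma HH_sub_not_inj:
  assumes v: "vmap n r g \<phi>" and I: "I \<subseteq> {..r}" "\<not> inj_on \<phi> I"
  shows "eqv r (HH r I (sub g a)) 0"
proof -
  have fin: "finite I" using I finite_subset by blast
  obtain l where l: "l \<in> I" "Suc l \<in> I" "\<phi> l = \<phi> (Suc l)" and inj: "inj_on \<phi> {x\<in>I. x < l}"
    using not_inj_split[OF v I(2)] .
  have lr: "l \<le> r" "Suc l \<le> r" and vm: "vertex_map n r g \<phi>" using l I v by (auto simp: vmap_def)
  let ?I = "{x\<in>I. x < l}" and ?J = "{x\<in>I. Suc l < x}"
  have split: "I = insert (Suc l) (insert l ?I) \<union> ?J" using l by (auto simp: not_less le_eq_less_or_eq)
  let ?b = "HH n (\<phi> ` ?I) a"
  have e: "eqv r (HH r ?I (sub g a)) (sub g ?b)" using I inj by (intro HH_sub[OF v]) auto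
  have "hh r l (HH r ?I (sub g a)) = nf r l (sub g (hh n (\<phi> l) ?b))"
    using hh_cong[OF e lr(1)] hh_sub[OF vm lr(1)] by simp
  then have "hh r (Suc l) (hh r l (HH r ?I (sub g a))) = hh r (Suc l) (sub g (hh n (\<phi> l) ?b))"
    by (metis eqv_nf hh_cong lr)
  also have "\<dots> = 0" unfolding hh_sub[OF vm lr(2)] l(3)[symmetric] hh_hh by (simp add: sub_def)
  finally have 0: "hh r (Suc l) (hh r l (HH r ?I (sub g a))) = 0" .
  have "HH r I (sub g a) = HH r ?J (HH r (insert (Suc l) (insert l ?I)) (sub g a))"
    by (subst split, rule HH_union) (use fin in auto)
  also have "HH r (insert (Suc l) (insert l ?I)) (sub g a) = hh r (Suc l) (HH r (insert l ?I) (sub g a))"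
    by (rule HH_max) (use fin in auto)
  also have "HH r (insert l ?I) (sub g a) = hh r l (HH r ?I (sub g a))"
    by (rule HH_max) (use fin in auto)
  finally show ?thesis unfolding 0 by simp
qed

text \<open>If two vertices of \<open>I\<close> collapse, either both precede the last one and a
  homotopy is squared, or the last one is involved and a form is evaluated at the vertex onto which
  it has just been contracted; \<open>eps_hh\<close> makes this 0.\<close>

lemma TT_sub:
  assumes v: "vmap n r g \<phi>" and I: "I \<subseteq> {..r}"
  shows "TT r I (sub g a) = (if inj_on \<phi> I then TT n (\<phi> ` I) a else 0)"
proof (cases "I = {}")
  case False
  have fin: "finite I" using I finite_subset by blast
  define m where "m = Max I"
  define I' where "I' = I - {m}"
  have mI: "m \<in> I" using False fin by (simp add: m_def)
  have II: "I = insert m I'" using mI I'_def by auto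
  have less: "x < m" if "x \<in> I'" for x
    using that fin unfolding I'_def m_def by (metis Diff_iff Max_ge insertI1 le_neq_implies_less)
  have fin': "finite I'" "I' \<subseteq> {..r}" using I by (auto simp: I'_def fin)
  have mr: "m \<le> r" and vm: "vertex_map n r g \<phi>" using mI I v by (auto simp: vmap_def)
  have T: "TT r I (sub g a) = eps r m (HH r I' (sub g a))"
    unfolding II by (rule TT_max[OF fin'(1) less])
  show ?thesis
  proof (cases "inj_on \<phi> I'")
    case inj': True
    then have "TT r I (sub g a) = eps r m (sub g (HH n (\<phi> ` I') a))"
      unfolding T by (intro eps_cong HH_sub[OF v fin'(2)] mr) 
    also have "\<dots> = eps n (\<phi> m) (HH n (\<phi> ` I') a)" by (rule eps_sub[OF vm mr])
    finally have T': "TT r I (sub g a) = eps n (\<phi> m) (HH n (\<phi> ` I') a)" .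
    show ?thesis
    proof (cases "inj_on \<phi> I")
      case True
      have "eps n (\<phi> m) (HH n (\<phi> ` I') a) = TT n (insert (\<phi> m) (\<phi> ` I')) a"
        by (rule TT_max[symmetric]) (use fin' less vmap_less[OF v True] mI in \<open>auto simp: I'_def\<close>)
      then show ?thesis using T' True II by simp
    next
      case False
      then have "\<phi> m \<in> \<phi> ` (I' - {m})" using inj' unfolding II inj_on_insert by blast
      then obtain x where x: "x \<in> I'" "\<phi> x = \<phi> m" by (metis DiffD1 imageE)
      let ?y = "\<phi> m"
      have max: "j < ?y" if "j \<in> \<phi> ` (I' - {x})" for j
      proof -
        obtain z where z: "z \<in> I'" "z \<noteq> x" "j = \<phi> z"
          using \<open>j \<in> \<phi> ` (I' - {x})\<close> by blast
        have "\<phi> z \<le> \<phi> m" using less[OF z(1)] v by (simp add: vmap_def)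
        moreover have "\<phi> z \<noteq> \<phi> x" using inj' z x by (metis inj_onD)
        ultimately show ?thesis using z x by simp
      qed
      have "I' = insert x (I' - {x})" using x(1) by blast
      then have "\<phi> ` I' = insert ?y (\<phi> ` (I' - {x}))" using x(2) by (metis image_insert)
      then have "HH n (\<phi> ` I') a = hh n ?y (HH n (\<phi> ` (I' - {x})) a)"
        using HH_max[of "\<phi> ` (I' - {x})" ?y n a] max fin' by simp
      then show ?thesis using T' False by simp
    qed
  next
    case False
    then have "\<not> inj_on \<phi> I" unfolding II by (auto simp: inj_on_insert)
    moreover have "eps r m (HH r I' (sub g a)) = eps r m 0"
      using HH_sub_not_inj[OF v fin'(2) False] mr by (intro eps_cong)
    ultimately show ?thesis using T by simp
  qed
qed (simp add: TT_def)

text \<open>The faces which a degeneracy maps isomorphically onto \<open>J\<close>.\<close>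

definition fibres :: "nat \<Rightarrow> (nat \<Rightarrow> nat) \<Rightarrow> nat set \<Rightarrow> nat set set" where
  "fibres r \<phi> J = {I \<in> Pow {..r}. inj_on \<phi> I \<and> \<phi> ` I = J}"

lemma fibres_empty [simp]: "fibres r \<phi> {} = {{}}"
  by (auto simp: fibres_def)

text \<open>Each \<open>dt_j\<close> goes to the sum of the \<open>dt_l\<close> over the fibre of
  \<open>j\<close>. Expanding the product picks one vertex from each fibre, and monotonicity of
  \<phi> keeps these in increasing order, so no signs arise.\<close>

lemma ee_sub:
  assumes v: "vmap n r g \<phi>" and J: "J \<subseteq> {..n}"
  shows "sub g (ee J) = (\<Sum>I\<in>fibres r \<phi> J. ee I)"
proof -
  have "finite J" using J finite_subset by blast
  then show ?thesis using J
  proof (induction J rule: finite_linorder_min_induct)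
    case (insert m J)
    let ?L = "{l. l \<le> r \<and> \<phi> l = m}"
    have mJ: "m \<notin> J" using insert(2) by blast
    have less: "l < i" if "\<phi> l = m" "I \<in> fibres r \<phi> J" "i \<in> I" for l I i
    proof (rule ccontr)
      assume "\<not> l < i"
      then have "\<phi> i \<le> \<phi> l" using v by (simp add: vmap_def)
      moreover have "\<phi> i \<in> J" using that by (auto simp: fibres_def)
      ultimately show False using insert(2) that(1) by force
    qed
    have fin: "finite I" if "I \<in> fibres r \<phi> J" for I J using that finite_subset by (auto simp: fibres_def)
    have "sub g (ee (insert m J)) = sub g (dtv m) * sub g (ee J)"
      using insert dtv_ee_min[of J m] by (metis sub_mult)
    also have "sub g (ee J) = (\<Sum>I\<in>fibres r \<phi> J. ee I)" using insert by auto
    also have "sub g (dtv m) = (\<Sum>l\<in>?L. dtv l)"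
      using v insert(4) by (simp add: sub_dtv vmap_def)
    also have "(\<Sum>l\<in>?L. dtv l) * (\<Sum>I\<in>fibres r \<phi> J. ee I) = (\<Sum>l\<in>?L. \<Sum>I\<in>fibres r \<phi> J. ee (insert l I))"
      unfolding sum_product by (intro sum.cong refl dtv_ee_min fin less) auto
    also have "\<dots> = (\<Sum>(l, I)\<in>?L \<times> fibres r \<phi> J. ee (insert l I))"
      by (subst sum.cartesian_product) auto
    also have "\<dots> = (\<Sum>I\<in>fibres r \<phi> (insert m J). ee I)"
    proof (rule sum.reindex_bij_witness[of _ "\<lambda>I. (Min I, I - {Min I})" "\<lambda>(l, I). insert l I"])
      fix I assume I: "I \<in> fibres r \<phi> (insert m J)"
      then have II: "finite I" "I \<noteq> {}" "inj_on \<phi> I" "\<phi> ` I = insert m J" "I \<subseteq> {..r}"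
        using fin by (auto simp: fibres_def)
      have Min: "Min I \<in> I" using II by simp
      obtain x where x: "x \<in> I" "\<phi> x = m" using II by (metis imageE insertI1)
      have "\<phi> (Min I) \<le> m" using v x II by (simp add: vmap_def flip: x(2))
      moreover have "\<phi> (Min I) \<in> insert m J" using Min II by blast
      ultimately have pm: "\<phi> (Min I) = m" using insert(2) by force
      show "(case (Min I, I - {Min I}) of (l, I) \<Rightarrow> insert l I) = I" using Min by auto
      have "\<phi> ` (I - {Min I}) = \<phi> ` I - {m}"
        using inj_on_image_set_diff[OF II(3), of I "{Min I}"] Min pm by auto
      then have "\<phi> ` (I - {Min I}) = J" using II mJ by auto
      then show "(Min I, I - {Min I}) \<in> ?L \<times> fibres r \<phi> J"
        using II subsetD[OF II(5) Min] pm by (auto simp: fibres_def intro: inj_on_subset)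
    next
      fix p assume p: "p \<in> ?L \<times> fibres r \<phi> J"
      obtain l I where [simp]: "p = (l, I)" by (cases p)
      have lI: "l \<le> r" "\<phi> l = m" "I \<in> fibres r \<phi> J" "finite I" using p fin by auto
      have less': "l < i" if "i \<in> I" for i using less lI that by blast
      have Min: "Min (insert l I) = l" by (rule Min_eqI) (use lI less' in \<open>auto intro: less_imp_le\<close>)
      have "l \<notin> I" using less' by blast
      then show "(Min (case p of (l, I) \<Rightarrow> insert l I), (case p of (l, I) \<Rightarrow> insert l I) - {Min (case p of (l, I) \<Rightarrow> insert l I)}) = p"
        using Min by simp
      show "(case p of (l, I) \<Rightarrow> insert l I) \<in> fibres r \<phi> (insert m J)"
        using lI mJ by (auto simp: fibres_def inj_on_insert)
      show "ee (case p of (l, I) \<Rightarrow> insert l I) = (case p of (l, I) \<Rightarrow> ee (insert l I))" by simp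
    qed
    finally show ?case .
  qed simp
qed

lemma whit_sub:
  assumes v: "vmap n r g \<phi>" and J: "J \<subseteq> {..n}"
  shows "sub g (whit J) = (\<Sum>I\<in>fibres r \<phi> J. whit I)"
proof -
  have "linear_subst g" using v by (auto simp: vmap_def vertex_map_def)
  then show ?thesis using ee_sub[OF assms] by (simp add: whit_def flip: iota_sub)
qed

lemma sum_fibres:
  assumes v: "vmap n r g \<phi>"
  shows "(\<Sum>J\<in>NE n. \<Sum>I\<in>fibres r \<phi> J. F I) = (\<Sum>I\<in>NE r. if inj_on \<phi> I then F I else 0)"
proof -
  let ?S = "{I \<in> NE r. inj_on \<phi> I}"
  have "(\<Sum>J\<in>NE n. \<Sum>I\<in>fibres r \<phi> J. F I) = (\<Sum>J\<in>NE n. sum F {I\<in>?S. \<phi> ` I = J})"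
    by (intro sum.cong refl) (auto simp: fibres_def)
  also have "\<dots> = sum F ?S"
    using v by (intro sum.group) (auto simp: vmap_def vertex_map_def)
  also have "\<dots> = (\<Sum>I\<in>NE r. if inj_on \<phi> I then F I else 0)"
    by (rule sum.inter_filter) simp
  finally show ?thesis .
qed

definition wsum :: "nat \<Rightarrow> (nat set \<Rightarrow> 'k) \<Rightarrow> 'k::field_char_0 pform" where
  "wsum n f = (\<Sum>J\<in>NE n. sc (f J) * whit J)"

lemma wsum_sub:
  assumes v: "vmap n r g \<phi>"
  shows "sub g (wsum n f) = wsum r (\<lambda>I. if inj_on \<phi> I then f (\<phi> ` I) else 0)"
proof -
  have "sub g (wsum n f) = (\<Sum>J\<in>NE n. \<Sum>I\<in>fibres r \<phi> J. sc (f (\<phi> ` I)) * whit I)"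
    unfolding wsum_def by (auto simp: whit_sub[OF v] sum_distrib_left fibres_def intro!: sum.cong)
  moreover have "(if inj_on \<phi> I then sc (f (\<phi> ` I)) * whit I else 0) =
      sc (if inj_on \<phi> I then f (\<phi> ` I) else 0) * whit I" for I
    by (cases "inj_on \<phi> I") simp_all
  ultimately show ?thesis unfolding sum_fibres[OF v] wsum_def by (simp only:)
qed

text \<open>Group the faces on which \<phi> is injective by their images, by
  \<open>sum_fibres\<close>; the remaining faces contribute 0 to the left side by
  \<open>HH_sub_not_inj\<close>.\<close>

lemma ss_sub:
  assumes v: "vmap n r g \<phi>"
  shows "eqv r (ss r (sub g a)) (sub g (ss n a))"
proof -
  have dc: "dcoef (\<phi> ` I) = dcoef I" if "inj_on \<phi> I" for I using that by (simp add: dcoef_def card_image)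
  have "sub g (ss n a) = (\<Sum>J\<in>NE n. \<Sum>I\<in>fibres r \<phi> J. sc (dcoef I) * (whit I * sub g (HH n (\<phi> ` I) a)))"
    unfolding ss_def
    by (auto simp: whit_sub[OF v] sum_distrib_left sum_distrib_right fibres_def dc intro!: sum.cong)
  also have "\<dots> = (\<Sum>I\<in>NE r. if inj_on \<phi> I then sc (dcoef I) * (whit I * sub g (HH n (\<phi> ` I) a)) else 0)"
    by (rule sum_fibres[OF v])
  finally have *: "sub g (ss n a) = \<dots>" .
  have "eqv r (ss r (sub g a)) \<dots>"
    unfolding ss_def
  proof (rule eqv_sum)
    fix I assume "I \<in> NE r"
    then have I: "I \<subseteq> {..r}" by auto
    show "eqv r (sc (dcoef I) * (whit I * HH r I (sub g a)))
      (if inj_on \<phi> I then sc (dcoef I) * (whit I * sub g (HH n (\<phi> ` I) a)) else 0)"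
    proof (cases "inj_on \<phi> I")
      case True
      then show ?thesis using eqv_mult[OF eqv_refl eqv_mult[OF eqv_refl HH_sub[OF v I True]]] by simp
    next
      case False
      then show ?thesis
        using eqv_mult[OF eqv_refl eqv_mult[OF eqv_refl HH_sub_not_inj[OF v I False]], of "sc (dcoef I)" "whit I" a] by simp
    qed
  qed
  then show ?thesis using * by simp
qed

section \<open>Linearity and degrees\<close>

lemma sc_swap: "sc c * (sc b * a) = sc b * (sc c * a)"
  by (metis mult.assoc sc_commute)

lemma ss_simps [simp]: "ss n (a + b) = ss n a + ss n b" "ss n (sc c * a) = sc c * ss n a" "ss n 0 = 0"
proof -
  show "ss n (sc c * a) = sc c * ss n a"
    unfolding ss_def HH_linear sc_left_commute[of "whit _"] sum_distrib_left
    by (intro sum.cong refl sc_swap)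
qed (simp_all add: ss_def distrib_left sum.distrib)

lemma ss_cong: "eqv n a b \<Longrightarrow> eqv n (ss n a) (ss n b)"
  unfolding ss_def by (intro eqv_sum eqv_mult eqv_refl HH_cong) auto

lemma homog_HH1: "finite J \<Longrightarrow> homog (q + card J) a \<Longrightarrow> homog q (HH n J a)"
proof (induction J arbitrary: q rule: finite_linorder_max_induct)
  case (insert m J)
  then have "m \<notin> J" by blast
  then have "homog (Suc q) (HH n J a)" using insert by auto
  then show ?case using insert HH_max[of J m n a] homog_hh(1) by metis
qed simp

lemma homog_HH2: "finite J \<Longrightarrow> homog p a \<Longrightarrow> p < card J \<Longrightarrow> HH n J a = 0"
proof (induction J rule: finite_linorder_max_induct)
  case (insert m J)
  then have m: "m \<notin> J" by blast
  have H: "HH n (insert m J) a = hh n m (HH n J a)" using insert HH_max by blast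
  show ?case
  proof (cases "p < card J")
    case True
    then show ?thesis using insert H by simp
  next
    case False
    then have "p = 0 + card J" using insert m by simp
    then have "homog 0 (HH n J a)" using insert homog_HH1 by blast
    then show ?thesis using H homog_hh(2) by metis
  qed
qed simp

text \<open>Each homotopy lowers the degree by one, and evaluation at a vertex only sees degree
  0.\<close>

lemma TT_homog: "finite J \<Longrightarrow> homog q a \<Longrightarrow> card J \<noteq> Suc q \<Longrightarrow> TT n J a = 0"
proof (cases "J = {}")
  case False
  assume J: "finite J" "homog q a" "card J \<noteq> Suc q"
  let ?J = "J - {Max J}"
  have c: "card ?J = card J - 1" "finite ?J" "card J > 0" using J False by (auto simp: card_gt_0_iff)
  show ?thesis
  proof (cases "q < card ?J")
    case True
    then show ?thesis using homog_HH2[OF c(2) J(2)] by (simp add: TT_def)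
  next
    case False
    then obtain p where "q = Suc p + card ?J" using c J(3) by (metis Suc_pred' add.commute add_Suc_right le_Suc_ex less_Suc_eq_le nat_neq_iff not_less_eq)
    then show ?thesis using homog_HH1[OF c(2), of "Suc p" a n] J(2) homog_eps by (auto simp: TT_def)
  qed
qed (simp add: TT_def)

lemma homog_ss: "homog (Suc q) a \<Longrightarrow> homog q (ss n a)" and homog_ss0: "homog 0 a \<Longrightarrow> ss n a = 0"
proof -
  have fin: "finite J" "J \<noteq> {}" "card J > 0" if "J \<in> NE n" for J
    using that finite_subset by (auto simp: card_gt_0_iff)
  show "homog q (ss n a)" if a: "homog (Suc q) a"
    unfolding ss_def
  proof (intro homog_sum homog_sc_mult)
    fix J assume "J \<in> NE n"
    note J = fin[OF this]
    show "homog q (whit J * HH n J a)"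
    proof (cases "Suc q < card J")
      case True
      then show ?thesis using homog_HH2[OF J(1) a] by simp
    next
      case False
      then obtain p where "Suc q = p + card J" by (metis add.commute le_Suc_ex not_less)
      then have "q = (card J - 1) + p" "homog p (HH n J a)" using J homog_HH1[OF J(1)] a by auto
      then show ?thesis using homog_mult homog_whit J by metis
    qed
  qed
  show "ss n a = 0" if "homog 0 a"
    unfolding ss_def using homog_HH2[OF _ that] fin by simp
qed

section \<open>Integration over the whole simplex\<close>

definition II :: "nat \<Rightarrow> 'k::field_char_0 pform \<Rightarrow> 'k" where "II n a = TT n {..n} a"

lemma II_simps [simp]: "II n (a + b) = II n a + II n b" "II n (a - b) = II n a - II n b"
  "II n (sc c * a) = c * II n a" "II n 0 = 0"
  by (simp_all add: II_def)

lemma II_sum [simp]: "II n (sum f S) = (\<Sum>x\<in>S. II n (f x))"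
  by (induction S rule: infinite_finite_induct) auto

lemma II_cong: "eqv n a b \<Longrightarrow> II n a = II n b"
  by (simp add: II_def TT_cong)

lemma II_homog: "homog q a \<Longrightarrow> q \<noteq> n \<Longrightarrow> II n a = 0"
  unfolding II_def by (rule TT_homog) auto

lemma TT_face:
  assumes "i \<le> Suc n" "J \<subseteq> {..n}"
  shows "TT n J (sub (face_subst i) a) = TT (Suc n) (face_v i ` J) a"
proof -
  have "inj_on (face_v i) J" by (auto simp: inj_on_def face_v_def split: if_splits)
  then show ?thesis using TT_sub[OF vmap_face[OF assms(1)] assms(2), of a] by simp
qed

lemma face_v_image: "i \<le> Suc n \<Longrightarrow> face_v i ` {..n} = {..Suc n} - {i}"
proof -
  assume "i \<le> Suc n"
  then have "j \<in> face_v i ` {..n}" if "j \<le> Suc n" "j \<noteq> i" for j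
    using that by (intro image_eqI[of _ _ "if j < i then j else j - 1"]) (auto simp: face_v_def)
  then show ?thesis by (auto simp: face_v_def)
qed

lemma II_face: "i \<le> Suc n \<Longrightarrow> II n (sub (face_subst i) a) = TT (Suc n) ({..Suc n} - {i}) a"
  unfolding II_def by (simp add: TT_face face_v_image del: image_Collect)

lemma II_degen:
  assumes "i \<le> n" shows "II (Suc n) (sub (degen_subst i) a) = 0"
proof -
  have "degen_v i i = degen_v i (Suc i)" by (simp add: degen_v_def)
  then have "\<not> inj_on (degen_v i) {..Suc n}"
    using assms by (metis Suc_leD Suc_le_mono atMost_iff inj_on_contraD n_not_Suc_n)
  then show ?thesis unfolding II_def using TT_sub[OF vmap_degen[OF assms], of "{..Suc n}" a] by simp
qed

text \<open>Apply \<open>dd_HH\<close> to all vertices but the last and evaluate at the last one.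
  The left side becomes the value of an exact form at a point, which is 0; what remains is the
  integral of \<open>dd a\<close> and those over the faces.\<close>

lemma stokes: "II (Suc n) (dd a) = (\<Sum>i\<le>Suc n. (- 1) ^ i * II n (sub (face_subst i) a))"
proof -
  let ?J = "{..n}"
  have T: "TT (Suc n) (insert (Suc n) L) b = eps (Suc n) (Suc n) (HH (Suc n) L b)" if "L \<subseteq> ?J" for L and b :: "'a pform"
    by (rule TT_max) (use that finite_subset in auto)
  have card: "card {l\<in>?J. j < l} = n - j" for j
  proof -
    have "{l\<in>?J. j < l} = {j<..n}" by auto
    then show ?thesis by simp
  qed
  have "eps (Suc n) (Suc n) (dd (HH (Suc n) ?J a)) = eps (Suc n) (Suc n) ((- 1) ^ card ?J * HH (Suc n) ?J (dd a) +
    (\<Sum>j\<in>?J. (- 1) ^ card {l\<in>?J. j < l} * HH (Suc n) (?J - {j}) a) - sc (TT (Suc n) ?J a))"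
    by (intro eps_cong dd_HH) auto
  then have "0 = (- 1) ^ Suc n * TT (Suc n) (insert (Suc n) ?J) (dd a)
     + (\<Sum>j\<in>?J. (- 1) ^ (n - j) * TT (Suc n) (insert (Suc n) (?J - {j})) a) - TT (Suc n) ?J a"
    by (simp only: eps_dd eps_simps(1,2,3) eps_sign eps_sum card T[OF subset_refl] T[OF Diff_subset] card_atMost)
  also have "insert (Suc n) ?J = {..Suc n}" by auto
  also have "?J = {..Suc n} - {Suc n}" by auto
  finally have "(- 1) ^ n * TT (Suc n) {..Suc n} (dd a) =
      (\<Sum>j\<le>n. (- 1) ^ (n - j) * TT (Suc n) (insert (Suc n) ({..n} - {j})) a) - TT (Suc n) ({..Suc n} - {Suc n}) a"
    by (simp add: atMost_Suc insert_Diff_if algebra_simps)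
  then have "(- 1) ^ n * ((- 1) ^ n * TT (Suc n) {..Suc n} (dd a)) =
     (\<Sum>j\<le>n. (- 1) ^ n * (- 1) ^ (n - j) * TT (Suc n) (insert (Suc n) ({..n} - {j})) a)
      + (- 1) ^ Suc n * TT (Suc n) ({..Suc n} - {Suc n}) a"
    by (simp add: right_diff_distrib sum_distrib_left mult.assoc)
  also have "(\<Sum>j\<le>n. (- 1) ^ n * (- 1) ^ (n - j) * TT (Suc n) (insert (Suc n) ({..n} - {j})) a) =
      (\<Sum>j\<le>n. (- 1) ^ j * II n (sub (face_subst j) a))"
  proof (rule sum.cong[OF refl])
    fix j assume "j \<in> {..n}"
    then have "insert (Suc n) ({..n} - {j}) = {..Suc n} - {j}" "j \<le> Suc n"
      "(- 1) ^ n * (- 1) ^ (n - j) = ((- 1) ^ j :: 'a)"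
      by (auto simp: minus_one_power_iff)
    then show "(- 1) ^ n * (- 1) ^ (n - j) * TT (Suc n) (insert (Suc n) ({..n} - {j})) a =
       (- 1) ^ j * II n (sub (face_subst j) a)"
      by (simp add: II_face)
  qed
  also have "TT (Suc n) ({..Suc n} - {Suc n}) a = II n (sub (face_subst (Suc n)) a)"
    by (simp add: II_face)
  finally show ?thesis by (simp add: II_def flip: mult.assoc power_mult_distrib)
qed

section \<open>Forms in \<open>t_0, ..., t_n\<close>\<close>

definition trunc :: "nat \<Rightarrow> nat \<Rightarrow> 'k::comm_ring_1 mpoly" where
  "trunc n j = (if j \<le> n then mp_var j else 0)"

text \<open>As a fixed point condition under a linear substitution it passes at once to every
  operator that commutes with such substitutions.\<close>

definition fr :: "nat \<Rightarrow> 'k::field_char_0 pform \<Rightarrow> bool" where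
  "fr n a \<longleftrightarrow> sub (trunc n) a = a"

lemma linear_trunc: "linear_subst (trunc n)"
  by (simp add: linear_subst_def trunc_def)

lemma fr_simps [simp]: "fr n (sc c)" "fr n 0" "fr n 1" "fr n a \<Longrightarrow> fr n b \<Longrightarrow> fr n (a + b)"
  "fr n a \<Longrightarrow> fr n b \<Longrightarrow> fr n (a - b)" "fr n a \<Longrightarrow> fr n b \<Longrightarrow> fr n (a * b)" "fr n a \<Longrightarrow> fr n (- a)"
  "fr n a \<Longrightarrow> fr n (dd a)" "fr n a \<Longrightarrow> fr n (bar a)" "fr n a \<Longrightarrow> fr n (iota a)" "fr n a \<Longrightarrow> fr n (KK a)"
  by (simp_all add: fr_def iota_sub[OF linear_trunc, symmetric] KK_sub[OF linear_trunc, symmetric] flip: dd_sub bar_sub)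

lemma fr_sum [simp]: "(\<And>x. x \<in> S \<Longrightarrow> fr n (f x)) \<Longrightarrow> fr n (sum f S)"
  by (induction S rule: infinite_finite_induct) auto

lemma fr_Xv [simp]: "i \<le> n \<Longrightarrow> fr n (Xv i)" "i \<le> n \<Longrightarrow> fr n (dtv i)"
  by (simp_all add: fr_def trunc_def sub_dtv)

lemma fr_ee: "J \<subseteq> {..n} \<Longrightarrow> fr n (ee J :: 'k::field_char_0 pform)"
proof -
  assume J: "J \<subseteq> {..n}"
  then have "finite J" using finite_subset by blast
  then show ?thesis using J
  proof (induction J rule: finite_linorder_min_induct)
    case (insert m J)
    then have "fr n (dtv m * ee J :: 'k pform)" by auto
    then show ?case using insert dtv_ee_min[of J m] by metis
  qed simp
qed

lemma fr_sub:
  assumes "fr n a" "\<And>j. j \<le> n \<Longrightarrow> fr r (Pf (g j))"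
  shows "fr r (sub g a)"
proof -
  have "mp_subst (trunc r) (mp_subst g (trunc n j)) = mp_subst g (trunc n j)" for j
  proof (cases "j \<le> n")
    case True
    then have "Pf (mp_subst (trunc r) (g j)) = Pf (g j)" using assms(2) by (simp add: fr_def)
    then have "mp_subst (trunc r) (g j) = g j" by (metis cf_Pf)
    then show ?thesis using True by (simp add: trunc_def[of n])
  qed (simp add: trunc_def[of n])
  then have "sub (trunc r) (sub g (sub (trunc n) a)) = sub g (sub (trunc n) a)"
    by (simp add: sub_sub)
  then show ?thesis using assms(1) by (simp add: fr_def)
qed

lemma fr_nf: "fr n a \<Longrightarrow> fr n (nf n i a)"
  unfolding nf_def by (rule fr_sub) (auto simp: nfs_def intro!: fr_simps(5) fr_sum)

lemma fr_hh: "fr n a \<Longrightarrow> fr n (hh n i a)"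
  unfolding hh_def by (simp add: fr_nf)

lemma fr_HH: "fr n a \<Longrightarrow> fr n (HH n J a)"
proof -
  have "fr n (fold (hh n) xs a)" if "fr n a" for xs
    using that by (induction xs arbitrary: a) (auto simp: fr_hh)
  then show "fr n a \<Longrightarrow> fr n (HH n J a)" by (simp add: HH_def)
qed

lemma fr_whit: "J \<subseteq> {..n} \<Longrightarrow> fr n (whit J)"
  unfolding whit_def by (simp add: fr_ee)

lemma fr_ss: "fr n a \<Longrightarrow> fr n (ss n a)"
  unfolding ss_def by (auto intro!: fr_sum fr_simps(6) fr_HH fr_whit)

lemma fr_wsum: "fr n (wsum n f)"
  unfolding wsum_def by (auto intro!: fr_sum fr_simps(6) fr_whit)

lemma fr_face: "i \<le> Suc n \<Longrightarrow> fr (Suc n) a \<Longrightarrow> fr n (sub (face_subst i) a)"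
  by (erule fr_sub) (auto simp: face_subst_def)

lemma fr_degen: "i \<le> n \<Longrightarrow> fr n a \<Longrightarrow> fr (Suc n) (sub (degen_subst i) a)"
  by (erule fr_sub) (auto simp: degen_subst_def)

section \<open>Preparations for integrals of monomials\<close>

lemma TT_min:
  assumes "finite J" "J \<noteq> {}" "\<And>j. j \<in> J \<Longrightarrow> m < j"
  shows "TT n (insert m J) a = TT n J (hh n m a)"
proof -
  have Max: "Max J \<in> J" using assms by simp
  then have "Max (insert m J) = Max J" using assms by (simp add: max_def not_le less_imp_le)
  moreover have "insert m J - {Max J} = insert m (J - {Max J})" using assms(3)[OF Max] by auto
  moreover have "HH n (insert m (J - {Max J})) a = HH n (J - {Max J}) (hh n m a)"
    using assms by (intro HH_min) auto
  ultimately show ?thesis using assms by (simp add: TT_def)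
qed

lemma LL_prod_var: "finite S \<Longrightarrow> LL (Pf (\<Prod>i\<in>S. mp_var i ^ m i)) =
  of_nat (\<Sum>i\<in>S. m i) * (Pf (\<Prod>i\<in>S. mp_var i ^ m i) :: 'k::comm_ring_1 pform)"
proof (induction rule: finite_induct)
  case (insert i S)
  have *: "LL (Pf (mp_var i ^ k)) = of_nat k * (Pf (mp_var i ^ k) :: 'k pform)" for k
  proof (induction k)
    case (Suc k)
    show ?case using LL_eigen_mult[OF _ Suc, of "Xv i" 1] by simp
  qed simp
  show ?case using insert LL_eigen_mult[OF * insert(3)] by (simp del: Pf_power)
qed simp

lemma sub_ee_fixed: "finite J \<Longrightarrow> (\<And>j. j \<in> J \<Longrightarrow> g j = mp_var j) \<Longrightarrow> sub g (ee J) = ee J"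
proof (induction J rule: finite_linorder_min_induct)
  case (insert m J)
  then have "ee (insert m J) = dtv m * (ee J :: 'a pform)" by (intro dtv_ee_min[symmetric]) auto
  then show ?case using insert by (simp add: sub_dtv)
qed simp

text \<open>For the face \<open>{1..n}\<close> the vertex 0 is the only missing one, so the sum in
  \<open>sum_whit\<close> has a single term. Thus the form of the whole simplex is the volume
  form.\<close>

lemma whit_top: "eqv n (whit {..n}) (ee {1..n} :: 'k::field_char_0 pform)"
proof -
  have "{..n} - {1..n} = {0}" "insert 0 {1..n} = {..n}" "{1..n} \<subseteq> {..n}" by auto
  moreover have "shuffle_sign {0} {1..n} = (1 :: 'k)" by (rule shuffle_sign_min) auto
  ultimately show ?thesis using sum_whit[of "{1..n}" n, where ?'a = 'k] by (simp del: atLeastAtMost_insertL)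
qed

lemma KK_eigen:
  assumes "LL b = of_nat w * b" "ev0 b = 0" "w \<noteq> 0"
  shows "KK b = sc (inverse (of_nat w)) * iota (b :: 'k::field_char_0 pform)"
proof -
  have "b = GG (sc (of_nat w) * b)" using GG_LL[of b] assms by simp
  then have "sc (inverse (of_nat w)) * b = sc (inverse (of_nat w) * of_nat w) * GG b"
    by (metis GG_sc_mult mult.assoc sc_simps(2))
  also have "inverse (of_nat w) * of_nat w = (1 :: 'k)" using assms(3) by simp
  finally have "GG b = sc (inverse (of_nat w)) * b" by simp
  then show ?thesis by (simp add: KK_def)
qed

lemma mp_subst_prod: "mp_subst g (prod f S) = (\<Prod>i\<in>S. mp_subst g (f i))"
  by (induction S rule: infinite_finite_induct) auto

section \<open>Dirichlet's integral\<close>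

text \<open>The classical value of the integral of the product of the \<open>t_i ^ m i\<close>
  (\<open>i \<le> n\<close>) against \<open>dt_1 ... dt_n\<close> over the standard simplex.\<close>

definition dirichlet :: "nat \<Rightarrow> (nat \<Rightarrow> nat) \<Rightarrow> 'k::field_char_0" where
  "dirichlet n m = (\<Prod>i\<le>n. fact (m i)) / fact ((\<Sum>i\<le>n. m i) + n)"

lemma dirichlet_update:
  assumes "i \<le> n"
  shows "dirichlet n (m(i := Suc (m i))) = dirichlet n m * of_nat (Suc (m i)) / of_nat ((\<Sum>i\<le>n. m i) + Suc n)"
proof -
  have "(\<Sum>j\<le>n. (m(i := Suc (m i))) j) = Suc (m i) + (\<Sum>j\<in>{..n} - {i}. m j)"
    using assms by (subst sum.remove[of _ i]) auto
  also have "\<dots> = Suc (\<Sum>j\<le>n. m j)" using assms by (subst sum.remove[of "{..n}" i]) auto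
  finally have 1: "(\<Sum>j\<le>n. (m(i := Suc (m i))) j) = Suc (\<Sum>j\<le>n. m j)" .
  have "(\<Prod>j\<le>n. fact ((m(i := Suc (m i))) j)) = fact (Suc (m i)) * (\<Prod>j\<in>{..n} - {i}. fact (m j) :: 'a)"
    using assms by (subst prod.remove[of _ i]) auto
  also have "\<dots> = of_nat (Suc (m i)) * (\<Prod>j\<le>n. fact (m j))"
    using assms by (subst prod.remove[of "{..n}" i]) (auto simp: algebra_simps)
  finally show ?thesis unfolding dirichlet_def 1 by (simp add: divide_simps)
qed

text \<open>Induction on the dimension and, inside it, on the exponent of \<open>t_0\<close>.
  Without \<open>t_0\<close>, the contraction onto the vertex 0 divides by the weight and leaves the
  same kind of integral over the opposite face. Otherwise one factor \<open>t_0\<close> is replaced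
  by 1 minus the other variables. The factor \<open>t_0\<close>, redundant in the quotient, is kept
  because the opposite face has its own first variable.\<close>

lemma II_dirichlet:
  "II n (Pf (\<Prod>i\<le>n. mp_var i ^ m i) * whit {..n}) = (dirichlet n m :: 'k::field_char_0)"
proof (induction n arbitrary: m)
  case 0
  have e: "eps 0 0 (Xv 0 :: 'k pform) = 1"
    by (simp add: eps_def nf_def nfs_def)
  then have "eps 0 0 (Xv 0 ^ k :: 'k pform) = 1" for k by (induction k) auto
  moreover have "TT 0 {0} a = eps 0 0 a" for a :: "'k pform" using TT_max[of "{}" 0 0 a] by simp
  ultimately show ?case using e by (simp add: II_def whit_def dirichlet_def)
next
  case (Suc n)
  let ?J = "{1..Suc n}"
  let ?t = "\<lambda>m. \<Prod>i\<le>Suc n. mp_var i ^ m i :: 'k mpoly"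
  have split: "{..Suc n} = insert 0 ?J" "0 \<notin> ?J" by auto
  have main: "II (Suc n) (Pf (?t m) * whit {..Suc n}) = (dirichlet (Suc n) m :: 'k)" if "m 0 = k" for m k
    using that
  proof (induction k arbitrary: m)
    case 0
    let ?f = "\<Prod>i\<in>?J. mp_var i ^ m i :: 'k mpoly"
    let ?b = "Pf ?f * ee ?J"
    let ?w = "(\<Sum>i\<in>?J. m i) + Suc n"
    have t: "?t m = ?f" using 0 split by simp
    have "II (Suc n) (Pf (?t m) * whit {..Suc n}) = II (Suc n) ?b"
      unfolding t by (intro II_cong eqv_mult eqv_refl whit_top)
    also have "\<dots> = TT (Suc n) ?J (hh (Suc n) 0 ?b)"
      unfolding II_def split(1) by (rule TT_min) auto
    also have "\<dots> = II n (sub (face_subst 0) (hh (Suc n) 0 ?b))"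
    proof -
      have "?J = {..Suc n} - {0}" by auto
      then show ?thesis by (simp only: II_face[OF le0])
    qed
    also have "hh (Suc n) 0 ?b = KK (nf (Suc n) 0 ?b)" by (rule hh_def)
    also have "nf (Suc n) 0 ?b = ?b"
    proof -
      have fixed: "mp_subst (nfs (Suc n) 0) (\<Prod>i\<in>S. mp_var i ^ m i) = (\<Prod>i\<in>S. mp_var i ^ m i :: 'k mpoly)" if "finite S" "0 \<notin> S" for S
        using that
      proof (induction S)
        case (insert i S)
        have "mp_subst (nfs (Suc n) 0) (mp_var i ^ k) = (mp_var i ^ k :: 'k mpoly)" for k
          using insert by (induction k) (auto simp: nfs_def)
        then show ?case using insert by simp
      qed simp
      have "mp_subst (nfs (Suc n) 0) ?f = ?f" by (rule fixed) auto
      then have "nf (Suc n) 0 (Pf ?f) = Pf ?f" unfolding nf_def sub_Pf by (rule arg_cong)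
      moreover have "nf (Suc n) 0 (ee ?J :: 'k pform) = ee ?J"
        unfolding nf_def by (rule sub_ee_fixed) (auto simp: nfs_def)
      ultimately show ?thesis by simp
    qed
    \<comment> \<open>The weight \<open>?w\<close> counts the polynomial degree and the
      \<open>Suc n\<close> differentials; it is exactly the factor by which the factorial in the
      denominator grows.\<close>
    also have "KK ?b = sc (inverse (of_nat ?w)) * (Pf ?f * whit ?J)"
    proof -
      have L: "LL ?b = of_nat ?w * ?b"
        using LL_eigen_mult[OF LL_prod_var LL_ee, of ?J ?J m, where ?'a = 'k] by simp
      have "homog (0 + card ?J) ?b" by (intro homog_mult homog_simps)
      then have "ev0 ?b = 0" by (intro homog_ev0[of n]) simp
      then have "KK ?b = sc (inverse (of_nat ?w)) * iota ?b" by (intro KK_eigen L) simp_all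
      also have "iota ?b = Pf ?f * whit ?J"
        unfolding iota_mult iota_Pf bar_Pf whit_def by (simp only: mult_zero_left add_0)
      finally show ?thesis .
    qed
    also have "sub (face_subst 0) (sc (inverse (of_nat ?w)) * (Pf ?f * whit ?J)) = sc (inverse (of_nat ?w)) * (Pf (\<Prod>i\<le>n. mp_var i ^ m (Suc i)) * whit {..n})"
    proof -
      have J: "?J = Suc ` {..n}" by (simp add: image_Suc_atMost)
      have pw: "mp_subst (face_subst 0) (mp_var (Suc i) ^ k) = (mp_var i ^ k :: 'k mpoly)" for i k
        by (induction k) (auto simp: face_subst_def)
      have "mp_subst (face_subst 0) (\<Prod>i\<in>Suc ` S. mp_var i ^ m i) = (\<Prod>i\<in>S. mp_var i ^ m (Suc i) :: 'k mpoly)" if "finite S" for S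
        using that by (simp add: prod.reindex mp_subst_prod pw)
      then have "mp_subst (face_subst 0) ?f = (\<Prod>i\<le>n. mp_var i ^ m (Suc i) :: 'k mpoly)" unfolding J by simp
      moreover have "sub (face_subst 0) (whit ?J) = (whit {..n} :: 'k pform)"
      proof -
        have v: "face_v 0 = Suc" by (auto simp: face_v_def)
        have "fibres n (face_v 0) ?J = {{..n}}"
          unfolding v J fibres_def by (auto simp: inj_image_eq_iff)
        then show ?thesis using whit_sub[OF vmap_face, of 0 n ?J, where ?'a = 'k] by simp
      qed
      ultimately show ?thesis by (simp only: sub_mult sub_sc sub_Pf)
    qed
    also have "II n (sc (inverse (of_nat ?w)) * (Pf (\<Prod>i\<le>n. mp_var i ^ m (Suc i) :: 'k mpoly) * whit {..n})) = inverse (of_nat ?w) * dirichlet n (\<lambda>i. m (Suc i))"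
      by (simp only: II_simps Suc[of "\<lambda>i. m (Suc i)"])
    also have "\<dots> = dirichlet (Suc n) m"
    proof -
      have "(\<Sum>i\<le>Suc n. m i) = (\<Sum>i\<le>n. m (Suc i))" "(\<Prod>i\<le>Suc n. fact (m i)) = (\<Prod>i\<le>n. fact (m (Suc i)) :: 'k)"
        using 0 by (simp_all add: sum.atMost_Suc_shift prod.atMost_Suc_shift del: sum.atMost_Suc prod.atMost_Suc)
      moreover have "(\<Sum>i\<in>?J. m i) = (\<Sum>i\<le>n. m (Suc i))"
        by (rule sum.reindex_bij_witness[of _ Suc "\<lambda>i. i - 1"]) auto
      ultimately show ?thesis by (simp add: dirichlet_def divide_simps)
    qed
    finally show ?case .
  next
    case (Suc k)
    let ?m = "m(0 := k)"
    have nn: "?t m = mp_var 0 * ?t ?m" using Suc.prems unfolding split(1) by (simp add: split(2))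
    have up: "?t (?m(i := Suc (?m i))) = mp_var i * ?t ?m" if "i \<in> ?J" for i
    proof -
      have i: "i \<in> {..Suc n}" using that by auto
      show ?thesis
        using i by (subst (1 2) prod.remove[of _ i]) (auto simp: mult.assoc intro!: prod.cong)
    qed
    have "nf (Suc n) 0 (Xv 0) = nf (Suc n) 0 (1 - (\<Sum>i\<in>?J. Xv i :: 'k pform))"
    proof -
      have "{..Suc n} - {0} = ?J" by auto
      then show ?thesis by (simp add: nf_def nfs_def)
    qed
    then have "eqv (Suc n) (Pf (?t m) * whit {..Suc n}) ((1 - (\<Sum>i\<in>?J. Xv i)) * (Pf (?t ?m) * whit {..Suc n}))"
      unfolding nn eqv_def by (simp add: mult.assoc)
    note e = this
    have "II (Suc n) (Pf (?t m) * whit {..Suc n}) =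
        II (Suc n) (Pf (?t ?m) * whit {..Suc n} - (\<Sum>i\<in>?J. Pf (?t (?m(i := Suc (?m i)))) * whit {..Suc n}))"
    proof -
      have "(\<Sum>i\<in>?J. Xv i) * (Pf (?t ?m) * whit {..Suc n}) =
          (\<Sum>i\<in>?J. Pf (?t (?m(i := Suc (?m i)))) * whit {..Suc n})"
        unfolding sum_distrib_right
        by (intro sum.cong refl) (simp only: up Pf_simps(2) mult.assoc)
      then show ?thesis using II_cong[OF e] by (simp only: left_diff_distrib mult_1)
    qed
    also have "\<dots> = dirichlet (Suc n) ?m - (\<Sum>i\<in>?J. dirichlet (Suc n) (?m(i := Suc (?m i))))"
    proof -
      have "(\<Sum>i\<in>?J. II (Suc n) (Pf (?t (?m(i := Suc (?m i)))) * whit {..Suc n})) =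
        (\<Sum>i\<in>?J. dirichlet (Suc n) (?m(i := Suc (?m i))) :: 'k)"
        by (intro sum.cong refl Suc.IH) auto
      then show ?thesis using Suc.IH[of ?m] by (simp only: II_simps II_sum fun_upd_same)
    qed
    also have "\<dots> = dirichlet (Suc n) ?m * (1 - (\<Sum>i\<in>?J. of_nat (Suc (?m i))) / of_nat ((\<Sum>i\<le>Suc n. ?m i) + Suc (Suc n)))"
    proof -
      have "(\<Sum>i\<in>?J. dirichlet (Suc n) (?m(i := Suc (?m i)))) =
         (\<Sum>i\<in>?J. dirichlet (Suc n) ?m * of_nat (Suc (?m i)) / of_nat ((\<Sum>i\<le>Suc n. ?m i) + Suc (Suc n)) :: 'k)"
        by (intro sum.cong refl dirichlet_update) auto
      also have "\<dots> = dirichlet (Suc n) ?m * ((\<Sum>i\<in>?J. of_nat (Suc (?m i))) / of_nat ((\<Sum>i\<le>Suc n. ?m i) + Suc (Suc n)))"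
        by (simp only: sum_distrib_left sum_divide_distrib times_divide_eq_right)
      finally show ?thesis by (simp only: right_diff_distrib mult_1_right)
    qed
    also have "\<dots> = dirichlet (Suc n) ?m * of_nat (Suc (?m 0)) / of_nat ((\<Sum>i\<le>Suc n. ?m i) + Suc (Suc n))"
    proof -
      \<comment> \<open>The numerators \<open>Suc (?m i)\<close> over all vertices add up to the
        denominator, so subtracting those of the vertices other than 0 leaves that of 0.\<close>
      have "(\<Sum>i\<le>Suc n. ?m i) + Suc (Suc n) = (\<Sum>i\<le>Suc n. Suc (?m i))" by (simp only: sum_Suc card_atMost)
      also have "\<dots> = Suc (?m 0) + (\<Sum>i\<in>?J. Suc (?m i))" unfolding split(1) using split(2) by simp
      finally have e: "of_nat ((\<Sum>i\<le>Suc n. ?m i) + Suc (Suc n)) = of_nat (Suc (?m 0)) + (\<Sum>i\<in>?J. of_nat (Suc (?m i)) :: 'k)"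
        by (metis of_nat_add of_nat_sum)
      have "of_nat ((\<Sum>i\<le>Suc n. ?m i) + Suc (Suc n)) \<noteq> (0 :: 'k)" by (metis add_Suc_right of_nat_neq_0)
      then have "1 - (\<Sum>i\<in>?J. of_nat (Suc (?m i))) / of_nat ((\<Sum>i\<le>Suc n. ?m i) + Suc (Suc n)) =
          of_nat (Suc (?m 0)) / (of_nat ((\<Sum>i\<le>Suc n. ?m i) + Suc (Suc n)) :: 'k)"
      proof -
        have "1 - S / (x + S) = x / (x + S)" if "x + S \<noteq> 0" for x S :: 'k
          using that by (simp add: field_simps)
        then show ?thesis using \<open>_ \<noteq> (0 :: 'k)\<close> unfolding e by blast
      qed
      then show ?thesis by (simp only: times_divide_eq_right)
    qed
    also have "\<dots> = dirichlet (Suc n) (?m(0 := Suc (?m 0)))"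
      by (rule dirichlet_update[symmetric]) simp
    also have "?m(0 := Suc (?m 0)) = m" using Suc.prems by auto
    finally show ?case .
  qed
  show ?case by (rule main) simp
qed

lemma II_sgl:
  assumes "supp m \<subseteq> {1..n}"
  shows "II n (Pf (sgl m 1) * ee {1..n}) = ((\<Prod>i\<in>{1..n}. fact (coef m i)) / fact ((\<Sum>i\<in>{1..n}. coef m i) + n) :: 'k::field_char_0)"
proof -
  have split: "{..n} = insert 0 {1..n}" "0 \<notin> {1..n}" by auto
  have m0: "coef m 0 = 0" using assms by (metis in_keys_iff split(2) subsetD)
  have "II n (Pf (sgl m 1) * ee {1..n}) = II n (Pf (sgl m 1) * whit {..n} :: 'k pform)"
    by (intro II_cong eqv_mult eqv_refl eqv_sym[OF whit_top])
  also have "\<dots> = dirichlet n (coef m)"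
  proof -
    have "sgl m 1 = (\<Prod>i\<le>n. mp_var i ^ coef m i :: 'k mpoly)"
      unfolding sgl_prod using assms by (intro prod.mono_neutral_left) (auto simp: in_keys_iff)
    then show ?thesis using II_dirichlet by metis
  qed
  also have "\<dots> = (\<Prod>i\<in>{1..n}. fact (coef m i)) / fact ((\<Sum>i\<in>{1..n}. coef m i) + n)"
    unfolding dirichlet_def split(1) using m0 split(2) by simp
  finally show ?thesis .
qed

section \<open>The integral over the real simplex\<close>

lemma nn_integral_beta:
  fixes s :: real assumes "0 \<le> s"
  shows "(\<integral>\<^sup>+y. ennreal (y ^ a * (s - y) ^ b) * indicator {0..s} y \<partial>lborel) =
    ennreal (fact a * fact b / fact (a + b + 1) * s ^ (a + b + 1))"
proof -
  \<comment> \<open>Integration by parts moves a factor \<open>y\<close> to a factor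
    \<open>s - y\<close>, hence the generalisation over \<open>b\<close>. The antiderivative is
    normalised to vanish at \<open>s\<close>, where the boundary term vanishes as well.\<close>
  have "\<exists>F. (\<forall>x. (F has_real_derivative x ^ a * (s - x) ^ b) (at x)) \<and> F s = 0 \<and>
      F 0 = - (fact a * fact b / fact (a + b + 1) * s ^ (a + b + 1))"
  proof (induction a arbitrary: b)
    case 0
    show ?case
      by (rule exI[of _ "\<lambda>y. - ((s - y) ^ Suc b) / real (Suc b)"])
        (auto intro!: derivative_eq_intros simp: divide_simps simp del: power_Suc of_nat_Suc)
  next
    case (Suc a)
    obtain F where F: "\<And>x. (F has_real_derivative x ^ a * (s - x) ^ Suc b) (at x)" "F s = 0"
      "F 0 = - (fact a * fact (Suc b) / fact (a + Suc b + 1) * s ^ (a + Suc b + 1))"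
      using Suc[of "Suc b"] by blast
    let ?G = "\<lambda>y. (real (Suc a) * F y - y ^ Suc a * (s - y) ^ Suc b) / real (Suc b)"
    show ?case
    proof (intro exI[of _ ?G] conjI allI)
      fix x
      have "((\<lambda>y. real (Suc a) * F y - y ^ Suc a * (s - y) ^ Suc b) has_real_derivative
          real (Suc b) * (x ^ Suc a * (s - x) ^ b)) (at x)"
      proof -
        have "((\<lambda>y. y ^ Suc a) has_real_derivative real (Suc a) * x ^ a) (at x)"
          using DERIV_pow[of "Suc a" x] by simp
        moreover have "((\<lambda>y. (s - y) ^ Suc b) has_real_derivative - (real (Suc b) * (s - x) ^ b)) (at x)"
          by (rule derivative_eq_intros refl | simp del: of_nat_Suc)+
        ultimately have "((\<lambda>y. y ^ Suc a * (s - y) ^ Suc b) has_real_derivative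
            real (Suc a) * x ^ a * (s - x) ^ Suc b + - (real (Suc b) * (s - x) ^ b) * x ^ Suc a) (at x)"
          by (rule DERIV_mult)
        from DERIV_diff[OF DERIV_cmult[OF F(1)] this] show ?thesis
          by (rule DERIV_cong) (simp add: algebra_simps del: of_nat_Suc power_Suc)
      qed
      from DERIV_cdivide[OF this, of "real (Suc b)"]
      show "(?G has_real_derivative x ^ Suc a * (s - x) ^ b) (at x)"
        by (simp del: of_nat_Suc power_Suc)
      show "?G s = 0" using F(2) by simp
      show "?G 0 = - (fact (Suc a) * fact b / fact (Suc a + b + 1) * s ^ (Suc a + b + 1))"
      proof -
        have e: "a + Suc b + 1 = Suc a + b + 1" by simp
        have "real (Suc a) * - (fact a * (real (Suc b) * fact b) / Q * S) / real (Suc b) =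
            - (real (Suc a) * fact a * fact b / Q * S)" for Q S :: real
          by (simp del: of_nat_Suc)
        then show ?thesis unfolding F(3) e fact_Suc[of b] fact_Suc[of a] by simp
      qed
    qed
  qed
  then obtain F where F: "\<And>x. (F has_real_derivative x ^ a * (s - x) ^ b) (at x)" "F s = 0"
      "F 0 = - (fact a * fact b / fact (a + b + 1) * s ^ (a + b + 1))" by blast
  have "(\<integral>\<^sup>+y. ennreal (y ^ a * (s - y) ^ b) * indicator {0..s} y \<partial>lborel) = ennreal (F s - F 0)"
    by (rule nn_integral_FTC_Icc) (use assms F(1) in \<open>auto intro: DERIV_subset\<close>)
  then show ?thesis using F by simp
qed

interpretation lborel_prod: product_sigma_finite "\<lambda>_::nat. lborel :: real measure" ..

definition in_simplex :: "nat set \<Rightarrow> real \<Rightarrow> (nat \<Rightarrow> real) \<Rightarrow> bool" where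
  "in_simplex I s x \<longleftrightarrow> (\<forall>i\<in>I. 0 \<le> x i) \<and> (\<Sum>i\<in>I. x i) \<le> s"

lemma measurable_simplex:
  assumes "finite I"
  shows "(\<lambda>x. if in_simplex I s x then \<Prod>i\<in>I. x i ^ m i else 0) \<in> borel_measurable (\<Pi>\<^sub>M i\<in>I. lborel)"
  unfolding in_simplex_def using assms by measurable

text \<open>For a fixed value \<open>y\<close> of one coordinate the others fill a simplex of size
  \<open>s - y\<close>. This is why the size is a parameter: the inner integral scales with a power
  of \<open>s - y\<close>, and a beta integral in \<open>y\<close> remains.\<close>

lemma nn_integral_simplex:
  assumes "finite I" "0 \<le> s"
  shows "(\<integral>\<^sup>+x. ennreal (if in_simplex I s x then \<Prod>i\<in>I. x i ^ m i else 0) \<partial>(\<Pi>\<^sub>M i\<in>I. lborel)) =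
    ennreal ((\<Prod>i\<in>I. fact (m i)) / fact ((\<Sum>i\<in>I. m i) + card I) * s ^ ((\<Sum>i\<in>I. m i) + card I))"
  using assms
proof (induction I arbitrary: s)
  case empty
  show ?case by (subst lborel_prod.nn_integral_empty) (auto simp: in_simplex_def empty)
next
  case (insert i I)
  let ?N = "(\<Sum>i\<in>I. m i) + card I"
  let ?C = "(\<Prod>i\<in>I. fact (m i)) / fact ?N :: real"
  have "(\<integral>\<^sup>+x. ennreal (if in_simplex (insert i I) s x then \<Prod>i\<in>insert i I. x i ^ m i else 0) \<partial>(\<Pi>\<^sub>M i\<in>insert i I. lborel)) =
    (\<integral>\<^sup>+y. (\<integral>\<^sup>+x. ennreal (if in_simplex (insert i I) s (x(i := y)) then \<Prod>j\<in>insert i I. (x(i := y)) j ^ m j else 0) \<partial>(\<Pi>\<^sub>M i\<in>I. lborel)) \<partial>lborel)"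
    using insert measurable_simplex[of "insert i I" s m]
    by (intro lborel_prod.product_nn_integral_insert_rev) auto
  also have "\<dots> = (\<integral>\<^sup>+y. ennreal ?C * (ennreal (y ^ m i * (s - y) ^ ?N) * indicator {0..s} y) \<partial>lborel)"
  proof (intro nn_integral_cong)
    fix y :: real
    have up: "in_simplex (insert i I) s (x(i := y)) \<longleftrightarrow> 0 \<le> y \<and> in_simplex I (s - y) x"
      "(\<Prod>j\<in>insert i I. (x(i := y)) j ^ m j) = y ^ m i * (\<Prod>j\<in>I. x j ^ m j)" for x
    proof -
      have "(\<Sum>j\<in>I. (x(i := y)) j) = (\<Sum>j\<in>I. x j)" "(\<Prod>j\<in>I. (x(i := y)) j ^ m j) = (\<Prod>j\<in>I. x j ^ m j)"
        using insert by (auto intro!: sum.cong prod.cong)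
      then show "in_simplex (insert i I) s (x(i := y)) \<longleftrightarrow> 0 \<le> y \<and> in_simplex I (s - y) x"
        "(\<Prod>j\<in>insert i I. (x(i := y)) j ^ m j) = y ^ m i * (\<Prod>j\<in>I. x j ^ m j)"
        using insert by (auto simp: in_simplex_def algebra_simps)
    qed
    show "(\<integral>\<^sup>+x. ennreal (if in_simplex (insert i I) s (x(i := y)) then \<Prod>j\<in>insert i I. (x(i := y)) j ^ m j else 0) \<partial>(\<Pi>\<^sub>M i\<in>I. lborel)) =
      ennreal ?C * (ennreal (y ^ m i * (s - y) ^ ?N) * indicator {0..s} y)"
    proof (cases "y \<in> {0..s}")
      case True
      have "(\<integral>\<^sup>+x. ennreal (if in_simplex (insert i I) s (x(i := y)) then \<Prod>j\<in>insert i I. (x(i := y)) j ^ m j else 0) \<partial>(\<Pi>\<^sub>M i\<in>I. lborel)) =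
        (\<integral>\<^sup>+x. ennreal (y ^ m i) * ennreal (if in_simplex I (s - y) x then \<Prod>j\<in>I. x j ^ m j else 0) \<partial>(\<Pi>\<^sub>M i\<in>I. lborel))"
        unfolding up using True by (intro nn_integral_cong) (auto simp: ennreal_mult' in_simplex_def)
      also have "\<dots> = ennreal (y ^ m i) * (\<integral>\<^sup>+x. ennreal (if in_simplex I (s - y) x then \<Prod>j\<in>I. x j ^ m j else 0) \<partial>(\<Pi>\<^sub>M i\<in>I. lborel))"
        using insert measurable_simplex[of I "s - y" m] by (intro nn_integral_cmult) auto
      also have "\<dots> = ennreal (y ^ m i) * ennreal (?C * (s - y) ^ ?N)"
        using insert True by simp
      also have "\<dots> = ennreal ?C * ennreal (y ^ m i * (s - y) ^ ?N)"
        using True by (subst (1 2) ennreal_mult[symmetric]) (auto simp: algebra_simps intro!: divide_nonneg_nonneg mult_nonneg_nonneg prod_nonneg)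
      finally show ?thesis using True by simp
    next
      case False
      then have "\<not> (0 \<le> y \<and> in_simplex I (s - y) x)" for x
        using sum_nonneg[of I x] by (auto simp: in_simplex_def)
      then have "(if 0 \<le> y \<and> in_simplex I (s - y) x then z else 0) = 0" for x and z :: real
        by (rule if_not_P)
      then show ?thesis unfolding up using False by simp
    qed
  qed
  also have "\<dots> = ennreal ?C * (\<integral>\<^sup>+y. ennreal (y ^ m i * (s - y) ^ ?N) * indicator {0..s} y \<partial>lborel)"
    by (intro nn_integral_cmult) measurable
  also have "\<dots> = ennreal ?C * ennreal (fact (m i) * fact ?N / fact (m i + ?N + 1) * s ^ (m i + ?N + 1))"
    using insert by (subst nn_integral_beta) auto
  also have "\<dots> = ennreal ((\<Prod>i\<in>insert i I. fact (m i)) / fact ((\<Sum>i\<in>insert i I. m i) + card (insert i I)) * s ^ ((\<Sum>i\<in>insert i I. m i) + card (insert i I)))"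
  proof -
    have e: "(\<Sum>i\<in>insert i I. m i) + card (insert i I) = m i + ?N + 1" using insert by simp
    have "?C * (fact (m i) * fact ?N / fact (m i + ?N + 1) * s ^ (m i + ?N + 1)) =
      (\<Prod>i\<in>insert i I. fact (m i)) / fact (m i + ?N + 1) * s ^ (m i + ?N + 1)"
      using insert by (simp del: fact_Suc add: field_simps)
    then show ?thesis unfolding e
      using insert by (subst ennreal_mult[symmetric]) (auto intro!: divide_nonneg_nonneg mult_nonneg_nonneg prod_nonneg simp: mult_ac simp del: fact_Suc)
  qed
  finally show ?case .
qed

lemma of_rat_fact: "of_rat (fact n) = (fact n :: 'k::field_char_0)"
  by (metis of_nat_fact of_rat_of_nat_eq)

lemma monom_integral_eq:
  "monom_integral p m = (\<Prod>i\<in>{1..p}. fact (Poly_Mapping.lookup m i)) /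
    fact ((\<Sum>i\<in>{1..p}. Poly_Mapping.lookup m i) + p)"
proof -
  let ?l = "Poly_Mapping.lookup m"
  let ?r = "(\<Prod>i\<in>{1..p}. fact (?l i)) / fact ((\<Sum>i\<in>{1..p}. ?l i) + p) :: rat"
  let ?f = "\<lambda>x. if in_simplex {1..p} 1 x then \<Prod>i\<in>{1..p}. x i ^ ?l i else 0 :: real"
  have "(LINT x:{x. (\<forall>i\<in>{1..p}. 0 \<le> x i) \<and> (\<Sum>i\<in>{1..p}. x i) \<le> 1} | (\<Pi>\<^sub>M i\<in>{1..p}. lborel).
        (\<Prod>i\<in>{1..p}. x i ^ ?l i)) = (LINT x | (\<Pi>\<^sub>M i\<in>{1..p}. lborel). ?f x)"
    unfolding set_lebesgue_integral_def
    by (intro Bochner_Integration.integral_cong) (auto simp: in_simplex_def indicator_def)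
  also have "\<dots> = enn2real (\<integral>\<^sup>+x. ennreal (?f x) \<partial>(\<Pi>\<^sub>M i\<in>{1..p}. lborel))"
    by (intro integral_eq_nn_integral measurable_simplex AE_I2) (auto simp: in_simplex_def intro!: prod_nonneg)
  also have "\<dots> = (\<Prod>i\<in>{1..p}. fact (?l i)) / fact ((\<Sum>i\<in>{1..p}. ?l i) + p)"
  proof -
    have "0 \<le> (\<Prod>i\<in>{1..p}. fact (?l i)) / (fact ((\<Sum>i\<in>{1..p}. ?l i) + p) :: real)"
      by (intro divide_nonneg_nonneg prod_nonneg) auto
    then show ?thesis
      by (subst nn_integral_simplex) (simp_all only: finite_atLeastAtMost zero_le_one power_one
          mult_1_right card_atLeastAtMost diff_Suc_1 enn2real_ennreal)
  qed
  also have "\<dots> = real_of_rat ?r"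
    by (simp add: of_rat_divide of_rat_prod of_rat_fact)
  finally show ?thesis
    unfolding monom_integral_def by (auto intro!: the_equality)
qed

section \<open>Signs, and Stokes' formula on a face\<close>

lemma GG_bar: "GG (bar a) = bar (GG a)"
proof (rule pform_coef_eqI)
  fix I m
  show "coef (cf (GG (bar a)) I) m = coef (cf (bar (GG a)) I) m"
    by (simp add: coef_GG cf_bar minus_one_power_iff)
qed

lemma hh_bar: "hh n i (bar a) = - bar (hh n i a)"
  by (simp add: hh_def KK_def nf_bar GG_bar iota_bar)

lemma eps_neg_pow: "eps n i ((- 1) ^ k) = (- 1) ^ k"
  by (simp add: minus_one_power_iff)

lemma TT_bar:
  fixes a :: "'a::field_char_0 pform"
  assumes "finite J" "J \<noteq> {}"
  shows "TT n J (bar a) = (- 1) ^ (card J - 1) * TT n J a"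
proof -
  have *: "HH n J (bar a) = (- 1) ^ card J * bar (HH n J a)" if "finite J" for J
    using that
  proof (induction J rule: finite_linorder_max_induct)
    case (insert m J)
    have "m \<notin> J" using insert by auto
    moreover have "HH n (insert m J) a = hh n m (HH n J a)" for a :: "'a pform" by (rule HH_max) (use insert in auto)
    ultimately show ?case using insert by (simp add: hh_sign hh_bar)
  qed simp
  have "Max J \<in> J" using assms by simp
  then show ?thesis using assms *[of "J - {Max J}"] by (simp add: TT_def eps_neg_pow)
qed

text \<open>Evaluate \<open>dd_HH\<close> for the vertices of \<open>J\<close> other than the last
  at the last one, as for the whole simplex. Multiplying by the sign of \<open>card J'\<close> turns
  the count of vertices above \<open>j\<close> into the count below \<open>j\<close>.\<close>

lemma TT_stokes:
  assumes "J \<subseteq> {..n}"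
  shows "TT n J (dd a) = (\<Sum>j\<in>J. (- 1) ^ card {l\<in>J. l < j} * TT n (J - {j}) a)"
proof (cases "J = {}")
  case True
  then show ?thesis by (simp add: TT_def)
next
  case False
  have fin: "finite J" using assms finite_subset by blast
  define m where "m = Max J"
  define J' where "J' = J - {m}"
  have m: "m \<in> J" using False fin by (simp add: m_def)
  have JJ: "J = insert m J'" "m \<notin> J'" using m J'_def by auto
  have less: "x < m" if "x \<in> J'" for x
    using that fin unfolding J'_def m_def by (metis Diff_iff Max_ge insertI1 le_neq_implies_less)
  have fin': "finite J'" "J' \<subseteq> {..n}" "m \<le> n" using assms m by (auto simp: J'_def fin)
  have T: "TT n (insert m L) b = eps n m (HH n L b)" if "L \<subseteq> J'" for L and b :: "'a pform"
    by (rule TT_max) (use that fin' less finite_subset in auto)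
  have "eps n m (dd (HH n J' a)) = eps n m ((- 1) ^ card J' * HH n J' (dd a) +
    (\<Sum>j\<in>J'. (- 1) ^ card {l\<in>J'. j < l} * HH n (J' - {j}) a) - sc (TT n J' a))"
    by (intro eps_cong dd_HH fin')
  then have 0: "0 = (- 1) ^ card J' * TT n J (dd a) +
      (\<Sum>j\<in>J'. (- 1) ^ card {l\<in>J'. j < l} * TT n (insert m (J' - {j})) a) - TT n J' a"
    by (simp only: eps_dd eps_simps(1,2,3) eps_sign eps_sum T[OF subset_refl] T[OF Diff_subset] JJ(1))
  have sgn: "(- 1) ^ card J' * (- 1) ^ card {l\<in>J'. j < l} = - ((- 1) ^ card {l\<in>J. l < j} :: 'a)" if j: "j \<in> J'" for j
  proof -
    have "{l\<in>J. l < j} = {l\<in>J'. l < j}" using less[OF j] JJ by auto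
    moreover have "J' = insert j ({l\<in>J'. l < j} \<union> {l\<in>J'. j < l})" using j by auto
    ultimately have "J' = insert j ({l\<in>J. l < j} \<union> {l\<in>J'. j < l})" by simp
    then have "card J' = card (insert j ({l\<in>J. l < j} \<union> {l\<in>J'. j < l}))" by (rule arg_cong)
    also have "\<dots> = Suc (card {l\<in>J. l < j} + card {l\<in>J'. j < l})"
      using fin fin' by (subst card_insert_disjoint) (auto intro!: card_Un_disjoint)
    finally show ?thesis by (simp add: power_add minus_one_power_iff)
  qed
  have "TT n J (dd a) = (- 1) ^ card J' * ((- 1) ^ card J' * TT n J (dd a))"
    by (simp add: minus_one_power_iff)
  also have "\<dots> = (- 1) ^ card J' * (TT n J' a - (\<Sum>j\<in>J'. (- 1) ^ card {l\<in>J'. j < l} * TT n (insert m (J' - {j})) a))"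
  proof -
    have "x = t - s" if "0 = x + s - t" for x s t :: 'a
      using that by (metis add_diff_cancel_right' eq_iff_diff_eq_0)
    from this[OF 0] show ?thesis by (rule arg_cong)
  qed
  also have "\<dots> = (- 1) ^ card J' * TT n J' a + (\<Sum>j\<in>J'. (- 1) ^ card {l\<in>J. l < j} * TT n (insert m (J' - {j})) a)"
    by (simp add: right_diff_distrib sum_distrib_left sgn sum_negf flip: mult.assoc cong: sum.cong)
  also have "(\<Sum>j\<in>J'. (- 1) ^ card {l\<in>J. l < j} * TT n (insert m (J' - {j})) a) =
     (\<Sum>j\<in>J'. (- 1) ^ card {l\<in>J. l < j} * TT n (J - {j}) a)"
  proof (rule sum.cong[OF refl])
    fix j assume "j \<in> J'"
    then have "insert m (J' - {j}) = J - {j}" using JJ by auto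
    then show "(- 1) ^ card {l\<in>J. l < j} * TT n (insert m (J' - {j})) a = (- 1) ^ card {l\<in>J. l < j} * TT n (J - {j}) a" by simp
  qed
  also have "(- 1) ^ card J' * TT n J' a = (- 1) ^ card {l\<in>J. l < m} * TT n (J - {m}) a"
  proof -
    have "{l\<in>J. l < m} = J'" using less JJ by auto
    then show ?thesis using J'_def by simp
  qed
  finally show ?thesis using JJ fin' by simp
qed

section \<open>The defect of multiplicativity\<close>

abbreviation fc :: "nat \<Rightarrow> 'k::field_char_0 pform \<Rightarrow> 'k pform" where "fc i \<equiv> sub (face_subst i)"
abbreviation dg :: "nat \<Rightarrow> 'k::field_char_0 pform \<Rightarrow> 'k pform" where "dg i \<equiv> sub (degen_subst i)"

lemma fc_fc: "i < j \<Longrightarrow> fc i (fc j a) = fc (j - 1) (fc i a)"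
  unfolding sub_sub by (rule arg_cong[where f = "\<lambda>g. sub g a"]) (auto simp: fun_eq_iff face_subst_def)

lemma fc_dg_same: "i = j \<or> i = Suc j \<Longrightarrow> fc i (dg j a) = a"
proof -
  assume "i = j \<or> i = Suc j"
  then have "mp_subst (face_subst i) (degen_subst j l) = (mp_var l :: 'a mpoly)" for l
    by (auto simp: face_subst_def degen_subst_def)
  moreover have "sub mp_var a = a" for a :: "'a pform"
    by (induction a rule: pform_induct) (auto simp: sub_dtv)
  ultimately show ?thesis by (simp add: sub_sub)
qed

lemma fc_dg_less: "i < j \<Longrightarrow> fc i (dg j a) = dg (j - 1) (fc i a)"
  unfolding sub_sub by (rule arg_cong[where f = "\<lambda>g. sub g a"]) (auto simp: fun_eq_iff face_subst_def degen_subst_def)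

lemma fc_dg_greater: "Suc j < i \<Longrightarrow> fc i (dg j a) = dg j (fc (i - 1) a)"
  unfolding sub_sub by (rule arg_cong[where f = "\<lambda>g. sub g a"]) (auto simp: fun_eq_iff face_subst_def degen_subst_def)

text \<open>The cup product of the two integration cochains on the simplex. Summing over all cuts
  makes it bilinear on inhomogeneous forms; if \<open>a\<close> has degree \<open>p\<close>, only
  the cut at \<open>p\<close> contributes.\<close>

definition cupI :: "nat \<Rightarrow> 'k::field_char_0 pform \<Rightarrow> 'k pform \<Rightarrow> 'k" where
  "cupI n a b = (\<Sum>p\<le>n. TT n {..p} a * TT n {p..n} b)"

definition EE :: "nat \<Rightarrow> 'k::field_char_0 pform \<Rightarrow> 'k pform \<Rightarrow> 'k" where
  "EE n a b = II n (a * b) - cupI n a b"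

text \<open>Stokes' formula on front and back faces deletes one vertex at a time. The two ways in
  which the vertex at the cut disappears, as last vertex of a front face or first vertex of a back
  face, cancel; every other deletion is a term of the cup product on a face of the simplex.\<close>

lemma cupI_d:
  "cupI (Suc n) (dd a) b + cupI (Suc n) (bar a) (dd b) =
    (\<Sum>i\<le>Suc n. (- 1) ^ i * cupI n (fc i a) (fc i (b :: 'k::field_char_0 pform)))"
proof -
  let ?N = "Suc n" and ?T = "TT (Suc n)"
  have c: "card {l\<in>{..p}. l < j} = j" if "j \<le> p" for p j :: nat
  proof -
    have "{l\<in>{..p}. l < j} = {..<j}" using that by auto
    then show ?thesis by simp
  qed
  have c': "card {l\<in>{p..?N}. l < j} = j - p" if "p \<le> j" "j \<le> ?N" for p j :: nat
  proof -
    have "{l\<in>{p..?N}. l < j} = {p..<j}" using that by auto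
    then show ?thesis by simp
  qed
  let ?A = "\<lambda>p j. (- 1) ^ j * ?T ({..p} - {j}) a * ?T {p..?N} b"
  let ?B = "\<lambda>p j. (- 1) ^ j * ?T {..p} a * ?T ({p..?N} - {j}) b"
  have "cupI ?N (dd a) b = (\<Sum>p\<le>?N. \<Sum>j\<le>p. ?A p j)"
    unfolding cupI_def
  proof (intro sum.cong refl)
    fix p assume p: "p \<in> {..?N}"
    have "?T {..p} (dd a) = (\<Sum>j\<in>{..p}. (- 1) ^ card {l\<in>{..p}. l < j} * ?T ({..p} - {j}) a)"
      by (rule TT_stokes) (use p in auto)
    also have "\<dots> = (\<Sum>j\<le>p. (- 1) ^ j * ?T ({..p} - {j}) a)"
      by (intro sum.cong refl, subst c) auto
    finally show "?T {..p} (dd a) * ?T {p..?N} b = (\<Sum>j\<le>p. ?A p j)" by (simp add: sum_distrib_right)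
  qed
  also have "\<dots> = (\<Sum>p\<le>?N. \<Sum>j<p. ?A p j) + (\<Sum>p\<le>?N. ?A p p)"
    by (simp add: sum.distrib flip: lessThan_Suc_atMost)
  also have "(\<Sum>p\<le>?N. \<Sum>j<p. ?A p j) = (\<Sum>p\<le>n. \<Sum>j\<le>p. ?A (Suc p) j)"
    by (subst sum.atMost_Suc_shift) (simp add: lessThan_Suc_atMost)
  \<comment> \<open>For \<open>p = 0\<close> deletion leaves the empty front face, whose integral is
    0 by convention; this permits the shift of the index.\<close>
  also have "(\<Sum>p\<le>?N. ?A p p) = (\<Sum>p\<le>n. ?A (Suc p) (Suc p))"
    by (subst sum.atMost_Suc_shift) (simp add: TT_def)
  finally have A: "cupI ?N (dd a) b = (\<Sum>p\<le>n. \<Sum>j\<le>p. ?A (Suc p) j) + (\<Sum>p\<le>n. ?A (Suc p) (Suc p))" .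
  have "cupI ?N (bar a) (dd b) = (\<Sum>p\<le>?N. \<Sum>j\<in>{p..?N}. ?B p j)"
    unfolding cupI_def
  proof (intro sum.cong refl)
    fix p assume p: "p \<in> {..?N}"
    have f1: "?T {p..?N} (dd b) = (\<Sum>j\<in>{p..?N}. (- 1) ^ (j - p) * ?T ({p..?N} - {j}) b)"
    proof -
      have "?T {p..?N} (dd b) = (\<Sum>j\<in>{p..?N}. (- 1) ^ card {l\<in>{p..?N}. l < j} * ?T ({p..?N} - {j}) b)"
        by (rule TT_stokes) auto
      also have "\<dots> = (\<Sum>j\<in>{p..?N}. (- 1) ^ (j - p) * ?T ({p..?N} - {j}) b)"
        by (intro sum.cong refl, subst c') auto
      finally show ?thesis .
    qed
    have f2: "?T {..p} (bar a) = (- 1) ^ p * ?T {..p} a" by (subst TT_bar) auto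
    have f3: "(- 1) ^ p * x * ((- 1) ^ (j - p) * y) = (- 1) ^ j * x * y" if "p \<le> j" for j and x y :: 'k
    proof -
      have "(- 1 :: 'k) ^ j = (- 1) ^ p * (- 1) ^ (j - p)" using that by (simp flip: power_add)
      then show ?thesis by (simp add: mult_ac)
    qed
    show "?T {..p} (bar a) * ?T {p..?N} (dd b) = (\<Sum>j\<in>{p..?N}. ?B p j)"
      unfolding f1 f2 sum_distrib_left by (intro sum.cong refl f3) auto
  qed
  also have "\<dots> = (\<Sum>p\<le>?N. ?B p p + (\<Sum>j\<in>{Suc p..?N}. ?B p j))"
  proof (intro sum.cong refl)
    fix p assume p: "p \<in> {..?N}"
    then have "{p..?N} = insert p {Suc p..?N}" by auto
    then have "(\<Sum>j\<in>{p..?N}. ?B p j) = (\<Sum>j\<in>insert p {Suc p..?N}. ?B p j)" by (rule sum.cong) simp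
    then show "(\<Sum>j\<in>{p..?N}. ?B p j) = ?B p p + (\<Sum>j\<in>{Suc p..?N}. ?B p j)" by simp
  qed
  also have "\<dots> = (\<Sum>p\<le>n. ?B p p) + (\<Sum>p\<le>n. \<Sum>j\<in>{Suc p..?N}. ?B p j)"
  proof -
    have "?B ?N ?N = 0" by (simp add: TT_def)
    then show ?thesis by (simp add: sum.distrib)
  qed
  finally have B: "cupI ?N (bar a) (dd b) = (\<Sum>p\<le>n. ?B p p) + (\<Sum>p\<le>n. \<Sum>j\<in>{Suc p..?N}. ?B p j)" .
  \<comment> \<open>The front face up to \<open>Suc p\<close> without its last vertex and the back
    face from \<open>p\<close> without its first one leave the same pair of faces, with opposite
    signs.\<close>
  have diag: "?A (Suc p) (Suc p) = - ?B p p" if "p \<le> n" for p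
  proof -
    have "{..Suc p} - {Suc p} = {..p}" "{p..?N} - {p} = {Suc p..?N}" by auto
    then show ?thesis by simp
  qed
  have "cupI n (fc i a) (fc i b) = (\<Sum>p\<le>n. if i \<le> p then ?T ({..Suc p} - {i}) a * ?T {Suc p..?N} b
      else ?T {..p} a * ?T ({p..?N} - {i}) b)" if i: "i \<le> ?N" for i
    unfolding cupI_def
  proof (intro sum.cong refl)
    fix p assume p: "p \<in> {..n}"
    have im: "face_v i ` {..p} = (if i \<le> p then {..Suc p} - {i} else {..p})"
    proof (intro equalityI subsetI)
      fix j assume "j \<in> (if i \<le> p then {..Suc p} - {i} else {..p})"
      then show "j \<in> face_v i ` {..p}"
        by (intro image_eqI[of _ _ "if j < i then j else j - 1"]) (auto simp: face_v_def split: if_splits)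
    qed (auto simp: face_v_def)
    have im': "face_v i ` {p..n} = (if i \<le> p then {Suc p..?N} else {p..?N} - {i})"
    proof (intro equalityI subsetI)
      fix j assume "j \<in> (if i \<le> p then {Suc p..?N} else {p..?N} - {i})"
      then show "j \<in> face_v i ` {p..n}"
        using i by (intro image_eqI[of _ _ "if j < i then j else j - 1"]) (auto simp: face_v_def split: if_splits)
    qed (use p in \<open>auto simp: face_v_def\<close>)
    have "TT n {..p} (fc i a) = ?T (face_v i ` {..p}) a" "TT n {p..n} (fc i b) = ?T (face_v i ` {p..n}) b"
      using p i by (auto intro!: TT_face)
    then show "TT n {..p} (fc i a) * TT n {p..n} (fc i b) =
      (if i \<le> p then ?T ({..Suc p} - {i}) a * ?T {Suc p..?N} b else ?T {..p} a * ?T ({p..?N} - {i}) b)"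
      unfolding im im' by simp
  qed
  then have "(\<Sum>i\<le>?N. (- 1) ^ i * cupI n (fc i a) (fc i b)) =
      (\<Sum>i\<le>?N. \<Sum>p\<le>n. if i \<le> p then ?A (Suc p) i else ?B p i)"
    by (auto simp: sum_distrib_left mult.assoc intro!: sum.cong)
  also have "\<dots> = (\<Sum>p\<le>n. \<Sum>i\<le>?N. if i \<le> p then ?A (Suc p) i else ?B p i)"
    by (rule sum.swap)
  also have "\<dots> = (\<Sum>p\<le>n. (\<Sum>i\<le>p. ?A (Suc p) i) + (\<Sum>i\<in>{Suc p..?N}. ?B p i))"
  proof (intro sum.cong refl)
    fix p assume p: "p \<in> {..n}"
    then have "{..?N} = {..p} \<union> {Suc p..?N}" by auto
    then have "(\<Sum>i\<le>?N. if i \<le> p then ?A (Suc p) i else ?B p i) =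
        (\<Sum>i\<in>{..p} \<union> {Suc p..?N}. if i \<le> p then ?A (Suc p) i else ?B p i)" by (rule sum.cong) simp
    also have "\<dots> = (\<Sum>i\<le>p. if i \<le> p then ?A (Suc p) i else ?B p i) +
        (\<Sum>i\<in>{Suc p..?N}. if i \<le> p then ?A (Suc p) i else ?B p i)"
      by (rule sum.union_disjoint) auto
    also have "\<dots> = (\<Sum>i\<le>p. ?A (Suc p) i) + (\<Sum>i\<in>{Suc p..?N}. ?B p i)"
      by (intro arg_cong2[of _ _ _ _ "(+)"] sum.cong) auto
    finally show "(\<Sum>i\<le>?N. if i \<le> p then ?A (Suc p) i else ?B p i) = (\<Sum>i\<le>p. ?A (Suc p) i) + (\<Sum>i\<in>{Suc p..?N}. ?B p i)" .
  qed
  finally have C: "(\<Sum>i\<le>?N. (- 1) ^ i * cupI n (fc i a) (fc i b)) =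
     (\<Sum>p\<le>n. \<Sum>i\<le>p. ?A (Suc p) i) + (\<Sum>p\<le>n. \<Sum>i\<in>{Suc p..?N}. ?B p i)"
    by (simp only: sum.distrib)
  have D: "(\<Sum>p\<le>n. ?A (Suc p) (Suc p)) = - (\<Sum>p\<le>n. ?B p p)"
    unfolding sum_negf[symmetric] by (intro sum.cong refl diag) simp
  show ?thesis unfolding A B C D by simp
qed

lemma EE_d: "EE (Suc n) (dd a) b + EE (Suc n) (bar a) (dd b) = (\<Sum>i\<le>Suc n. (- 1) ^ i * EE n (fc i a) (fc i b))"
proof -
  have "II (Suc n) (dd a * b) + II (Suc n) (bar a * dd b) = (\<Sum>i\<le>Suc n. (- 1) ^ i * II n (fc i a * fc i b))"
    using stokes[of n "a * b"] by (simp add: dd_mult del: sum.atMost_Suc)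
  then show ?thesis
    using cupI_d[of n a b] by (simp add: EE_def right_diff_distrib sum_subtractf del: sum.atMost_Suc)
      (metis (no_types, lifting) add_diff_add)
qed

lemma EE_0 [simp]: "EE 0 a b = 0"
proof -
  have "{..0::nat} = {0}" by auto
  moreover have "TT 0 {0} a = eps 0 0 a" for a :: "'a pform" using TT_max[of "{}" 0 0 a] by simp
  ultimately show ?thesis by (simp add: EE_def cupI_def II_def)
qed

lemma EE_linear: "EE n (a + a') b = EE n a b + EE n a' b" "EE n a (b + b') = EE n a b + EE n a b'"
  "EE n (sc c * a) b = c * EE n a b" "EE n a (sc c * b) = c * EE n a b" "EE n 0 b = 0" "EE n a 0 = 0"
  by (simp_all add: EE_def cupI_def algebra_simps sum.distrib sum_distrib_left sc_left_commute[of a])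
    (metis II_simps(3) mult.assoc)?

text \<open>\<open>FF (Suc n)\<close> is what remains of \<open>EE\<close> after the homotopies already chosen on the faces. It is a cocycle for the
  differential of the tensor product, so composing with the contraction onto the vertex \<open>0\<close> in both arguments
  (this is \<open>hm\<close>) exhibits it as a coboundary.\<close>

definition hm :: "(('k::field_char_0) pform \<Rightarrow> 'k pform \<Rightarrow> 'k) \<Rightarrow> nat \<Rightarrow> 'k pform \<Rightarrow> 'k pform \<Rightarrow> 'k" where
  "hm F n a b = F (hh n 0 a) b + eps n 0 a * F 1 (hh n 0 b)"

primrec FF :: "nat \<Rightarrow> 'k::field_char_0 pform \<Rightarrow> 'k pform \<Rightarrow> 'k" where
  "FF 0 = EE 0"
| "FF (Suc n) = (\<lambda>a b. EE (Suc n) a b - (\<Sum>i\<le>Suc n. (- 1) ^ i * hm (FF n) n (fc i a) (fc i b)))"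

declare FF.simps(2) [simp del]

abbreviation hmf :: "nat \<Rightarrow> 'k::field_char_0 pform \<Rightarrow> 'k pform \<Rightarrow> 'k" where "hmf n \<equiv> hm (FF n) n"

lemma FF_linear: "FF n (a + a') b = FF n a b + FF n a' b" "FF n a (b + b') = FF n a b + FF n a b'"
  "FF n (sc c * a) b = c * FF n a b" "FF n a (sc c * b) = c * FF n a b"
proof (induction n arbitrary: a a' b b')
  case (Suc n)
  have hm1: "hmf n (x + x') y = hmf n x y + hmf n x' y" "hmf n x (y + y') = hmf n x y + hmf n x y'"
    "hmf n (sc c * x) y = c * hmf n x y" "hmf n x (sc c * y) = c * hmf n x y" for x x' y y'
    by (simp_all only: hm_def hh_simps eps_simps Suc) (simp_all add: algebra_simps)
  { case 1 show ?case
      by (simp add: FF.simps(2) EE_linear hm1 distrib_left sum.distrib del: sum.atMost_Suc) }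
  { case 2 show ?case
      by (simp add: FF.simps(2) EE_linear hm1 distrib_left sum.distrib del: sum.atMost_Suc) }
  { case 3 show ?case
      by (simp add: FF.simps(2) EE_linear hm1 right_diff_distrib sum_distrib_left mult.left_commute del: sum.atMost_Suc) }
  { case 4 show ?case
      by (simp add: FF.simps(2) EE_linear hm1 right_diff_distrib sum_distrib_left mult.left_commute del: sum.atMost_Suc) }
qed (simp_all add: EE_linear)

lemma FF_zero [simp]: "FF n 0 b = 0" "FF n a 0 = 0"
  using FF_linear(1)[of n 0 0 b] FF_linear(2)[of n a 0 0] by auto

lemma hmf_zero [simp]: "hmf n 0 b = 0" "hmf n a 0 = 0"
  by (simp_all add: hm_def)

lemma FF_cong: "eqv n a a' \<Longrightarrow> eqv n b b' \<Longrightarrow> FF n a b = FF n a' b'"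
proof (induction n arbitrary: a a' b b')
  case (Suc n)
  have "EE (Suc n) a b = EE (Suc n) a' b'"
    using Suc.prems eqv_mult[OF Suc.prems] unfolding EE_def cupI_def
    by (intro arg_cong2[of _ _ _ _ "(-)"] II_cong sum.cong arg_cong2[of _ _ _ _ "(*)"] TT_cong) auto
  moreover have "hmf n (fc i a) (fc i b) = hmf n (fc i a') (fc i b')" if "i \<le> Suc n" for i
  proof -
    have e: "eqv n (fc i a) (fc i a')" "eqv n (fc i b) (fc i b')"
      using eqv_sub[OF vertex_map_face[OF that]] Suc.prems by auto
    then have "hh n 0 (fc i a) = hh n 0 (fc i a')" "hh n 0 (fc i b) = hh n 0 (fc i b')" "eps n 0 (fc i a) = eps n 0 (fc i a')"
      by (auto intro: hh_cong eps_cong)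
    then show ?thesis using Suc.IH[OF eqv_refl e(2)] by (simp add: hm_def)
  qed
  ultimately show ?case by (simp add: FF.simps(2) del: sum.atMost_Suc)
qed simp

text \<open>Contracting both arguments leaves only the pair of constants, so the defect has to
  vanish there. In positive dimension, one of the two faces of every cut has more than one vertex,
  and the integral of 1 over it is 0 by degree.\<close>

lemma EE_1_1: "EE n 1 (1 :: 'a::field_char_0 pform) = 0"
proof (cases n)
  case (Suc k)
  have z: "TT n {..p} (1 :: 'a pform) * TT n {p..n} 1 = 0" if "p \<le> n" for p
  proof (cases "p = 0")
    case True
    then show ?thesis using TT_homog[of "{p..n}" 0 "1 :: 'a pform" n] Suc by simp
  next
    case False
    then show ?thesis using TT_homog[of "{..p}" 0 "1 :: 'a pform" n] by simp
  qed
  have "cupI n (1 :: 'a pform) 1 = 0" unfolding cupI_def by (rule sum.neutral) (use z in auto)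
  moreover have "II n (1 :: 'a pform) = 0" using II_homog[of 0 "1 :: 'a pform" n] Suc by simp
  ultimately show ?thesis by (simp add: EE_def)
qed simp

lemma FF_1_1: "FF n 1 1 = 0"
  by (cases n) (simp_all add: FF.simps(2) EE_1_1 hm_def del: sum.atMost_Suc)

text \<open>With \<open>k\<close> the contraction and \<open>e\<close> the evaluation at 0,
  \<open>hm\<close> is composition with the homotopy \<open>k\<close> on the first factor plus
  \<open>e\<close> on the first and \<open>k\<close> on the second. This contracts the tensor
  product onto constants, where \<open>FF\<close> is 0. The cocycle property is a hypothesis here
  because it is itself proved by an induction that uses this lemma.\<close>

lemma hmf_d_if:
  fixes a b :: "'a::field_char_0 pform"
  assumes "\<And>a b :: 'a pform. FF n (dd a) b + FF n (bar a) (dd b) = 0"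
  shows "hmf n (dd a) b + hmf n (bar a) (dd b) = FF n a b"
proof -
  let ?k = "hh n 0 :: 'a pform \<Rightarrow> 'a pform" and ?e = "eps n 0 :: 'a pform \<Rightarrow> 'a"
  have dec: "FF n x y = FF n (dd (?k x)) y + FF n (?k (dd x)) y + ?e x * FF n 1 y"
    "FF n y x = FF n y (dd (?k x)) + FF n y (?k (dd x)) + ?e x * FF n y 1" for x y :: "'a pform"
  proof -
    have "eqv n x (dd (?k x) + ?k (dd x) + sc (?e x) * 1)"
      using hh_homotopy[of 0 n x] by (simp add: eqv_def algebra_simps)
    from FF_cong[OF this eqv_refl] FF_cong[OF eqv_refl this]
    show "FF n x y = FF n (dd (?k x)) y + FF n (?k (dd x)) y + ?e x * FF n 1 y"
      "FF n y x = FF n y (dd (?k x)) + FF n y (?k (dd x)) + ?e x * FF n y 1"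
      by (simp_all only: FF_linear)
  qed
  have neg: "FF n (- x) y = - FF n x y" for x y
    by (metis FF_linear(1) FF_zero(1) add.right_inverse add_eq_0_iff)
  have "FF n (dd (?k a)) b = FF n (?k (bar a)) (dd b)"
    using assms[of "?k a" b] by (simp add: hh_bar neg add_eq_0_iff2)
  moreover have "FF n 1 b = FF n 1 (?k (dd b))"
    using dec(2)[of 1 b] assms[of 1 "?k b"] FF_1_1[of n, where ?'a = 'a] by simp
  ultimately have "FF n a b = FF n (?k (bar a)) (dd b) + FF n (?k (dd a)) b + ?e a * FF n 1 (?k (dd b))"
    using dec(1)[of a b] by simp
  then show ?thesis by (simp add: hm_def)
qed

text \<open>The pairing behind the vanishing of the square of a simplicial coboundary. It is stated
  for an abstract \<open>G\<close> because it serves both the forms on a standard simplex and the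
  cochains of \<open>X\<close>.\<close>

lemma alternating_double_sum:
  fixes G :: "nat \<Rightarrow> nat \<Rightarrow> 'k::comm_ring_1"
  assumes "\<And>i j. i < j \<Longrightarrow> j \<le> Suc (Suc n) \<Longrightarrow> G i j = G (j - 1) i"
  shows "(\<Sum>j\<le>Suc (Suc n). (- 1) ^ j * (\<Sum>i\<le>Suc n. (- 1) ^ i * G i j)) = 0"
proof -
  let ?N = "Suc (Suc n)"
  let ?f = "\<lambda>(j, i). (- 1) ^ j * ((- 1) ^ i * G i j)"
  let ?P = "{..?N} \<times> {..Suc n}"
  let ?L = "{(j, i)\<in>?P. i < j}" and ?U = "{(j, i)\<in>?P. j \<le> i}"
  have "(\<Sum>j\<le>?N. (- 1) ^ j * (\<Sum>i\<le>Suc n. (- 1) ^ i * G i j)) = sum ?f ?P"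
    unfolding sum_distrib_left sum.cartesian_product ..
  also have "?P = ?L \<union> ?U" by auto
  also have "sum ?f (?L \<union> ?U) = sum ?f ?L + sum ?f ?U"
  proof (rule sum.union_disjoint)
    show "finite ?L" by (rule finite_subset[of _ ?P]) auto
    show "finite ?U" by (rule finite_subset[of _ ?P]) auto
  qed auto
  also have "sum ?f ?L = (\<Sum>p\<in>?U. - ?f p)"
    by (rule sum.reindex_bij_witness[of _ "\<lambda>(j, i). (Suc i, j)" "\<lambda>(j, i). (i, j - 1)"])
      (use assms in \<open>auto simp: minus_one_power_iff\<close>)
  finally show ?thesis by (simp add: sum_negf)
qed

text \<open>By \<open>EE_d\<close> and the previous dimension the left side is the alternating sum
  of \<open>EE - FF\<close> over the faces. But \<open>EE - FF\<close> is again an alternating sum,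
  of \<open>hmf\<close> over the faces of the face, so the simplicial identity cancels
  everything.\<close>

lemma FF_d: "FF n (dd a) b + FF n (bar a) (dd (b :: 'a::field_char_0 pform)) = 0"
proof (induction n arbitrary: a b)
  case (Suc n)
  have h: "hmf n (dd x) y + hmf n (bar x) (dd y) = FF n x y" for x y :: "'a pform"
    by (rule hmf_d_if) (rule Suc.IH)
  have "FF (Suc n) (dd a) b + FF (Suc n) (bar a) (dd b) = (\<Sum>i\<le>Suc n. (- 1) ^ i * EE n (fc i a) (fc i b)) -
     (\<Sum>i\<le>Suc n. (- 1) ^ i * (hmf n (dd (fc i a)) (fc i b) + hmf n (bar (fc i a)) (dd (fc i b))))"
    unfolding EE_d[symmetric]
    by (simp add: FF.simps(2) dd_sub bar_sub distrib_left sum.distrib del: sum.atMost_Suc)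
  also have "\<dots> = (\<Sum>i\<le>Suc n. (- 1) ^ i * (EE n (fc i a) (fc i b) - FF n (fc i a) (fc i b)))"
    unfolding h by (simp only: right_diff_distrib sum_subtractf)
  also have "\<dots> = 0"
  proof (cases n)
    case (Suc k)
    have "(\<Sum>j\<le>Suc (Suc k). (- 1) ^ j * (\<Sum>i\<le>Suc k. (- 1) ^ i * hmf k (fc i (fc j a)) (fc i (fc j b)))) = 0"
      by (rule alternating_double_sum) (simp add: fc_fc)
    then show ?thesis unfolding Suc by (simp add: FF.simps(2) del: sum.atMost_Suc)
  qed simp
  finally show ?case .
qed simp

theorem hmf_d: "hmf n (dd a) b + hmf n (bar a) (dd b) = FF n a b"
  by (rule hmf_d_if) (rule FF_d)

text \<open>The left side is the coboundary of the function whose value on a simplex is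
  \<open>hmf\<close>. On closed forms the last two terms vanish, so the defect of multiplicativity
  is a coboundary.\<close>

theorem hmf_homotopy:
  "(\<Sum>i\<le>Suc n. (- 1) ^ i * hmf n (fc i a) (fc i b)) =
    EE (Suc n) a b - hmf (Suc n) (dd a) b - hmf (Suc n) (bar a) (dd b)"
  using hmf_d[of "Suc n" a b] by (simp add: FF.simps(2) algebra_simps del: sum.atMost_Suc)

text \<open>For every cut at \<open>p\<close> the two vertices which the degeneracy identifies lie
  both in the front face (\<open>p > j\<close>) or both in the back face (\<open>p \<le> j\<close>),
  so one of the integrals vanishes.\<close>

lemma EE_degen:
  assumes "j \<le> n" shows "EE (Suc n) (dg j a) (dg j b) = 0"
proof -
  have v: "degen_v j j = degen_v j (Suc j)" by (simp add: degen_v_def)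
  have z: "TT (Suc n) {..p} (dg j a) * TT (Suc n) {p..Suc n} (dg j b) = 0" if "p \<le> Suc n" for p
  proof (cases "Suc j \<le> p")
    case True
    then have "\<not> inj_on (degen_v j) {..p}"
      using v by (metis Suc_leD atMost_iff inj_on_contraD n_not_Suc_n)
    then show ?thesis using TT_sub[OF vmap_degen[OF assms], of "{..p}" a] that by simp
  next
    case False
    then have "j \<in> {p..Suc n}" "Suc j \<in> {p..Suc n}" using assms by auto
    then have "\<not> inj_on (degen_v j) {p..Suc n}" using v by (metis inj_on_contraD n_not_Suc_n)
    then show ?thesis using TT_sub[OF vmap_degen[OF assms], of "{p..Suc n}" b] by simp
  qed
  have "cupI (Suc n) (dg j a) (dg j b) = 0" unfolding cupI_def by (rule sum.neutral) (use z in auto)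
  then show ?thesis using II_degen[OF assms, of "a * b"] by (simp add: EE_def)
qed

text \<open>All degeneracies fix the vertex 0, so the contraction onto it commutes with them and
  \<open>hmf\<close> inherits the vanishing from \<open>FF\<close>. For \<open>FF\<close>, the faces
  \<open>j\<close> and \<open>Suc j\<close> of a degenerate pair coincide and enter with opposite
  signs, while the others are degenerate pairs of lower dimension.\<close>

lemma hmf_degen: "j \<le> n \<Longrightarrow> hmf (Suc n) (dg j a) (dg j b) = 0"
  and FF_degen: "j \<le> n \<Longrightarrow> FF (Suc n) (dg j a) (dg j b) = 0"
proof -
  have *: "j \<le> n \<Longrightarrow> hmf (Suc n) (dg j a) (dg j b) = 0"
    if F: "\<And>j a b. j \<le> n \<Longrightarrow> FF (Suc n) (dg j a) (dg j b) = (0 :: 'a)" for n j and a b :: "'a pform"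
  proof -
    assume j: "j \<le> n"
    have e: "eqv (Suc n) (hh (Suc n) 0 (dg j x)) (dg j (hh n 0 x))" for x :: "'a pform"
    proof -
      have "degen_v j 0 = 0" by (simp add: degen_v_def)
      then have "hh (Suc n) 0 (dg j x) = nf (Suc n) 0 (dg j (hh n 0 x))"
        using hh_sub[OF vertex_map_degen[OF j], of 0 x] by simp
      then show ?thesis by (simp add: eqv_nf)
    qed
    have "FF (Suc n) (hh (Suc n) 0 (dg j a)) (dg j b) = FF (Suc n) (dg j (hh n 0 a)) (dg j b)"
      by (rule FF_cong[OF e eqv_refl])
    moreover have "FF (Suc n) 1 (hh (Suc n) 0 (dg j b)) = FF (Suc n) (dg j 1) (dg j (hh n 0 b))"
      by (rule FF_cong) (simp_all add: e)
    ultimately show ?thesis using F[OF j] by (simp add: hm_def del: sub_0)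
  qed
  have F: "j \<le> n \<Longrightarrow> FF (Suc n) (dg j a) (dg j b) = 0" for n j and a b :: "'a pform"
  proof (induction n arbitrary: j a b rule: less_induct)
    case (less n)
    let ?g = "\<lambda>i. (- 1) ^ i * hmf n (fc i (dg j a)) (fc i (dg j b))"
    have 0: "?g i = 0" if i: "i \<le> Suc n" "i \<noteq> j" "i \<noteq> Suc j" for i
    proof -
      obtain k where k: "n = Suc k" using i less.prems by (cases n) auto
      have H: "l \<le> k \<Longrightarrow> hmf n (dg l x) (dg l y) = 0" for l and x y :: "'a pform"
        unfolding k by (rule *) (use less.IH k in auto)
      show ?thesis
      proof (cases "i < j")
        case True
        then show ?thesis using H[of "j - 1"] less.prems k by (simp add: fc_dg_less)
      next
        case False
        then show ?thesis using H[of j] i less.prems k by (simp add: fc_dg_greater)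
      qed
    qed
    have "sum ?g {..Suc n} = sum ?g {j, Suc j}"
      by (rule sum.mono_neutral_right) (use 0 less.prems in auto)
    also have "\<dots> = 0" by (simp add: fc_dg_same)
    finally show ?case using EE_degen[OF less.prems] by (simp add: FF.simps(2) del: sum.atMost_Suc)
  qed
  show "j \<le> n \<Longrightarrow> hmf (Suc n) (dg j a) (dg j b) = 0" by (rule *) (rule F)
  show "j \<le> n \<Longrightarrow> FF (Suc n) (dg j a) (dg j b) = 0" by (rule F)
qed

section \<open>The quotient algebras\<close>

definition restr :: "nat set \<Rightarrow> nat \<Rightarrow> 'k::comm_ring_1 mpoly" where
  "restr V j = (if j \<in> V then mp_var j else 0)"

lemma trunc_eq_restr: "trunc n = restr {..n}"
  by (auto simp: fun_eq_iff trunc_def restr_def)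

lemma mpolys_over_simps: "0 \<in> mpolys_over V" "mp_const c \<in> mpolys_over V" "1 \<in> mpolys_over V"
  "f \<in> mpolys_over V \<Longrightarrow> g \<in> mpolys_over V \<Longrightarrow> f + g \<in> mpolys_over V"
  "f \<in> mpolys_over V \<Longrightarrow> g \<in> mpolys_over V \<Longrightarrow> f * g \<in> mpolys_over V"
  "i \<in> V \<Longrightarrow> mp_var i \<in> mpolys_over V"
proof -
  show "f + g \<in> mpolys_over V" if "f \<in> mpolys_over V" "g \<in> mpolys_over V"
    using that Poly_Mapping.keys_add[of f g] unfolding mpolys_over_def by blast
  show "f * g \<in> mpolys_over V" if fg: "f \<in> mpolys_over V" "g \<in> mpolys_over V"
    unfolding mpolys_over_def
  proof (intro CollectI ballI)
    fix m assume "m \<in> supp (f * g)"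
    then obtain a b where "m = a + b" "a \<in> supp f" "b \<in> supp g"
      using keys_mult[of f g] by blast
    then show "supp m \<subseteq> V"
      using fg Poly_Mapping.keys_add[of a b] unfolding mpolys_over_def by blast
  qed
  show "i \<in> V \<Longrightarrow> mp_var i \<in> mpolys_over V" by (auto simp: mpolys_over_def mp_var_def)
  show "mp_const c \<in> mpolys_over V" by (cases "c = 0") (auto simp: mpolys_over_def mp_const_def)
qed (auto simp: mpolys_over_def)

definition over :: "nat set \<Rightarrow> 'k::comm_ring_1 pform \<Rightarrow> bool" where
  "over V a \<longleftrightarrow> (\<forall>I. cf a I \<in> mpolys_over V \<and> (cf a I \<noteq> 0 \<longrightarrow> I \<subseteq> V))"

lemma mpolys_over_sum: "(\<And>x. x \<in> S \<Longrightarrow> f x \<in> mpolys_over V) \<Longrightarrow> sum f S \<in> mpolys_over V"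
  by (induction S rule: infinite_finite_induct) (auto simp: mpolys_over_simps)

lemma over_mult: assumes "over V a" "over V b" shows "over V (a * b)"
  unfolding over_def
proof (intro allI conjI impI)
  fix K
  have s: "shuffle_sign I J = mp_const (shuffle_sign I J :: 'a)" for I J
    by (simp add: shuffle_sign_def minus_one_power_iff)
  have "(shuffle_sign I J :: 'a mpoly) \<in> mpolys_over V" for I J
    by (subst s) (rule mpolys_over_simps)
  then show "cf (a * b) K \<in> mpolys_over V"
    unfolding cf_mult using assms by (intro mpolys_over_sum mpolys_over_simps(5)) (auto simp: over_def)
  assume "cf (a * b) K \<noteq> 0"
  then have "form_mult (cf a) (cf b) K \<noteq> 0" by (simp add: times_pform.rep_eq)
  from form_mult_nonzero[OF this] obtain I J where "K = I \<union> J" "cf a I \<noteq> 0" "cf b J \<noteq> 0"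
    by (elim exE conjE)
  then show "K \<subseteq> V" using assms by (auto simp: over_def)
qed

lemma over_add: "over V a \<Longrightarrow> over V b \<Longrightarrow> over V (a + b)"
proof -
  assume ab: "over V a" "over V b"
  have "I \<subseteq> V" if "cf (a + b) I \<noteq> 0" for I
  proof -
    have "cf a I \<noteq> 0 \<or> cf b I \<noteq> 0" using that by auto
    then show ?thesis using ab by (auto simp: over_def)
  qed
  then show ?thesis using ab by (simp add: over_def mpolys_over_simps)
qed

lemma over_restr: "over V (sub (restr V) a)"
proof (induction a rule: pform_induct)
  case (const c)
  show ?case by (auto simp: over_def sc_def cf_Pf mpolys_over_simps)
next
  case (var i)
  show ?case by (auto simp: over_def restr_def cf_Pf mpolys_over_simps)
next
  case (diff i)
  show ?case by (auto simp: sub_dtv over_def restr_def cf_ee mpolys_over_simps)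
qed (auto intro: over_add over_mult)

lemma fr_iff_over: "fr n a \<longleftrightarrow> over {..n} (a :: 'k::field_char_0 pform)"
proof
  assume "fr n a"
  then show "over {..n} a" using over_restr[of "{..n}" a] by (simp add: fr_def trunc_eq_restr)
next
  assume a: "over {..n} a"
  show "fr n a"
    by (rule pform_induct_on[where V = "{..n}"]) (use a in \<open>auto simp: over_def\<close>)
qed

lemma carrier_free_forms: "carrier (free_forms n) = cf ` {a :: 'k::field_char_0 pform. fr n a}"
proof (intro equalityI subsetI)
  fix w :: "'k form" assume w: "w \<in> carrier (free_forms n)"
  then have nz: "I \<subseteq> {..n}" if "w I \<noteq> 0" for I using that by (auto simp: free_forms_def)
  have "finite {I. w I \<noteq> 0}" by (rule finite_subset[of _ "Pow {..n}"]) (use nz in auto)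
  moreover have "finite I" if "w I \<noteq> 0" for I using nz[OF that] finite_subset by blast
  ultimately have e: "cf (Abs_pform w) = w" by (intro Abs_pform_inverse) auto
  then have "over {..n} (Abs_pform w)" using w by (auto simp: over_def free_forms_def)
  then show "w \<in> cf ` {a. fr n a}" using e fr_iff_over by (metis CollectI image_eqI)
next
  fix w :: "'k form" assume "w \<in> cf ` {a. fr n a}"
  then obtain a where "fr n a" "w = cf a" by auto
  then show "w \<in> carrier (free_forms n)" by (auto simp: fr_iff_over over_def free_forms_def)
qed

lemma free_forms_ops [simp]: "cf a \<otimes>\<^bsub>free_forms n\<^esub> cf b = cf (a * b)" "cf a \<oplus>\<^bsub>free_forms n\<^esub> cf b = cf (a + b)"
  "\<zero>\<^bsub>free_forms n\<^esub> = cf 0" "\<one>\<^bsub>free_forms n\<^esub> = cf 1"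
  by (auto simp: free_forms_def times_pform.rep_eq plus_pform.rep_eq zero_pform.rep_eq one_pform.rep_eq)

lemma ring_free_forms: "ring (free_forms n :: 'k::field_char_0 form ring)"
proof (intro ringI abelian_groupI monoidI)
  fix x :: "'k form" assume "x \<in> carrier (free_forms n)"
  then obtain a where a: "fr n a" "x = cf a" by (auto simp: carrier_free_forms)
  have "cf (- a) \<in> carrier (free_forms n)" "cf (- a) \<oplus>\<^bsub>free_forms n\<^esub> x = \<zero>\<^bsub>free_forms n\<^esub>"
    using a by (auto simp: carrier_free_forms simp del: cf_simps)
  then show "\<exists>y\<in>carrier (free_forms n). y \<oplus>\<^bsub>free_forms n\<^esub> x = \<zero>\<^bsub>free_forms n\<^esub>" by blast
qed (auto simp: carrier_free_forms algebra_simps simp del: cf_simps intro!: imageI)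

lemma a_minus_free_forms: "fr n a \<Longrightarrow> fr n b \<Longrightarrow> cf a \<ominus>\<^bsub>free_forms n\<^esub> cf b = cf (a - (b :: 'k::field_char_0 pform))"
proof -
  interpret ring "free_forms n :: 'k form ring" by (rule ring_free_forms)
  assume ab: "fr n a" "fr n b"
  have "\<ominus>\<^bsub>free_forms n\<^esub> cf b = cf (- b)"
    by (rule minus_equality) (use ab in \<open>auto simp: carrier_free_forms simp del: cf_simps\<close>)
  then show ?thesis by (simp add: a_minus_def del: cf_simps)
qed

lemma ideal_kernel: "ideal (cf ` {a. fr n a \<and> nf n 0 a = 0}) (free_forms n :: 'k::field_char_0 form ring)"
proof (rule idealI)
  interpret ring "free_forms n :: 'k form ring" by (rule ring_free_forms)
  have inv: "inv\<^bsub>add_monoid (free_forms n)\<^esub> cf a = cf (- a)" if "fr n a" for a :: "'k pform"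
  proof -
    have "\<ominus>\<^bsub>free_forms n\<^esub> cf a = cf (- a)"
      by (rule minus_equality) (use that in \<open>auto simp: carrier_free_forms simp del: cf_simps\<close>)
    then show ?thesis by (simp only: a_inv_def)
  qed
  show "subgroup (cf ` {a. fr n a \<and> nf n 0 a = 0}) (add_monoid (free_forms n :: 'k form ring))"
  proof (rule subgroup.intro)
    fix x assume "x \<in> cf ` {a :: 'k pform. fr n a \<and> nf n 0 a = 0}"
    then obtain a :: "'k pform" where a: "fr n a" "nf n 0 a = 0" "x = cf a" by auto
    then have "cf (- a) \<in> cf ` {a. fr n a \<and> nf n 0 a = 0}" by (intro imageI) simp
    then show "inv\<^bsub>add_monoid (free_forms n)\<^esub> x \<in> cf ` {a. fr n a \<and> nf n 0 a = 0}"
      unfolding a(3) inv[OF a(1)] .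
  qed (auto simp: carrier_free_forms simp del: cf_simps intro!: imageI)
qed (auto simp: ring_free_forms carrier_free_forms simp del: cf_simps intro!: imageI)

text \<open>The generators lie in the kernel since elimination makes the \<open>t_i\<close> add up
  to 1. Conversely \<open>a - nf n 0 a\<close> lies in the ideal for every \<open>a\<close>: this
  holds for generators of the algebra and passes to sums and products.\<close>

lemma nabla_ideal_eq: "nabla_ideal n = cf ` {a :: 'k::field_char_0 pform. fr n a \<and> nf n 0 a = 0}"
proof -
  interpret ring "free_forms n :: 'k form ring" by (rule ring_free_forms)
  let ?S = "{form_monom ((\<Sum>i\<le>n. mp_var i) - 1) {}, (\<lambda>I. \<Sum>i\<le>n. form_monom 1 {i} I)} :: 'k form set"
  let ?x = "(\<Sum>i\<le>n. Xv i) - 1 :: 'k pform" and ?y = "\<Sum>i\<le>n. dtv i :: 'k pform"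
  have S: "?S = {cf ?x, cf ?y}"
  proof -
    have "form_monom ((\<Sum>i\<le>n. mp_var i) - 1) {} = cf ?x"
      by (auto simp: fun_eq_iff form_monom_def cf_Pf cf_1 sum_negf)
    moreover have "(\<lambda>I. \<Sum>i\<le>n. form_monom 1 {i} I) = cf ?y"
      by (auto simp: fun_eq_iff form_monom_def cf_ee)
    ultimately show ?thesis by simp
  qed
  have fr: "fr n ?x" "fr n ?y" by (auto intro!: fr_simps(5) fr_sum)
  have X: "nf n 0 (\<Sum>i\<le>n. Xv i) = (1 :: 'k pform)"
    using sum_nfs[of 0 n, where ?'a = 'k] by (simp add: nf_def flip: Pf_sum)
  have y: "?y = dd (\<Sum>i\<le>n. Xv i)" by simp
  have ker: "nf n 0 ?x = 0" "nf n 0 ?y = 0" using X unfolding y nf_dd by simp_all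
  have Sc: "?S \<subseteq> carrier (free_forms n)" unfolding S using fr by (auto simp: carrier_free_forms simp del: cf_simps cf_sum)
  have "nabla_ideal n \<subseteq> cf ` {a :: 'k pform. fr n a \<and> nf n 0 a = 0}"
    unfolding nabla_ideal_def
    by (rule genideal_minimal[OF ideal_kernel]) (use S fr ker in auto)
  moreover have "cf ` {a :: 'k pform. fr n a \<and> nf n 0 a = 0} \<subseteq> nabla_ideal n"
  proof -
    interpret I: ideal "nabla_ideal n" "free_forms n :: 'k form ring"
      unfolding nabla_ideal_def by (rule genideal_ideal[OF Sc])
    have N: "nabla_ideal n = Idl\<^bsub>free_forms n\<^esub> {cf ?x, cf ?y}" by (simp only: nabla_ideal_def S)
    have J: "cf (0 :: 'k pform) \<in> nabla_ideal n" "cf ?x \<in> nabla_ideal n" "cf ?y \<in> nabla_ideal n"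
      using I.zero_closed genideal_self[OF Sc] unfolding S N by (simp_all del: cf_simps cf_sum)
    have Jadd: "cf (a + b) \<in> nabla_ideal n" if "cf a \<in> nabla_ideal n" "cf b \<in> nabla_ideal n" for a b :: "'k pform"
      using I.a_closed[OF that] by simp
    have Jl: "cf (a * b) \<in> nabla_ideal n" "cf (b * a) \<in> nabla_ideal n"
      if "fr n a" "cf b \<in> nabla_ideal n" for a b :: "'k pform"
      using I.I_l_closed[OF that(2), of "cf a"] I.I_r_closed[OF that(2), of "cf a"] that(1) by (auto simp: carrier_free_forms)
    have main: "fr n a \<and> cf (a - nf n 0 a) \<in> nabla_ideal n" if "fr n a" for a :: "'k pform"
    proof (rule pform_induct_on[where V = "{..n}" and Q = "\<lambda>a. fr n a \<and> cf (a - nf n 0 a) \<in> nabla_ideal n"])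
      fix c :: 'k show "fr n (sc c :: 'k pform) \<and> cf (sc c - nf n 0 (sc c) :: 'k pform) \<in> nabla_ideal n" using J(1) by simp
    next
      fix i assume i: "i \<in> {..n}"
      \<comment> \<open>Elimination changes \<open>t_0\<close> only, and it does so by the relation
        itself; likewise for the differentials below.\<close>
      have "Xv i - nf n 0 (Xv i) = (if i = 0 then ?x else 0 :: 'k pform)"
        by (simp add: nf_def nfs_def sum.remove[of "{..n}" 0])
      then show "fr n (Xv i :: 'k pform) \<and> cf (Xv i - nf n 0 (Xv i) :: 'k pform) \<in> nabla_ideal n" using i J by auto
      have "dtv i - nf n 0 (dtv i) = (if i = 0 then ?y else 0 :: 'k pform)"
        by (simp add: nf_def nfs_def sub_dtv sum.remove[of "{..n}" 0])
      then show "fr n (dtv i :: 'k pform) \<and> cf (dtv i - nf n 0 (dtv i) :: 'k pform) \<in> nabla_ideal n" using i J by auto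
    next
      fix a b :: "'k pform"
      assume ab: "fr n a \<and> cf (a - nf n 0 a) \<in> nabla_ideal n" "fr n b \<and> cf (b - nf n 0 b) \<in> nabla_ideal n"
      have "a + b - nf n 0 (a + b) = (a - nf n 0 a) + (b - nf n 0 b)" by (simp add: algebra_simps)
      then show "fr n (a + b) \<and> cf (a + b - nf n 0 (a + b)) \<in> nabla_ideal n"
        using ab Jadd by (metis fr_simps(4))
      have "a * b - nf n 0 (a * b) = (a - nf n 0 a) * b + nf n 0 a * (b - nf n 0 b)" by (simp add: algebra_simps)
      then show "fr n (a * b) \<and> cf (a * b - nf n 0 (a * b)) \<in> nabla_ideal n"
        using ab Jadd Jl fr_nf by (metis fr_simps(6))
    qed (use that in \<open>auto simp: fr_iff_over over_def\<close>)
    show ?thesis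
    proof (rule image_subsetI)
      fix a :: "'k pform" assume "a \<in> {a. fr n a \<and> nf n 0 a = 0}"
      then show "cf a \<in> nabla_ideal n" using main[of a] by simp
    qed
  qed
  ultimately show ?thesis by blast
qed

lemma ideal_nabla: "ideal (nabla_ideal n) (free_forms n :: 'k::field_char_0 form ring)"
  unfolding nabla_ideal_eq by (rule ideal_kernel)

definition cl :: "nat \<Rightarrow> 'k::field_char_0 pform \<Rightarrow> 'k form set" where
  "cl n a = nabla_class n (cf a)"

lemma cl_eq_iff:
  assumes "fr n a" "fr n b"
  shows "cl n a = cl n b \<longleftrightarrow> eqv n a (b :: 'k::field_char_0 pform)"
proof -
  interpret I: ideal "nabla_ideal n" "free_forms n :: 'k form ring" by (rule ideal_nabla)
  have "cl n a = cl n b \<longleftrightarrow> cf a \<ominus>\<^bsub>free_forms n\<^esub> cf b \<in> nabla_ideal n"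
    unfolding cl_def nabla_class_def
    by (rule ring.quotient_eq_iff_same_a_r_cos[OF ring_free_forms ideal_nabla, symmetric])
      (use assms in \<open>auto simp: carrier_free_forms\<close>)
  also have "\<dots> \<longleftrightarrow> eqv n a b"
    unfolding a_minus_free_forms[OF assms] nabla_ideal_eq eqv_def
    using assms by (auto simp: cf_inject simp del: cf_simps intro!: image_eqI[of _ _ "a - b"])
  finally show ?thesis .
qed

lemma cl_elements:
  assumes "fr n a" shows "cl n a = cf ` {b :: 'k::field_char_0 pform. fr n b \<and> eqv n b a}"
proof (intro equalityI subsetI)
  fix w assume "w \<in> cl n a"
  then obtain k where k: "fr n k" "nf n 0 k = 0" "w = cf k \<oplus>\<^bsub>free_forms n\<^esub> cf a"
    unfolding cl_def nabla_class_def a_r_coset_def' nabla_ideal_eq by auto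
  then show "w \<in> cf ` {b. fr n b \<and> eqv n b a}"
    using assms by (auto simp: eqv_def simp del: cf_simps intro!: imageI)
next
  fix w assume "w \<in> cf ` {b. fr n b \<and> eqv n b a}"
  then obtain b where b: "fr n b" "eqv n b a" "w = cf b" by auto
  have "w = cf (b - a) \<oplus>\<^bsub>free_forms n\<^esub> cf a" using b by (simp del: cf_simps)
  moreover have "cf (b - a) \<in> nabla_ideal n" using b assms unfolding nabla_ideal_eq by (auto simp: eqv_def simp del: cf_simps)
  ultimately show "w \<in> cl n a" unfolding cl_def nabla_class_def a_r_coset_def' by blast
qed

lemma nabla_add: "fr n a \<Longrightarrow> fr n b \<Longrightarrow> cl n a \<oplus>\<^bsub>nabla_ring n\<^esub> cl n b = cl n (a + b)"
  unfolding nabla_ring_def FactRing_def cl_def nabla_class_def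
  using abelian_subgroup.a_rcos_sum[OF abelian_subgroupI3[OF ideal.axioms(1)[OF ideal_nabla] ring.is_abelian_group[OF ring_free_forms]], of "cf a" n "cf b"]
  by (auto simp: carrier_free_forms simp del: cf_simps)

lemma nabla_mult: "fr n a \<Longrightarrow> fr n b \<Longrightarrow> cl n a \<otimes>\<^bsub>nabla_ring n\<^esub> cl n b = cl n (a * b)"
  unfolding nabla_ring_def FactRing_def cl_def nabla_class_def
  using ideal.rcoset_mult_add[OF ideal_nabla, of "cf a" n "cf b"]
  by (auto simp: carrier_free_forms simp del: cf_simps)

lemma nabla_zero: "\<zero>\<^bsub>nabla_ring n\<^esub> = cl n (0 :: 'k::field_char_0 pform)"
proof -
  have "cl n (0 :: 'k pform) = nabla_ideal n" unfolding cl_elements[OF fr_simps(2)] nabla_ideal_eq eqv_def by simp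
  then show ?thesis by (simp add: nabla_ring_def FactRing_def)
qed

lemma nabla_smult_cl: "fr n a \<Longrightarrow> nabla_smult n c (cl n a) = cl n (sc c * a)"
proof -
  have "form_monom (mp_const c) {} = cf (sc c)" by (auto simp: fun_eq_iff form_monom_def sc_def cf_Pf)
  then show "fr n a \<Longrightarrow> ?thesis" unfolding nabla_smult_def using nabla_mult[of n "sc c" a] by (simp add: cl_def)
qed

text \<open>The definition takes the union over all representatives. By \<open>eqv_dd\<close> they
  all yield one class, and the union over a nonempty set collapses to it;
  \<open>nabla_subst_cl\<close> below works in the same way.\<close>

lemma nabla_d_cl: "fr n a \<Longrightarrow> nabla_d n (cl n a) = cl n (dd a)"
proof -
  assume a: "fr n a"
  have "nabla_class n (form_d w) = cl n (dd a)" if "w \<in> cl n a" for w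
  proof -
    obtain b where b: "fr n b" "eqv n b a" "w = cf b" using \<open>w \<in> cl n a\<close> unfolding cl_elements[OF a] by auto
    then have "nabla_class n (form_d w) = cl n (dd b)" by (simp add: cl_def dd.rep_eq)
    then show ?thesis using a b by (simp add: cl_eq_iff eqv_dd)
  qed
  moreover have "cl n a \<noteq> {}" unfolding cl_elements[OF a] using a by auto
  ultimately show ?thesis by (auto simp: nabla_d_def)
qed

lemma cf_prod_list: "cf (prod_list (map x xs)) = foldr form_mult (map (\<lambda>i. cf (x i)) xs) (form_monom 1 {})"
  by (induction xs) (auto simp: one_pform.rep_eq times_pform.rep_eq)

lemma form_subst_cf: "fr n b \<Longrightarrow> form_subst n g (cf b) = cf (sub g b)"
proof
  fix K
  assume b: "fr n b"
  have d: "form_d (form_monom (g i) {}) = cf (dd (Pf (g i)))" for i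
    by (simp add: dd.rep_eq Pf_def pf_monom.rep_eq)
  have "sub g b = (\<Sum>I\<in>Pow {..n}. Pf (mp_subst g (cf b I)) * ext_prod (\<lambda>i. dd (Pf (g i))) I)"
    by (rule sub_superset) (use b in \<open>auto simp: fr_iff_over over_def\<close>)
  then show "form_subst n g (cf b) K = cf (sub g b) K"
    by (simp add: form_subst_def d ext_prod_def cf_prod_list)
qed

lemma nabla_subst_cl:
  assumes "vertex_map n r g \<phi>" "\<And>b. fr n b \<Longrightarrow> fr r (sub g b)" "fr n a"
  shows "nabla_subst n r g (cl n a) = cl r (sub g a)"
proof -
  have "nabla_class r (form_subst n g w) = cl r (sub g a)" if "w \<in> cl n a" for w
  proof -
    obtain b where b: "fr n b" "eqv n b a" "w = cf b" using \<open>w \<in> cl n a\<close> unfolding cl_elements[OF assms(3)] by auto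
    then have "nabla_class r (form_subst n g w) = cl r (sub g b)" by (simp add: cl_def form_subst_cf)
    then show ?thesis using assms b eqv_sub[OF assms(1)] by (simp add: cl_eq_iff)
  qed
  moreover have "cl n a \<noteq> {}" unfolding cl_elements[OF assms(3)] using assms by auto
  ultimately show ?thesis by (auto simp: nabla_subst_def)
qed

lemma nabla_face_cl: "i \<le> Suc n \<Longrightarrow> fr (Suc n) a \<Longrightarrow> nabla_subst (Suc n) n (face_subst i) (cl (Suc n) a) = cl n (fc i a)"
  by (rule nabla_subst_cl[OF vertex_map_face]) (auto intro: fr_face)

lemma nabla_degen_cl: "i \<le> n \<Longrightarrow> fr n a \<Longrightarrow> nabla_subst n (Suc n) (degen_subst i) (cl n a) = cl (Suc n) (dg i a)"
  by (rule nabla_subst_cl[OF vertex_map_degen]) (auto intro: fr_degen)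

section \<open>Homogeneous parts and their integrals\<close>

lemma nabla_eq: "nabla n q = cl n ` {a :: 'k::field_char_0 pform. fr n a \<and> homog q a}"
  unfolding nabla_def carrier_free_forms cl_def homog_def by (auto simp: image_iff)

text \<open>Here the real integral meets the algebraic one: both take Dirichlet's value on
  monomials.\<close>

lemma mp_integral_eq:
  assumes "f \<in> mpolys_over {1..n}"
  shows "mp_integral n f = II n (Pf f * ee {1..n} :: 'k::field_char_0 pform)"
proof -
  have "Pf f = (\<Sum>m\<in>supp f. sc (coef f m) * Pf (sgl m 1))"
    by (subst poly_mapping_sum_sgls[of f], simp only: Pf_sum)
      (intro sum.cong refl, subst sgl_mult, simp only: Pf_simps sc_def)
  then have "II n (Pf f * ee {1..n}) = (\<Sum>m\<in>supp f. coef f m * II n (Pf (sgl m 1) * ee {1..n}))"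
    by (simp add: sum_distrib_right mult.assoc)
  also have "\<dots> = (\<Sum>m\<in>supp f. coef f m * of_rat (monom_integral n m))"
  proof (intro sum.cong refl)
    fix m assume "m \<in> supp f"
    then have "supp m \<subseteq> {1..n}" using assms by (auto simp: mpolys_over_def)
    then show "coef f m * II n (Pf (sgl m 1) * ee {1..n}) = coef f m * of_rat (monom_integral n m)"
      unfolding monom_integral_eq II_sgl[OF \<open>supp m \<subseteq> {1..n}\<close>] by (simp add: of_rat_divide of_rat_prod of_rat_fact)
  qed
  finally show ?thesis by (simp add: mp_integral_def)
qed

text \<open>Eliminating \<open>t_0\<close> leaves a form in \<open>t_1, ..., t_n\<close>; in degree
  \<open>n\<close> its only possible monomial of differentials is \<open>dt_1 ... dt_n\<close>,
  which gives the required representative. The definite description ranges over the value of the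
  integral, whose uniqueness is \<open>II_cong\<close>.\<close>

lemma form_integral_cl:
  assumes a: "fr n a" "homog n a"
  shows "form_integral n (cl n a) = II n (a :: 'k::field_char_0 pform)"
proof -
  have cl': "nabla_class n (form_monom f {1..n}) = cl n (Pf f * ee {1..n})" for f :: "'k mpoly"
  proof -
    have "form_monom f {1..n} = cf (Pf f * ee {1..n})" by (auto simp: fun_eq_iff form_monom_def cf_ee)
    then show ?thesis by (simp add: cl_def)
  qed
  have frf: "fr n (Pf f * ee {1..n})" if "f \<in> mpolys_over {1..n}" for f :: "'k mpoly"
    using that by (auto simp: fr_iff_over over_def cf_ee mpolys_over_def) fastforce+
  let ?b = "nf n 0 a"
  have "sub (restr {1..n}) ?b = ?b"
  proof -
    have "sub (trunc n) (sub (kill 0) ?b) = ?b" using fr_nf[OF a(1), of 0] by (simp add: sub_kill_nf fr_def)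
    moreover have "mp_subst (trunc n) (kill 0 j) = (restr {1..n} j :: 'k mpoly)" for j
      by (auto simp: trunc_def kill_def restr_def)
    ultimately show ?thesis by (simp add: sub_sub)
  qed
  then have b: "over {1..n} ?b" using over_restr[of "{1..n}" ?b] by simp
  have bh: "homog n ?b" using a by auto
  let ?f = "cf ?b {1..n}"
  have "?b = Pf ?f * ee {1..n}"
  proof (rule pform_eqI)
    fix I :: "nat set" assume "finite I"
    have "I = {1..n}" if "cf ?b I \<noteq> 0"
      using that b bh by (intro card_subset_eq) (auto simp: over_def homog_def)
    then show "cf ?b I = cf (Pf ?f * ee {1..n}) I" by (auto simp: cf_ee)
  qed
  moreover have f: "?f \<in> mpolys_over {1..n}" using b by (auto simp: over_def)
  moreover have "cl n a = cl n ?b" using a by (simp add: cl_eq_iff fr_nf eqv_sym[OF eqv_nf])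
  ultimately have ex: "cl n a = nabla_class n (form_monom ?f {1..n})" using cl' by metis
  show ?thesis
    unfolding form_integral_def
  proof (rule the_equality)
    have e: "mp_integral n f = II n a" if "f \<in> mpolys_over {1..n}" "cl n a = nabla_class n (form_monom f {1..n})" for f
      using that a frf[OF that(1)] II_cong unfolding mp_integral_eq[OF that(1)] cl' by (metis cl_eq_iff)
    show "\<exists>f\<in>mpolys_over {1..n}. cl n a = nabla_class n (form_monom f {1..n}) \<and> II n a = mp_integral n f"
      using f ex e by metis
    show "c = II n a" if "\<exists>f\<in>mpolys_over {1..n}. cl n a = nabla_class n (form_monom f {1..n}) \<and> c = mp_integral n f" for c
      using that e by metis
  qed
qed

section \<open>Cohomology\<close>

text \<open>The structure by which \<open>cohomologous\<close> is an equivalence relation compatible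
  with addition and scalars. Negatives are existential because \<open>dg\<close> has no operation
  for them.\<close>

locale lin_complex =
  fixes A :: "('k::field_char_0, 'm) dg"
  assumes zero_closed: "dg_zero A q \<in> dg_carrier A q"
    and add_closed: "x \<in> dg_carrier A q \<Longrightarrow> y \<in> dg_carrier A q \<Longrightarrow> dg_add A q x y \<in> dg_carrier A q"
    and add_assoc: "x \<in> dg_carrier A q \<Longrightarrow> y \<in> dg_carrier A q \<Longrightarrow> z \<in> dg_carrier A q \<Longrightarrow>
      dg_add A q (dg_add A q x y) z = dg_add A q x (dg_add A q y z)"
    and add_comm: "x \<in> dg_carrier A q \<Longrightarrow> y \<in> dg_carrier A q \<Longrightarrow> dg_add A q x y = dg_add A q y x"
    and add_zero: "x \<in> dg_carrier A q \<Longrightarrow> dg_add A q (dg_zero A q) x = x"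
    and neg: "x \<in> dg_carrier A q \<Longrightarrow> \<exists>y\<in>dg_carrier A q. dg_add A q x y = dg_zero A q"
    and smult_closed: "x \<in> dg_carrier A q \<Longrightarrow> dg_smult A q c x \<in> dg_carrier A q"
    and smult_add: "x \<in> dg_carrier A q \<Longrightarrow> y \<in> dg_carrier A q \<Longrightarrow>
      dg_smult A q c (dg_add A q x y) = dg_add A q (dg_smult A q c x) (dg_smult A q c y)"
    and d_closed: "x \<in> dg_carrier A q \<Longrightarrow> dg_d A q x \<in> dg_carrier A (Suc q)"
    and d_add: "x \<in> dg_carrier A q \<Longrightarrow> y \<in> dg_carrier A q \<Longrightarrow>
      dg_d A q (dg_add A q x y) = dg_add A (Suc q) (dg_d A q x) (dg_d A q y)"
    and d_smult: "x \<in> dg_carrier A q \<Longrightarrow> dg_d A q (dg_smult A q c x) = dg_smult A (Suc q) c (dg_d A q x)"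
    and d_d: "x \<in> dg_carrier A q \<Longrightarrow> dg_d A (Suc q) (dg_d A q x) = dg_zero A (Suc (Suc q))"
begin

abbreviation "Z \<equiv> cocycles A"
abbreviation "B \<equiv> coboundaries A"
abbreviation "coh \<equiv> cohomologous A"

lemma add_zero_right: "x \<in> dg_carrier A q \<Longrightarrow> dg_add A q x (dg_zero A q) = x"
  using add_comm add_zero zero_closed by metis

lemma add_cancel:
  assumes "x \<in> dg_carrier A q" "y \<in> dg_carrier A q" "z \<in> dg_carrier A q" "dg_add A q x y = dg_add A q x z"
  shows "y = z"
proof -
  obtain x' where x': "x' \<in> dg_carrier A q" "dg_add A q x x' = dg_zero A q" using neg assms by blast
  have "dg_add A q x' (dg_add A q x w) = w" if "w \<in> dg_carrier A q" for w
    using that x' assms(1) by (metis add_assoc add_comm add_zero)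
  then show ?thesis using assms by metis
qed

lemma idem_zero: "x \<in> dg_carrier A q \<Longrightarrow> dg_add A q x x = x \<Longrightarrow> x = dg_zero A q"
  using add_cancel[of x q x "dg_zero A q"] add_zero_right zero_closed by metis

lemma d_zero: "dg_d A q (dg_zero A q) = dg_zero A (Suc q)"
  by (rule idem_zero) (metis d_closed zero_closed, metis add_zero d_add zero_closed)

lemma smult_zero: "dg_smult A q c (dg_zero A q) = dg_zero A q"
  by (rule idem_zero) (metis smult_closed zero_closed, metis add_zero smult_add zero_closed)

lemma Z_carrier: "x \<in> Z q \<Longrightarrow> x \<in> dg_carrier A q" by (simp add: cocycles_def)

lemma Z_add: "x \<in> Z q \<Longrightarrow> y \<in> Z q \<Longrightarrow> dg_add A q x y \<in> Z q"
  by (simp add: cocycles_def add_closed d_add add_zero zero_closed)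

lemma Z_smult: "x \<in> Z q \<Longrightarrow> dg_smult A q c x \<in> Z q"
  by (simp add: cocycles_def smult_closed d_smult smult_zero)

lemma B_Z: "x \<in> B q \<Longrightarrow> x \<in> Z q"
  by (cases q) (auto simp: coboundaries_def cocycles_def zero_closed d_zero d_closed d_d)

lemma B_zero: "dg_zero A q \<in> B q"
proof (cases q)
  case (Suc r)
  have "dg_d A r (dg_zero A r) \<in> B q" using Suc zero_closed by (auto simp: coboundaries_def)
  then show ?thesis using Suc by (simp add: d_zero)
qed (simp add: coboundaries_def)

lemma B_add: "x \<in> B q \<Longrightarrow> y \<in> B q \<Longrightarrow> dg_add A q x y \<in> B q"
proof (cases q)
  case (Suc r)
  assume "x \<in> B q" "y \<in> B q"
  then obtain u v where "u \<in> dg_carrier A r" "x = dg_d A r u" "v \<in> dg_carrier A r" "y = dg_d A r v"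
    using Suc by (auto simp: coboundaries_def)
  then show ?thesis using Suc by (auto simp: coboundaries_def d_add[symmetric] add_closed)
qed (auto simp: coboundaries_def add_zero zero_closed)

lemma B_smult: "x \<in> B q \<Longrightarrow> dg_smult A q c x \<in> B q"
  by (cases q) (auto simp: coboundaries_def smult_zero d_smult[symmetric] smult_closed)

lemma B_neg: "x \<in> B q \<Longrightarrow> \<exists>y\<in>B q. dg_add A q x y = dg_zero A q"
proof (cases q)
  case (Suc r)
  assume "x \<in> B q"
  then obtain u where u: "u \<in> dg_carrier A r" "x = dg_d A r u" using Suc by (auto simp: coboundaries_def)
  obtain u' where u': "u' \<in> dg_carrier A r" "dg_add A r u u' = dg_zero A r" using neg u by blast
  then have "dg_add A q x (dg_d A r u') = dg_zero A q" using u Suc d_add d_zero by metis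
  then show ?thesis using u' Suc by (auto simp: coboundaries_def)
qed (auto simp: coboundaries_def add_zero zero_closed)

lemma coh_iff: "(x, y) \<in> coh q \<longleftrightarrow> x \<in> Z q \<and> y \<in> Z q \<and> (\<exists>b\<in>B q. y = dg_add A q x b)"
  by (simp add: cohomologous_def)

lemma coh_refl: "x \<in> Z q \<Longrightarrow> (x, x) \<in> coh q"
  using B_zero add_zero_right Z_carrier unfolding coh_iff by metis

lemma coh_trans: "(x, y) \<in> coh q \<Longrightarrow> (y, z) \<in> coh q \<Longrightarrow> (x, z) \<in> coh q"
  unfolding coh_iff using add_assoc B_add B_Z Z_carrier by metis

lemma coh_sym: "(x, y) \<in> coh q \<Longrightarrow> (y, x) \<in> coh q"
proof -
  assume "(x, y) \<in> coh q"
  then obtain b where b: "x \<in> Z q" "y \<in> Z q" "b \<in> B q" "y = dg_add A q x b" unfolding coh_iff by auto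
  obtain b' where "b' \<in> B q" "dg_add A q b b' = dg_zero A q" using B_neg b by blast
  then have "x = dg_add A q y b'" using b by (metis add_assoc B_Z Z_carrier add_zero_right)
  then show ?thesis unfolding coh_iff using b \<open>b' \<in> B q\<close> by blast
qed

lemma coh_add: "(x, x') \<in> coh q \<Longrightarrow> (y, y') \<in> coh q \<Longrightarrow> (dg_add A q x y, dg_add A q x' y') \<in> coh q"
proof -
  assume "(x, x') \<in> coh q" "(y, y') \<in> coh q"
  then obtain b c where b: "x \<in> Z q" "x' \<in> Z q" "b \<in> B q" "x' = dg_add A q x b"
    "y \<in> Z q" "y' \<in> Z q" "c \<in> B q" "y' = dg_add A q y c" unfolding coh_iff by auto
  have car: "x \<in> dg_carrier A q" "y \<in> dg_carrier A q" "b \<in> dg_carrier A q" "c \<in> dg_carrier A q"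
    using b Z_carrier B_Z by auto
  have "dg_add A q x' y' = dg_add A q (dg_add A q x y) (dg_add A q b c)"
    unfolding b using car by (metis add_assoc add_comm add_closed)
  then show ?thesis unfolding coh_iff using b Z_add B_add by metis
qed

lemma coh_smult: "(x, x') \<in> coh q \<Longrightarrow> (dg_smult A q c x, dg_smult A q c x') \<in> coh q"
  unfolding coh_iff using smult_add Z_smult B_smult B_Z Z_carrier by metis

lemma class_eq: "(x, y) \<in> coh q \<Longrightarrow> coh q `` {x} = coh q `` {y}"
  using coh_sym coh_trans by blast

lemma class_mem: "x \<in> Z q \<Longrightarrow> x \<in> coh q `` {x}"
  using coh_refl by blast

lemma class_eqD: "coh q `` {x} = coh q `` {y} \<Longrightarrow> y \<in> Z q \<Longrightarrow> (x, y) \<in> coh q"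
  using class_mem by blast

lemma cohomologyE:
  assumes "a \<in> cohomology A q"
  obtains x where "x \<in> Z q" "a = coh q `` {x}"
  using assms by (auto simp: cohomology_def quotient_def)

lemma cohomologyI: "x \<in> Z q \<Longrightarrow> coh q `` {x} \<in> cohomology A q"
  by (auto simp: cohomology_def quotient_def)

text \<open>Operations on cohomology are unions of classes over representatives. Such a union is a
  single class as soon as all results are cohomologous to one element.\<close>

lemma UN_class:
  assumes "a \<noteq> {}" "\<And>x. x \<in> a \<Longrightarrow> (u, F x) \<in> coh q"
  shows "(\<Union>x\<in>a. coh q `` {F x}) = coh q `` {u}"
proof -
  have "(\<Union>x\<in>a. coh q `` {F x}) = (\<Union>x\<in>a. coh q `` {u})"
    by (rule SUP_cong[OF refl]) (rule class_eq[symmetric, OF assms(2)])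
  then show ?thesis using assms(1) by simp
qed

lemma coh_add_class:
  assumes "x \<in> Z q" "y \<in> Z q"
  shows "coh_add A q (coh q `` {x}) (coh q `` {y}) = coh q `` {dg_add A q x y}"
proof -
  have "(\<Union>y'\<in>coh q `` {y}. coh q `` {dg_add A q x' y'}) = coh q `` {dg_add A q x y}" if "(x, x') \<in> coh q" for x'
    using that assms class_mem[OF assms(2)] by (intro UN_class) (auto intro: coh_add)
  then show ?thesis unfolding coh_add_def using class_mem[OF assms(1)] by auto
qed

lemma coh_smult_class:
  assumes "x \<in> Z q"
  shows "coh_smult A q c (coh q `` {x}) = coh q `` {dg_smult A q c x}"
  unfolding coh_smult_def using assms class_mem[OF assms] by (intro UN_class) (auto intro: coh_smult)

end

text \<open>Surjectivity is asked on the nose for cocycles, which the identity between integration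
  and Whitney's map supplies. Products are compared up to coboundaries only.\<close>

locale coh_pair = A: lin_complex A + C: lin_complex C
  for A :: "('k::field_char_0, 'm) dg" and C :: "('k, 'n) dg" +
  fixes r :: "nat \<Rightarrow> 'm \<Rightarrow> 'n"
  assumes cm: "cochain_map A C r"
    and surj: "z \<in> cocycles C q \<Longrightarrow> \<exists>x\<in>cocycles A q. r q x = z"
    and inj: "x \<in> cocycles A q \<Longrightarrow> r q x \<in> coboundaries C q \<Longrightarrow> x \<in> coboundaries A q"
    and mult: "x \<in> cocycles A p \<Longrightarrow> y \<in> cocycles A q \<Longrightarrow>
      (dg_mult C p q (r p x) (r q y), r (p + q) (dg_mult A p q x y)) \<in> cohomologous C (p + q)"
    and mult_A: "(x, x') \<in> cohomologous A p \<Longrightarrow> (y, y') \<in> cohomologous A q \<Longrightarrow>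
      (dg_mult A p q x y, dg_mult A p q x' y') \<in> cohomologous A (p + q)"
begin

lemma r_closed: "x \<in> dg_carrier A q \<Longrightarrow> r q x \<in> dg_carrier C q"
  and r_d: "x \<in> dg_carrier A q \<Longrightarrow> r (Suc q) (dg_d A q x) = dg_d C q (r q x)"
  and r_add: "x \<in> dg_carrier A q \<Longrightarrow> y \<in> dg_carrier A q \<Longrightarrow> r q (dg_add A q x y) = dg_add C q (r q x) (r q y)"
  and r_smult: "x \<in> dg_carrier A q \<Longrightarrow> r q (dg_smult A q c x) = dg_smult C q c (r q x)"
  using cm by (auto simp: cochain_map_def)

lemma r_zero: "r q (dg_zero A q) = dg_zero C q"
  by (rule C.idem_zero) (metis r_closed A.zero_closed, metis A.add_zero r_add A.zero_closed)

lemma r_Z: "x \<in> cocycles A q \<Longrightarrow> r q x \<in> cocycles C q"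
  by (auto simp: cocycles_def r_closed r_d[symmetric] r_zero)

lemma r_B: "x \<in> coboundaries A q \<Longrightarrow> r q x \<in> coboundaries C q"
  by (cases q) (auto simp: coboundaries_def r_zero r_d r_closed)

lemma r_coh_iff:
  assumes "x \<in> cocycles A q" "x' \<in> cocycles A q"
  shows "(r q x, r q x') \<in> cohomologous C q \<longleftrightarrow> (x, x') \<in> cohomologous A q"
proof
  assume "(x, x') \<in> cohomologous A q"
  then obtain b where b: "b \<in> coboundaries A q" "x' = dg_add A q x b" by (auto simp: A.coh_iff)
  then have "r q x' = dg_add C q (r q x) (r q b)" using assms A.B_Z A.Z_carrier r_add by metis
  then show "(r q x, r q x') \<in> cohomologous C q"
    using r_Z[OF assms(1)] r_Z[OF assms(2)] r_B[OF b(1)] unfolding C.coh_iff by metis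
next
  assume "(r q x, r q x') \<in> cohomologous C q"
  then obtain b where b: "b \<in> coboundaries C q" "r q x' = dg_add C q (r q x) b" by (auto simp: C.coh_iff)
  obtain y where y: "y \<in> dg_carrier A q" "dg_add A q x y = dg_zero A q" using A.neg A.Z_carrier assms by blast
  \<comment> \<open>As \<open>y\<close> is the negative of \<open>x\<close>, this is the difference
    \<open>x' - x\<close>; it is the cocycle to which \<open>inj\<close> is applied.\<close>
  let ?e = "dg_add A q y x'"
  have car: "x \<in> dg_carrier A q" "x' \<in> dg_carrier A q" using assms A.Z_carrier by auto
  have e: "dg_add A q x ?e = x'" "?e \<in> dg_carrier A q"
    using y car by (metis A.add_assoc A.add_zero, metis A.add_closed)
  have dd: "dg_d A q x = dg_zero A (Suc q)" "dg_d A q x' = dg_zero A (Suc q)" using assms by (auto simp: cocycles_def)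
  then have "dg_d A q ?e = dg_zero A (Suc q)"
    using e car A.d_add[of x q ?e] A.add_zero A.d_closed by metis
  then have eZ: "?e \<in> cocycles A q" using e by (simp add: cocycles_def)
  have "dg_add C q (r q x) (r q ?e) = dg_add C q (r q x) b"
    using b e car r_add by metis
  then have "r q ?e = b" using C.add_cancel r_closed e car b C.B_Z C.Z_carrier by metis
  then have "?e \<in> coboundaries A q" using inj eZ b by simp
  then show "(x, x') \<in> cohomologous A q" using assms e(1) unfolding A.coh_iff by metis
qed

lemma coh_map_class:
  assumes "x \<in> cocycles A q"
  shows "coh_map C r q (cohomologous A q `` {x}) = cohomologous C q `` {r q x}"
  unfolding coh_map_def
proof (rule C.UN_class)
  show "cohomologous A q `` {x} \<noteq> {}" using A.class_mem assms by blast
  fix x' assume "x' \<in> cohomologous A q `` {x}"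
  then show "(r q x, r q x') \<in> cohomologous C q" using r_coh_iff assms by (auto simp: A.coh_iff)
qed

text \<open>Well-definedness of the product is transported from \<open>A\<close>: lift the four
  cocycles along \<open>r\<close>, multiply there, and come back by \<open>mult\<close>.\<close>

lemma mult_C:
  assumes "(u, u') \<in> cohomologous C p" "(v, v') \<in> cohomologous C q"
  shows "(dg_mult C p q u v, dg_mult C p q u' v') \<in> cohomologous C (p + q)"
proof -
  obtain x x' y y' where "x \<in> cocycles A p" "r p x = u" "x' \<in> cocycles A p" "r p x' = u'"
    "y \<in> cocycles A q" "r q y = v" "y' \<in> cocycles A q" "r q y' = v'"
    using assms surj unfolding C.coh_iff by metis
  note xy = this
  then have "(x, x') \<in> cohomologous A p" "(y, y') \<in> cohomologous A q" using assms r_coh_iff by metis+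
  from mult_A[OF this] have m: "(dg_mult A p q x y, dg_mult A p q x' y') \<in> cohomologous A (p + q)" .
  then have "(r (p + q) (dg_mult A p q x y), r (p + q) (dg_mult A p q x' y')) \<in> cohomologous C (p + q)"
    using r_coh_iff by (metis A.coh_iff)
  then show ?thesis using mult xy C.coh_trans C.coh_sym by metis
qed

lemma coh_mult_class_C:
  assumes "x \<in> cocycles C p" "y \<in> cocycles C q"
  shows "coh_mult C p q (cohomologous C p `` {x}) (cohomologous C q `` {y}) = cohomologous C (p + q) `` {dg_mult C p q x y}"
proof -
  have "(\<Union>y'\<in>cohomologous C q `` {y}. cohomologous C (p + q) `` {dg_mult C p q x' y'}) = cohomologous C (p + q) `` {dg_mult C p q x y}"
    if "(x, x') \<in> cohomologous C p" for x'
    using that assms C.class_mem[OF assms(2)] by (intro C.UN_class) (auto intro: mult_C)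
  then show ?thesis unfolding coh_mult_def using C.class_mem[OF assms(1)] by auto
qed

lemma coh_mult_class_A:
  assumes "x \<in> cocycles A p" "y \<in> cocycles A q"
  shows "coh_mult A p q (cohomologous A p `` {x}) (cohomologous A q `` {y}) = cohomologous A (p + q) `` {dg_mult A p q x y}"
proof -
  have "(\<Union>y'\<in>cohomologous A q `` {y}. cohomologous A (p + q) `` {dg_mult A p q x' y'}) = cohomologous A (p + q) `` {dg_mult A p q x y}"
    if "(x, x') \<in> cohomologous A p" for x'
    using that assms A.class_mem[OF assms(2)] by (intro A.UN_class) (auto intro: mult_A)
  then show ?thesis unfolding coh_mult_def using A.class_mem[OF assms(1)] by auto
qed

theorem coh_map_bij: "bij_betw (coh_map C r q) (cohomology A q) (cohomology C q)"
  unfolding bij_betw_def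
proof
  show "inj_on (coh_map C r q) (cohomology A q)"
  proof (rule inj_onI)
    fix a b assume ab: "a \<in> cohomology A q" "b \<in> cohomology A q" "coh_map C r q a = coh_map C r q b"
    obtain x where x: "x \<in> cocycles A q" "a = cohomologous A q `` {x}" by (rule A.cohomologyE[OF ab(1)])
    obtain y where y: "y \<in> cocycles A q" "b = cohomologous A q `` {y}" by (rule A.cohomologyE[OF ab(2)])
    have "cohomologous C q `` {r q x} = cohomologous C q `` {r q y}"
      using ab(3) unfolding x(2) y(2) coh_map_class[OF x(1)] coh_map_class[OF y(1)] .
    then have "(r q x, r q y) \<in> cohomologous C q" by (rule C.class_eqD[OF _ r_Z[OF y(1)]])
    then show "a = b" unfolding x(2) y(2) using r_coh_iff[OF x(1) y(1)] A.class_eq by blast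
  qed
  show "coh_map C r q ` cohomology A q = cohomology C q"
  proof (intro equalityI subsetI)
    fix z assume "z \<in> coh_map C r q ` cohomology A q"
    then obtain a where a: "a \<in> cohomology A q" "z = coh_map C r q a" by blast
    obtain x where x: "x \<in> cocycles A q" "a = cohomologous A q `` {x}" by (rule A.cohomologyE[OF a(1)])
    show "z \<in> cohomology C q"
      unfolding a(2) x(2) coh_map_class[OF x(1)] by (rule C.cohomologyI[OF r_Z[OF x(1)]])
  next
    fix z assume z: "z \<in> cohomology C q"
    obtain y where y: "y \<in> cocycles C q" "z = cohomologous C q `` {y}" by (rule C.cohomologyE[OF z])
    obtain x where x: "x \<in> cocycles A q" "r q x = y" using surj[OF y(1)] by blast
    show "z \<in> coh_map C r q ` cohomology A q"
      unfolding y(2) x(2)[symmetric] coh_map_class[OF x(1), symmetric] by (intro imageI A.cohomologyI x)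
  qed
qed

theorem coh_map_add:
  assumes "a \<in> cohomology A q" "b \<in> cohomology A q"
  shows "coh_map C r q (coh_add A q a b) = coh_add C q (coh_map C r q a) (coh_map C r q b)"
  proof -
    obtain x where x: "x \<in> cocycles A q" "a = cohomologous A q `` {x}" by (rule A.cohomologyE[OF assms(1)])
    obtain y where y: "y \<in> cocycles A q" "b = cohomologous A q `` {y}" by (rule A.cohomologyE[OF assms(2)])
    from x y show ?thesis
      by (simp add: A.coh_add_class C.coh_add_class coh_map_class A.Z_add r_Z r_add A.Z_carrier)
  qed

theorem coh_map_smult:
  assumes "a \<in> cohomology A q"
  shows "coh_map C r q (coh_smult A q c a) = coh_smult C q c (coh_map C r q a)"
  proof -
    obtain x where "x \<in> cocycles A q" "a = cohomologous A q `` {x}" by (rule A.cohomologyE[OF assms])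
    then show ?thesis
      by (simp add: A.coh_smult_class C.coh_smult_class coh_map_class A.Z_smult r_Z r_smult A.Z_carrier)
  qed

theorem coh_map_mult:
  assumes ab: "a \<in> cohomology A p" "b \<in> cohomology A q"
  shows "coh_map C r (p + q) (coh_mult A p q a b) = coh_mult C p q (coh_map C r p a) (coh_map C r q b)"
  proof -
    obtain x where x: "x \<in> cocycles A p" "a = cohomologous A p `` {x}" by (rule A.cohomologyE[OF ab(1)])
    obtain y where y: "y \<in> cocycles A q" "b = cohomologous A q `` {y}" by (rule A.cohomologyE[OF ab(2)])
    note xy = x y
    have "dg_mult A p q x y \<in> cocycles A (p + q)"
      using mult_A[OF A.coh_refl A.coh_refl] xy by (metis A.coh_iff)
    then show ?thesis
      using xy C.class_eq[OF C.coh_sym[OF mult[OF xy(1,3)]]]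
      by (simp add: coh_mult_class_A coh_mult_class_C coh_map_class r_Z)
  qed

end

section \<open>Compatible families of forms on a simplicial set\<close>

definition shift :: "nat \<Rightarrow> nat set \<Rightarrow> nat set" where
  "shift i J = (\<lambda>l. if l < i then l else l - 1) ` J"

text \<open>The face of the \<open>n\<close>-simplex \<open>x\<close> spanned by the vertices in \<open>J\<close>, by deleting the largest missing vertex and
  renumbering; meaningful only for nonempty \<open>J\<close>.\<close>

primrec subf :: "'a sset \<Rightarrow> nat \<Rightarrow> nat set \<Rightarrow> 'a \<Rightarrow> 'a" where
  "subf X 0 J x = x"
| "subf X (Suc n) J x = (if J = {..Suc n} then x
    else subf X n (shift (Max ({..Suc n} - J)) J) (face X n (Max ({..Suc n} - J)) x))"

lemma inj_on_shift:
  assumes "i \<notin> (J :: nat set)" shows "inj_on (\<lambda>l. if l < i then l else l - 1) J"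
proof (rule inj_onI)
  fix x y assume xy: "x \<in> J" "y \<in> J" "(if x < i then x else x - 1) = (if y < i then y else y - 1)"
  then have "x \<noteq> i" "y \<noteq> i" using assms by auto
  then show "x = y" using xy(3) by (cases "x < i"; cases "y < i") auto
qed

lemma shift_props:
  assumes "i \<notin> J" "J \<subseteq> {..Suc n}" "i \<le> Suc n"
  shows "card (shift i J) = card J" "shift i J \<subseteq> {..n}" "face_v i ` shift i J = J"
proof -
  show "card (shift i J) = card J" unfolding shift_def by (rule card_image[OF inj_on_shift[OF assms(1)]])
  show "shift i J \<subseteq> {..n}"
  proof -
    have "(if l < i then l else l - 1) \<le> n" if "l \<in> J" for l
      using that assms by (cases "l < i") auto
    then show ?thesis unfolding shift_def by (intro image_subsetI) simp
  qed
  have "face_v i (if l < i then l else l - 1) = l" if "l \<in> J" for l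
  proof -
    have "l \<noteq> i" using that assms by auto
    then show ?thesis by (cases "l < i") (auto simp: face_v_def)
  qed
  then have "(\<lambda>l. face_v i (if l < i then l else l - 1)) ` J = (\<lambda>l. l) ` J" by (rule image_cong[OF refl])
  then show "face_v i ` shift i J = J" unfolding shift_def image_image by (simp only: image_ident)
qed

lemma shift_face_v: "shift i (face_v i ` J) = J"
proof -
  have "(if face_v i l < i then face_v i l else face_v i l - 1) = l" for l by (auto simp: face_v_def)
  then show ?thesis unfolding shift_def image_image by (simp only: image_ident)
qed

lemma face_v_not_mem: "i \<notin> face_v i ` J"
  by (auto simp: face_v_def)

lemma shift_shift: "i < j \<Longrightarrow> i \<notin> J \<Longrightarrow> j \<notin> J \<Longrightarrow> shift i (shift j J) = shift (j - 1) (shift i J)"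
  unfolding shift_def image_image by (rule image_cong) auto

lemma max_missing:
  assumes "(J :: nat set) \<subseteq> {..n}" "J \<noteq> {..n}"
  shows "Max ({..n} - J) \<le> n" "Max ({..n} - J) \<notin> J"
proof -
  have "finite ({..n} - J)" "{..n} - J \<noteq> {}" using assms by auto
  then have "Max ({..n} - J) \<in> {..n} - J" by (rule Max_in)
  then show "Max ({..n} - J) \<le> n" "Max ({..n} - J) \<notin> J" by auto
qed

lemma simplicial_subset_faceD: "simplicial_subset X K \<Longrightarrow> x \<in> K (Suc n) \<Longrightarrow> i \<le> Suc n \<Longrightarrow> face X n i x \<in> K n"
  by (auto simp: simplicial_subset_def)

lemma subf_closed:
  assumes "simplicial_subset X K" "x \<in> K n" "J \<subseteq> {..n}" "J \<noteq> {}"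
  shows "subf X n J x \<in> K (card J - 1)"
  using assms(2-)
proof (induction n arbitrary: J x)
  case 0
  then have "J = {0}" by auto
  then show ?case using 0 by simp
next
  case (Suc n)
  show ?case
  proof (cases "J = {..Suc n}")
    case False
    let ?i = "Max ({..Suc n} - J)"
    note m = max_missing[OF Suc.prems(2) False]
    note sp = shift_props[OF m(2) Suc.prems(2) m(1)]
    have "subf X n (shift ?i J) (face X n ?i x) \<in> K (card (shift ?i J) - 1)"
      using Suc.prems m sp simplicial_subset_faceD[OF assms(1)] by (intro Suc.IH) (auto simp: shift_def)
    then show ?thesis using False sp by simp
  qed (use Suc.prems in simp)
qed

context simplicial_set begin

lemma subset_self: "simplicial_subset X (simplices X)"
  using face_closed degen_closed by (auto simp: simplicial_subset_def)

text \<open>Any missing vertex may be deleted first, not just the largest. In the induction the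
  deletions of \<open>i\<close> and of the largest missing vertex are exchanged by the simplicial
  identity.\<close>

lemma subf_face:
  assumes "x \<in> simplices X (Suc n)" "J \<subseteq> {..Suc n}" "J \<noteq> {}" "i \<le> Suc n" "i \<notin> J"
  shows "subf X (Suc n) J x = subf X n (shift i J) (face X n i x)"
  using assms
proof (induction n arbitrary: J x i)
  case 0
  let ?m = "Max ({..Suc 0} - J)"
  have ne: "J \<noteq> {..Suc 0}" using 0 by auto
  have "i = ?m"
  proof -
    have s: "{..Suc 0} = {0, 1}" by auto
    obtain j where "j \<in> J" using 0 by blast
    moreover have "j = 0 \<or> j = 1" "i = 0 \<or> i = 1" using \<open>j \<in> J\<close> 0 unfolding s by auto
    ultimately have "{..Suc 0} - J = {i}" using 0 unfolding s by auto
    then show ?thesis by simp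
  qed
  then show ?case using ne by simp
next
  case (Suc n)
  let ?N = "Suc (Suc n)"
  let ?m = "Max ({..?N} - J)"
  have ne: "J \<noteq> {..?N}" using Suc.prems by auto
  note m = max_missing[OF Suc.prems(2) ne]
  have im: "i \<le> ?m" using Suc.prems by (intro Max_ge) auto
  have e: "subf X ?N J x = subf X (Suc n) (shift ?m J) (face X (Suc n) ?m x)" using ne by simp
  show ?case
  proof (cases "i = ?m")
    case False
    then have im: "i < ?m" using im by simp
    note sp = shift_props[OF m(2) Suc.prems(2) m(1)] shift_props[OF Suc.prems(5,2,4)]
    have neS: "shift k J \<noteq> {}" for k using Suc.prems by (auto simp: shift_def)
    have i1: "i \<notin> shift ?m J"
    proof
      assume "i \<in> shift ?m J"
      then obtain l where "l \<in> J" "i = (if l < ?m then l else l - 1)" by (auto simp: shift_def)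
      then show False using im Suc.prems(5) m(2) by (cases "l < ?m") (auto simp: not_less le_less)
    qed
    have i2: "?m - 1 \<notin> shift i J"
    proof
      assume "?m - 1 \<in> shift i J"
      then obtain l where l: "l \<in> J" "?m - 1 = (if l < i then l else l - 1)" by (auto simp: shift_def)
      show False
      proof (cases "l < i")
        case True then show False using l im by auto
      next
        case False
        then have "l \<noteq> i" using l Suc.prems(5) by auto
        then have "l = ?m" using l False im by auto
        then show False using l m(2) by simp
      qed
    qed
    have "subf X (Suc n) (shift ?m J) (face X (Suc n) ?m x) =
        subf X n (shift i (shift ?m J)) (face X n i (face X (Suc n) ?m x))"
      using Suc.prems sp m im i1 neS face_closed by (intro Suc.IH) auto
    also have "\<dots> = subf X n (shift (?m - 1) (shift i J)) (face X n (?m - 1) (face X (Suc n) i x))"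
      using shift_shift[OF im Suc.prems(5) m(2)] face_face[OF im m(1) Suc.prems(1)] by simp
    also have "\<dots> = subf X (Suc n) (shift i J) (face X (Suc n) i x)"
      using Suc.prems sp m im i2 neS face_closed by (intro Suc.IH[symmetric]) auto
    finally show ?thesis using e by simp
  qed (use e in simp)
qed

lemma subf_full [simp]: "subf X n {..n} x = x"
  by (cases n) auto

lemma subf_of_face:
  assumes "x \<in> simplices X (Suc n)" "I \<subseteq> {..n}" "I \<noteq> {}" "i \<le> Suc n"
  shows "subf X n I (face X n i x) = subf X (Suc n) (face_v i ` I) x"
proof -
  have "face_v i ` I \<subseteq> {..Suc n}" using assms by (auto simp: face_v_def)
  then show ?thesis
    using subf_face[OF assms(1), of "face_v i ` I" i] assms face_v_not_mem shift_face_v by simp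
qed

text \<open>Injectivity means that \<open>i\<close> or \<open>Suc i\<close> is missing from
  \<open>I\<close>. Deleting that vertex first undoes the degeneracy.\<close>

lemma subf_of_degen:
  assumes "x \<in> simplices X n" "I \<subseteq> {..Suc n}" "I \<noteq> {}" "i \<le> n" "inj_on (degen_v i) I"
  shows "subf X (Suc n) I (degen X n i x) = subf X n (degen_v i ` I) x"
proof -
  have "degen_v i i = degen_v i (Suc i)" by (simp add: degen_v_def)
  then have "i \<notin> I \<or> Suc i \<notin> I" using assms(5) by (metis inj_on_contraD n_not_Suc_n)
  then obtain k where k: "k = i \<or> k = Suc i" "k \<notin> I" by blast
  have "shift k I = degen_v i ` I"
    unfolding shift_def by (rule image_cong) (use k in \<open>auto simp: degen_v_def le_less\<close>)
  moreover have "subf X (Suc n) I (degen X n i x) = subf X n (shift k I) (face X n k (degen X n i x))"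
    by (rule subf_face[OF degen_closed[OF assms(4,1)] assms(2,3)]) (use k assms in auto)
  ultimately show ?thesis by (simp only: face_degen_same[OF k(1) assms(4,1)])
qed

text \<open>The vertices to be deleted differ from \<open>i\<close> and \<open>Suc i\<close>, so
  each deletion moves past the degeneracy, which survives to the end.\<close>

lemma subf_degenerate:
  assumes "x \<in> simplices X n" "I \<subseteq> {..Suc n}" "i \<le> n" "i \<in> I" "Suc i \<in> I"
  shows "subf X (Suc n) I (degen X n i x) \<in> degenerate X (card I - 1)"
  using assms
proof (induction n arbitrary: I x i)
  case 0
  then have "I = {..Suc 0}" by (auto simp: atMost_Suc)
  then show ?case using 0 by (auto simp: degenerate_def)
next
  case (Suc n)
  let ?N = "Suc (Suc n)"
  show ?case
  proof (cases "I = {..?N}")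
    case True
    then show ?thesis using Suc.prems unfolding degenerate_def by auto
  next
    case False
    let ?m = "Max ({..?N} - I)"
    note m = max_missing[OF Suc.prems(2) False]
    note sp = shift_props[OF m(2) Suc.prems(2) m(1)]
    have mi: "?m \<noteq> i" "?m \<noteq> Suc i" using m Suc.prems by auto
    have e: "subf X ?N I (degen X (Suc n) i x) = subf X (Suc n) (shift ?m I) (face X (Suc n) ?m (degen X (Suc n) i x))"
      using False by simp
    show ?thesis
    proof (cases "?m < i")
      case True
      have "i - 1 \<in> shift ?m I" "Suc (i - 1) \<in> shift ?m I"
        using Suc.prems True unfolding shift_def by (auto intro!: image_eqI[of _ _ i] image_eqI[of _ _ "Suc i"])
      then have "subf X (Suc n) (shift ?m I) (degen X n (i - 1) (face X n ?m x)) \<in> degenerate X (card (shift ?m I) - 1)"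
        using Suc.prems True sp m face_closed[of ?m n x] by (intro Suc.IH) auto
      then show ?thesis using e sp face_degen_less[OF True] Suc.prems by simp
    next
      case False
      then have gt: "Suc i < ?m" using mi by simp
      have "i \<in> shift ?m I" "Suc i \<in> shift ?m I"
        using Suc.prems gt unfolding shift_def by (auto intro!: image_eqI[of _ _ i] image_eqI[of _ _ "Suc i"])
      then have "subf X (Suc n) (shift ?m I) (degen X n i (face X n (?m - 1) x)) \<in> degenerate X (card (shift ?m I) - 1)"
        using Suc.prems gt sp m face_closed[of "?m - 1" n x] by (intro Suc.IH) auto
      then show ?thesis using e sp face_degen_greater[OF gt m(1)] Suc.prems by simp
    qed
  qed
qed

lemma front_face_subf: "x \<in> simplices X (p + q) \<Longrightarrow> front_face X p q x = subf X (p + q) {..p} x"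
proof (induction q arbitrary: x)
  case (Suc q)
  have "shift (Suc (p + q)) {..p} = {..p}" by (auto simp: shift_def)
  then show ?case
    using Suc subf_face[of x "p + q" "{..p}" "Suc (p + q)"] face_closed[of "Suc (p + q)" "p + q" x] by simp
qed simp

lemma back_face_subf: "x \<in> simplices X (p + q) \<Longrightarrow> back_face X p q x = subf X (p + q) {p..p + q} x"
proof (induction p arbitrary: x)
  case 0
  then show ?case by (simp add: atLeast0AtMost)
next
  case (Suc p)
  have "shift 0 {Suc p..Suc p + q} = {p..p + q}"
    unfolding shift_def by (auto intro!: image_eqI[of _ _ "Suc _"])
  then show ?case
    using Suc subf_face[of x "p + q" "{Suc p..Suc p + q}" 0] face_closed[of 0 "p + q" x] by simp
qed

end

section \<open>Integration and Whitney's map on families\<close>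

lemma wsum_cong: "(\<And>J. J \<in> NE n \<Longrightarrow> f J = g J) \<Longrightarrow> wsum n f = wsum n g"
  unfolding wsum_def by (rule sum.cong) simp_all

lemma hmf_cong: "eqv n a a' \<Longrightarrow> eqv n b b' \<Longrightarrow> hmf n a b = hmf n a' b'"
  using hh_cong[of n a a' 0] hh_cong[of n b b' 0] eps_cong[of n a a' 0] FF_cong[OF eqv_refl, of n b b' "hh n 0 a'"]
  by (simp add: hm_def)

lemma II_whit: "II q (whit {..q}) = (1 / fact q :: 'k::field_char_0)"
  using II_dirichlet[of q "\<lambda>_. 0", where ?'k = 'k] by (simp add: dirichlet_def)

context simplicial_set begin

text \<open>Families of representatives which are compatible with faces and degeneracies only up to \<open>eqv\<close>.\<close>

definition FA :: "nat \<Rightarrow> (nat \<Rightarrow> 'a \<Rightarrow> 'k::field_char_0 pform) \<Rightarrow> bool" where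
  "FA q v \<longleftrightarrow> (\<forall>n. \<forall>x\<in>simplices X n. fr n (v n x) \<and> homog q (v n x)) \<and>
    (\<forall>n i. \<forall>x\<in>simplices X (Suc n). i \<le> Suc n \<longrightarrow> eqv n (fc i (v (Suc n) x)) (v n (face X n i x))) \<and>
    (\<forall>n i. \<forall>x\<in>simplices X n. i \<le> n \<longrightarrow> eqv (Suc n) (dg i (v n x)) (v (Suc n) (degen X n i x)))"

lemma FA_fr: "FA q v \<Longrightarrow> x \<in> simplices X n \<Longrightarrow> fr n (v n x)"
  and FA_homog: "FA q v \<Longrightarrow> x \<in> simplices X n \<Longrightarrow> homog q (v n x)"
  and FA_face: "FA q v \<Longrightarrow> x \<in> simplices X (Suc n) \<Longrightarrow> i \<le> Suc n \<Longrightarrow> eqv n (fc i (v (Suc n) x)) (v n (face X n i x))"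
  and FA_degen: "FA q v \<Longrightarrow> x \<in> simplices X n \<Longrightarrow> i \<le> n \<Longrightarrow> eqv (Suc n) (dg i (v n x)) (v (Suc n) (degen X n i x))"
  by (auto simp: FA_def)

lemma FA_I:
  assumes "\<And>n x. x \<in> simplices X n \<Longrightarrow> fr n (v n x)" "\<And>n x. x \<in> simplices X n \<Longrightarrow> homog q (v n x)"
    "\<And>n i x. x \<in> simplices X (Suc n) \<Longrightarrow> i \<le> Suc n \<Longrightarrow> eqv n (fc i (v (Suc n) x)) (v n (face X n i x))"
    "\<And>n i x. x \<in> simplices X n \<Longrightarrow> i \<le> n \<Longrightarrow> eqv (Suc n) (dg i (v n x)) (v (Suc n) (degen X n i x))"
  shows "FA q v"
  using assms by (simp add: FA_def)

lemma FA_add: "FA q v \<Longrightarrow> FA q w \<Longrightarrow> FA q (\<lambda>n x. v n x + w n x)"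
  by (rule FA_I) (auto simp: FA_fr FA_homog intro!: eqv_add FA_face FA_degen)

lemma FA_sc: "FA q v \<Longrightarrow> FA q (\<lambda>n x. sc c * v n x)"
  by (rule FA_I) (auto simp: FA_fr FA_homog intro!: eqv_mult FA_face FA_degen)

lemma FA_zero: "FA q (\<lambda>n x. 0)"
  by (rule FA_I) auto

lemma FA_dd: "FA q v \<Longrightarrow> FA (Suc q) (\<lambda>n x. dd (v n x))"
  by (rule FA_I) (auto simp: FA_fr FA_homog dd_sub[symmetric] intro!: eqv_dd FA_face FA_degen)

lemma FA_mul: "FA p v \<Longrightarrow> FA q w \<Longrightarrow> FA (p + q) (\<lambda>n x. v n x * w n x)"
  by (rule FA_I) (auto simp: FA_fr FA_homog intro!: eqv_mult FA_face FA_degen)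

lemma FA_bar: "FA q v \<Longrightarrow> FA q (\<lambda>n x. bar (v n x))"
  by (rule FA_I) (auto simp: FA_fr FA_homog bar_sub[symmetric] intro!: eqv_bar FA_face FA_degen)

lemma FA_ss: assumes "FA (Suc q) v" shows "FA q (\<lambda>n x. ss n (v n x))"
proof (rule FA_I)
  fix n i x assume x: "x \<in> simplices X (Suc n)" "i \<le> Suc n"
  show "eqv n (fc i (ss (Suc n) (v (Suc n) x))) (ss n (v n (face X n i x)))"
    by (rule eqv_trans[OF eqv_sym[OF ss_sub[OF vmap_face[OF x(2)]]] ss_cong[OF FA_face[OF assms x]]])
next
  fix n i x assume x: "x \<in> simplices X n" "i \<le> n"
  show "eqv (Suc n) (dg i (ss n (v n x))) (ss (Suc n) (v (Suc n) (degen X n i x)))"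
    by (rule eqv_trans[OF eqv_sym[OF ss_sub[OF vmap_degen[OF x(2)]]] ss_cong[OF FA_degen[OF assms x]]])
qed (use FA_fr[OF assms] FA_homog[OF assms] in \<open>auto intro: fr_ss homog_ss\<close>)

definition RR :: "(nat \<Rightarrow> 'a \<Rightarrow> 'k::field_char_0 pform) \<Rightarrow> nat \<Rightarrow> 'a \<Rightarrow> 'k" where
  "RR v q x = II q (v q x)"

definition dlt :: "nat \<Rightarrow> ('a \<Rightarrow> 'k::comm_ring_1) \<Rightarrow> 'a \<Rightarrow> 'k" where
  "dlt q f x = (\<Sum>i\<le>Suc q. (- 1) ^ i * f (face X q i x))"

definition NC :: "nat \<Rightarrow> ('a \<Rightarrow> 'k::comm_ring_1) \<Rightarrow> bool" where
  "NC q f \<longleftrightarrow> (\<forall>x\<in>degenerate X q. f x = 0)"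

text \<open>Whitney's map \<open>W\<close>. The coefficient of the face \<open>J\<close> is the
  value of \<open>f\<close> there, and \<open>fact q\<close> turns \<open>whit J\<close> into the
  usual Whitney form, whose integral is 1.\<close>

definition fW :: "nat \<Rightarrow> ('a \<Rightarrow> 'k::field_char_0) \<Rightarrow> nat \<Rightarrow> 'a \<Rightarrow> 'k pform" where
  "fW q f n x = wsum n (\<lambda>J. if card J = Suc q then fact q * f (subf X n J x) else 0)"

lemma TT_subf:
  assumes v: "FA q v"
  shows "x \<in> simplices X n \<Longrightarrow> J \<subseteq> {..n} \<Longrightarrow> J \<noteq> {} \<Longrightarrow>
    TT n J (v n x) = RR v (card J - 1) (subf X n J x)"
proof (induction n arbitrary: J x)
  case 0
  then have "J = {..0}" by auto
  then show ?case by (simp add: RR_def II_def)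
next
  case (Suc n)
  show ?case
  proof (cases "J = {..Suc n}")
    case True
    then show ?thesis by (simp add: RR_def II_def)
  next
    case False
    let ?i = "Max ({..Suc n} - J)"
    note m = max_missing[OF Suc.prems(2) False]
    note sp = shift_props[OF m(2) Suc.prems(2) m(1)]
    have "TT (Suc n) J (v (Suc n) x) = TT n (shift ?i J) (fc ?i (v (Suc n) x))"
      using TT_face[OF m(1) sp(2), of "v (Suc n) x"] sp(3) by simp
    also have "\<dots> = TT n (shift ?i J) (v n (face X n ?i x))"
      by (rule TT_cong[OF FA_face[OF v Suc.prems(1) m(1)] sp(2)])
    also have "\<dots> = RR v (card (shift ?i J) - 1) (subf X n (shift ?i J) (face X n ?i x))"
      by (rule Suc.IH) (use Suc.prems m sp face_closed in \<open>auto simp: shift_def\<close>)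
    finally show ?thesis using False sp(1) by simp
  qed
qed

lemma RR_dd: "FA q v \<Longrightarrow> x \<in> simplices X (Suc q) \<Longrightarrow> RR (\<lambda>n x. dd (v n x)) (Suc q) x = dlt q (RR v q) x"
  unfolding RR_def dlt_def stokes by (intro sum.cong refl arg_cong2[of _ _ _ _ "(*)"] II_cong FA_face) auto

lemma RR_NC:
  assumes "FA q v" shows "NC q (RR v q)"
  unfolding NC_def
proof
  fix x assume "x \<in> degenerate X q"
  then obtain m i y where x: "q = Suc m" "i \<le> m" "y \<in> simplices X m" "x = degen X m i y"
    by (auto simp: degenerate_def)
  have "RR v q x = II (Suc m) (dg i (v m y))"
    unfolding RR_def x(1,4) by (rule II_cong[OF eqv_sym[OF FA_degen[OF assms x(3,2)]]])
  then show "RR v q x = 0" by (simp add: II_degen[OF x(2)])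
qed

text \<open>Compatibility with degeneracies is where normalisation enters: a face on which the
  degeneracy is not injective is a degenerate simplex, so its coefficient vanishes, as does the
  corresponding term of the pulled back sum.\<close>

lemma FA_W:
  assumes f: "NC q f" shows "FA q (fW q f)"
proof (rule FA_I)
  fix n x assume x: "x \<in> simplices X n"
  show "fr n (fW q f n x)" unfolding fW_def by (rule fr_wsum)
  show "homog q (fW q f n x)"
    unfolding fW_def wsum_def
  proof (rule homog_sum)
    fix J assume J: "J \<in> NE n"
    then have "finite J" "J \<noteq> {}" using finite_subset by auto
    then show "homog q (sc (if card J = Suc q then fact q * f (subf X n J x) else 0) * whit J)"
      using homog_whit[of J] by (cases "card J = Suc q") (auto simp del: sc_simps(2))
  qed
next
  fix n i x assume x: "x \<in> simplices X (Suc n)" "i \<le> Suc n"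
  have inj: "inj_on (face_v i) I" for I by (auto simp: inj_on_def face_v_def split: if_splits)
  have "fc i (fW q f (Suc n) x) = fW q f n (face X n i x)"
    unfolding fW_def wsum_sub[OF vmap_face[OF x(2)]]
  proof (rule wsum_cong)
    fix I assume I: "I \<in> NE n"
    then have "subf X n I (face X n i x) = subf X (Suc n) (face_v i ` I) x"
      using x by (intro subf_of_face) auto
    then show "(if inj_on (face_v i) I then if card (face_v i ` I) = Suc q
        then fact q * f (subf X (Suc n) (face_v i ` I) x) else 0 else 0) =
      (if card I = Suc q then fact q * f (subf X n I (face X n i x)) else 0)"
      using inj[of I] by (simp add: card_image)
  qed
  then show "eqv n (fc i (fW q f (Suc n) x)) (fW q f n (face X n i x))" by simp
next
  fix n i x assume x: "x \<in> simplices X n" "i \<le> n"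
  have "dg i (fW q f n x) = fW q f (Suc n) (degen X n i x)"
    unfolding fW_def wsum_sub[OF vmap_degen[OF x(2)]]
  proof (rule wsum_cong)
    fix I assume I: "I \<in> NE (Suc n)"
    show "(if inj_on (degen_v i) I then if card (degen_v i ` I) = Suc q
        then fact q * f (subf X n (degen_v i ` I) x) else 0 else 0) =
      (if card I = Suc q then fact q * f (subf X (Suc n) I (degen X n i x)) else 0)"
    proof (cases "inj_on (degen_v i) I")
      case True
      then show ?thesis using subf_of_degen[OF x(1) _ _ x(2) True] I by (auto simp: card_image simp del: subf.simps)
    next
      case False
      then obtain l l' where l: "l \<in> I" "l' \<in> I" "l \<noteq> l'" "degen_v i l = degen_v i l'" by (auto simp: inj_on_def)
      then have "{l, l'} = {i, Suc i}" by (auto simp: degen_v_def split: if_splits)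
      then have "i \<in> I" "Suc i \<in> I" using l by (auto simp: doubleton_eq_iff)
      then have "subf X (Suc n) I (degen X n i x) \<in> degenerate X (card I - 1)"
        using I x by (intro subf_degenerate) auto
      then have "card I = Suc q \<Longrightarrow> f (subf X (Suc n) I (degen X n i x)) = 0" using f by (simp add: NC_def del: subf.simps)
      then show ?thesis using False by (simp del: subf.simps)
    qed
  qed
  then show "eqv (Suc n) (dg i (fW q f n x)) (fW q f (Suc n) (degen X n i x))" by simp
qed

text \<open>Only the whole simplex has \<open>Suc q\<close> vertices, and \<open>fact q\<close>
  cancels the integral \<open>1 / fact q\<close> of its form.\<close>

lemma RR_W: "RR (fW q f) q x = f x"
proof -
  let ?g = "\<lambda>J. (if card J = Suc q then fact q * f (subf X q J x) else 0) * II q (whit J)"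
  have "RR (fW q f) q x = (\<Sum>J\<in>NE q. ?g J)"
    unfolding RR_def fW_def wsum_def II_sum II_simps ..
  also have "\<dots> = (\<Sum>J\<in>{{..q}}. ?g J)"
  proof (rule sum.mono_neutral_right)
    show "\<forall>J\<in>NE q - {{..q}}. ?g J = 0"
    proof
      fix J assume J: "J \<in> NE q - {{..q}}"
      then have "card J \<noteq> Suc q" using card_subset_eq[of "{..q}" J] by auto
      then show "?g J = 0" by simp
    qed
  qed auto
  also have "\<dots> = f x" by (simp add: II_whit)
  finally show ?thesis .
qed

lemma fW_cong:
  assumes "\<And>y. y \<in> simplices X q \<Longrightarrow> f y = g y" "x \<in> simplices X n"
  shows "fW q f n x = fW q g n x"
  unfolding fW_def
proof (rule wsum_cong)
  fix J assume J: "J \<in> NE n"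
  have "subf X n J x \<in> simplices X (card J - 1)"
    by (rule subf_closed[OF subset_self]) (use J assms(2) in auto)
  then show "(if card J = Suc q then fact q * f (subf X n J x) else 0) = (if card J = Suc q then fact q * g (subf X n J x) else 0)"
    using assms(1) by auto
qed

lemma dupont_family:
  assumes v: "FA q v" and x: "x \<in> simplices X n"
  shows "eqv n (dd (ss n (v n x)) + ss n (dd (v n x))) (v n x - fW q (RR v q) n x)"
proof -
  have "(\<Sum>J\<in>NE n. sc (fact (card J - 1) * TT n J (v n x)) * whit J) = fW q (RR v q) n x"
    unfolding fW_def wsum_def
  proof (rule sum.cong[OF refl])
    fix J assume J: "J \<in> NE n"
    then have fin: "finite J" using finite_subset by auto
    have "fact (card J - 1) * TT n J (v n x) = (if card J = Suc q then fact q * RR v q (subf X n J x) else 0)"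
      using TT_subf[OF v x, of J] TT_homog[OF fin FA_homog[OF v x], of n] J by auto
    then show "sc (fact (card J - 1) * TT n J (v n x)) * whit J =
        sc (if card J = Suc q then fact q * RR v q (subf X n J x) else 0) * whit J" by simp
  qed
  then show ?thesis using dupont[of n "v n x"] by simp
qed

lemma fW_zero: "fW q (\<lambda>_. 0) n x = 0"
  unfolding fW_def wsum_def by (rule sum.neutral) simp

text \<open>This comes from Dupont's formula, used twice. For \<open>W f\<close> the right side is 0
  since integration inverts \<open>W\<close>; differentiating gives \<open>d s d W f = 0\<close>.
  For \<open>d W f\<close> the formula then says \<open>d W f = W \<rho> d W f\<close>, and
  \<open>\<rho> d W f\<close> is the coboundary of \<open>f\<close> by Stokes.\<close>

lemma dd_W:
  assumes f: "NC q f" and x: "x \<in> simplices X n"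
  shows "eqv n (dd (fW q f n x)) (fW (Suc q) (dlt q f) n x)"
proof -
  note w = FA_W[OF f]
  have "fW q (RR (fW q f) q) n x = fW q f n x" by (rule fW_cong[OF _ x]) (rule RR_W)
  then have "eqv n (dd (ss n (fW q f n x)) + ss n (dd (fW q f n x))) 0"
    using dupont_family[OF w x] by simp
  from eqv_dd[OF this] have 1: "eqv n (dd (ss n (dd (fW q f n x)))) 0" by simp
  have "fW (Suc q) (RR (\<lambda>n x. dd (fW q f n x)) (Suc q)) n x = fW (Suc q) (dlt q f) n x"
  proof (rule fW_cong[OF _ x])
    fix y assume "y \<in> simplices X (Suc q)"
    then show "RR (\<lambda>n x. dd (fW q f n x)) (Suc q) y = dlt q f y"
      unfolding RR_dd[OF w \<open>y \<in> _\<close>] by (simp add: dlt_def RR_W)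
  qed
  then show ?thesis using dupont_family[OF FA_dd[OF w] x] 1 by (simp add: eqv_def)
qed

section \<open>Compact supports\<close>

definition supported :: "(nat \<Rightarrow> 'a \<Rightarrow> bool) \<Rightarrow> bool" where
  "supported P \<longleftrightarrow> (\<exists>K. finite_subset X K \<and> (\<forall>n. \<forall>x\<in>complement_span X K n. P n x))"

lemma complement_span_subset: "simplicial_subset X (complement_span X K)"
proof -
  let ?S = "\<lambda>m. simplices X m - K m"
  have "complement_span X K n \<subseteq> simplices X n" for n
    unfolding complement_span_def generated_def using subset_self by (intro Inter_lower CollectI exI[of _ "simplices X"]) auto
  moreover have "face X n i x \<in> complement_span X K n" if "x \<in> complement_span X K (Suc n)" "i \<le> Suc n" for n i x
    using that unfolding complement_span_def generated_def simplicial_subset_def by blast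
  moreover have "degen X n i x \<in> complement_span X K (Suc n)" if "x \<in> complement_span X K n" "i \<le> n" for n i x
    using that unfolding complement_span_def generated_def simplicial_subset_def by blast
  ultimately show ?thesis by (simp add: simplicial_subset_def)
qed

lemma supported_zero: "(\<And>n x. x \<in> simplices X n \<Longrightarrow> P n x) \<Longrightarrow> supported P"
proof -
  assume P: "\<And>n x. x \<in> simplices X n \<Longrightarrow> P n x"
  have "finite_subset X (\<lambda>_. {})"
    by (simp add: finite_subset_def simplicial_subset_def finite_sset_def)
  moreover have "P n x" if "x \<in> complement_span X (\<lambda>_. {}) n" for n x
    using that complement_span_subset P unfolding simplicial_subset_def by blast
  ultimately show ?thesis unfolding supported_def by blast
qed

text \<open>A simplex degenerate in \<open>K\<close> or in \<open>L\<close> is so in the union,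
  hence the non-degenerate simplices of the union already occur in one of the two finite
  sets.\<close>

lemma finite_subset_Un:
  assumes "finite_subset X K" "finite_subset X L" shows "finite_subset X (\<lambda>n. K n \<union> L n)"
proof -
  let ?N = "\<lambda>K. {(n, x). x \<in> simplices (X\<lparr>simplices := K\<rparr>) n - degenerate (X\<lparr>simplices := K\<rparr>) n}"
  have "?N (\<lambda>n. K n \<union> L n) \<subseteq> ?N K \<union> ?N L" by (auto simp: degenerate_def)
  moreover have "finite (?N K \<union> ?N L)" using assms by (auto simp: finite_subset_def finite_sset_def)
  ultimately have "finite (?N (\<lambda>n. K n \<union> L n))" by (rule finite_subset)
  moreover have "simplicial_subset X (\<lambda>n. K n \<union> L n)"
    using assms by (auto simp: finite_subset_def simplicial_subset_def)
  ultimately show ?thesis by (simp add: finite_subset_def finite_sset_def)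
qed

lemma complement_span_antimono: "(\<And>n. K n \<subseteq> L n) \<Longrightarrow> complement_span X L n \<subseteq> complement_span X K n"
  unfolding complement_span_def generated_def by blast

lemma supported2:
  assumes "supported P" "supported Q" "\<And>n x. x \<in> simplices X n \<Longrightarrow> P n x \<Longrightarrow> Q n x \<Longrightarrow> T n x"
  shows "supported T"
proof -
  obtain K L where K: "finite_subset X K" "\<And>n x. x \<in> complement_span X K n \<Longrightarrow> P n x"
    and L: "finite_subset X L" "\<And>n x. x \<in> complement_span X L n \<Longrightarrow> Q n x"
    using assms(1,2) unfolding supported_def by blast
  have "T n x" if x: "x \<in> complement_span X (\<lambda>n. K n \<union> L n) n" for n x
  proof (rule assms(3))
    show "x \<in> simplices X n" using x complement_span_subset unfolding simplicial_subset_def by blast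
    show "P n x" "Q n x" using x complement_span_antimono[of K "\<lambda>n. K n \<union> L n" n] complement_span_antimono[of L "\<lambda>n. K n \<union> L n" n] K L by auto
  qed
  then show ?thesis using finite_subset_Un[OF K(1) L(1)] unfolding supported_def by blast
qed

text \<open>The simplicial subset generated by the complement is closed under faces. Hence an
  operator whose value on a simplex depends only on the faces preserves compact supports; Whitney's
  map and the coboundary are of this kind.\<close>

lemma supported_subf:
  assumes "supported P" "\<And>n x. x \<in> simplices X n \<Longrightarrow>
    (\<And>J. J \<subseteq> {..n} \<Longrightarrow> J \<noteq> {} \<Longrightarrow> P (card J - 1) (subf X n J x)) \<Longrightarrow> T n x"
  shows "supported T"
proof -
  obtain K where K: "finite_subset X K" "\<And>n x. x \<in> complement_span X K n \<Longrightarrow> P n x"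
    using assms(1) unfolding supported_def by blast
  have "T n x" if x: "x \<in> complement_span X K n" for n x
  proof (rule assms(2))
    show "x \<in> simplices X n" using x complement_span_subset unfolding simplicial_subset_def by blast
    show "P (card J - 1) (subf X n J x)" if "J \<subseteq> {..n}" "J \<noteq> {}" for J
      by (rule K(2)) (rule subf_closed[OF complement_span_subset x that])
  qed
  then show ?thesis using K(1) unfolding supported_def by blast
qed

definition CSf :: "(nat \<Rightarrow> 'a \<Rightarrow> 'k::field_char_0 pform) \<Rightarrow> bool" where
  "CSf v \<longleftrightarrow> supported (\<lambda>n x. eqv n (v n x) 0)"

definition CSc :: "nat \<Rightarrow> ('a \<Rightarrow> 'k::comm_ring_1) \<Rightarrow> bool" where
  "CSc q f \<longleftrightarrow> supported (\<lambda>n x. n = q \<longrightarrow> f x = 0)"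

lemma CSf_1: "CSf v \<Longrightarrow> (\<And>n x. x \<in> simplices X n \<Longrightarrow> eqv n (v n x) 0 \<Longrightarrow> eqv n (w n x) 0) \<Longrightarrow> CSf w"
  unfolding CSf_def by (rule supported2[of _ "\<lambda>n x. eqv n (v n x) 0"]) auto

lemma CSf_add: "CSf v \<Longrightarrow> CSf w \<Longrightarrow> CSf (\<lambda>n x. v n x + w n x)"
  unfolding CSf_def by (erule (1) supported2) (simp add: eqv_def)

lemma CSf_zero: "CSf (\<lambda>n x. 0)"
  unfolding CSf_def by (rule supported_zero) simp

lemma CSf_ops: "CSf v \<Longrightarrow> CSf (\<lambda>n x. sc c * v n x)" "CSf v \<Longrightarrow> CSf (\<lambda>n x. dd (v n x))"
  "CSf v \<Longrightarrow> CSf (\<lambda>n x. v n x * w n x)" "CSf w \<Longrightarrow> CSf (\<lambda>n x. v n x * w n x)"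
  "CSf v \<Longrightarrow> CSf (\<lambda>n x. bar (v n x))"
  by (erule CSf_1, simp add: eqv_def nf_dd nf_bar)+

lemma CSf_ss:
  assumes "CSf v" shows "CSf (\<lambda>n x. ss n (v n x))"
  using assms
proof (rule CSf_1)
  fix n x assume "eqv n (v n x) 0"
  from ss_cong[OF this] show "eqv n (ss n (v n x)) 0" by simp
qed

lemma CSf_RR: "CSf v \<Longrightarrow> CSc q (RR v q)"
  unfolding CSf_def CSc_def RR_def
  by (rule supported2[of _ "\<lambda>n x. eqv n (v n x) 0"]) (use II_cong in fastforce)+

lemma CSf_W: assumes "CSc q f" shows "CSf (fW q f)"
  using assms unfolding CSf_def CSc_def
proof (rule supported_subf)
  fix n x assume x: "x \<in> simplices X n"
    and h: "\<And>J. J \<subseteq> {..n} \<Longrightarrow> J \<noteq> {} \<Longrightarrow> card J - 1 = q \<longrightarrow> f (subf X n J x) = 0"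
  have "fW q f n x = 0"
    unfolding fW_def wsum_def
  proof (rule sum.neutral, rule ballI)
    fix J assume "J \<in> NE n"
    then have "card J = Suc q \<Longrightarrow> f (subf X n J x) = 0" using h[of J] by auto
    then show "sc (if card J = Suc q then fact q * f (subf X n J x) else 0) * whit J = 0" by auto
  qed
  then show "eqv n (fW q f n x) 0" by simp
qed

lemma CSc_add: "CSc q f \<Longrightarrow> CSc q g \<Longrightarrow> CSc q (\<lambda>x. f x + g x)"
  unfolding CSc_def by (erule (1) supported2) simp

lemma CSc_sc: "CSc q f \<Longrightarrow> CSc q (\<lambda>x. c * f x)"
  unfolding CSc_def by (rule supported2[of _ "\<lambda>n x. n = q \<longrightarrow> f x = 0"]) auto

lemma CSc_zero: "CSc q (\<lambda>x. 0)"
  unfolding CSc_def by (rule supported_zero) simp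

lemma face_subf: "x \<in> simplices X (Suc n) \<Longrightarrow> i \<le> Suc n \<Longrightarrow> face X n i x = subf X (Suc n) (face_v i ` {..n}) x"
  using subf_of_face[of x n "{..n}" i] by auto

lemma CSc_dlt: assumes "CSc q f" shows "CSc (Suc q) (dlt q f)"
  using assms unfolding CSc_def
proof (rule supported_subf)
  fix n x assume x: "x \<in> simplices X n"
    and h: "\<And>J. J \<subseteq> {..n} \<Longrightarrow> J \<noteq> {} \<Longrightarrow> card J - 1 = q \<longrightarrow> f (subf X n J x) = 0"
  show "n = Suc q \<longrightarrow> dlt q f x = 0"
  proof
    assume n: "n = Suc q"
    have "f (face X q i x) = 0" if i: "i \<le> Suc q" for i
    proof -
      have "inj_on (face_v i) {..q}" by (auto simp: inj_on_def face_v_def split: if_splits)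
      then have "card (face_v i ` {..q}) - 1 = q" by (simp add: card_image)
      moreover have "face_v i ` {..q} \<subseteq> {..n}" using n by (auto simp: face_v_def)
      ultimately show ?thesis using h[of "face_v i ` {..q}"] face_subf[of x q i] x n i by auto
    qed
    then show "dlt q f x = 0" unfolding dlt_def by (intro sum.neutral) auto
  qed
qed

text \<open>The coboundary of \<open>f\<close> is the integral of \<open>d W f\<close>, and
  integration cochains are normalised.\<close>

lemma NC_dlt:
  fixes f :: "'a \<Rightarrow> 'k::field_char_0"
  assumes "NC q f" shows "NC (Suc q) (dlt q f)"
proof -
  have "FA q (fW q f)" by (rule FA_W[OF assms])
  from RR_NC[OF FA_dd[OF this]] have "NC (Suc q) (RR (\<lambda>n x. dd (fW q f n x)) (Suc q))" .
  moreover have "degenerate X (Suc q) \<subseteq> simplices X (Suc q)" using degen_closed by (auto simp: degenerate_def)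
  ultimately show ?thesis
    using RR_dd[OF FA_W[OF assms]] unfolding NC_def by (simp add: dlt_def RR_W subset_iff del: sum.atMost_Suc)
qed

lemma dlt_dlt: "x \<in> simplices X (Suc (Suc q)) \<Longrightarrow> dlt (Suc q) (dlt q f) x = 0"
  unfolding dlt_def by (rule alternating_double_sum) (auto simp: face_face)

end

section \<open>Cochains as functions on simplices\<close>

definition Lf :: "('a \<Rightarrow> 'k::comm_ring_1) \<Rightarrow> ('a \<Rightarrow>\<^sub>0 'k) \<Rightarrow> 'k" where
  "Lf f v = (\<Sum>x\<in>supp v. coef v x * f x)"

lemma Lf_superset: "finite S \<Longrightarrow> supp v \<subseteq> S \<Longrightarrow> Lf f v = (\<Sum>x\<in>S. coef v x * f x)"
  unfolding Lf_def by (rule sum.mono_neutral_left) (auto simp: in_keys_iff)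

lemma Lf_add: "Lf f (u + v) = Lf f u + Lf f v"
proof -
  let ?S = "supp u \<union> supp v"
  have "finite ?S" "supp u \<subseteq> ?S" "supp v \<subseteq> ?S" "supp (u + v) \<subseteq> ?S"
    using Poly_Mapping.keys_add[of u v] by auto
  then show ?thesis by (simp add: Lf_superset[of ?S] lookup_add distrib_right sum.distrib)
qed

lemma Lf_0 [simp]: "Lf f 0 = 0" by (simp add: Lf_def)

lemma Lf_sum: "Lf f (sum g S) = (\<Sum>i\<in>S. Lf f (g i))"
  by (induction S rule: infinite_finite_induct) (auto simp: Lf_add)

lemma Lf_single [simp]: "Lf f (sgl x c) = c * f x"
  by (cases "c = 0") (simp_all add: Lf_def)

lemma coef_map_times: "coef (Poly_Mapping.map ((*) a) v) x = a * (coef v x :: 'k::comm_ring_1)"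
  by (simp add: map.rep_eq when_def)

lemma supp_map_times: "supp (Poly_Mapping.map ((*) (a :: 'k::comm_ring_1)) v) \<subseteq> supp v"
  by (auto simp: in_keys_iff coef_map_times)

lemma Lf_map: "Lf f (Poly_Mapping.map ((*) a) v) = a * Lf f v"
  using supp_map_times[of a v]
  by (simp add: Lf_superset[of "supp v"] coef_map_times sum_distrib_left mult.assoc)

abbreviation lin :: "'a sset \<Rightarrow> nat \<Rightarrow> ('a \<Rightarrow> 'k) \<Rightarrow> ('a \<Rightarrow>\<^sub>0 'k) \<Rightarrow> 'k::comm_ring_1" where
  "lin \<equiv> linear_extension"

lemma lin_eq: "lin X q f = (\<lambda>v\<in>chains X q. Lf f v)"
  by (simp add: linear_extension_def Lf_def)

lemma chains_add: "u \<in> chains X q \<Longrightarrow> v \<in> chains X q \<Longrightarrow> u + v \<in> chains X q"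
  using Poly_Mapping.keys_add[of u v] by (auto simp: chains_def)

lemma chains_sum: "(\<And>i. i \<in> S \<Longrightarrow> g i \<in> chains X q) \<Longrightarrow> sum g S \<in> chains X q"
proof (induction S rule: infinite_finite_induct)
  case (insert i S)
  then show ?case by (simp add: chains_add)
qed (simp_all add: chains_def)

lemma chains_sgl: "x \<in> simplices X q \<Longrightarrow> sgl x c \<in> chains X q"
  by (cases "c = 0") (auto simp: chains_def)

context simplicial_set begin

lemma lin_on: "x \<in> simplices X q \<Longrightarrow> on_simplex (lin X q f) x = f x"
  by (simp add: on_simplex_def lin_eq chains_sgl)

lemma lin_cong: "(\<And>x. x \<in> simplices X q \<Longrightarrow> f x = g x) \<Longrightarrow> lin X q f = lin X q g"
  unfolding lin_eq by (rule restrict_ext) (auto simp: Lf_def chains_def intro!: sum.cong)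

lemma lin_eq_iff: "lin X q f = lin X q g \<longleftrightarrow> (\<forall>x\<in>simplices X q. f x = g x)"
  using lin_on lin_cong by metis

lemma degenerate_simplices: "degenerate X q \<subseteq> simplices X q"
  using degen_closed by (auto simp: degenerate_def)

lemma lin_normalised: "NC q f \<Longrightarrow> lin X q f \<in> normalised_cochains X q"
proof -
  assume f: "NC q f"
  have "degenerate_chains X q \<subseteq> chains X q"
    using degenerate_simplices by (auto simp: degenerate_chains_def chains_def)
  moreover have "Lf f v = 0" if "v \<in> degenerate_chains X q" for v
    unfolding Lf_def using that f by (intro sum.neutral) (auto simp: degenerate_chains_def NC_def)
  moreover have "Poly_Mapping.map ((*) a) v \<in> chains X q" if "v \<in> chains X q" for a and v :: "'a \<Rightarrow>\<^sub>0 'b"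
    using that supp_map_times[of a v] by (auto simp: chains_def)
  ultimately show ?thesis
    unfolding normalised_cochains_def lin_eq by (auto simp: chains_add Lf_add Lf_map)
qed

lemma normalised_lin:
  assumes c: "c \<in> normalised_cochains X q"
  shows "NC q (on_simplex c)" "c = lin X q (on_simplex c)"
proof -
  have add: "c (u + v) = c u + c v" if "u \<in> chains X q" "v \<in> chains X q" for u v
    using c that by (auto simp: normalised_cochains_def)
  have sc: "c (Poly_Mapping.map ((*) a) v) = a * c v" if "v \<in> chains X q" for a v
    using c that by (auto simp: normalised_cochains_def)
  have deg: "c v = 0" if "v \<in> degenerate_chains X q" for v
    using c that by (auto simp: normalised_cochains_def)
  have und: "c v = undefined" if "v \<notin> chains X q" for v
    using c that by (auto simp: normalised_cochains_def PiE_def extensional_def)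
  show "NC q (on_simplex c)"
    unfolding NC_def on_simplex_def by (auto intro!: deg simp: degenerate_chains_def)
  have 0: "c 0 = 0" by (rule deg) (simp add: degenerate_chains_def)
  have single: "c (sgl x a) = a * on_simplex c x" if "x \<in> simplices X q" for x a
    using sc[OF chains_sgl[OF that], of a 1] by (simp add: on_simplex_def)
  have "c (\<Sum>x\<in>S. sgl x (a x)) = (\<Sum>x\<in>S. a x * on_simplex c x)" if "finite S" "S \<subseteq> simplices X q" for S a
    using that
  proof (induction S)
    case (insert x S)
    have "c (sgl x (a x) + (\<Sum>x\<in>S. sgl x (a x))) = c (sgl x (a x)) + c (\<Sum>x\<in>S. sgl x (a x))"
      using insert.prems by (intro add chains_sgl chains_sum) auto
    then show ?case using insert by (simp add: single)
  qed (simp add: 0)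
  note sum = this
  have "c v = Lf (on_simplex c) v" if "v \<in> chains X q" for v
  proof -
    have "c (\<Sum>x\<in>supp v. sgl x (coef v x)) = Lf (on_simplex c) v"
      unfolding Lf_def by (rule sum) (use that in \<open>auto simp: chains_def\<close>)
    then show ?thesis unfolding poly_mapping_sum_sgls[symmetric] .
  qed
  then show "c = lin X q (on_simplex c)" unfolding lin_eq using und by (intro ext) (simp add: restrict_def)
qed

abbreviation "CC \<equiv> cochains_c X"

lemma C_carrierI: "NC q f \<Longrightarrow> CSc q f \<Longrightarrow> lin X q f \<in> dg_carrier CC q"
proof -
  assume f: "NC q f" "CSc q f"
  obtain K where K: "finite_subset X K" "\<And>x. x \<in> complement_span X K q \<Longrightarrow> f x = 0"
    using f(2) unfolding CSc_def supported_def by blast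
  have "on_simplex (lin X q f) x = 0" if "x \<in> complement_span X K q" for x
    using that K(2) complement_span_subset[of K] lin_on unfolding simplicial_subset_def by (metis subsetD)
  then show ?thesis using K(1) lin_normalised[OF f(1)] by (auto simp: cochains_c_def cochains_def)
qed

lemma C_carrierE:
  assumes "c \<in> dg_carrier CC q"
  obtains f where "NC q f" "CSc q f" "c = lin X q f"
proof -
  have c: "c \<in> normalised_cochains X q" "\<exists>K. finite_subset X K \<and> (\<forall>x\<in>complement_span X K q. on_simplex c x = 0)"
    using assms by (auto simp: cochains_c_def cochains_def)
  then have "CSc q (on_simplex c)" unfolding CSc_def supported_def by blast
  then show ?thesis using that normalised_lin[OF c(1)] by blast
qed

lemma C_ops:
  "dg_zero CC q = lin X q (\<lambda>x. 0)"
  "dg_add CC q (lin X q f) (lin X q g) = lin X q (\<lambda>x. f x + g x)"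
  "dg_smult CC q a (lin X q f) = lin X q (\<lambda>x. a * f x)"
  by (auto simp: cochains_c_def cochains_def lin_eq fun_eq_iff Lf_def distrib_left sum.distrib sum_distrib_left mult.left_commute)

lemma C_d: "dg_d CC q (lin X q f) = lin X (Suc q) (dlt q f)"
proof -
  have "chain_boundary X q v \<in> chains X q \<and> Lf f (chain_boundary X q v) = Lf (dlt q f) v" if v: "v \<in> chains X (Suc q)" for v
  proof
    show "chain_boundary X q v \<in> chains X q"
      unfolding chain_boundary_def using v face_closed by (intro chains_sum chains_sgl) (auto simp: chains_def)
    show "Lf f (chain_boundary X q v) = Lf (dlt q f) v"
      unfolding chain_boundary_def Lf_sum Lf_single dlt_def
      by (simp add: Lf_def[of _ v] sum_distrib_left mult_ac del: sum.atMost_Suc)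
  qed
  then show ?thesis by (auto simp: cochains_c_def cochains_def lin_eq fun_eq_iff)
qed

lemma C_mult: "dg_mult CC p q (lin X p f) (lin X q g) =
    lin X (p + q) (\<lambda>x. f (subf X (p + q) {..p} x) * g (subf X (p + q) {p..p + q} x))"
proof -
  have "on_simplex (lin X p f) (front_face X p q x) * on_simplex (lin X q g) (back_face X p q x) =
      f (subf X (p + q) {..p} x) * g (subf X (p + q) {p..p + q} x)" if x: "x \<in> simplices X (p + q)" for x
  proof -
    have "subf X (p + q) {..p} x \<in> simplices X (card {..p} - 1)" "subf X (p + q) {p..p + q} x \<in> simplices X (card {p..p + q} - 1)"
      by (rule subf_closed[OF subset_self x]; auto)+
    then show ?thesis unfolding front_face_subf[OF x] back_face_subf[OF x] by (simp add: lin_on)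
  qed
  then show ?thesis by (simp add: cochains_c_def cochains_def) (rule lin_cong)
qed

lemma dlt_ops: "dlt q (\<lambda>x. f x + g x) = (\<lambda>x. dlt q f x + dlt q g x)" "dlt q (\<lambda>x. a * f x) = (\<lambda>x. a * dlt q f x)"
  by (simp_all add: dlt_def fun_eq_iff distrib_left sum.distrib sum_distrib_left mult.left_commute del: sum.atMost_Suc)

lemma NC_ops: "NC q f \<Longrightarrow> NC q g \<Longrightarrow> NC q (\<lambda>x. f x + g x)" "NC q f \<Longrightarrow> NC q (\<lambda>x. a * f x)" "NC q (\<lambda>x. 0)"
  by (auto simp: NC_def)

lemma lin_complex_C: "lin_complex (CC :: ('k::field_char_0, ('a \<Rightarrow>\<^sub>0 'k) \<Rightarrow> 'k) dg)"
proof
  fix q and x y z :: "('a \<Rightarrow>\<^sub>0 'k) \<Rightarrow> 'k" and c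
  show "dg_zero CC q \<in> dg_carrier (CC :: ('k, _) dg) q"
    unfolding C_ops by (intro C_carrierI NC_ops CSc_zero)
  assume "x \<in> dg_carrier CC q"
  then obtain f where f: "NC q f" "CSc q f" "x = lin X q f" by (rule C_carrierE)
  show "dg_add CC q (dg_zero CC q) x = x" by (simp add: f C_ops)
  show "\<exists>y\<in>dg_carrier CC q. dg_add CC q x y = dg_zero CC q"
  proof (rule bexI)
    show "lin X q (\<lambda>x. (- 1) * f x) \<in> dg_carrier CC q" by (intro C_carrierI NC_ops CSc_sc f)
    show "dg_add CC q x (lin X q (\<lambda>x. (- 1) * f x)) = dg_zero CC q" by (simp add: f C_ops)
  qed
  show "dg_smult CC q c x \<in> dg_carrier CC q" unfolding f C_ops by (intro C_carrierI NC_ops CSc_sc f)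
  show "dg_d CC q x \<in> dg_carrier CC (Suc q)" unfolding f C_d by (intro C_carrierI NC_dlt CSc_dlt f)
  show "dg_d CC q (dg_smult CC q c x) = dg_smult CC (Suc q) c (dg_d CC q x)"
    by (simp add: f C_ops C_d dlt_ops)
  show "dg_d CC (Suc q) (dg_d CC q x) = dg_zero CC (Suc (Suc q))"
    unfolding f C_ops C_d by (rule lin_cong) (rule dlt_dlt)
  assume "y \<in> dg_carrier CC q"
  then obtain g where g: "NC q g" "CSc q g" "y = lin X q g" by (rule C_carrierE)
  show "dg_add CC q x y \<in> dg_carrier CC q" unfolding f g C_ops by (intro C_carrierI NC_ops CSc_add f g)
  show "dg_add CC q x y = dg_add CC q y x" by (simp add: f g C_ops add.commute)
  show "dg_smult CC q c (dg_add CC q x y) = dg_add CC q (dg_smult CC q c x) (dg_smult CC q c y)"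
    by (simp add: f g C_ops distrib_left)
  show "dg_d CC q (dg_add CC q x y) = dg_add CC (Suc q) (dg_d CC q x) (dg_d CC q y)"
    by (simp add: f g C_ops C_d dlt_ops)
  assume "z \<in> dg_carrier CC q"
  then obtain h where h: "z = lin X q h" by (rule C_carrierE)
  show "dg_add CC q (dg_add CC q x y) z = dg_add CC q x (dg_add CC q y z)"
    by (simp add: f g h C_ops add.assoc)
qed

section \<open>Forms on \<open>X\<close> as classes of families\<close>

definition mk :: "(nat \<Rightarrow> 'a \<Rightarrow> 'k::field_char_0 pform) \<Rightarrow> nat \<Rightarrow> 'a \<Rightarrow> 'k form set" where
  "mk v = (\<lambda>n. \<lambda>x\<in>simplices X n. cl n (v n x))"

lemma mk_eq_iff: "FA p v \<Longrightarrow> FA q w \<Longrightarrow> mk v = mk w \<longleftrightarrow> (\<forall>n. \<forall>x\<in>simplices X n. eqv n (v n x) (w n x))"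
proof -
  assume vw: "FA p v" "FA q w"
  have "mk v = mk w \<longleftrightarrow> (\<forall>n. \<forall>x\<in>simplices X n. cl n (v n x) = cl n (w n x))"
    by (auto simp: mk_def fun_eq_iff restrict_def)
  then show ?thesis using cl_eq_iff[OF FA_fr[OF vw(1)] FA_fr[OF vw(2)]] by blast
qed

lemma mk_hom: assumes v: "FA q v" shows "mk v \<in> sset_hom X (nabla_sset q)"
proof -
  have "mk v n \<in> simplices X n \<rightarrow>\<^sub>E nabla n q" for n
    unfolding mk_def nabla_eq using FA_fr[OF v] FA_homog[OF v] by (auto simp del: restrict_apply)
  moreover have "mk v n (face X n i x) = nabla_subst (Suc n) n (face_subst i) (mk v (Suc n) x)"
    if x: "x \<in> simplices X (Suc n)" "i \<le> Suc n" for n i x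
  proof -
    have "cl n (fc i (v (Suc n) x)) = cl n (v n (face X n i x))"
      using FA_face[OF v x] cl_eq_iff[OF fr_face[OF x(2) FA_fr[OF v x(1)]] FA_fr[OF v face_closed[OF x(2,1)]]] by blast
    then show ?thesis unfolding mk_def using x face_closed[OF x(2,1)] nabla_face_cl[OF x(2) FA_fr[OF v x(1)]] by simp
  qed
  moreover have "mk v (Suc n) (degen X n i x) = nabla_subst n (Suc n) (degen_subst i) (mk v n x)"
    if x: "x \<in> simplices X n" "i \<le> n" for n i x
  proof -
    have "cl (Suc n) (dg i (v n x)) = cl (Suc n) (v (Suc n) (degen X n i x))"
      using FA_degen[OF v x] cl_eq_iff[OF fr_degen[OF x(2) FA_fr[OF v x(1)]] FA_fr[OF v degen_closed[OF x(2,1)]]] by blast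
    then show ?thesis unfolding mk_def using x degen_closed[OF x(2,1)] nabla_degen_cl[OF x(2) FA_fr[OF v x(1)]] by simp
  qed
  ultimately show ?thesis unfolding sset_hom_def nabla_sset_def by simp
qed

text \<open>Representatives are chosen independently on each simplex, so faces and degeneracies
  match them only modulo the relations; \<open>FA\<close> is phrased accordingly.\<close>

lemma hom_mk:
  assumes w: "w \<in> sset_hom X (nabla_sset q :: 'k::field_char_0 form set sset)"
  obtains v where "FA q v" "w = mk v"
proof -
  have wn: "w n \<in> simplices X n \<rightarrow>\<^sub>E nabla n q" for n
    using w by (auto simp: sset_hom_def nabla_sset_def)
  have "\<exists>a :: 'k pform. fr n a \<and> homog q a \<and> w n x = cl n a" if "x \<in> simplices X n" for n x
    using PiE_mem[OF wn that] unfolding nabla_eq by blast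
  note ex = this
  define v where "v n x = (SOME a :: 'k pform. fr n a \<and> homog q a \<and> w n x = cl n a)" for n x
  have v: "fr n (v n x) \<and> homog q (v n x) \<and> w n x = cl n (v n x)" if "x \<in> simplices X n" for n x
    unfolding v_def by (rule someI_ex[OF ex[OF that]])
  have "FA q v"
  proof (rule FA_I)
    fix n i x assume x: "x \<in> simplices X (Suc n)" "i \<le> Suc n"
    have "w n (face X n i x) = nabla_subst (Suc n) n (face_subst i) (w (Suc n) x)"
      using w x by (auto simp: sset_hom_def nabla_sset_def)
    then have "cl n (v n (face X n i x)) = cl n (fc i (v (Suc n) x))"
      using v[OF x(1)] v[OF face_closed[OF x(2,1)]] x by (simp add: nabla_face_cl)
    then show "eqv n (fc i (v (Suc n) x)) (v n (face X n i x))"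
      using cl_eq_iff[OF fr_face[OF x(2)], of "v (Suc n) x" "v n (face X n i x)"] v[OF x(1)] v[OF face_closed[OF x(2,1)]]
      by presburger
  next
    fix n i x assume x: "x \<in> simplices X n" "i \<le> n"
    have "w (Suc n) (degen X n i x) = nabla_subst n (Suc n) (degen_subst i) (w n x)"
      using w x by (auto simp: sset_hom_def nabla_sset_def)
    then have "cl (Suc n) (v (Suc n) (degen X n i x)) = cl (Suc n) (dg i (v n x))"
      using v[OF x(1)] v[OF degen_closed[OF x(2,1)]] x by (simp add: nabla_degen_cl)
    then show "eqv (Suc n) (dg i (v n x)) (v (Suc n) (degen X n i x))"
      using cl_eq_iff[OF fr_degen[OF x(2)], of "v n x" "v (Suc n) (degen X n i x)"] v[OF x(1)] v[OF degen_closed[OF x(2,1)]]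
      by presburger
  qed (use v in auto)
  moreover have "w = mk v"
  proof (intro ext)
    fix n x
    show "w n x = mk v n x" using v[of x n] wn[of n] PiE_arb[OF wn[of n], of x]
      by (cases "x \<in> simplices X n") (simp_all add: mk_def)
  qed
  ultimately show ?thesis using that by blast
qed

abbreviation "AA \<equiv> forms_c X"

lemma mk_zero_iff: "FA q v \<Longrightarrow> x \<in> simplices X n \<Longrightarrow> mk v n x = \<zero>\<^bsub>nabla_ring n\<^esub> \<longleftrightarrow> eqv n (v n x) 0"
  by (simp add: mk_def nabla_zero cl_eq_iff FA_fr)

lemma span_simplices: "x \<in> complement_span X K n \<Longrightarrow> x \<in> simplices X n"
  using complement_span_subset[of K] unfolding simplicial_subset_def by blast

lemma A_carrierI: "FA q v \<Longrightarrow> CSf v \<Longrightarrow> mk v \<in> dg_carrier AA q"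
proof -
  assume v: "FA q v" "CSf v"
  obtain K where "finite_subset X K" "\<And>n x. x \<in> complement_span X K n \<Longrightarrow> eqv n (v n x) 0"
    using v(2) unfolding CSf_def supported_def by blast
  then have "\<exists>K. finite_subset X K \<and> (\<forall>n. \<forall>x\<in>complement_span X K n. mk v n x = \<zero>\<^bsub>nabla_ring n\<^esub>)"
    using mk_zero_iff[OF v(1) span_simplices] by blast
  then show ?thesis using mk_hom[OF v(1)] by (simp add: forms_c_def forms_def)
qed

lemma A_carrierE:
  assumes "w \<in> dg_carrier (AA :: ('k::field_char_0, _) dg) q"
  obtains v where "FA q v" "CSf v" "w = mk v"
proof -
  have w: "w \<in> sset_hom X (nabla_sset q)" "\<exists>K. finite_subset X K \<and> (\<forall>n. \<forall>x\<in>complement_span X K n. w n x = \<zero>\<^bsub>nabla_ring n\<^esub>)"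
    using assms by (auto simp: forms_c_def forms_def)
  obtain v where v: "FA q v" "w = mk v" by (rule hom_mk[OF w(1)])
  have "CSf v" using w(2) mk_zero_iff[OF v(1) span_simplices] unfolding v(2) CSf_def supported_def by blast
  then show ?thesis using that v by blast
qed

lemma A_ops:
  "dg_zero AA q = mk (\<lambda>n x. 0)"
  "FA p v \<Longrightarrow> FA r w \<Longrightarrow> dg_add AA q (mk v) (mk w) = mk (\<lambda>n x. v n x + w n x)"
  "FA p v \<Longrightarrow> dg_smult AA q c (mk v) = mk (\<lambda>n x. sc c * v n x)"
  "FA p v \<Longrightarrow> FA r w \<Longrightarrow> dg_mult AA q s (mk v) (mk w) = mk (\<lambda>n x. v n x * w n x)"
  "FA p v \<Longrightarrow> dg_d AA q (mk v) = mk (\<lambda>n x. dd (v n x))"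
  unfolding forms_c_def forms_def mk_def
  by (auto simp: fun_eq_iff nabla_zero nabla_add nabla_mult nabla_smult_cl nabla_d_cl FA_fr restrict_def)

lemma lin_complex_A: "lin_complex (AA :: ('k::field_char_0, _) dg)"
proof
  fix q and x y z :: "nat \<Rightarrow> 'a \<Rightarrow> 'k form set" and c
  show "dg_zero AA q \<in> dg_carrier (AA :: ('k, _) dg) q"
    unfolding A_ops by (intro A_carrierI FA_zero CSf_zero)
  assume "x \<in> dg_carrier AA q"
  then obtain u where u: "FA q u" "CSf u" "x = mk u" by (rule A_carrierE)
  show "dg_add AA q (dg_zero AA q) x = x" using A_ops(2)[OF FA_zero[of q] u(1), of q] by (simp add: u(3) A_ops(1))
  show "\<exists>y\<in>dg_carrier AA q. dg_add AA q x y = dg_zero AA q"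
  proof (rule bexI)
    show "mk (\<lambda>n x. sc (- 1) * u n x) \<in> dg_carrier AA q" by (intro A_carrierI FA_sc CSf_ops u)
    show "dg_add AA q x (mk (\<lambda>n x. sc (- 1) * u n x)) = dg_zero AA q"
      unfolding u(3) A_ops(2)[OF u(1) FA_sc[OF u(1)]] A_ops(1) by simp
  qed
  show "dg_smult AA q c x \<in> dg_carrier AA q"
    unfolding u(3) A_ops(3)[OF u(1)] by (intro A_carrierI FA_sc CSf_ops u)
  show "dg_d AA q x \<in> dg_carrier AA (Suc q)"
    unfolding u(3) A_ops(5)[OF u(1)] by (intro A_carrierI FA_dd CSf_ops u)
  show "dg_d AA q (dg_smult AA q c x) = dg_smult AA (Suc q) c (dg_d AA q x)"
    unfolding u(3) A_ops(3)[OF u(1)] A_ops(5)[OF u(1)] A_ops(5)[OF FA_sc[OF u(1)]] A_ops(3)[OF FA_dd[OF u(1)]] by simp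
  show "dg_d AA (Suc q) (dg_d AA q x) = dg_zero AA (Suc (Suc q))"
    unfolding u(3) A_ops(5)[OF u(1)] A_ops(5)[OF FA_dd[OF u(1)]] A_ops(1) by simp
  assume "y \<in> dg_carrier AA q"
  then obtain v where v: "FA q v" "CSf v" "y = mk v" by (rule A_carrierE)
  show "dg_add AA q x y \<in> dg_carrier AA q"
    unfolding u(3) v(3) A_ops(2)[OF u(1) v(1)] by (intro A_carrierI FA_add CSf_add u v)
  show "dg_add AA q x y = dg_add AA q y x"
    unfolding u(3) v(3) A_ops(2)[OF u(1) v(1)] A_ops(2)[OF v(1) u(1)] by (simp add: add.commute)
  show "dg_smult AA q c (dg_add AA q x y) = dg_add AA q (dg_smult AA q c x) (dg_smult AA q c y)"
    unfolding u(3) v(3) A_ops(2)[OF u(1) v(1)] A_ops(3)[OF FA_add[OF u(1) v(1)]] A_ops(3)[OF u(1)] A_ops(3)[OF v(1)]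
      A_ops(2)[OF FA_sc[OF u(1)] FA_sc[OF v(1)]] by (simp add: distrib_left)
  show "dg_d AA q (dg_add AA q x y) = dg_add AA (Suc q) (dg_d AA q x) (dg_d AA q y)"
    unfolding u(3) v(3) A_ops(2)[OF u(1) v(1)] A_ops(5)[OF FA_add[OF u(1) v(1)]] A_ops(5)[OF u(1)] A_ops(5)[OF v(1)]
      A_ops(2)[OF FA_dd[OF u(1)] FA_dd[OF v(1)]] by simp
  assume "z \<in> dg_carrier AA q"
  then obtain w where w: "FA q w" "z = mk w" by (rule A_carrierE)
  show "dg_add AA q (dg_add AA q x y) z = dg_add AA q x (dg_add AA q y z)"
    unfolding u(3) v(3) w(2) A_ops(2)[OF u(1) v(1)] A_ops(2)[OF v(1) w(1)] A_ops(2)[OF FA_add[OF u(1) v(1)] w(1)]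
      A_ops(2)[OF u(1) FA_add[OF v(1) w(1)]] by (simp add: add.assoc)
qed

lemma rho_mk: "FA q v \<Longrightarrow> rho X q (mk v) = lin X q (RR v q)"
  unfolding rho_def by (rule lin_cong) (simp add: mk_def RR_def form_integral_cl FA_fr FA_homog)

lemma cocycle_mk_iff: "FA q v \<Longrightarrow> CSf v \<Longrightarrow>
    mk v \<in> cocycles AA q \<longleftrightarrow> (\<forall>n. \<forall>x\<in>simplices X n. eqv n (dd (v n x)) 0)"
  using mk_eq_iff[OF FA_dd[of q v] FA_zero[of q]] by (simp add: cocycles_def A_carrierI A_ops(1) A_ops(5)[of q v])

lemma cocycleE:
  assumes "x \<in> cocycles (AA :: ('k::field_char_0, _) dg) q"
  obtains v where "FA q v" "CSf v" "x = mk v" "\<And>n y. y \<in> simplices X n \<Longrightarrow> eqv n (dd (v n y)) 0"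
proof -
  obtain v where v: "FA q v" "CSf v" "x = mk v" using assms A_carrierE[of x q] by (auto simp: cocycles_def)
  then show ?thesis using that cocycle_mk_iff[OF v(1,2)] assms by blast
qed

end

section \<open>Integration in compactly supported cohomology\<close>

lemma eqv_mult_zero: "eqv n a 0 \<Longrightarrow> eqv n (a * b) 0" "eqv n b 0 \<Longrightarrow> eqv n (a * b) 0"
  using eqv_mult[of n a 0 b b] eqv_mult[of n a a b 0] by simp_all

context simplicial_set begin

lemma rho_cochain_map: "cochain_map (AA :: ('k::field_char_0, _) dg) CC (rho X)"
  unfolding cochain_map_def
proof (intro allI ballI conjI)
  fix q and x :: "nat \<Rightarrow> 'a \<Rightarrow> 'k form set" assume "x \<in> dg_carrier AA q"
  then obtain v where v: "FA q v" "CSf v" "x = mk v" by (rule A_carrierE)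
  note r = rho_mk[OF v(1)]
  show "rho X q x \<in> dg_carrier CC q" unfolding v(3) r by (intro C_carrierI RR_NC CSf_RR v)
  show "rho X (Suc q) (dg_d AA q x) = dg_d CC q (rho X q x)"
    unfolding v(3) r A_ops(5)[OF v(1)] rho_mk[OF FA_dd[OF v(1)]] C_d by (rule lin_cong) (rule RR_dd[OF v(1)])
  show "rho X q (dg_smult AA q c x) = dg_smult CC q c (rho X q x)" for c
    unfolding v(3) r A_ops(3)[OF v(1)] rho_mk[OF FA_sc[OF v(1)]] C_ops by (rule lin_cong) (simp add: RR_def)
  fix y :: "nat \<Rightarrow> 'a \<Rightarrow> 'k form set" assume "y \<in> dg_carrier AA q"
  then obtain w where w: "FA q w" "CSf w" "y = mk w" by (rule A_carrierE)
  show "rho X q (dg_add AA q x y) = dg_add CC q (rho X q x) (rho X q y)"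
    unfolding v(3) w(3) r rho_mk[OF w(1)] A_ops(2)[OF v(1) w(1)] rho_mk[OF FA_add[OF v(1) w(1)]] C_ops
    by (rule lin_cong) (simp add: RR_def)
qed

lemma rho_cocycle:
  assumes "x \<in> cocycles (AA :: ('k::field_char_0, _) dg) q" shows "rho X q x \<in> cocycles CC q"
proof -
  have x: "x \<in> dg_carrier AA q" "dg_d AA q x = dg_zero AA (Suc q)" using assms by (auto simp: cocycles_def)
  have "rho X q x \<in> dg_carrier CC q" "rho X (Suc q) (dg_d AA q x) = dg_d CC q (rho X q x)"
    using rho_cochain_map x(1) unfolding cochain_map_def by blast+
  moreover have "rho X (Suc q) (dg_zero (AA :: ('k, _) dg) (Suc q)) = dg_zero CC (Suc q)"
    unfolding A_ops rho_mk[OF FA_zero] C_ops by (rule lin_cong) (simp add: RR_def)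
  ultimately show ?thesis using x(2) by (simp add: cocycles_def)
qed

text \<open>A cocycle \<open>f\<close> is the integral of \<open>W f\<close>, and \<open>W f\<close>
  is closed because \<open>W\<close> commutes with the differentials.\<close>

lemma rho_surj:
  fixes z :: "('a \<Rightarrow>\<^sub>0 'k::field_char_0) \<Rightarrow> 'k"
  assumes "z \<in> cocycles CC q"
  shows "\<exists>x\<in>cocycles AA q. rho X q x = z"
proof -
  have "z \<in> dg_carrier CC q" and dz: "dg_d CC q z = dg_zero CC (Suc q)" using assms by (auto simp: cocycles_def)
  then obtain f where f: "NC q f" "CSc q f" "z = lin X q f" by (blast elim: C_carrierE)
  have 0: "dlt q f x = 0" if "x \<in> simplices X (Suc q)" for x
    using dz that unfolding f(3) C_d C_ops lin_eq_iff by blast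
  have W: "FA q (fW q f)" "CSf (fW q f)" by (intro FA_W CSf_W f)+
  have "eqv n (dd (fW q f n x)) 0" if x: "x \<in> simplices X n" for n x
  proof -
    have "fW (Suc q) (dlt q f) n x = fW (Suc q) (\<lambda>_. 0) n x" by (rule fW_cong[OF 0 x])
    then show ?thesis using dd_W[OF f(1) x] by (simp add: fW_zero)
  qed
  then have "mk (fW q f) \<in> cocycles AA q" using cocycle_mk_iff[OF W] by blast
  moreover have "rho X q (mk (fW q f)) = z" unfolding f(3) rho_mk[OF W(1)] by (rule lin_cong) (rule RR_W)
  ultimately show ?thesis by blast
qed

text \<open>For closed \<open>v\<close> Dupont's formula reads
  \<open>v = d s v + W \<rho> v\<close>. If \<open>\<rho> v\<close> is the coboundary of
  \<open>f\<close>, then \<open>W \<rho> v = d W f\<close> and \<open>v\<close> is the differential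
  of \<open>s v + W f\<close>, which has compact support. In degree 0 both \<open>s v\<close> and
  \<open>\<rho> v\<close> are 0, so \<open>v\<close> is 0.\<close>

lemma rho_inj:
  assumes x: "x \<in> cocycles (AA :: ('k::field_char_0, _) dg) q" and r: "rho X q x \<in> coboundaries CC q"
  shows "x \<in> coboundaries AA q"
proof -
  obtain v where v: "FA q v" "CSf v" "x = mk v" "\<And>n y. y \<in> simplices X n \<Longrightarrow> eqv n (dd (v n y)) 0"
    by (rule cocycleE[OF x]) blast
  have D: "eqv n (dd (ss n (v n y)) + fW q (RR v q) n y) (v n y)" if y: "y \<in> simplices X n" for n y
  proof -
    have "eqv n (ss n (dd (v n y))) 0" using ss_cong[OF v(4)[OF y]] by simp
    from eqv_add[OF eqv_refl[of n "dd (ss n (v n y))"] this]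
    have "eqv n (dd (ss n (v n y)) + ss n (dd (v n y))) (dd (ss n (v n y)))" by simp
    then have "eqv n (dd (ss n (v n y))) (v n y - fW q (RR v q) n y)"
      using dupont_family[OF v(1) y] eqv_sym eqv_trans by blast
    from eqv_add[OF this eqv_refl[of n "fW q (RR v q) n y"]] show ?thesis by simp
  qed
  show ?thesis
  proof (cases q)
    case 0
    have "rho X 0 x = lin X 0 (\<lambda>_. 0)" using r 0 by (simp add: coboundaries_def C_ops)
    then have R: "RR v 0 y = 0" if "y \<in> simplices X 0" for y
      using that v(1) unfolding v(3) 0 rho_mk[OF v(1)[unfolded 0]] lin_eq_iff by blast
    have "eqv n (v n y) 0" if y: "y \<in> simplices X n" for n y
    proof -
      have "ss n (v n y) = 0" by (rule homog_ss0) (use FA_homog[OF v(1) y] 0 in simp)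
      moreover have "fW q (RR v q) n y = 0"
        unfolding 0 using fW_cong[of 0 "RR v 0" "\<lambda>_. 0" y n, OF R y] by (simp only: fW_zero)
      ultimately show ?thesis using eqv_sym[OF D[OF y]] by simp
    qed
    then have "mk v = mk (\<lambda>n x. 0)" using mk_eq_iff[OF v(1) FA_zero[of q]] by blast
    then show ?thesis unfolding v(3) by (simp add: coboundaries_def 0 A_ops(1))
  next
    case (Suc s)
    obtain c where "c \<in> dg_carrier CC s" "rho X q x = dg_d CC s c" using r Suc by (auto simp: coboundaries_def)
    then obtain f where f: "NC s f" "CSc s f" "rho X q x = dg_d CC s (lin X s f)" by (blast elim: C_carrierE)
    have R: "RR v (Suc s) y = dlt s f y" if "y \<in> simplices X (Suc s)" for y
      using f(3) that unfolding v(3) Suc rho_mk[OF v(1)[unfolded Suc]] C_d lin_eq_iff by blast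
    define u where "u n y = ss n (v n y) + fW s f n y" for n y
    have u: "FA s u" "CSf u"
      unfolding u_def by (intro FA_add FA_ss[OF v(1)[unfolded Suc]] FA_W f CSf_add CSf_ss CSf_W v)+
    have "eqv n (dd (u n y)) (v n y)" if y: "y \<in> simplices X n" for n y
    proof -
      have "fW q (RR v q) n y = fW (Suc s) (dlt s f) n y" unfolding Suc by (rule fW_cong[OF R y])
      then have "eqv n (dd (fW s f n y)) (fW q (RR v q) n y)" using dd_W[OF f(1) y] by simp
      from eqv_trans[OF eqv_add[OF eqv_refl this] D[OF y]] show ?thesis by (simp add: u_def)
    qed
    then have "mk (\<lambda>n y. dd (u n y)) = x" unfolding v(3) using mk_eq_iff[OF FA_dd[OF u(1)] v(1)] by blast
    then have "x = dg_d AA s (mk u)" using A_ops(5)[OF u(1), of s] by simp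
    then show ?thesis using A_carrierI[OF u] Suc by (auto simp: coboundaries_def)
  qed
qed

lemma cocycle_mult:
  assumes x: "x \<in> cocycles (AA :: ('k::field_char_0, _) dg) p" and y: "y \<in> cocycles AA q"
  shows "dg_mult AA p q x y \<in> cocycles AA (p + q)"
proof -
  obtain v where v: "FA p v" "CSf v" "x = mk v" "\<And>n y. y \<in> simplices X n \<Longrightarrow> eqv n (dd (v n y)) 0"
    by (rule cocycleE[OF x]) blast
  obtain w where w: "FA q w" "CSf w" "y = mk w" "\<And>n y. y \<in> simplices X n \<Longrightarrow> eqv n (dd (w n y)) 0"
    by (rule cocycleE[OF y]) blast
  have "eqv n (dd (v n z * w n z)) 0" if z: "z \<in> simplices X n" for n z
    using eqv_add[OF eqv_mult_zero(1)[OF v(4)[OF z]] eqv_mult_zero(2)[OF w(4)[OF z]]] by (simp add: dd_mult)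
  then show ?thesis
    unfolding v(3) w(3) A_ops(4)[OF v(1) w(1)]
    using cocycle_mk_iff[OF FA_mul[OF v(1) w(1)] CSf_ops(3)[OF v(2)]] by blast
qed

text \<open>The two cochains differ by the defect \<open>EE\<close>, which
  \<open>hmf_homotopy\<close> exhibits as the coboundary of \<open>hmf\<close> on closed forms. In
  total degree 0 the defect itself is 0.\<close>

lemma rho_mult:
  assumes x: "x \<in> cocycles (AA :: ('k::field_char_0, _) dg) p" and y: "y \<in> cocycles AA q"
  shows "(dg_mult CC p q (rho X p x) (rho X q y), rho X (p + q) (dg_mult AA p q x y)) \<in> cohomologous CC (p + q)"
proof -
  interpret C: lin_complex "CC :: ('k, _) dg" by (rule lin_complex_C)
  obtain v where v: "FA p v" "CSf v" "x = mk v" "\<And>n y. y \<in> simplices X n \<Longrightarrow> eqv n (dd (v n y)) 0"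
    by (rule cocycleE[OF x]) blast
  obtain w where w: "FA q w" "CSf w" "y = mk w" "\<And>n y. y \<in> simplices X n \<Longrightarrow> eqv n (dd (w n y)) 0"
    by (rule cocycleE[OF y]) blast
  let ?n = "p + q"
  let ?vw = "\<lambda>n z. v n z * w n z"
  let ?cp = "\<lambda>z. cupI ?n (v ?n z) (w ?n z)"
  have cp: "dg_mult CC p q (rho X p x) (rho X q y) = lin X ?n ?cp"
    unfolding v(3) w(3) rho_mk[OF v(1)] rho_mk[OF w(1)] C_mult
  proof (rule lin_cong)
    fix z assume z: "z \<in> simplices X ?n"
    let ?t = "\<lambda>i. TT ?n {..i} (v ?n z) * TT ?n {i..?n} (w ?n z)"
    have "?cp z = (\<Sum>i\<le>?n. ?t i)" by (rule cupI_def)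
    \<comment> \<open>By degree only the cut at \<open>p\<close> survives, so \<open>cupI\<close>
      computes the cup product of the two integration cochains.\<close>
    also have "\<dots> = (\<Sum>i\<in>{p}. ?t i)"
    proof (rule sum.mono_neutral_right)
      show "\<forall>i\<in>{..?n} - {p}. ?t i = 0"
      proof
        fix i assume "i \<in> {..?n} - {p}"
        then have "TT ?n {..i} (v ?n z) = 0" by (intro TT_homog[OF _ FA_homog[OF v(1) z]]) auto
        then show "?t i = 0" by simp
      qed
    qed auto
    also have "\<dots> = RR v p (subf X ?n {..p} z) * RR w q (subf X ?n {p..?n} z)"
      using TT_subf[OF v(1) z, of "{..p}"] TT_subf[OF w(1) z, of "{p..?n}"] by simp
    finally show "RR v p (subf X ?n {..p} z) * RR w q (subf X ?n {p..?n} z) = ?cp z" ..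
  qed
  have rr: "rho X ?n (dg_mult AA p q x y) = lin X ?n (RR ?vw ?n)"
    unfolding v(3) w(3) A_ops(4)[OF v(1) w(1)] by (rule rho_mk[OF FA_mul[OF v(1) w(1)]])
  have G: "lin X ?n (RR ?vw ?n) \<in> cocycles CC ?n"
    unfolding rr[symmetric] by (rule rho_cocycle[OF cocycle_mult[OF x y]])
  have EE: "RR ?vw ?n z = ?cp z + EE ?n (v ?n z) (w ?n z)" for z by (simp add: EE_def RR_def)
  have "\<exists>b\<in>coboundaries CC ?n. lin X ?n ?cp = dg_add CC ?n (lin X ?n (RR ?vw ?n)) b"
  proof (cases ?n)
    case 0
    have "lin X ?n ?cp = lin X ?n (RR ?vw ?n)"
    proof (rule lin_cong)
      fix z
      have "EE ?n (v ?n z) (w ?n z) = 0" unfolding 0 by (rule EE_0)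
      then show "?cp z = RR ?vw ?n z" using EE[of z] by simp
    qed
    then have "lin X ?n ?cp = dg_add CC ?n (lin X ?n (RR ?vw ?n)) (dg_zero CC ?n)"
      by (rule trans[OF _ C.add_zero_right[OF C.Z_carrier[OF G], symmetric]])
    then show ?thesis using C.B_zero by (rule bexI)
  next
    case (Suc m)
    \<comment> \<open>This is a compactly supported normalised cochain: it vanishes on degenerate
      simplices by \<open>hmf_degen\<close>, and wherever the first form vanishes.\<close>
    define h where "h z = hmf m (v m z) (w m z)" for z
    have "NC m h"
      unfolding NC_def
    proof
      fix z assume "z \<in> degenerate X m"
      then obtain k i z' where z: "m = Suc k" "i \<le> k" "z' \<in> simplices X k" "z = degen X k i z'"
        by (auto simp: degenerate_def)
      have "h z = hmf (Suc k) (dg i (v k z')) (dg i (w k z'))"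
        unfolding h_def z(1,4) by (intro hmf_cong eqv_sym[OF FA_degen[OF v(1) z(3,2)]] eqv_sym[OF FA_degen[OF w(1) z(3,2)]])
      then show "h z = 0" by (simp add: hmf_degen[OF z(2)])
    qed
    moreover have "CSc m h"
      using v(2) v(2) unfolding CSf_def CSc_def
    proof (rule supported2)
      fix n z assume "eqv n (v n z) 0"
      then have "hmf n (v n z) (w n z) = 0" using hmf_cong[of n "v n z" 0 "w n z" "w n z"] by simp
      then show "n = m \<longrightarrow> h z = 0" by (auto simp: h_def)
    qed
    ultimately have H: "lin X m (\<lambda>z. (- 1) * h z) \<in> dg_carrier CC m" by (intro C_carrierI NC_ops CSc_sc)
    have dh: "dlt m h z = EE (Suc m) (v (Suc m) z) (w (Suc m) z)" if z: "z \<in> simplices X (Suc m)" for z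
    proof -
      let ?a = "v (Suc m) z" and ?b = "w (Suc m) z"
      have "dlt m h z = (\<Sum>i\<le>Suc m. (- 1) ^ i * hmf m (fc i ?a) (fc i ?b))"
        unfolding dlt_def h_def
        by (intro sum.cong refl arg_cong2[of _ _ _ _ "(*)"] hmf_cong eqv_sym[OF FA_face[OF v(1) z]] eqv_sym[OF FA_face[OF w(1) z]]) auto
      moreover have "hmf (Suc m) (dd ?a) ?b = 0" using hmf_cong[OF v(4)[OF z] eqv_refl] by simp
      moreover have "hmf (Suc m) (bar ?a) (dd ?b) = 0" using hmf_cong[OF eqv_refl w(4)[OF z]] by simp
      ultimately show ?thesis unfolding hmf_homotopy by simp
    qed
    \<comment> \<open>The sign appears because the cup product is the integral of the product minus
      the defect.\<close>
    have "lin X ?n ?cp = lin X ?n (\<lambda>z. RR ?vw ?n z + (- 1) * dlt m h z)"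
    proof (rule lin_cong)
      fix z assume "z \<in> simplices X ?n"
      then show "?cp z = RR ?vw ?n z + (- 1) * dlt m h z" using EE[of z] dh[of z] by (simp add: Suc)
    qed
    also have "\<dots> = dg_add CC ?n (lin X ?n (RR ?vw ?n)) (dg_d CC m (lin X m (\<lambda>z. (- 1) * h z)))"
      unfolding C_d Suc C_ops dlt_ops ..
    finally show ?thesis using H Suc by (auto simp: coboundaries_def)
  qed
  then obtain b where b: "b \<in> coboundaries CC ?n" "lin X ?n ?cp = dg_add CC ?n (lin X ?n (RR ?vw ?n)) b" by blast
  then have "(lin X ?n (RR ?vw ?n), lin X ?n ?cp) \<in> cohomologous CC ?n"
    unfolding C.coh_iff using G C.Z_add[OF G C.B_Z[OF b(1)]] by auto
  then show ?thesis unfolding cp rr by (rule C.coh_sym)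
qed

text \<open>The factors are changed one at a time. For closed \<open>w\<close> and \<open>v\<close>,
  \<open>du w = d (u w)\<close> and \<open>v du = d (bar v u)\<close>; a product has compact support
  if one factor has.\<close>

lemma mult_coh:
  assumes xx: "(x, x') \<in> cohomologous (AA :: ('k::field_char_0, _) dg) p" and yy: "(y, y') \<in> cohomologous AA q"
  shows "(dg_mult AA p q x y, dg_mult AA p q x' y') \<in> cohomologous AA (p + q)"
proof -
  interpret A: lin_complex "AA :: ('k, _) dg" by (rule lin_complex_A)
  have Z: "x \<in> cocycles AA p" "x' \<in> cocycles AA p" "y \<in> cocycles AA q" "y' \<in> cocycles AA q"
    using xx yy by (auto simp: A.coh_iff)
  obtain v where v: "FA p v" "CSf v" "x' = mk v" "\<And>n y. y \<in> simplices X n \<Longrightarrow> eqv n (dd (v n y)) 0"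
    by (rule cocycleE[OF Z(2)]) blast
  obtain v0 where v0: "FA p v0" "CSf v0" "x = mk v0" by (rule cocycleE[OF Z(1)]) blast
  obtain w where w: "FA q w" "CSf w" "y = mk w" "\<And>n y. y \<in> simplices X n \<Longrightarrow> eqv n (dd (w n y)) 0"
    by (rule cocycleE[OF Z(3)]) blast
  have "(dg_mult AA p q x y, dg_mult AA p q x' y) \<in> cohomologous AA (p + q)"
  proof (cases p)
    case 0
    then have "x' = x" using xx A.add_zero_right[OF A.Z_carrier[OF Z(1)]] by (auto simp: A.coh_iff coboundaries_def)
    then show ?thesis using A.coh_refl cocycle_mult[OF Z(1,3)] by simp
  next
    case (Suc r)
    obtain c where c: "c \<in> dg_carrier AA r" "x' = dg_add AA p x (dg_d AA r c)"
      using xx Suc by (auto simp: A.coh_iff coboundaries_def)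
    obtain u where u: "FA r u" "CSf u" "c = mk u" by (rule A_carrierE[OF c(1)])
    have du: "FA p (\<lambda>n x. dd (u n x))" using FA_dd[OF u(1)] Suc by simp
    have uw: "FA (r + q) (\<lambda>n x. u n x * w n x)" by (rule FA_mul[OF u(1) w(1)])
    have duw: "FA (p + q) (\<lambda>n x. dd (u n x * w n x))" using FA_dd[OF uw] Suc by simp
    have x': "x' = mk (\<lambda>n x. v0 n x + dd (u n x))"
      unfolding c(2) v0(3) u(3) A_ops(5)[OF u(1)] by (rule A_ops(2)[OF v0(1) du])
    have "eqv n ((v0 n z + dd (u n z)) * w n z) (v0 n z * w n z + dd (u n z * w n z))" if z: "z \<in> simplices X n" for n z
      using eqv_add[OF eqv_refl[of n "v0 n z * w n z + dd (u n z) * w n z"] eqv_sym[OF eqv_mult_zero(2)[OF w(4)[OF z], of "bar (u n z)"]]]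
      by (simp add: dd_mult distrib_right add.assoc)
    then have "mk (\<lambda>n z. (v0 n z + dd (u n z)) * w n z) = mk (\<lambda>n z. v0 n z * w n z + dd (u n z * w n z))"
      using mk_eq_iff[OF FA_mul[OF FA_add[OF v0(1) du] w(1)] FA_add[OF FA_mul[OF v0(1) w(1)] duw]] by blast
    then have "dg_mult AA p q x' y = dg_add AA (p + q) (dg_mult AA p q x y) (dg_d AA (r + q) (mk (\<lambda>n x. u n x * w n x)))"
      unfolding x' v0(3) w(3) A_ops(4)[OF v0(1) w(1)] A_ops(4)[OF FA_add[OF v0(1) du] w(1)] A_ops(5)[OF uw]
        A_ops(2)[OF FA_mul[OF v0(1) w(1)] duw] .
    moreover have "dg_d AA (r + q) (mk (\<lambda>n x. u n x * w n x)) \<in> coboundaries AA (p + q)"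
      using A_carrierI[OF uw CSf_ops(3)[OF u(2)]] by (auto simp: coboundaries_def Suc)
    ultimately show ?thesis unfolding A.coh_iff using cocycle_mult Z by blast
  qed
  moreover have "(dg_mult AA p q x' y, dg_mult AA p q x' y') \<in> cohomologous AA (p + q)"
  proof (cases q)
    case 0
    then have "y' = y" using yy A.add_zero_right[OF A.Z_carrier[OF Z(3)]] by (auto simp: A.coh_iff coboundaries_def)
    then show ?thesis using A.coh_refl cocycle_mult[OF Z(2,3)] by simp
  next
    case (Suc r)
    obtain c where c: "c \<in> dg_carrier AA r" "y' = dg_add AA q y (dg_d AA r c)"
      using yy Suc by (auto simp: A.coh_iff coboundaries_def)
    obtain u where u: "FA r u" "CSf u" "c = mk u" by (rule A_carrierE[OF c(1)])
    have du: "FA q (\<lambda>n x. dd (u n x))" using FA_dd[OF u(1)] Suc by simp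
    \<comment> \<open>Taking \<open>bar (v n x)\<close> in the primitive absorbs the sign in the
      Leibniz rule, since \<open>bar\<close> is an involution.\<close>
    have vu: "FA (p + r) (\<lambda>n x. bar (v n x) * u n x)" by (rule FA_mul[OF FA_bar[OF v(1)] u(1)])
    have dvu: "FA (p + q) (\<lambda>n x. dd (bar (v n x) * u n x))" using FA_dd[OF vu] Suc by simp
    have y': "y' = mk (\<lambda>n x. w n x + dd (u n x))"
      unfolding c(2) w(3) u(3) A_ops(5)[OF u(1)] by (rule A_ops(2)[OF w(1) du])
    have "eqv n (v n z * (w n z + dd (u n z))) (v n z * w n z + dd (bar (v n z) * u n z))" if z: "z \<in> simplices X n" for n z
    proof -
      have "eqv n (dd (bar (v n z))) 0"
        using eqv_mult_zero(2)[OF eqv_bar[OF v(4)[OF z], simplified], of "- 1"] by (simp add: dd_bar)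
      from eqv_add[OF eqv_sym[OF eqv_mult_zero(1)[OF this, of "u n z"]] eqv_refl[of n "v n z * w n z + v n z * dd (u n z)"]]
      show ?thesis by (simp add: dd_mult distrib_left ac_simps)
    qed
    then have "mk (\<lambda>n z. v n z * (w n z + dd (u n z))) = mk (\<lambda>n z. v n z * w n z + dd (bar (v n z) * u n z))"
      using mk_eq_iff[OF FA_mul[OF v(1) FA_add[OF w(1) du]] FA_add[OF FA_mul[OF v(1) w(1)] dvu]] by blast
    then have "dg_mult AA p q x' y' = dg_add AA (p + q) (dg_mult AA p q x' y) (dg_d AA (p + r) (mk (\<lambda>n x. bar (v n x) * u n x)))"
      unfolding y' v(3) w(3) A_ops(4)[OF v(1) w(1)] A_ops(4)[OF v(1) FA_add[OF w(1) du]] A_ops(5)[OF vu]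
        A_ops(2)[OF FA_mul[OF v(1) w(1)] dvu] .
    moreover have "dg_d AA (p + r) (mk (\<lambda>n x. bar (v n x) * u n x)) \<in> coboundaries AA (p + q)"
      using A_carrierI[OF vu CSf_ops(4)[OF u(2)]] by (auto simp: coboundaries_def Suc)
    ultimately show ?thesis unfolding A.coh_iff using cocycle_mult Z by blast
  qed
  ultimately show ?thesis by (rule A.coh_trans)
qed

lemma coh_pair_rho: "coh_pair (AA :: ('k::field_char_0, _) dg) CC (rho X)"
  by (intro coh_pair.intro coh_pair_axioms.intro lin_complex_A lin_complex_C
      rho_cochain_map rho_surj rho_inj rho_mult mult_coh)

end

theorem theorem3p7:
  fixes X :: "'a sset"
    and A :: "('k::field_char_0, nat \<Rightarrow> 'a \<Rightarrow> 'k form set) dg"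
    and C :: "('k, ('a \<Rightarrow>\<^sub>0 'k) \<Rightarrow> 'k) dg"
  assumes "simplicial_set X"
    and A: "A = forms_c X"
    and C: "C = cochains_c X"
  shows "(cochain_map A C (rho X)) \<and>
    (\<forall>q. bij_betw (coh_map C (rho X) q) (cohomology A q) (cohomology C q)) \<and>
    (\<forall>q. \<forall>a\<in>cohomology A q. \<forall>b\<in>cohomology A q.
      coh_map C (rho X) q (coh_add A q a b) =
        coh_add C q (coh_map C (rho X) q a) (coh_map C (rho X) q b)) \<and>
    (\<forall>q. \<forall>c. \<forall>a\<in>cohomology A q.
      coh_map C (rho X) q (coh_smult A q c a) = coh_smult C q c (coh_map C (rho X) q a)) \<and>
    (\<forall>p q. \<forall>a\<in>cohomology A p. \<forall>b\<in>cohomology A q.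
      coh_map C (rho X) (p + q) (coh_mult A p q a b) =
        coh_mult C p q (coh_map C (rho X) p a) (coh_map C (rho X) q b))"
proof -
  interpret simplicial_set X by fact
  interpret coh_pair A C "rho X" unfolding A C by (rule coh_pair_rho)
  show ?thesis using cm coh_map_bij coh_map_add coh_map_smult coh_map_mult by blast
qed

end
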